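(* Let $k$ be a number field with a fixed algebraic closure $\bar k$, and let $\ell$ be a rational prime. Let $C/k$ be a geometrically irreducible curve with affine model $$y^{\ell^n} = f(x), \qquad f \in k(x),$$ with $n \geq 1$. Let $J$ denote the Jacobian variety of $C$, and let $S \subseteq \mathbb{P}^1(\bar{k})$ be the branch locus of $C$ (that is, of the $x$-coordinate covering $C \to \mathbb{P}^1$). Suppose that: (a) the variety $J$ has good reduction away from $\ell$; (b) every element of $S$ is $\mathcal{T}(k,\ell)$-rational. Then $k(J[\ell^\infty]) \subseteq \mathcal{T}(k,\ell)$.
   Context: $C$ denotes the complete smooth curve with the given affine model. $\mu_{\ell^\infty}\subset \bar k$ is the group of all roots of unity of $\ell$-power order. $\mathcal{T}(k,\ell)\subset\bar k$ (denoted by a kanji character in the paper) is the maximal pro-$\ell$ extension of $k(\mu_{\ell^\infty})$ which is unramified away from $\ell$. "Good reduction away from $\ell$" means good reduction at every finite place of $k$ not dividing $\ell$. $G_k=\mathrm{Gal}(\bar k/k)$; for a $G_k$-set $T$, $k(T)$ is the subfield of $\bar k$ fixed by the kernel of $G_k\to\mathrm{Aut}(T)$; so $k(J[\ell^\infty])$ is the field generated over $k$ by the coordinates of all $\ell$-power torsion points of $J$, and condition (b) is equivalent to $k(S)\subseteq \mathcal{T}(k,\ell)$. *)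

theory Defs
  imports "HOL-Library.Poly_Mapping" "HOL-Algebra.Algebraic_Closure_Type" "HOL-Algebra.Generated_Fields"
begin

text \<open>
  The type \<open>'a\<close> plays the part of the algebraic closure of the number field. Fields and rings
  of integers are subsets of \<open>'a\<close>, and \<open>ring_on M\<close> is such a subset seen as a structure of
  HOL-Algebra.
\<close>

abbreviation ring_on :: "'a::field set \<Rightarrow> 'a ring" where
  "ring_on M \<equiv> ring_of_type_algebra\<lparr>carrier := M\<rparr>"

definition number_field :: "'a::field_char_0 set \<Rightarrow> bool" where
  "number_field k \<longleftrightarrow> subfield k (ring_on UNIV) \<and> ring.finite_dimension (ring_on UNIV) \<rat> k"

definition int_closure :: "'a::field set \<Rightarrow> 'a set" where
  "int_closure R = {z. \<exists>p. lead_coeff p = 1 \<and> set (coeffs p) \<subseteq> R \<and> poly p z = 0}"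

definition integers :: "'a::field_char_0 set \<Rightarrow> 'a set" where
  "integers M = {z \<in> M. algebraic_int z}"

text \<open>Finite places, also of infinite algebraic extensions of \<open>\<rat>\<close>, are the nonzero primes.\<close>

definition finite_places :: "'a::field_char_0 set \<Rightarrow> 'a set set" where
  "finite_places M = {\<pp>. primeideal \<pp> (ring_on (integers M)) \<and> \<pp> \<noteq> {0}}"

definition loc :: "'a::field set \<Rightarrow> 'a set \<Rightarrow> 'a set" where
  "loc A \<qq> = {a / b | a b. a \<in> A \<and> b \<in> A - \<qq>}"

definition loc_max :: "'a::field set \<Rightarrow> 'a set \<Rightarrow> 'a set" where
  "loc_max A \<qq> = {a / b | a b. a \<in> \<qq> \<and> b \<in> A - \<qq>}"

definition Gal :: "'a::field set \<Rightarrow> 'a set \<Rightarrow> ('a \<Rightarrow> 'a) set" where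
  "Gal K M = {\<sigma> \<in> extensional M. \<sigma> \<in> ring_iso (ring_on M) (ring_on M) \<and> (\<forall>a\<in>K. \<sigma> a = a)}"

text \<open>All extensions below are algebraic, so being Galois only requires the right fixed field.\<close>

definition galois_ext :: "'a::field set \<Rightarrow> 'a set \<Rightarrow> bool" where
  "galois_ext K M \<longleftrightarrow> subfield K (ring_on UNIV) \<and> subfield M (ring_on UNIV) \<and> K \<subseteq> M \<and>
     {z \<in> M. \<forall>\<sigma>\<in>Gal K M. \<sigma> z = z} = K"

definition pro_ext :: "nat \<Rightarrow> 'a::field set \<Rightarrow> 'a set \<Rightarrow> bool" where
  "pro_ext l K M \<longleftrightarrow> galois_ext K M \<and>
     (\<forall>L\<subseteq>M. galois_ext K L \<and> finite (Gal K L) \<longrightarrow> (\<exists>e. card (Gal K L) = l ^ e))"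

text \<open>
  Unramified at every finite place not above \<open>l\<close>: all inertia groups are trivial. An element
  of the inertia group automatically stabilises the prime.
\<close>

definition unramified_away :: "nat \<Rightarrow> 'a::field_char_0 set \<Rightarrow> 'a set \<Rightarrow> bool" where
  "unramified_away l K M \<longleftrightarrow>
     (\<forall>\<qq>\<in>finite_places M. of_nat l \<notin> \<qq> \<longrightarrow>
        (\<forall>\<sigma>\<in>Gal K M. (\<forall>z\<in>integers M. \<sigma> z - z \<in> \<qq>) \<longrightarrow> (\<forall>z\<in>M. \<sigma> z = z)))"

definition adjoin :: "'a::field set \<Rightarrow> 'a set \<Rightarrow> 'a set" where
  "adjoin K S = generate_field (ring_on UNIV) (K \<union> S)"

definition cyclotomic :: "nat \<Rightarrow> 'a::field set \<Rightarrow> 'a set" where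
  "cyclotomic l k = adjoin k {z. \<exists>m. z ^ (l ^ m) = 1}"

text \<open>
  Pro-\<open>l\<close> extensions, and extensions unramified away from \<open>l\<close>, are stable under composita, so
  the maximal one is the compositum of all of them. Archimedean places play no role, because
  \<open>cyclotomic l k\<close> has no real place.
\<close>

definition max_pro_ext :: "nat \<Rightarrow> 'a::field_char_0 set \<Rightarrow> 'a set" where
  "max_pro_ext l k = adjoin (cyclotomic l k)
     (\<Union>{M. pro_ext l (cyclotomic l k) M \<and> unramified_away l (cyclotomic l k) M})"

type_synonym ('v, 'a) mpol = "('v \<Rightarrow>\<^sub>0 nat) \<Rightarrow>\<^sub>0 'a"

definition ev :: "('v \<Rightarrow> 'a) \<Rightarrow> ('v, 'a::comm_ring_1) mpol \<Rightarrow> 'a" where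
  "ev x p = (\<Sum>\<mu>\<in>Poly_Mapping.keys p.
     Poly_Mapping.lookup p \<mu> * (\<Prod>v\<in>Poly_Mapping.keys \<mu>. x v ^ Poly_Mapping.lookup \<mu> v))"

text \<open>The value at \<open>x\<close> of the formal partial derivative with respect to the variable \<open>v\<close>.\<close>

definition ev_deriv :: "'v \<Rightarrow> ('v \<Rightarrow> 'a) \<Rightarrow> ('v, 'a::comm_ring_1) mpol \<Rightarrow> 'a" where
  "ev_deriv v x p = (\<Sum>\<mu>\<in>Poly_Mapping.keys p.
     Poly_Mapping.lookup p \<mu> * of_nat (Poly_Mapping.lookup \<mu> v) * x v ^ (Poly_Mapping.lookup \<mu> v - 1) *
     (\<Prod>u\<in>Poly_Mapping.keys \<mu> - {v}. x u ^ Poly_Mapping.lookup \<mu> u))"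

definition polys :: "'a::zero set \<Rightarrow> 'v set \<Rightarrow> ('v, 'a) mpol set" where
  "polys R V = {p. \<forall>\<mu>\<in>Poly_Mapping.keys p. Poly_Mapping.lookup p \<mu> \<in> R \<and> Poly_Mapping.keys \<mu> \<subseteq> V}"

definition forms :: "'a::zero set \<Rightarrow> nat \<Rightarrow> nat \<Rightarrow> (nat, 'a) mpol set" where
  "forms R N d = {p \<in> polys R {..N}. \<forall>\<mu>\<in>Poly_Mapping.keys p. (\<Sum>i\<le>N. Poly_Mapping.lookup \<mu> i) = d}"

definition biforms ::
  "'a::zero set \<Rightarrow> nat \<Rightarrow> nat \<Rightarrow> nat \<Rightarrow> nat \<Rightarrow> (nat + nat, 'a) mpol set" where
  "biforms R N N' d d' = {p \<in> polys R ({..N} <+> {..N'}). \<forall>\<mu>\<in>Poly_Mapping.keys p.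
     (\<Sum>i\<le>N. Poly_Mapping.lookup \<mu> (Inl i)) = d \<and> (\<Sum>i\<le>N'. Poly_Mapping.lookup \<mu> (Inr i)) = d'}"

text \<open>
  A closed subscheme of the projective space \<open>P\<^sup>N\<close> over a subring \<open>R\<close> of \<open>'a\<close> is given by finitely
  many forms over \<open>R\<close> in the variables \<open>0, \<dots>, N\<close>.
\<close>

type_synonym 'a scheme = "nat \<times> (nat, 'a) mpol set"

abbreviation amb :: "'a::zero scheme \<Rightarrow> nat" where "amb \<equiv> fst"

abbreviation eqs :: "'a::zero scheme \<Rightarrow> (nat, 'a) mpol set" where "eqs \<equiv> snd"

definition proj_scheme :: "'a::zero set \<Rightarrow> 'a scheme \<Rightarrow> bool" where
  "proj_scheme R V \<longleftrightarrow> finite (eqs V) \<and> eqs V \<subseteq> (\<Union>d. forms R (amb V) d)"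

text \<open>
  The geometric points of \<open>Spec R\<close>: a prime of the integral closure of \<open>R\<close> in \<open>'a\<close> gives a local
  ring \<open>W\<close> with maximal ideal \<open>\<mm>\<close>, and \<open>W / \<mm>\<close> is an algebraic closure of the residue field of
  the prime of \<open>R\<close> below. If \<open>R\<close> is a field, this is only \<open>(UNIV, {0})\<close>; if \<open>R\<close> is a discrete
  valuation ring, there are moreover the geometric points above the closed point of \<open>Spec R\<close>.
\<close>

definition geom_points :: "'a::field set \<Rightarrow> ('a set \<times> 'a set) set" where
  "geom_points R = {(loc (int_closure R) \<qq>, loc_max (int_closure R) \<qq>) | \<qq>.
     primeideal \<qq> (ring_on (int_closure R))}"

text \<open>
  The points of the fibre of \<open>V\<close> over \<open>(W, \<mm>)\<close>, as vectors of homogeneous coordinates in \<open>W\<close>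
  to be read modulo \<open>\<mm>\<close>.
\<close>

definition fibre :: "'a::comm_ring_1 set \<times> 'a set \<Rightarrow> 'a scheme \<Rightarrow> (nat \<Rightarrow> 'a) set" where
  "fibre = (\<lambda>(W, \<mm>) V. {P. range P \<subseteq> W \<and> (\<forall>i>amb V. P i = 0) \<and> (\<exists>i\<le>amb V. P i \<notin> \<mm>) \<and>
     (\<forall>h\<in>eqs V. ev P h \<in> \<mm>)})"

definition cone :: "'a::comm_ring_1 scheme \<Rightarrow> (nat \<Rightarrow> 'a) set" where
  "cone V = fibre (UNIV, {0}) V"

text \<open>The points of \<open>V\<close> with values in \<open>'a\<close>; the first nonzero coordinate is scaled to be 1.\<close>

definition normalise :: "(nat \<Rightarrow> 'a::field) \<Rightarrow> nat \<Rightarrow> 'a" where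
  "normalise v = (\<lambda>i. v i / v (LEAST j. v j \<noteq> 0))"

definition points :: "'a::field scheme \<Rightarrow> (nat \<Rightarrow> 'a) set" where
  "points V = normalise ` cone V"

definition ideal_of :: "'a::comm_ring_1 set \<Rightarrow> 'a scheme \<Rightarrow> (nat, 'a) mpol set" where
  "ideal_of R V = {\<Sum>h\<in>eqs V. c h * h | c. range c \<subseteq> polys R {..amb V}}"

text \<open>
  Smoothness over \<open>R\<close> of relative dimension \<open>d\<close> at a geometric point: locally \<open>V\<close> is cut out in
  \<open>P\<^sup>N\<close> by \<open>N - d\<close> equations whose differentials are linearly independent at the point. By Euler's
  identity, the Jacobian matrix with respect to all homogeneous coordinates has the same rank
  as the one in an affine chart.
\<close>

definition smooth_at ::
  "'a::comm_ring_1 set \<Rightarrow> 'a scheme \<Rightarrow> nat \<Rightarrow> 'a set \<times> 'a set \<Rightarrow> (nat \<Rightarrow> 'a) \<Rightarrow> bool" where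
  "smooth_at R V d = (\<lambda>(W, \<mm>) P. \<exists>fs. length fs + d = amb V \<and>
     set fs \<subseteq> ideal_of R V \<inter> (\<Union>e. forms R (amb V) e) \<and>
     (\<exists>g\<in>\<Union>e. forms R (amb V) e. ev P g \<notin> \<mm> \<and>
        (\<forall>h\<in>eqs V. \<exists>c. range c \<subseteq> polys R {..amb V} \<and>
           g * h = (\<Sum>i<length fs. c i * fs ! i))) \<and>
     (\<forall>c. range c \<subseteq> W \<and>
          (\<forall>j\<le>amb V. (\<Sum>i<length fs. c i * ev_deriv j P (fs ! i)) \<in> \<mm>) \<longrightarrow>
          (\<forall>i<length fs. c i \<in> \<mm>)))"

definition irreducible_fibre :: "'a::comm_ring_1 scheme \<Rightarrow> 'a set \<times> 'a set \<Rightarrow> bool" where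
  "irreducible_fibre V = (\<lambda>(W, \<mm>). fibre (W, \<mm>) V \<noteq> {} \<and>
     (\<forall>d e. \<forall>f\<in>forms W (amb V) d. \<forall>g\<in>forms W (amb V) e.
        (\<forall>P\<in>fibre (W, \<mm>) V. ev P f * ev P g \<in> \<mm>) \<longrightarrow>
        (\<forall>P\<in>fibre (W, \<mm>) V. ev P f \<in> \<mm>) \<or> (\<forall>P\<in>fibre (W, \<mm>) V. ev P g \<in> \<mm>)))"

definition smooth_projective :: "'a::field set \<Rightarrow> 'a scheme \<Rightarrow> nat \<Rightarrow> bool" where
  "smooth_projective R V d \<longleftrightarrow> proj_scheme R V \<and>
     (\<forall>s\<in>geom_points R. irreducible_fibre V s \<and> (\<forall>P\<in>fibre s V. smooth_at R V d s P))"

text \<open>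
  Morphisms over \<open>R\<close> between smooth \<open>R\<close>-schemes, given by their effect on \<open>'a\<close>-valued points.
  Near each geometric point of the source, also in the special fibres, the map is given by
  forms over \<open>R\<close> without common zero there. Such a map extends uniquely to a morphism of
  \<open>R\<close>-schemes, because the source is flat and reduced.
\<close>

definition morphism ::
  "'a::field set \<Rightarrow> 'a scheme \<Rightarrow> 'a scheme \<Rightarrow> ((nat \<Rightarrow> 'a) \<Rightarrow> nat \<Rightarrow> 'a) \<Rightarrow> bool" where
  "morphism R V Y \<phi> \<longleftrightarrow> \<phi> ` points V \<subseteq> points Y \<and>
     (\<forall>(W, \<mm>)\<in>geom_points R. \<forall>P\<in>fibre (W, \<mm>) V. \<exists>d F.
        (\<forall>i. F i \<in> forms R (amb V) d) \<and> (\<forall>i>amb Y. F i = 0) \<and> (\<exists>i. ev P (F i) \<notin> \<mm>) \<and>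
        (\<forall>A\<in>points V. (\<exists>i. ev A (F i) \<noteq> 0) \<longrightarrow> \<phi> A = normalise (\<lambda>i. ev A (F i))))"

definition bimorphism :: "'a::field set \<Rightarrow> 'a scheme \<Rightarrow> 'a scheme \<Rightarrow> 'a scheme \<Rightarrow>
    ((nat \<Rightarrow> 'a) \<Rightarrow> (nat \<Rightarrow> 'a) \<Rightarrow> nat \<Rightarrow> 'a) \<Rightarrow> bool" where
  "bimorphism R V Y Z \<phi> \<longleftrightarrow> (\<forall>A\<in>points V. \<forall>B\<in>points Y. \<phi> A B \<in> points Z) \<and>
     (\<forall>(W, \<mm>)\<in>geom_points R. \<forall>P\<in>fibre (W, \<mm>) V. \<forall>Q\<in>fibre (W, \<mm>) Y. \<exists>d e F.
        (\<forall>i. F i \<in> biforms R (amb V) (amb Y) d e) \<and> (\<forall>i>amb Z. F i = 0) \<and>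
        (\<exists>i. ev (case_sum P Q) (F i) \<notin> \<mm>) \<and>
        (\<forall>A\<in>points V. \<forall>B\<in>points Y. (\<exists>i. ev (case_sum A B) (F i) \<noteq> 0) \<longrightarrow>
           \<phi> A B = normalise (\<lambda>i. ev (case_sum A B) (F i))))"

text \<open>The group \<open>G\<close> on the \<open>'a\<close>-valued points is part of the data. The last clause says that
  the zero section is defined over \<open>R\<close>.\<close>

definition abelian_scheme :: "'a::field set \<Rightarrow> 'a scheme \<Rightarrow> (nat \<Rightarrow> 'a) monoid \<Rightarrow> bool" where
  "abelian_scheme R V G \<longleftrightarrow> (\<exists>d. smooth_projective R V d) \<and>
     comm_group G \<and> carrier G = points V \<and>
     bimorphism R V V V (\<lambda>A B. A \<otimes>\<^bsub>G\<^esub> B) \<and> morphism R V V (\<lambda>A. inv\<^bsub>G\<^esub> A) \<and>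
     (\<forall>(W, \<mm>)\<in>geom_points R. \<exists>v. range v \<subseteq> R \<and> (\<exists>i. v i \<notin> \<mm>) \<and> normalise v = \<one>\<^bsub>G\<^esub>)"

abbreviation abelian_variety :: "'a::field set \<Rightarrow> 'a scheme \<Rightarrow> (nat \<Rightarrow> 'a) monoid \<Rightarrow> bool" where
  "abelian_variety \<equiv> abelian_scheme"

text \<open>
  Good reduction at the finite place \<open>\<pp>\<close> of \<open>k\<close>: there is an abelian scheme over the local ring
  at \<open>\<pp>\<close> whose generic fibre is isomorphic to the given abelian variety over \<open>k\<close>. Abelian
  schemes over a discrete valuation ring are projective.
\<close>

definition good_reduction ::
  "'a::field_char_0 set \<Rightarrow> 'a set \<Rightarrow> 'a scheme \<Rightarrow> (nat \<Rightarrow> 'a) monoid \<Rightarrow> bool" where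
  "good_reduction k \<pp> J G \<longleftrightarrow> (\<exists>V H. abelian_scheme (loc (integers k) \<pp>) V H \<and>
     (\<exists>\<theta>\<in>iso H G. morphism k V J \<theta> \<and> morphism k J V (inv_into (points V) \<theta>)))"

definition torsion :: "nat \<Rightarrow> ('b, 'c) monoid_scheme \<Rightarrow> 'b set" where
  "torsion l G = {P \<in> carrier G. \<exists>m. P [^]\<^bsub>G\<^esub> (l ^ m) = \<one>\<^bsub>G\<^esub>}"

text \<open>The field \<open>k(T)\<close> of a Galois stable set \<open>T\<close> of points; Galois acts on the coordinates.\<close>

definition field_of_points :: "'a::field set \<Rightarrow> (nat \<Rightarrow> 'a) set \<Rightarrow> 'a set" where
  "field_of_points k T = {z. \<forall>\<sigma>\<in>Gal k UNIV. (\<forall>P\<in>T. \<sigma> \<circ> P = P) \<longrightarrow> \<sigma> z = z}"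

text \<open>
  For a smooth projective curve \<open>C\<close> over \<open>'a\<close>: \<open>t\<close> is a uniformizer at \<open>P\<close> if it generates, after
  dehomogenisation, the maximal ideal of the local ring at \<open>P\<close>. The forms \<open>h\<close> and \<open>u\<close> are units
  there. Evaluating on the whole cone makes an identity of values respect degrees.
\<close>

definition uniformizer :: "'a::field scheme \<Rightarrow> (nat \<Rightarrow> 'a) \<Rightarrow> (nat, 'a) mpol \<Rightarrow> bool" where
  "uniformizer C P t \<longleftrightarrow> t \<in> (\<Union>d. forms UNIV (amb C) d) \<and> ev P t = 0 \<and>
     (\<forall>a\<in>\<Union>d. forms UNIV (amb C) d. ev P a = 0 \<longrightarrow>
        (\<exists>h\<in>\<Union>d. forms UNIV (amb C) d. \<exists>b\<in>\<Union>d. forms UNIV (amb C) d.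
           ev P h \<noteq> 0 \<and> (\<forall>Q\<in>cone C. ev Q h * ev Q a = ev Q t * ev Q b)))"

text \<open>The order of vanishing at \<open>P\<close> of a form that is not identically zero on \<open>C\<close>.\<close>

definition vanishing_order :: "'a::field scheme \<Rightarrow> (nat \<Rightarrow> 'a) \<Rightarrow> (nat, 'a) mpol \<Rightarrow> nat" where
  "vanishing_order C P f = (THE n. \<exists>t. uniformizer C P t \<and>
     (\<exists>h\<in>\<Union>d. forms UNIV (amb C) d. \<exists>u\<in>\<Union>d. forms UNIV (amb C) d.
        ev P h \<noteq> 0 \<and> ev P u \<noteq> 0 \<and>
        (\<forall>Q\<in>cone C. ev Q h * ev Q f = ev Q t ^ n * ev Q u)))"

text \<open>Rational functions on \<open>C\<close> with coefficients in \<open>K\<close> are quotients \<open>f / g\<close> of two forms of the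
  same degree.\<close>

definition rat_fun :: "'a::field set \<Rightarrow> 'a scheme \<Rightarrow> (nat, 'a) mpol \<times> (nat, 'a) mpol \<Rightarrow> bool" where
  "rat_fun K C = (\<lambda>(f, g). (\<exists>d. f \<in> forms K (amb C) d \<and> g \<in> forms K (amb C) d) \<and>
     (\<exists>P\<in>points C. ev P g \<noteq> 0))"

type_synonym 'a divisor = "(nat \<Rightarrow> 'a) \<Rightarrow>\<^sub>0 int"

definition div0 :: "'a::field scheme \<Rightarrow> 'a divisor set" where
  "div0 C = {D. Poly_Mapping.keys D \<subseteq> points C \<and>
     (\<Sum>P\<in>Poly_Mapping.keys D. Poly_Mapping.lookup D P) = 0}"

definition principal :: "'a::field scheme \<Rightarrow> 'a divisor \<Rightarrow> bool" where
  "principal C D \<longleftrightarrow> Poly_Mapping.keys D \<subseteq> points C \<and>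
     (\<exists>f g. rat_fun UNIV C (f, g) \<and> (\<exists>P\<in>points C. ev P f \<noteq> 0) \<and>
        (\<forall>P\<in>points C. Poly_Mapping.lookup D P = int (vanishing_order C P f) - int (vanishing_order C P g)))"

text \<open>
  The abelian variety \<open>J\<close> over \<open>k\<close> is the Jacobian of \<open>C\<close>: its points are the divisor classes of
  degree 0 on \<open>C\<close>, in such a way that \<open>(A, B) \<mapsto> [A - B]\<close> is a morphism over \<open>k\<close>. No rational
  point on \<open>C\<close> is needed, and in characteristic 0 this determines \<open>J\<close> up to a unique isomorphism
  compatible with the classes.
\<close>

definition jacobian ::
  "'a::field set \<Rightarrow> 'a scheme \<Rightarrow> 'a scheme \<Rightarrow> (nat \<Rightarrow> 'a) monoid \<Rightarrow> bool" where
  "jacobian k C J G \<longleftrightarrow> abelian_variety k J G \<and>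
     (\<exists>cls. cls ` div0 C = carrier G \<and>
        (\<forall>D\<in>div0 C. \<forall>E\<in>div0 C. cls (D + E) = cls D \<otimes>\<^bsub>G\<^esub> cls E) \<and>
        (\<forall>D\<in>div0 C. cls D = \<one>\<^bsub>G\<^esub> \<longleftrightarrow> principal C D) \<and>
        bimorphism k C C J
          (\<lambda>A B. cls (Poly_Mapping.single A 1 - Poly_Mapping.single B 1)))"

definition affine_curve :: "nat \<Rightarrow> 'a::field poly \<Rightarrow> 'a poly \<Rightarrow> ('a \<times> 'a) set" where
  "affine_curve m p q = {(a, b). poly q a \<noteq> 0 \<and> b ^ m = poly p a / poly q a}"

definition defined_at :: "(nat \<Rightarrow> 'a) \<Rightarrow> (nat, 'a::field) mpol \<times> (nat, 'a) mpol \<Rightarrow> bool" where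
  "defined_at P = (\<lambda>(f, g). ev P g \<noteq> 0)"

definition value_at :: "(nat \<Rightarrow> 'a) \<Rightarrow> (nat, 'a::field) mpol \<times> (nat, 'a) mpol \<Rightarrow> 'a" where
  "value_at P = (\<lambda>(f, g). ev P f / ev P g)"

definition ev2 :: "'a \<times> 'a \<Rightarrow> (bool, 'a::comm_ring_1) mpol \<Rightarrow> 'a" where
  "ev2 = (\<lambda>(a, b). ev (\<lambda>second. if second then b else a))"

text \<open>
  \<open>C\<close> has the affine model \<open>y ^ m = p(x) / q(x)\<close> over \<open>k\<close>, with coordinate functions \<open>x\<close> and \<open>y\<close>:
  these define a birational map from \<open>C\<close> to the affine curve, the inverse \<open>H\<close> being given by
  polynomials over \<open>k\<close> in the two coordinates. The condition \<open>p \<noteq> 0\<close> makes the affine curve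
  reduced, so that it is described by its points.
\<close>

definition affine_model :: "'a::field set \<Rightarrow> 'a scheme \<Rightarrow> nat \<Rightarrow> 'a poly \<Rightarrow> 'a poly \<Rightarrow>
    (nat, 'a) mpol \<times> (nat, 'a) mpol \<Rightarrow> (nat, 'a) mpol \<times> (nat, 'a) mpol \<Rightarrow> bool" where
  "affine_model k C m p q x y \<longleftrightarrow> p \<noteq> 0 \<and> q \<noteq> 0 \<and> rat_fun k C x \<and> rat_fun k C y \<and>
     (\<exists>H. (\<forall>i. H i \<in> polys k UNIV) \<and> (\<forall>i>amb C. H i = 0) \<and>
        finite {P \<in> points C. \<not> (defined_at P x \<and> defined_at P y \<and>
           (value_at P x, value_at P y) \<in> affine_curve m p q \<and>
           (\<exists>i. ev2 (value_at P x, value_at P y) (H i) \<noteq> 0) \<and>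
           normalise (\<lambda>i. ev2 (value_at P x, value_at P y) (H i)) = P)} \<and>
        finite {z \<in> affine_curve m p q. \<not> ((\<exists>i. ev2 z (H i) \<noteq> 0) \<and>
           (\<exists>P\<in>points C. P = normalise (\<lambda>i. ev2 z (H i)) \<and> defined_at P x \<and> defined_at P y \<and>
              z = (value_at P x, value_at P y)))})"

text \<open>
  The ramification index at \<open>P\<close> of the covering \<open>x = f / g : C \<rightarrow> P\<^sup>1\<close>, relative to the point \<open>u\<close> of
  \<open>P\<^sup>1\<close>; it is 0 if \<open>u\<close> is not the image of \<open>P\<close>. The element \<open>a\<close> of the affine line is the point
  \<open>(1, a)\<close> of \<open>P\<^sup>1\<close> and infinity is \<open>(0, 1)\<close>. After removal of the common zeros of \<open>f\<close> and \<open>g\<close>, the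
  index is the multiplicity of \<open>P\<close> in the pullback of the linear form vanishing at \<open>u\<close>.
\<close>

definition ram_index :: "'a::field scheme \<Rightarrow> (nat, 'a) mpol \<times> (nat, 'a) mpol \<Rightarrow> (nat \<Rightarrow> 'a) \<Rightarrow>
    (nat \<Rightarrow> 'a) \<Rightarrow> nat" where
  "ram_index C = (\<lambda>(f, g) P u.
     vanishing_order C P (Poly_Mapping.single 0 (u 0) * f - Poly_Mapping.single 0 (u 1) * g)
       - min (vanishing_order C P f) (vanishing_order C P g))"

definition branch_locus ::
  "'a::field scheme \<Rightarrow> (nat, 'a) mpol \<times> (nat, 'a) mpol \<Rightarrow> (nat \<Rightarrow> 'a) set" where
  "branch_locus C x = {u \<in> points (1, {}). \<exists>P\<in>points C. ram_index C x P u > 1}"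

end

(* Let K be the l-cyclotomic extension of k, and M the field generated over K by the l-power torsion
   points of J. It suffices that M / K is pro-l and unramified away from l.

   Unramifiedness is half of the Neron-Ogg-Shafarevich criterion: an element of inertia moves a torsion
   point only within its residue class in the good model, and near the zero section multiplication by
   l ^ m is a unit times the coordinates up to second order, so no l-power torsion is in the kernel of
   reduction.

   For the pro-l part, let delta generate the group of the Kummer covering C -> P^1 over K. In the group
   ring of the cyclic group of order l ^ n a power of delta - 1 is divisible by l, so every l-power torsion
   class is killed by a power of delta - 1. A class fixed by delta is represented, by Hilbert 90, by a
   delta-invariant divisor, which is a combination of fibres of x. Outside the branch locus these are
   principal up to the fibre at infinity, and the branch points generate an l-extension of K. Hence every
   s in the Galois group of K has a power s ^ (l ^ e) that fixes a given torsion class.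

   The curve is handled through its function field, realised in an algebraic closure of the field of
   rational functions of x: points are valuation rings, and automorphisms act on them. *)

theory Submission
  imports Defs "HOL-Algebra.Sylow"
begin

text \<open>Galois groups carry no topology here. Whether \<open>M\<close> is pro-l over
  \<open>K\<close> is tested on elements: every automorphism \<open>s\<close> over \<open>K\<close>
  must have, for each element of \<open>M\<close>, an iterate \<open>s ^^ (l ^ e)\<close> that fixes
  it. The elements passing this test form a field, so only coordinates of torsion points have to be
  examined, and Sylow's theorem leads back to finite quotients of l-power order. The same test,
  applied to the maximal extension, yields what is used about branch points. No Tate module is
  formed either, and the exponent \<open>e\<close> may depend on the torsion class. The filtration
  by powers of delta - 1 is climbed class by class, and each step costs further l-power iterates.
  For this the Galois action must commute with delta, which multiplies y by a root of unity: that is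
  why this root of unity has to lie in \<open>K\<close>. Degrees of divisors are not recorded in the
  main computation. This is possible because the fibre at infinity is preserved by all automorphisms
  that occur, so that finitely many affine fibres remain to be controlled.\<close>

abbreviation "lookup \<equiv> Poly_Mapping.lookup"
abbreviation "keys \<equiv> Poly_Mapping.keys"
abbreviation "single \<equiv> Poly_Mapping.single"

section \<open>Ring homomorphisms and evaluation of polynomials in several variables\<close>

definition is_hom :: "('a::comm_ring_1 => 'b::comm_ring_1) => bool" where
  "is_hom h \<longleftrightarrow> h 1 = 1 & (ALL a b. h (a + b) = h a + h b) & (ALL a b. h (a * b) = h a * h b)"

lemma is_homD:
  assumes "is_hom h"
  shows "h 1 = 1" "h (a + b) = h a + h b" "h (a * b) = h a * h b" "h 0 = 0" "h (- a) = - h a"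
   "h (a - b) = h a - h b" "h (a ^ n) = h a ^ n" "h (sum f A) = (\<Sum>i\<in>A. h (f i))"
   "h (prod f A) = (\<Prod>i\<in>A. h (f i))" "h (of_nat n) = of_nat n"
proof -
  have 1: "h 1 = 1" and a: "!!a b. h (a + b) = h a + h b" and m: "!!a b. h (a * b) = h a * h b"
   using assms by (auto simp: is_hom_def)
  show "h 1 = 1" "h (a + b) = h a + h b" "h (a * b) = h a * h b" by (auto simp: 1 a m)
  show z: "h 0 = 0" using a[of 0 0] by simp
  show u: "h (- a) = - h a" for a using a[of a "-a"] z by (simp add: eq_neg_iff_add_eq_0 add.commute)
  show "h (a - b) = h a - h b" using a[of a "-b"] u by simp
  show "h (a ^ n) = h a ^ n" by (induction n) (auto simp: 1 m)
  show "h (sum f A) = (\<Sum>i\<in>A. h (f i))" by (induction A rule: infinite_finite_induct) (auto simp: z a)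
  show "h (prod f A) = (\<Prod>i\<in>A. h (f i))" by (induction A rule: infinite_finite_induct) (auto simp: 1 m)
  show "h (of_nat n) = of_nat n" by (induction n) (auto simp: 1 a z)
qed

lemma is_hom_id: "is_hom (%x. x)" by (auto simp: is_hom_def)

lemma is_hom_comp: "is_hom f ==> is_hom g ==> is_hom (%x. f (g x))" by (auto simp: is_hom_def)

lemma is_hom_field:
  fixes h :: "'a::field => 'b::field"
  assumes "is_hom h"
  shows "h a = 0 \<longleftrightarrow> a = 0" "h a = h b \<longleftrightarrow> a = b" "h (inverse a) = inverse (h a)" "h (a / b) = h a / h b"
proof -
  note h = is_homD[OF assms]
  show z: "h a = 0 \<longleftrightarrow> a = 0" for a using h(1) h(3)[of a "inverse a"] h(4) by (cases "a = 0") auto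
  show "h a = h b \<longleftrightarrow> a = b" using z[of "a - b"] h(6)[of a b] by auto
  show i: "h (inverse a) = inverse (h a)" for a
  proof (cases "a = 0")
   case False
   hence "h (inverse a) * h a = 1" using h(1) h(3)[of "inverse a" a] by simp
   thus ?thesis by (metis inverse_unique mult.commute)
  qed (simp add: h)
  show "h (a / b) = h a / h b" by (simp add: divide_inverse h i)
qed

definition mev :: "('v => 'b) => ('v \<Rightarrow>\<^sub>0 nat) => 'b::comm_ring_1" where "mev x \<mu> = (\<Prod>v\<in>keys \<mu>. x v ^ lookup \<mu> v)"

text \<open>Coefficients pass through \<open>h\<close>, so that one definition covers values in the
  base field (\<open>h\<close> the identity), values at the generic point in the function field, and
  substitution of polynomials for the variables.\<close>

definition evh :: "('a => 'b) => ('v => 'b) => ('v, 'a::comm_ring_1) mpol => 'b::comm_ring_1" where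
  "evh h x p = (\<Sum>\<mu>\<in>keys p. h (lookup p \<mu>) * mev x \<mu>)"

lemma ev_evh: "ev x p = evh (%a. a) x p" by (simp add: ev_def evh_def mev_def)

lemma mev_superset: "finite A ==> keys \<mu> \<subseteq> A ==> mev x \<mu> = (\<Prod>v\<in>A. x v ^ lookup \<mu> v)"
  unfolding mev_def by (rule prod.mono_neutral_left) (auto simp: in_keys_iff)

lemma mev_0 [simp]: "mev x 0 = 1" by (simp add: mev_def)

lemma mev_add: "mev x (\<mu> + \<nu>) = mev x \<mu> * mev x \<nu>"
proof -
  let ?A = "keys \<mu> \<union> keys \<nu>"
  have "keys (\<mu> + \<nu>) \<subseteq> ?A" by (rule keys_add)
  thus ?thesis by (simp add: mev_superset[of ?A] lookup_add power_add prod.distrib)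
qed

lemma mev_single [simp]: "mev x (single v n) = x v ^ n" by (cases "n = 0") (auto simp: mev_def)

lemma evh_superset:
  assumes "h 0 = 0" "finite A" "keys p \<subseteq> A"
  shows "evh h x p = (\<Sum>\<mu>\<in>A. h (lookup p \<mu>) * mev x \<mu>)"
  unfolding evh_def by (rule sum.mono_neutral_left) (use assms in "auto simp: in_keys_iff")

lemma mpol_sum_singles: "p = (\<Sum>\<mu>\<in>keys p. single \<mu> (lookup p \<mu>))"
proof (rule poly_mapping_eqI)
  fix k
  have "(\<Sum>\<mu>\<in>keys p. lookup (single \<mu> (lookup p \<mu>)) k) = (\<Sum>\<mu>\<in>keys p. if \<mu> = k then lookup p k else 0)"
   by (rule sum.cong) (auto simp: lookup_single when_def)
  also have "... = lookup p k" by (auto simp: in_keys_iff)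
  finally show "lookup p k = lookup (\<Sum>\<mu>\<in>keys p. single \<mu> (lookup p \<mu>)) k" by (simp add: lookup_sum)
qed

lemma mpol_induct [case_names zero single add]:
  fixes p :: "'v \<Rightarrow>\<^sub>0 'a::comm_monoid_add"
  assumes "P 0" and "!!\<mu>. \<mu> : keys p ==> P (single \<mu> (lookup p \<mu>))" and "!!q r. P q ==> P r ==> P (q + r)"
  shows "P p"
proof -
  have "P (\<Sum>\<mu>\<in>S. single \<mu> (lookup p \<mu>))" if "S \<subseteq> keys p" for S using finite_subset[OF that finite_keys] that
   by (induction S rule: finite_induct) (auto intro: assms)
  from this[OF order_refl] show ?thesis by (simp flip: mpol_sum_singles)
qed

lemma mono_induct [case_names zero step]:
  fixes \<mu> :: "'v \<Rightarrow>\<^sub>0 nat"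
  assumes "P 0" and "!!v \<nu>. v : keys \<mu> ==> P \<nu> ==> P (single v 1 + \<nu>)"
  shows "P \<mu>"
proof -
  have *: "P (single v n + \<nu>)" if "v : keys \<mu>" "P \<nu>" for v n \<nu>
  proof (induction n)
   case (Suc n)
   have "single v (Suc n) + \<nu> = single v 1 + (single v n + \<nu>)"
    by (simp add: add.assoc[symmetric] single_add[symmetric])
   thus ?case using assms(2)[OF that(1) Suc] by simp
  qed (use that in auto)
  have "P (\<Sum>v\<in>S. single v (lookup \<mu> v))" if "S \<subseteq> keys \<mu>" for S using finite_subset[OF that finite_keys] that
   by (induction S rule: finite_induct) (auto intro: assms *)
  from this[OF order_refl] show ?thesis by (simp flip: mpol_sum_singles)
qed

lemma evh_zero [simp]: "evh h x 0 = 0" by (simp add: evh_def)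

lemma evh_add:
  assumes "is_hom h" shows "evh h x (p + q) = evh h x p + evh h x q"
proof -
  let ?A = "keys p \<union> keys q"
  have "keys (p + q) \<subseteq> ?A" by (rule keys_add)
  thus ?thesis by (simp add: evh_superset[of h ?A] is_homD[OF assms] lookup_add ring_distribs sum.distrib)
qed

lemma evh_single:
  assumes "is_hom h" shows "evh h x (single \<mu> c) = h c * mev x \<mu>"
  by (cases "c = 0") (auto simp: evh_def is_homD[OF assms])

lemma evh_mult:
  assumes "is_hom h" shows "evh h x (p * q) = evh h x p * evh h x q"
proof (induction p rule: mpol_induct)
  case (single \<mu>)
  show ?case by (induction q rule: mpol_induct)
    (auto simp: mult_single evh_single[OF assms] evh_add[OF assms] is_homD[OF assms] mev_add ring_distribs)
qed (auto simp: evh_add[OF assms] ring_distribs)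

lemma is_hom_evh: "is_hom h ==> is_hom (evh h x)" unfolding is_hom_def[of "evh h x"]
  using evh_single[of h x 0 1] by (simp add: evh_add evh_mult is_homD(1))

lemma is_hom_ev: "is_hom (ev x)" using is_hom_evh[OF is_hom_id, of x] by (simp add: ev_evh[abs_def])

lemma mev_hom: "is_hom g ==> g (mev x \<mu>) = mev (%v. g (x v)) \<mu>" by (simp add: mev_def is_homD(7,9)[of g])

lemma evh_hom: "is_hom g ==> g (evh h x p) = evh (%a. g (h a)) (%v. g (x v)) p"
  by (simp add: evh_def is_homD(3,8)[of g] mev_hom)

lemma mev_cong: "(!!v. v : keys \<mu> ==> x v = y v) ==> mev x \<mu> = mev y \<mu>" by (simp add: mev_def)

lemma evh_cong_polys:
  assumes "p : polys R V" "!!c. c : R ==> h c = g c" "!!v. v : V ==> x v = y v"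
  shows "evh h x p = evh g y p" unfolding evh_def
  by (rule sum.cong) (use assms in \<open>auto simp: polys_def subset_iff intro!: arg_cong2[of _ _ _ _ "(*)"] mev_cong\<close>)

lemma evh_closed:
  assumes "p : polys R V" "0 : A" "1 : A" "!!a b. a : A ==> b : A ==> a + b : A"
   "!!a b. a : A ==> b : A ==> a * b : A" "!!c. c : R ==> h c : A" "!!v. v : V ==> x v : A"
  shows "evh h x p : A"
proof -
  have pw: "a ^ n : A" if "a : A" for a n by (induction n) (auto simp: assms that)
  have sm: "sum f S : A" if "!!i. i : S ==> f i : A" for f and S :: "('v \<Rightarrow>\<^sub>0 nat) set"
   using that by (induction S rule: infinite_finite_induct) (auto simp: assms)
  have pr: "prod f S : A" if "!!i. i : S ==> f i : A" for f and S :: "'v set"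
   using that by (induction S rule: infinite_finite_induct) (auto simp: assms)
  show ?thesis unfolding evh_def mev_def using assms(1) by (intro sm assms pr pw) (auto simp: polys_def)
qed

section \<open>Formal derivatives and Euler's identity\<close>

definition dmev :: "'v => ('v => 'b) => ('v \<Rightarrow>\<^sub>0 nat) => 'b::comm_ring_1" where
  "dmev v x \<mu> = of_nat (lookup \<mu> v) * x v ^ (lookup \<mu> v - 1) * (\<Prod>u\<in>keys \<mu> - {v}. x u ^ lookup \<mu> u)"

lemma ev_deriv_dmev: "ev_deriv v x p = (\<Sum>\<mu>\<in>keys p. lookup p \<mu> * dmev v x \<mu>)"
  by (simp add: ev_deriv_def dmev_def mult.assoc)

text \<open>The product rule for one extra factor \<open>x u\<close>. Adding variables one at a time
  is the form of induction used for monomials, both in Euler's identity and in the Taylor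
  expansion.\<close>

lemma dmev_step: "dmev v x (single u 1 + \<nu>) = (if u = v then mev x \<nu> else 0) + x u * dmev v x \<nu>"
proof -
  let ?S = "insert u (keys \<nu>)"
  have sub: "keys (single u 1 + \<nu>) \<subseteq> ?S" using keys_add[of "single u 1" \<nu>] by auto
  define R where "R \<mu> = (\<Prod>w\<in>?S - {v}. x w ^ lookup \<mu> w)" for \<mu>
  have R: "(\<Prod>w\<in>keys \<mu> - {v}. x w ^ lookup \<mu> w) = R \<mu>"
   if "keys \<mu> \<subseteq> ?S" for \<mu> unfolding R_def using that
   by (intro prod.mono_neutral_left) (auto simp: in_keys_iff intro!: gr0I)
  have m: "mev x \<nu> = x v ^ lookup \<nu> v * R \<nu>"
  proof -
   have "mev x \<nu> = (\<Prod>w\<in>insert v ?S. x w ^ lookup \<nu> w)" by (rule mev_superset) auto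
   also have "... = x v ^ lookup \<nu> v * R \<nu>"
    unfolding R_def by (subst prod.insert_remove) (auto simp: insert_Diff_if)
   finally show ?thesis .
  qed
  have d: "dmev v x \<mu> = of_nat (lookup \<mu> v) * x v ^ (lookup \<mu> v - 1) * R \<mu>"
   if "keys \<mu> \<subseteq> ?S" for \<mu> using R[OF that] by (simp add: dmev_def)
  show ?thesis
  proof (cases "u = v")
   case True
   have "R (single u 1 + \<nu>) = R \<nu>" unfolding R_def by (rule prod.cong) (auto simp: lookup_add lookup_single True)
   thus ?thesis using d[OF sub] d[OF subset_insertI] m True
    by (cases "lookup \<nu> v") (auto simp: lookup_add algebra_simps)
  next
   case False
   have "R (single u 1 + \<nu>) = (\<Prod>w\<in>?S - {v}. (if w = u then x u else 1) * x w ^ lookup \<nu> w)"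
    unfolding R_def by (rule prod.cong) (auto simp: lookup_add lookup_single)
   also have "... = x u * R \<nu>" using False by (simp add: prod.distrib R_def)
   finally show ?thesis using d[OF sub] d[OF subset_insertI] False
    by (auto simp: lookup_add lookup_single algebra_simps)
  qed
qed

lemma dmev_0 [simp]: "dmev v x 0 = 0" by (simp add: dmev_def)

lemma euler_mono:
  fixes N :: nat
  assumes "keys \<mu> \<subseteq> {..N}"
  shows "(\<Sum>v\<le>N. x v * dmev v x \<mu>) = of_nat (\<Sum>v\<le>N. lookup \<mu> v) * mev x \<mu>"
proof (induction \<mu> rule: mono_induct)
  case (step u \<nu>)
  have u: "u <= N" using step assms by auto
  have "(\<Sum>v\<le>N. x v * dmev v x (single u 1 + \<nu>)) =
    (\<Sum>v\<le>N. (if u = v then x v * mev x \<nu> else 0) + x u * (x v * dmev v x \<nu>))"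
   by (rule sum.cong) (auto simp only: dmev_step ring_distribs mult.left_commute add_0_left if_True if_False mult_zero_right split: if_splits)
  also have "... = x u * mev x \<nu> + x u * (\<Sum>v\<le>N. x v * dmev v x \<nu>)"
   using u by (simp add: sum.distrib sum_distrib_left)
  also have "... = of_nat (\<Sum>v\<le>N. lookup (single u 1 + \<nu>) v) * mev x (single u 1 + \<nu>)"
   using u by (simp add: step lookup_add lookup_single sum.distrib when_def mev_add algebra_simps)
  finally show ?case .
qed auto

lemma euler_identity:
  assumes "f : forms R N d"
  shows "(\<Sum>v\<le>N. x v * ev_deriv v x f) = of_nat d * ev x f"
proof -
  have "(\<Sum>v\<le>N. x v * ev_deriv v x f) = (\<Sum>\<mu>\<in>keys f. lookup f \<mu> * (\<Sum>v\<le>N. x v * dmev v x \<mu>))"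
   unfolding ev_deriv_dmev sum_distrib_left by (subst sum.swap) (auto intro!: sum.cong simp: algebra_simps)
  also have "... = (\<Sum>\<mu>\<in>keys f. of_nat d * (lookup f \<mu> * mev x \<mu>))"
   by (rule sum.cong) (use assms in "auto simp: forms_def polys_def euler_mono algebra_simps")
  finally show ?thesis by (simp add: ev_evh evh_def sum_distrib_left)
qed

subsection \<open>Forms\<close>

lemma mev_scale:
  fixes N :: nat
  assumes "keys \<mu> \<subseteq> {..N}"
  shows "mev (%i. c * x i) \<mu> = c ^ (\<Sum>i\<le>N. lookup \<mu> i) * mev x \<mu>"
  by (simp only: mev_superset[OF finite_atMost assms] power_mult_distrib prod.distrib power_sum)

lemma evh_forms_scale:
  assumes "f : forms R N d"
  shows "evh h (%i. c * x i) f = c ^ d * evh h x f" unfolding evh_def sum_distrib_left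
  by (rule sum.cong) (use assms in "auto simp: forms_def polys_def mev_scale[where N=N] algebra_simps")

lemma forms_polys: "f : forms R N d ==> f : polys R {..N}" by (auto simp: forms_def)

lemma forms_zero [simp]: "0 : forms R N d" by (auto simp: forms_def polys_def)

lemma forms_add:
  assumes "f : forms R N d" "g : forms R N d" "!!a b. a : R ==> b : R ==> a + b : R" "0 : R"
  shows "f + g : forms R N d"
proof -
  have r: "lookup f \<mu> : R" "lookup g \<mu> : R" for \<mu>
   using assms by (cases "\<mu> : keys f"; cases "\<mu> : keys g"; auto simp: forms_def polys_def in_keys_iff)+
  show ?thesis using assms keys_add[of f g] r by (auto simp: forms_def polys_def lookup_add subset_iff)
qed

lemma forms_uminus:
  assumes "f : forms R N d" "!!a. a : R ==> - a : R"
  shows "- f : forms R N (d::nat)"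
proof -
  have k: "keys (- f) = keys f" by (auto simp: in_keys_iff)
  show ?thesis using assms by (auto simp: forms_def polys_def k)
qed

lemma forms_mult:
  fixes f g :: "(nat, 'a::comm_ring_1) mpol"
  assumes "f : forms UNIV N d" "g : forms UNIV N e"
  shows "f * g : forms UNIV N (d + e)"
proof -
  have "keys \<mu> \<subseteq> {..N} & (\<Sum>i\<le>N. lookup \<mu> i) = d + e"
   if mu: "\<mu> : keys (f * g)" for \<mu>
  proof -
   obtain a b where ab: "\<mu> = a + b" "a : keys f" "b : keys g" using keys_mult[of f g] mu by blast
   thus ?thesis using assms keys_add[of a b] by (auto simp: forms_def polys_def lookup_add sum.distrib subset_iff)
  qed
  thus ?thesis by (auto simp: forms_def polys_def)
qed

lemma forms_const: "single 0 c : forms UNIV N 0" by (auto simp: forms_def polys_def)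

lemma forms_one:
  fixes N :: nat
  shows "(1 :: (nat, 'a::comm_ring_1) mpol) : forms UNIV N 0" using forms_const[of "1::'a" N] by simp

lemma forms_var: "i <= N ==> single (single i 1) 1 : forms UNIV N 1"
  by (auto simp: forms_def polys_def lookup_single when_def)

lemma forms_const_mult:
  fixes f :: "(nat, 'a::comm_ring_1) mpol"
  shows "f : forms UNIV N d ==> single 0 c * f : forms UNIV N d" using forms_mult[OF forms_const] by fastforce

lemma forms_power:
  fixes f :: "(nat, 'a::comm_ring_1) mpol"
  shows "f : forms UNIV N d ==> f ^ n : forms UNIV N (n * d)" by (induction n) (auto simp: forms_one forms_mult)

lemma forms_add': "f : forms UNIV N d ==> g : forms UNIV N d ==> f + g : forms UNIV N d" by (rule forms_add) auto

lemma forms_minus':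
  fixes f :: "(nat, 'a::comm_ring_1) mpol"
  shows "f : forms UNIV N d ==> g : forms UNIV N d ==> f - g : forms UNIV N d"
  using forms_add'[of f N d "- g"] forms_uminus[of g UNIV N d] by auto

lemma forms_sum: "(!!i. i : S ==> f i : forms UNIV N d) ==> (\<Sum>i\<in>S. f i) : forms UNIV N d"
  by (induction S rule: infinite_finite_induct) (auto intro: forms_add')

lemma forms_UNIV: "f : forms R N d ==> f : forms UNIV N d" by (auto simp: forms_def polys_def)

subsection \<open>Subrings, subfields and prime ideals of a field\<close>

text \<open>Subrings, ideals and primes are plain conditions on sets, which suit simplification
  better than the record structures; \<open>subfield_iff\<close> and \<open>primeideal_iff\<close>
  translate.\<close>

definition subr :: "'b::field set => bool" where
  "subr A \<longleftrightarrow> 0 : A & 1 : A & (ALL a:A. ALL b:A. a + b : A) & (ALL a:A. ALL b:A. a * b : A) & (ALL a:A. - a : A)"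

lemma subrD:
  assumes "subr A"
  shows "0 : A" "1 : A" "a : A ==> b : A ==> a + b : A" "a : A ==> b : A ==> a * b : A"
   "a : A ==> - a : A" "a : A ==> b : A ==> a - b : A" "a : A ==> a ^ n : A"
   "(!!i. i : S ==> f i : A) ==> sum f S : A" "(!!i. i : S ==> f i : A) ==> prod f S : A"
   "of_nat n : A" "of_int m : A"
proof -
  have z: "0 : A" and o: "1 : A" and a: "!!a b. a : A ==> b : A ==> a + b : A"
   and m: "!!a b. a : A ==> b : A ==> a * b : A" and u: "!!a. a : A ==> - a : A"
   using assms by (auto simp: subr_def)
  show "0 : A" "1 : A" by (fact z, fact o)
  show "a : A ==> b : A ==> a + b : A" "a : A ==> b : A ==> a * b : A" "a : A ==> - a : A"
   by (fact a, fact m, fact u)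
  show "a : A ==> b : A ==> a - b : A" using a[of a "- b"] u by simp
  show "a ^ n : A" if "a : A" by (induction n) (auto intro: o m that)
  show "(!!i. i : S ==> f i : A) ==> sum f S : A" by (induction S rule: infinite_finite_induct) (auto intro: z a)
  show "(!!i. i : S ==> f i : A) ==> prod f S : A" by (induction S rule: infinite_finite_induct) (auto intro: o m)
  show n: "of_nat n : A" for n by (induction n) (auto intro: z o a)
  show "of_int m : A" by (cases m rule: int_cases2) (auto intro: n u)
qed

lemma subrI:
  assumes "0 : A" "1 : A" "!!a b. a : A ==> b : A ==> a + b : A"
   "!!a b. a : A ==> b : A ==> a * b : A" "!!a b. a : A ==> b : A ==> - a : A"
  shows "subr A" using assms by (auto simp: subr_def)

lemma subr_poly:
  assumes "subr A" "!!i. coeff p i : A" "z : A"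
  shows "poly p z : A" unfolding poly_altdef by (intro subrD[OF assms(1)] assms)

lemma coeffs_subset_iff: "0 : A ==> set (coeffs p) \<subseteq> A \<longleftrightarrow> (ALL i. coeff p i : A)"
proof
  assume "0 : A" "set (coeffs p) \<subseteq> A"
  thus "ALL i. coeff p i : A" by (metis coeff_0 coeff_in_coeffs le_degree subsetD)
next
  show "ALL i. coeff p i : A ==> set (coeffs p) \<subseteq> A" by (auto simp: coeffs_def)
qed

definition subf :: "'b::field set => bool" where "subf K \<longleftrightarrow> subr K & (ALL a:K. inverse a : K)"

lemma subf_subr: "subf K ==> subr K" by (simp add: subf_def)

lemma subf_inverse: "subf K ==> a : K ==> inverse a : K" by (simp add: subf_def)

lemma subf_divide: "subf K ==> a : K ==> b : K ==> a / b : K"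
  by (simp add: divide_inverse subf_inverse subrD(4)[OF subf_subr])

lemma subf_UNIV [simp]: "subf UNIV" by (simp add: subf_def subr_def)

lemma subr_Ints: "subr \<int>" by (auto simp: subr_def)

lemma subr_Int: "subr A ==> subr B ==> subr (A \<inter> B)" by (auto simp: subr_def)

lemma ring_on_simps: "carrier (ring_on M) = M" "x \<otimes>\<^bsub>ring_on M\<^esub> y = x * y" "x \<oplus>\<^bsub>ring_on M\<^esub> y = x + y"
  "\<one>\<^bsub>ring_on M\<^esub> = 1" "\<zero>\<^bsub>ring_on M\<^esub> = 0" "x \<otimes>\<^bsub>ring_of_type_algebra\<^esub> y = x * y" "x \<oplus>\<^bsub>ring_of_type_algebra\<^esub> y = x + y"
  "\<one>\<^bsub>ring_of_type_algebra\<^esub> = 1" "\<zero>\<^bsub>ring_of_type_algebra\<^esub> = 0" by (simp_all add: ring_of_type_algebra_def)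

lemma cring_ring_on:
  assumes "subr A" shows "cring (ring_on A)"
proof -
  note s = subrD[OF assms]
  have *: "EX y:A. x + y = 0" if "x : A" for x using s(5)[OF that] by (intro bexI[of _ "- x"]) auto
  have **: "EX y:A. y + x = 0 & x + y = 0" if "x : A" for x using s(5)[OF that] by (intro bexI[of _ "- x"]) auto
  show ?thesis by unfold_locales (auto simp: ring_on_simps s algebra_simps Units_def * **)
qed

lemma a_inv_ring_on:
  assumes "subr A" "x : A" shows "\<ominus>\<^bsub>ring_on A\<^esub> x = - x"
proof -
  interpret cring "ring_on A" by (rule cring_ring_on[OF assms(1)])
  show ?thesis by (rule minus_equality) (use assms subrD(5)[OF assms(1)] in "auto simp: ring_on_simps")
qed

lemma subfield_iff: "subfield K (ring_on (UNIV :: 'b::field set)) \<longleftrightarrow> subf K"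
proof -
  interpret f: field "ring_on (UNIV :: 'b set)"
   using field_from_type_algebra[where 'a = 'b] by (simp add: ring_of_type_algebra_def)
  have U: "subr (UNIV :: 'b set)" by (simp add: subr_def)
  have inv: "inv\<^bsub>ring_on UNIV\<^esub> x = inverse x" if "x ~= 0" for x :: 'b
   by (rule f.comm_inv_char) (use that in "auto simp: ring_on_simps")
  show ?thesis
  proof
   assume s: "subfield K (ring_on (UNIV :: 'b set))"
   note sr = subfieldE(1)[OF s]
   have "subr K" using subringE[OF sr] a_inv_ring_on[OF U] by (auto simp: subr_def ring_on_simps)
   moreover have "inverse a : K" if "a : K" for a
   proof (cases "a = 0")
    case False
    thus ?thesis using f.subfield_m_inv(1)[OF s, of a] that by (simp add: ring_on_simps inv)
   qed (use that in auto)
   ultimately show "subf K" by (simp add: subf_def)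
  next
   assume K: "subf K"
   note k = subrD[OF subf_subr[OF K]]
   have "subring K (ring_on (UNIV :: 'b set))"
    by (rule f.subringI) (auto simp: ring_on_simps a_inv_ring_on[OF U] k)
   thus "subfield K (ring_on (UNIV :: 'b set))"
    by (rule f.subfieldI') (use K in "auto simp: ring_on_simps inv subf_inverse")
  qed
qed

definition ideal_on :: "'b::field set => 'b set => bool" where
  "ideal_on A I \<longleftrightarrow> I \<subseteq> A & 0 : I & (ALL a:I. ALL b:I. a + b : I) & (ALL a:A. ALL b:I. a * b : I)"

lemma ideal_onD:
  assumes "ideal_on A I"
  shows "I \<subseteq> A" "0 : I" "a : I ==> b : I ==> a + b : I" "a : A ==> b : I ==> a * b : I"
   "a : I ==> a : A" "a : A ==> b : I ==> b * a : I" using assms by (auto simp: ideal_on_def mult.commute)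

lemma ideal_on_minus:
  assumes "subr A" "ideal_on A I"
  shows "a : I ==> - a : I" "a : I ==> b : I ==> a - b : I"
proof -
  have m: "- a : I" if "a : I" for a
   using ideal_onD(4)[OF assms(2), of "- 1" a] subrD(2,5)[OF assms(1)] that by simp
  thus "a : I ==> - a : I" "a : I ==> b : I ==> a - b : I" using ideal_onD(3)[OF assms(2), of a "- b"] by auto
qed

lemma ideal_on_sum: "ideal_on A I ==> (!!i. i : S ==> f i : I) ==> sum f S : I"
  by (induction S rule: infinite_finite_induct) (auto simp: ideal_on_def)

definition prime_on :: "'b::field set => 'b set => bool" where
  "prime_on A q \<longleftrightarrow> ideal_on A q & 1 ~: q & (ALL a:A. ALL b:A. a * b : q --> a : q | b : q)"

lemma primeideal_iff:
  assumes "subr A" shows "primeideal q (ring_on A) \<longleftrightarrow> prime_on A q"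
proof -
  interpret cring "ring_on A" by (rule cring_ring_on[OF assms])
  note s = subrD[OF assms]
  show ?thesis
  proof
   assume p: "primeideal q (ring_on A)"
   interpret primeideal q "ring_on A" by (fact p)
   have "ideal_on A q" unfolding ideal_on_def
    using a_subset additive_subgroup.zero_closed[OF is_additive_subgroup] a_closed I_l_closed
    unfolding ring_on_simps by blast
   moreover have "1 ~: q" using I_notcarr one_imp_carrier unfolding ring_on_simps by blast
   ultimately show "prime_on A q" using I_prime by (auto simp: prime_on_def ring_on_simps)
  next
   assume p: "prime_on A q"
   hence i: "ideal_on A q" by (simp add: prime_on_def)
   have "ideal q (ring_on A)"
   proof (rule idealI)
    show "subgroup q (add_monoid (ring_on A))" by (rule group.subgroupI[OF a_group])
      (use ideal_onD[OF i] ideal_on_minus[OF assms i] a_inv_ring_on[OF assms, unfolded a_inv_def] in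
       \<open>auto simp: ring_on_simps\<close>)
   qed (use ideal_onD[OF i] in "auto simp: ring_on_simps ring_axioms")
   thus "primeideal q (ring_on A)"
    by (rule primeidealI) (use p s in "auto simp: prime_on_def ring_on_simps is_cring")
  qed
qed

subsection \<open>Valuation rings\<close>

definition val_ring :: "'b::field set => bool" where "val_ring V \<longleftrightarrow> subr V & (ALL z. z : V | inverse z : V)"

definition vmax :: "'b::field set => 'b set" where "vmax V = {z : V. z = 0 | inverse z ~: V}"

lemma val_ring_max_ideal:
  assumes "val_ring V" shows "ideal_on V (vmax V)" "1 ~: vmax V"
proof -
  have s: "subr V" and d: "!!z. z : V | inverse z : V" using assms by (auto simp: val_ring_def)
  note S = subrD[OF s]
  show "1 ~: vmax V" using S by (auto simp: vmax_def)
  have m: "a * b : vmax V" if "a : V" "b : vmax V" for a b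
  proof -
   have "inverse b = a * inverse (a * b)" if "a * b ~= 0" using that by (simp add: field_simps)
   thus ?thesis using that S(4)[of a "inverse (a * b)"] S(4) by (auto simp: vmax_def simp del: inverse_mult_distrib)
  qed
  have aux: "a + b : vmax V" if "a : vmax V" "b : vmax V" "a / b : V" "b ~= 0" for a b
  proof -
   have "a + b = (a / b + 1) * b" using that by (simp add: field_simps)
   thus ?thesis using m[of "a / b + 1" b] that S by metis
  qed
  have "a + b : vmax V" if "a : vmax V" "b : vmax V" for a b
  proof (cases "a = 0 | b = 0")
   case False
   thus ?thesis using aux[of a b] aux[of b a] d[of "a / b"] that by (auto simp: add.commute)
  qed (use that in auto)
  thus "ideal_on V (vmax V)" using m S by (auto simp: ideal_on_def vmax_def)
qed

text \<open>If \<open>z\<close> is not in \<open>V\<close>, the equation is divided by a power of \<open>z\<close>.\<close>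

lemma val_ring_lead:
  assumes V: "val_ring V" and c: "!!i. coeff p i : V" and r: "poly p z = 0"
  shows "lead_coeff p * z : V"
proof (cases "z : V")
  case True
  thus ?thesis using c V subrD(4) by (auto simp: val_ring_def)
next
  case False
  have s: "subr V" using V by (auto simp: val_ring_def)
  let ?w = "inverse z"
  have w: "?w : V" and z: "z ~= 0" using V False subrD(1)[OF s] by (auto simp: val_ring_def)
  obtain a q where q: "reflect_poly p = pCons a q" by (cases "reflect_poly p")
  have "coeff (reflect_poly p) i : V" for i using c subrD(1)[OF s] by (simp add: coeff_reflect_poly)
  hence "coeff q i : V" for i using q by (metis coeff_pCons_Suc)
  hence "poly q ?w : V" by (intro subr_poly s w)
  moreover have "a = lead_coeff p" using q by (metis coeff_0_reflect_poly coeff_pCons_0)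
  moreover have "poly (reflect_poly p) ?w = 0" using z r by (simp add: poly_reflect_poly_nz)
  hence "a + ?w * poly q ?w = 0" by (simp add: q)
  hence "a * z = - poly q ?w" using z by (simp add: field_simps add_eq_0_iff2)
  ultimately show ?thesis using subrD(5)[OF s] by metis
qed

text \<open>Elements are built by adding one multiple at a time. Membership thus involves finitely
  many elements of \<open>B\<close>, which is what passes to the union of a chain of rings in
  \<open>chevalley\<close>.\<close>

inductive_set idl :: "'b::field set => 'b set => 'b set" for B I where
  zero: "0 : idl B I"
| step: "x : I ==> b : B ==> s : idl B I ==> b * x + s : idl B I"

lemma idl_ideal:
  assumes "subr B" "I \<subseteq> B" shows "ideal_on B (idl B I)" "I \<subseteq> idl B I"
proof -
  note s = subrD[OF assms(1)]
  have "x : B" if "x : idl B I" for x using that by induction (use assms s in auto)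
  moreover have "x + y : idl B I" if "x : idl B I" "y : idl B I" for x y
   using that by induction (auto simp: add.assoc intro: idl.step)
  moreover have "b * x : idl B I" if "x : idl B I" "b : B" for x b
   using that by induction (auto simp: ring_distribs mult.assoc[symmetric] intro: idl.intros s)
  ultimately show "ideal_on B (idl B I)" by (auto simp: ideal_on_def idl.zero)
  show "I \<subseteq> idl B I" using idl.step[OF _ s(2) idl.zero] by force
qed

lemma idl_mono: "x : idl B I ==> B \<subseteq> B' ==> x : idl B' I" by (induction rule: idl.induct) (auto intro: idl.intros)

definition ring_adj :: "'b::field set => 'b => 'b set" where "ring_adj B z = {poly p z | p. ALL i. coeff p i : B}"

lemma subr_coeff_mult:
  assumes "subr B" "!!i. coeff p i : B" "!!i. coeff q i : B" shows "coeff (p * q) i : B"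
  unfolding coeff_mult by (intro subrD[OF assms(1)] assms)

lemma subr_ring_adj:
  assumes "subr B" shows "subr (ring_adj B z)" "B \<subseteq> ring_adj B z" "z : ring_adj B z"
proof -
  note s = subrD[OF assms]
  have c: "B \<subseteq> ring_adj B z"
  proof
   fix b assume "b : B"
   thus "b : ring_adj B z" unfolding ring_adj_def
    using s(1) by (intro CollectI exI[of _ "[:b:]"]) (auto simp: coeff_pCons split: nat.splits)
  qed
  show "subr (ring_adj B z)"
  proof (rule subrI)
   fix a b assume "a : ring_adj B z" "b : ring_adj B z"
   then obtain p q where pq: "a = poly p z" "!!i. coeff p i : B" "b = poly q z" "!!i. coeff q i : B"
    by (auto simp: ring_adj_def)
   show "a + b : ring_adj B z" unfolding ring_adj_def by (intro CollectI exI[of _ "p + q"]) (simp add: pq s)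
   show "a * b : ring_adj B z" unfolding ring_adj_def
    by (intro CollectI exI[of _ "p * q"]) (simp add: pq subr_coeff_mult[OF assms])
   show "- a : ring_adj B z" unfolding ring_adj_def by (intro CollectI exI[of _ "- p"]) (simp add: pq s)
  qed (use c s in auto)
  show "B \<subseteq> ring_adj B z" by fact
  show "z : ring_adj B z" unfolding ring_adj_def
   using s by (intro CollectI exI[of _ "[:0, 1:]"]) (auto simp: coeff_pCons split: nat.splits)
qed

lemma idl_ring_adj:
  assumes B: "subr B" "I \<subseteq> B" and x: "x : idl (ring_adj B z) I"
  shows "EX p. (ALL i. coeff p i : idl B I) & poly p z = x" using x
proof induction
  case zero
  thus ?case by (intro exI[of _ 0]) (auto intro: idl.zero)
next
  case (step x b s)
  note J = ideal_onD[OF idl_ideal(1)[OF B]]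
  obtain p where p: "!!i. coeff p i : idl B I" "poly p z = s" using step by auto
  obtain r where r: "!!i. coeff r i : B" "b = poly r z" using step by (auto simp: ring_adj_def)
  show ?case using p r J idl_ideal(2)[OF B] step(1) by (intro exI[of _ "smult x r + p"]) auto
qed

text \<open>The reduction step in the proof that a maximal element is a valuation ring.\<close>

lemma chevalley_step:
  fixes z :: "'b::field"
  assumes B: "subr B" "ideal_on B J" "1 ~: J" "z ~= 0" and p: "!!i. coeff p i : J" "poly p z = 1"
   and q: "!!i. coeff q i : J" "poly q (inverse z) = 1" and le: "degree q <= degree p"
  shows "EX p'. (ALL i. coeff p' i : J) & poly p' z = 1 & degree p' < degree p"
proof -
  note J = ideal_onD[OF B(2)] and JB = ideal_on_minus[OF B(1,2)] and s = subrD[OF B(1)]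
  obtain b q' where bq: "q = pCons b q'" by (cases q)
  have q'0: "q' ~= 0" using q bq B(3) by (metis coeff_pCons_0 mult_zero_right add_0_right poly_0 poly_pCons)
  have b: "b : J" using q(1)[of 0] bq by simp
  have q'J: "coeff q' i : J" for i using q(1)[of "Suc i"] bq by simp
  define n where "n = degree p"
  define k where "k = degree q'"
  have k: "degree q = Suc k" using bq q'0 by (simp add: k_def)
  have n: "n >= Suc k" using le k n_def by simp
  define p0 where "p0 = p - monom (coeff p n) n"
  have p0: "degree p0 < n"
  proof -
   have "degree p0 <= n - 1" by (rule degree_le) (auto simp: p0_def n_def coeff_eq_0)
   thus ?thesis using n by linarith
  qed
  \<comment> \<open>The relation for \<open>inverse z\<close> says that 1 - b is
    \<open>inverse z * poly q' (inverse z)\<close>. Multiplied by \<open>z ^ n\<close> it turns the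
    leading term of \<open>(1 - b) * p\<close> into a polynomial of degree at most n - 1, which is
    \<open>t\<close>.\<close>
  define t where "t = monom (coeff p n) (n - Suc k) * reflect_poly q'"
  have t: "degree t <= n - 1"
  proof -
   have "degree t <= (n - Suc k) + k"
    unfolding t_def k_def using degree_mult_le degree_monom_le degree_reflect_poly_le
    by (metis (no_types, lifting) add_mono le_trans)
   thus ?thesis using n by simp
  qed
  define p' where "p' = [:b:] + smult (1 - b) p0 + t"
  have "degree p' <= n - 1"
   unfolding p'_def using p0 t by (intro degree_add_le) (auto intro: degree_smult_le order.trans)
  moreover have "coeff p' i : J" for i
  proof -
   have "coeff [:b:] i : J" using b J(2) by (auto simp: coeff_pCons split: nat.splits)
   moreover have "coeff p0 i : J" unfolding p0_def using p(1) J(2) by (auto simp: n_def)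
   hence "(1 - b) * coeff p0 i : J" by (intro J(4) s(6) s(2) J(5)[OF b])
   moreover have "coeff t i : J" unfolding t_def
    using q'J p(1)[of n] J by (auto simp: coeff_monom_mult coeff_reflect_poly)
   ultimately show ?thesis unfolding p'_def using J by simp
  qed
  moreover have "poly p' z = 1"
  proof -
   have pz: "poly p z = poly p0 z + coeff p n * z ^ n" by (simp add: p0_def poly_monom)
   have "poly q (inverse z) = b + inverse z * poly q' (inverse z)" by (simp add: bq)
   hence e: "inverse z * poly q' (inverse z) = 1 - b" using q by (simp add: algebra_simps)
   have "poly t z = coeff p n * z ^ (n - Suc k) * (z ^ k * poly q' (inverse z))"
    using B(4) by (simp add: t_def poly_monom poly_reflect_poly_nz k_def)
   also have "... = coeff p n * (z ^ (n - Suc k) * z ^ Suc k) * (inverse z * poly q' (inverse z))"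
    using B(4) by (simp add: field_simps)
   also have "z ^ (n - Suc k) * z ^ Suc k = z ^ n" using n by (simp only: power_add[symmetric] le_add_diff_inverse2)
   finally have "poly p' z = b + (1 - b) * (poly p0 z + coeff p n * z ^ n)" by (simp add: p'_def e algebra_simps)
   thus ?thesis using p pz by simp
  qed
  ultimately show ?thesis using n n_def by (intro exI[of _ p']) auto
qed

text \<open>Infinite descent on the sum of the degrees: the relation of larger degree is shortened
  by means of the other, after exchanging \<open>z\<close> and \<open>inverse z\<close> if
  necessary.\<close>

lemma chevalley_no_pair:
  fixes z :: "'b::field"
  assumes B: "subr B" "ideal_on B J" "1 ~: J" "z ~= 0"
  shows "~ ((ALL i. coeff p i : J) & poly p z = 1 & (ALL i. coeff q i : J) & poly q (inverse z) = 1)"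
proof (induction "degree p + degree q" arbitrary: p q rule: less_induct)
  case less
  show ?case
  proof
   assume h: "(ALL i. coeff p i : J) & poly p z = 1 & (ALL i. coeff q i : J) & poly q (inverse z) = 1"
   show False
   proof (cases "degree q <= degree p")
    case True
    then obtain p' where "ALL i. coeff p' i : J" "poly p' z = 1" "degree p' < degree p"
     using chevalley_step[OF B, of p q] h by auto
    thus False using less[of p' q] h by auto
   next
    case False
    then obtain q' where "ALL i. coeff q' i : J" "poly q' (inverse z) = 1" "degree q' < degree q"
     using chevalley_step[OF B(1-3), of "inverse z" q p] B(4) h by auto
    thus False using less[of p q'] h by auto
   qed
  qed
qed

text \<open>Zorn's lemma over the rings in which \<open>I\<close> does not generate 1. In a maximal
  one, an element \<open>z\<close> with neither \<open>z\<close> nor its inverse inside would let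
  both adjunctions produce 1, giving the pair of relations excluded by
  \<open>chevalley_no_pair\<close>.\<close>

lemma chevalley:
  assumes A: "subr A" and I: "ideal_on A I" "1 ~: I"
  obtains V where "val_ring V" "A \<subseteq> V" "I \<subseteq> vmax V"
proof -
  define F where "F = {B. subr B & A \<subseteq> B & 1 ~: idl B I}"
  have IA: "I \<subseteq> A" by (rule ideal_onD(1)[OF I(1)])
  have "x : I" if "x : idl A I" for x using that by induction (use ideal_onD[OF I(1)] in auto)
  hence "A : F" using A I by (auto simp: F_def)
  moreover have "\<Union>C : F" if "C ~= {}" "subset.chain F C" for C
  proof -
   have ch: "!!D E. D : C ==> E : C ==> D \<subseteq> E | E \<subseteq> D" and CF: "C \<subseteq> F" using that by (auto simp: subset.chain_def)
   obtain D0 where D0: "D0 : C" using \<open>C ~= {}\<close> by auto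
   have sC: "subr D" if "D : C" for D using CF that by (auto simp: F_def)
   have two: "EX D:C. a : D & b : D" if "a : \<Union>C" "b : \<Union>C" for a b using that ch by blast
   have "subr (\<Union>C)"
   proof (rule subrI)
    fix a b assume "a : \<Union>C" "b : \<Union>C"
    then obtain D where D: "D : C" "a : D" "b : D" using two by blast
    show "a + b : \<Union>C" "a * b : \<Union>C" "- a : \<Union>C" using D subrD(3,4,5)[OF sC[OF D(1)]] by blast+
   qed (use subrD(1,2)[OF sC[OF D0]] D0 in auto)
   moreover have "EX D:C. x : idl D I" if "x : idl (\<Union>C) I" for x using that
   proof induction
    case (step x b s)
    then obtain D E where XY: "D : C" "b : D" "E : C" "s : idl E I" by auto
    then consider "D \<subseteq> E" | "E \<subseteq> D" using ch by blast
    thus ?case using XY step(1) by cases (auto intro: idl.step idl_mono)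
   qed (use D0 in "auto intro: idl.zero")
   ultimately show ?thesis using D0 CF by (auto simp: F_def)
  qed
  ultimately obtain V where V: "V : F" and max: "!!D. D : F ==> V \<subseteq> D ==> D = V"
   using subset_Zorn_nonempty[of F] by blast
  have sV: "subr V" "I \<subseteq> V" "1 ~: idl V I" using V IA by (auto simp: F_def)
  have adj: "EX p. (ALL i. coeff p i : idl V I) & poly p z = 1" if "z ~: V" for z
  proof -
   have "ring_adj V z ~: F" using max[of "ring_adj V z"] subr_ring_adj[OF sV(1), of z] that by blast
   hence "1 : idl (ring_adj V z) I" using subr_ring_adj[OF sV(1), of z] V by (auto simp: F_def)
   thus ?thesis by (rule idl_ring_adj[OF sV(1,2)])
  qed
  have "z : V | inverse z : V" for z
  proof (cases "z = 0")
   case False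
   thus ?thesis
    using adj[of z] adj[of "inverse z"] chevalley_no_pair[OF sV(1) idl_ideal(1)[OF sV(1,2)] sV(3)] by blast
  qed (simp add: subrD[OF sV(1)])
  hence "val_ring V" using sV by (auto simp: val_ring_def)
  moreover have "I \<subseteq> vmax V"
  proof
   fix x assume x: "x : I"
   have "inverse x ~: V" if "x ~= 0"
   proof
    assume "inverse x : V"
    hence "inverse x * x : idl V I"
     using ideal_onD(4)[OF idl_ideal(1)[OF sV(1,2)]] idl_ideal(2)[OF sV(1,2)] x by blast
    thus False using that sV by simp
   qed
   thus "x : vmax V" using x sV by (auto simp: vmax_def)
  qed
  ultimately show thesis using that V by (auto simp: F_def)
qed

subsection \<open>Integral closures\<close>

text \<open>For non-integral \<open>z\<close> the ideal generated by \<open>inverse z\<close> in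
  R[1/z] is proper, since an expression of 1 in it becomes a monic equation for \<open>z\<close>; a
  valuation ring dominating it contains \<open>R\<close> but not \<open>z\<close>. The criterion
  makes closure of integral elements under sums and products immediate.\<close>

lemma int_closure_iff_val:
  assumes R: "subr R"
  shows "z : int_closure R \<longleftrightarrow> (ALL V. val_ring V & R \<subseteq> V --> z : V)"
proof
  assume "z : int_closure R"
  then obtain p where p: "lead_coeff p = 1" "!!i. coeff p i : R" "poly p z = 0"
   by (auto simp: int_closure_def coeffs_subset_iff[OF subrD(1)[OF R]])
  show "ALL V. val_ring V & R \<subseteq> V --> z : V"
  proof safe
   fix V assume "val_ring V" "R \<subseteq> V"
   thus "z : V" using val_ring_lead[of V p z] p by auto
  qed
next
  assume h: "ALL V. val_ring V & R \<subseteq> V --> z : V"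
  show "z : int_closure R"
  proof (rule ccontr)
   assume n: "z ~: int_closure R"
   have "0 : int_closure R" unfolding int_closure_def
    using subrD(1,2)[OF R] by (intro CollectI exI[of _ "[:0, 1:]"]) auto
   hence z: "z ~= 0" using n by auto
   let ?w = "inverse z"
   let ?A = "ring_adj R ?w"
   note A = subr_ring_adj[OF R, of ?w]
   let ?I = "(%a. ?w * a) ` ?A"
   have I: "ideal_on ?A ?I" unfolding ideal_on_def using subrD[OF A(1)] A(3)
    by (auto simp: ring_distribs[symmetric] mult.left_commute)
   have "1 ~: ?I"
   proof
    assume "1 : ?I"
    then obtain p where p: "!!i. coeff p i : R" "1 = ?w * poly p ?w" unfolding ring_adj_def by blast
    define q where "q = pCons (- 1) p"
    have q: "coeff q 0 = - 1" "!!i. coeff q i : R" "poly q ?w = 0"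
     using p subrD[OF R] by (auto simp: q_def coeff_pCons split: nat.splits)
    \<comment> \<open>The constant coefficient of \<open>q\<close> is -1, so its reversal has
      leading coefficient -1 and the sign makes it monic.\<close>
    define r where "r = - reflect_poly q"
    have "lead_coeff r = 1" using q(1) by (simp add: r_def coeff_reflect_poly)
    moreover have "coeff r i : R" for i using q subrD[OF R] by (auto simp: r_def coeff_reflect_poly)
    moreover have "poly r z = 0" using q(3) z by (simp add: r_def poly_reflect_poly_nz)
    ultimately show False using n by (auto simp: int_closure_def coeffs_subset_iff[OF subrD(1)[OF R]])
   qed
   then obtain V where V: "val_ring V" "?A \<subseteq> V" "?I \<subseteq> vmax V" using chevalley[OF A(1) I] by blast
   have "?w : ?I" using subrD(2)[OF A(1)] by force
   hence "z ~: V" using V z by (auto simp: vmax_def)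
   thus False using h V A(2) by auto
  qed
qed

lemma int_closure_subr:
  assumes "subr R" shows "subr (int_closure R)" "R \<subseteq> int_closure R"
  using assms by (auto simp: subr_def[of "int_closure R"] int_closure_iff_val val_ring_def subrD)

lemma int_closure_lead:
  assumes "subr R" "!!i. coeff p i : int_closure R" "poly p z = 0"
  shows "lead_coeff p * z : int_closure R" using assms by (auto simp: int_closure_iff_val intro!: val_ring_lead)

lemma int_closure_mono: "R \<subseteq> S ==> int_closure R \<subseteq> int_closure S" by (auto simp: int_closure_def)

lemma algebraic_int_iff: "algebraic_int z \<longleftrightarrow> z : int_closure \<int>"
  by (auto simp: algebraic_int.simps int_closure_def coeffs_subset_iff[OF Ints_0])

lemma integers_eq: "integers M = int_closure \<int> \<inter> M" by (auto simp: integers_def algebraic_int_iff)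

lemma integers_subr: "subf M ==> subr (integers M)"
  unfolding integers_eq by (intro subr_Int int_closure_subr subr_Ints subf_subr)

text \<open>With \<open>c\<close> the leading coefficient, \<open>c * u\<close> is integral, so
  \<open>c * u\<close> over \<open>c\<close> is the wanted fraction unless both lie in
  \<open>q\<close>. In that case the top term is moved down one degree by means of
  \<open>c * u\<close>; the coefficients change only by elements of \<open>q\<close>, so one outside
  \<open>q\<close> survives.\<close>

lemma fraction_not_both_in:
  assumes R: "subr R" and M: "subf M" and A: "A = int_closure R \<inter> M" and q: "ideal_on A q" and u: "u : M"
   and p: "!!i. coeff p i : A" "poly p u = 0" "EX i. coeff p i ~: q"
  shows "EX a:A. EX b:A. ~ (a : q & b : q) & b * u = a" using p
proof (induction "degree p" arbitrary: p rule: less_induct)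
  case less
  have sA: "subr A" unfolding A by (intro subr_Int int_closure_subr(1) R subf_subr[OF M])
  note q' = ideal_onD[OF q] and qm = ideal_on_minus[OF sA q]
  show ?case
  proof (cases "degree p")
   case 0
   then obtain c where "p = [:c:]" by (rule degree_eq_zeroE)
   thus ?thesis using less q' by (auto simp: coeff_pCons split: nat.splits)
  next
   case (Suc m)
   define c where "c = lead_coeff p"
   define d where "d = c * u"
   have c: "c : A" using less c_def by auto
   have "d : int_closure R" unfolding d_def c_def by (rule int_closure_lead) (use less R A in auto)
   hence d: "d : A" using c u subrD(4)[OF subf_subr[OF M]] by (auto simp: A d_def)
   show ?thesis
   proof (cases "c : q & d : q")
    case False
    thus ?thesis using c d d_def by auto
   next
    case True
    define r where "r = p - monom c (Suc m) + monom d m"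
    have rc: "coeff r i = (if i = Suc m then 0 else if i = m then coeff p m + d else coeff p i)" for i
     by (auto simp: r_def c_def Suc)
    have "degree r <= m" by (rule degree_le) (use Suc in "auto simp: rc coeff_eq_0")
    moreover have "coeff r i : A" for i using less.prems(1) d subrD[OF sA] by (auto simp: rc)
    moreover have "poly r u = 0" using less.prems(2) by (simp add: r_def poly_monom d_def)
    moreover obtain i where i: "coeff p i ~: q" using less.prems by blast
    hence "i ~= Suc m" using True by (auto simp: c_def Suc)
    have "coeff r i ~: q"
    proof
     assume "coeff r i : q"
     hence "coeff r i - (if i = m then d else 0) : q" using qm True q'(2) by auto
     thus False using i \<open>i ~= Suc m\<close> by (auto simp: rc split: if_splits)
    qed
    ultimately show ?thesis using less.hyps[of r] Suc by (metis le_imp_less_Suc)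
   qed
  qed
qed

subsection \<open>Automorphisms of an algebraic closure\<close>

lemma is_hom_map_poly:
  assumes "is_hom h" shows "is_hom (map_poly h)"
proof -
  note h = is_homD[OF assms]
  have "map_poly h (p * q) = map_poly h p * map_poly h q" for p q
   by (rule poly_eqI) (simp add: coeff_map_poly h coeff_mult)
  moreover have "map_poly h (p + q) = map_poly h p + map_poly h q" for p q
   by (rule poly_eqI) (simp add: coeff_map_poly h)
  ultimately show ?thesis using h by (auto simp: is_hom_def[of "map_poly h"] map_poly_1')
qed

lemma poly_map_hom:
  assumes "is_hom h" shows "poly (map_poly h p) (h x) = h (poly p x)"
  by (induction p) (auto simp: is_homD[OF assms] map_poly_pCons)

lemma is_hom_poly: "is_hom (%p. poly p x)" by (auto simp: is_hom_def)

lemma Rats_subf: "subf K ==> \<rat> \<subseteq> (K :: 'a::field_char_0 set)"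
  by (auto simp: Rats_def of_rat_def elim!: Rats_cases') (metis subf_divide subf_subr subrD(11))

text \<open>An integer equation with nonzero constant term, divided by that term, writes the inverse
  as a polynomial in the element.\<close>

lemma subring_is_subfield:
  fixes A :: "'a::field_char_0 set"
  assumes alg: "!!z::'a. algebraic z" and A: "subr A" "\<rat> \<subseteq> A"
  shows "subf A" unfolding subf_def
proof (intro conjI ballI)
  fix u assume u: "u : A"
  show "inverse u : A"
  proof (cases "u = 0")
   case False
   obtain p0 where p0: "coeff p0 0 ~= 0" "poly (map_poly of_int p0) u = 0"
    using algebraicE'_nonzero[OF alg False] by metis
   define p :: "'a poly" where "p = map_poly of_int p0"
   have p: "!!i. coeff p i : \<int>" "coeff p 0 ~= 0" "poly p u = 0" using p0 by (auto simp: p_def coeff_map_poly)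
   obtain c q where q: "p = pCons c q" by (cases p)
   have cz: "c : \<rat>" "c ~= 0" using p(1)[of 0] p(2) q by (auto simp: Ints_def)
   have "coeff q i : A" for i using p(1)[of "Suc i"] A(2) q by (auto simp: Ints_def subset_iff)
   hence "poly q u : A" by (intro subr_poly A u)
   moreover have "inverse u = - (inverse c * poly q u)"
    using p(3) False cz by (simp add: q field_simps add_eq_0_iff2)
   moreover have "inverse c : A" using cz A(2) by (auto simp: subset_iff)
   ultimately show ?thesis using subrD[OF A(1)] by metis
  qed (use u in simp)
qed (fact A)

text \<open>Homomorphisms from a subring, as graphs.\<close>

definition phom :: "('a::field \<times> 'a) set => bool" where "phom H \<longleftrightarrow> (0, 0) : H & (1, 1) : H &
    (ALL x y x' y'. (x, y) : H & (x', y') : H --> (x + x', y + y') : H & (x * x', y * y') : H) &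
    (ALL x y. (x, y) : H --> (- x, - y) : H) & (ALL x y y'. (x, y) : H & (x, y') : H --> y = y')"

definition pcoeffs :: "('a::field \<times> 'a) set => 'a poly => 'a poly => bool" where
  "pcoeffs H p q \<longleftrightarrow> (ALL i. (coeff p i, coeff q i) : H)"

lemma phomD:
  assumes "phom H"
  shows "(0, 0) : H" "(1, 1) : H" "(x, y) : H ==> (x', y') : H ==> (x + x', y + y') : H"
   "(x, y) : H ==> (x', y') : H ==> (x * x', y * y') : H" "(x, y) : H ==> (- x, - y) : H"
   "(x, y) : H ==> (x', y') : H ==> (x - x', y - y') : H" "(x, y) : H ==> (x, y') : H ==> y = y'"
   "(!!i. i : S ==> (f i, g i) : H) ==> (sum f S, sum g S) : H"
proof -
  show a: "(0, 0) : H" "(1, 1) : H" "(x, y) : H ==> (x', y') : H ==> (x + x', y + y') : H"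
   "(x, y) : H ==> (x', y') : H ==> (x * x', y * y') : H"
   "(x, y) : H ==> (- x, - y) : H" "(x, y) : H ==> (x, y') : H ==> y = y'" for x y x' y'
   using assms unfolding phom_def by blast+
  show "(x, y) : H ==> (x', y') : H ==> (x - x', y - y') : H" using a(3)[of x y "- x'" "- y'"] a(5) by simp
  show "(!!i. i : S ==> (f i, g i) : H) ==> (sum f S, sum g S) : H"
   by (induction S rule: infinite_finite_induct) (auto intro: a)
qed

lemma pcoeffs_closed:
  assumes H: "phom H" and pq: "pcoeffs H p q" "pcoeffs H p' q'"
  shows "pcoeffs H (p + p') (q + q')" "pcoeffs H (p - p') (q - q')" "pcoeffs H (p * p') (q * q')"
   "pcoeffs H (- p) (- q)"
proof -
  note h = phomD[OF H]
  have c: "(coeff p i, coeff q i) : H" "(coeff p' i, coeff q' i) : H" for i using pq by (auto simp: pcoeffs_def)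
  show "pcoeffs H (p + p') (q + q')" "pcoeffs H (p - p') (q - q')" "pcoeffs H (- p) (- q)"
   unfolding pcoeffs_def coeff_add coeff_diff coeff_minus using h(3)[OF c] h(6)[OF c] h(5)[OF c(1)] by auto
  show "pcoeffs H (p * p') (q * q')" unfolding pcoeffs_def coeff_mult by (intro allI h(8) h(4) c)
qed

text \<open>The hypothesis is exactly what makes the assignment of \<open>poly q w\<close> to
  \<open>poly p z\<close> well defined.\<close>

lemma phom_extend:
  assumes H: "phom H" and zw: "!!p q. pcoeffs H p q ==> poly p z = 0 ==> poly q w = 0"
  shows "EX H'. phom H' & H \<subseteq> H' & (z, w) : H'"
proof -
  note h = phomD[OF H]
  define H' where "H' = {(poly p z, poly q w) | p q. pcoeffs H p q}"
  have I: "(x, y) : H'" if "pcoeffs H p q" "x = poly p z" "y = poly q w" for p q x y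
   using that by (auto simp: H'_def)
  note clo = pcoeffs_closed[OF H]
  have c: "pcoeffs H [:a:] [:b:]" if "(a, b) : H" for a b
   using that h(1) by (auto simp: pcoeffs_def coeff_pCons split: nat.splits)
  have "phom H'" unfolding phom_def
  proof (intro conjI allI impI)
   show "(0, 0) : H'" "(1, 1) : H'" using I[OF c] h(1,2) by auto
   fix x y assume xy: "(x, y) : H'"
   then obtain p q where pq: "pcoeffs H p q" "x = poly p z" "y = poly q w" by (auto simp: H'_def)
   show "(- x, - y) : H'" using I[OF clo(4)[OF pq(1) pq(1)]] pq by simp
  next
   fix x y x' y' assume a: "(x, y) : H' & (x', y') : H'"
   then obtain p q where pq: "pcoeffs H p q" "x = poly p z" "y = poly q w" by (auto simp: H'_def)
   obtain p' q' where pq': "pcoeffs H p' q'" "x' = poly p' z" "y' = poly q' w" using a by (auto simp: H'_def)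
   show "(x + x', y + y') : H'" "(x * x', y * y') : H'"
    using I[OF clo(1)[OF pq(1) pq'(1)]] I[OF clo(3)[OF pq(1) pq'(1)]] pq pq' by auto
  next
   fix x y y' assume a: "(x, y) : H' & (x, y') : H'"
   then obtain p q where pq: "pcoeffs H p q" "x = poly p z" "y = poly q w" by (auto simp: H'_def)
   obtain p' q' where pq': "pcoeffs H p' q'" "x = poly p' z" "y' = poly q' w" using a by (auto simp: H'_def)
   show "y = y'" using zw[OF clo(2)[OF pq(1) pq'(1)]] pq pq' by simp
  qed
  moreover have "H \<subseteq> H'" using I[OF c] by auto
  moreover have "(z, w) : H'"
   by (rule I[of "[:0, 1:]" "[:0, 1:]"]) (use h(1,2) in "auto simp: pcoeffs_def coeff_pCons split: nat.splits")
  ultimately show ?thesis by blast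
qed

text \<open>\<open>f\<close> is the minimal polynomial of \<open>z\<close> over the domain of
  \<open>H\<close>, and \<open>g\<close> is its image. Division by \<open>f\<close> is carried out
  on both members of a pair at once, so every relation for \<open>z\<close> passes to any root of
  \<open>g\<close>, and any such root may serve in \<open>phom_extend\<close>.\<close>

lemma phom_min_poly:
  fixes H :: "('a::field_char_0 \<times> 'a) set"
  assumes alg: "!!z::'a. algebraic z" and H: "phom H" and Q: "!!r. r : \<rat> ==> (r, r) : H"
  obtains f g where "pcoeffs H f g" "lead_coeff f = 1" "lead_coeff g = 1" "degree f > 0"
   "degree g = degree f" "poly f z = 0"
   "ALL p q w. pcoeffs H p q --> poly p z = 0 --> poly g w = 0 --> poly q w = 0"
proof -
  note h = phomD[OF H]
  have zero: "b = 0" if "(0, b) : H" for b using h(7)[OF that h(1)] .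
  have dom: "subf (fst ` H)"
  proof (rule subring_is_subfield[OF alg])
   show "subr (fst ` H)"
   proof (rule subrI)
    show "0 : fst ` H" "1 : fst ` H" using h(1,2) by (metis fst_conv imageI)+
    fix a b assume "a : fst ` H" "b : fst ` H"
    then obtain c d where cd: "(a, c) : H" "(b, d) : H" by auto
    show "a + b : fst ` H" "a * b : fst ` H" "- a : fst ` H"
     using h(3)[OF cd] h(4)[OF cd] h(5)[OF cd(1)] by (metis fst_conv imageI)+
   qed
   show "\<rat> \<subseteq> fst ` H" using Q by force
  qed
  define P where "P f \<longleftrightarrow> f ~= 0 & poly f z = 0 & (EX g. pcoeffs H f g)" for f
  obtain r where r: "!!i. coeff r i : \<rat>" "r ~= 0" "poly r z = 0" using alg[of z] by (auto simp: algebraic_altdef)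
  hence "P r" unfolding P_def pcoeffs_def using Q by blast
  then obtain f0 where f0: "P f0" and min: "!!f. P f ==> degree f0 <= degree f"
   using ex_has_least_nat[of P r degree] by auto
  then obtain g0 where g0: "pcoeffs H f0 g0" by (auto simp: P_def)
  have "lead_coeff f0 : fst ` H" using g0 unfolding pcoeffs_def by (metis fst_conv imageI)
  then obtain c where c: "(inverse (lead_coeff f0), c) : H" using subf_inverse[OF dom] by fastforce
  define f g where "f = smult (inverse (lead_coeff f0)) f0" and "g = smult c g0"
  have fg: "pcoeffs H f g" using g0 c h by (auto simp: pcoeffs_def f_def g_def)
  have f: "lead_coeff f = 1" "poly f z = 0" "f ~= 0" "degree f = degree f0" using f0 by (auto simp: f_def P_def)
  have f1: "coeff f (degree f) = 1" using f by simp
  have cg: "coeff g i = 0" if "coeff f i = 0" for i using fg that zero unfolding pcoeffs_def by metis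
  have g1: "coeff g (degree f) = 1" using fg f1 h(7)[OF _ h(2)] unfolding pcoeffs_def by metis
  have "coeff g (degree f) ~= 0" using g1 by simp
  hence "degree f <= degree g" by (rule le_degree)
  moreover have "degree g <= degree f" by (intro degree_le allI impI cg coeff_eq_0)
  ultimately have dg: "degree g = degree f" by simp
  have fd: "degree f > 0"
  proof (rule ccontr)
   assume "~ degree f > 0"
   hence "f = 1" using f(1) by (metis degree_eq_zeroE gr0I lead_coeff_pCons(2) coeff_pCons_0 one_pCons degree_pCons_0)
   thus False using f by simp
  qed
  have fin: "poly q w = 0" if "pcoeffs H p q" "poly p z = 0" "poly g w = 0" for p q w using that
  proof (induction "degree p" arbitrary: p q rule: less_induct)
   case less
   show ?case
   proof (cases "degree p < degree f")
    case True
    hence "p = 0" using min[of p] less.prems f by (fastforce simp: P_def)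
    hence "coeff q i = 0" for i using less.prems zero unfolding pcoeffs_def by (metis coeff_0)
    hence "q = 0" by (simp add: poly_eq_iff)
    thus ?thesis by simp
   next
    case False
    define n m where "n = degree p" and "m = degree f"
    define a b where "a = coeff p n" and "b = coeff q n"
    define p' q' where "p' = p - monom a (n - m) * f" and "q' = q - monom b (n - m) * g"
    have mn: "0 < m" "m <= n" using fd False n_def m_def by auto
    have ab: "(a, b) : H" using less.prems by (auto simp: pcoeffs_def a_def b_def)
    have "pcoeffs H (monom a (n - m)) (monom b (n - m))" using ab h(1) by (auto simp: pcoeffs_def)
    hence pq': "pcoeffs H p' q'" unfolding p'_def q'_def by (intro pcoeffs_closed(2,3)[OF H] less.prems fg)
    have "degree p' <= n - 1"
    proof (rule degree_le, intro allI impI)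
     fix i assume i: "n - 1 < i"
     show "coeff p' i = 0"
     proof (cases "i = n")
      case True
      thus ?thesis using mn f1 by (simp add: p'_def coeff_monom_mult a_def m_def)
     next
      case False
      hence "i > n" using i by simp
      hence "coeff p i = 0" "n - m <= i --> coeff f (i - (n - m)) = 0"
       using mn by (auto simp: n_def m_def intro!: coeff_eq_0)
      thus ?thesis by (auto simp: p'_def coeff_monom_mult)
     qed
    qed
    hence "degree p' < degree p" using mn n_def by linarith
    moreover have "poly p' z = 0" using less.prems f by (simp add: p'_def)
    ultimately have "poly q' w = 0" using less pq' by blast
    thus ?thesis using less.prems by (simp add: q'_def)
   qed
  qed
  show thesis by (rule that[of f g]) (use fg f g1 dg fd fin in auto)
qed

text \<open>A maximal extension is total, because the image of a minimal polynomial has a root in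
  the algebraically closed field.\<close>

lemma phom_extend_UNIV:
  fixes H :: "('a::{alg_closed_field, field_char_0} \<times> 'a) set"
  assumes alg: "!!z::'a. algebraic z" and H: "phom H" and Q: "!!r. r : \<rat> ==> (r, r) : H"
  obtains h where "is_hom h" "!!x y. (x, y) : H ==> h x = y"
proof -
  define F where "F = {D. phom D & H \<subseteq> D}"
  have "H : F" using H by (simp add: F_def)
  moreover have "\<Union>C : F" if "C ~= {}" "subset.chain F C" for C
  proof -
   have ch: "!!D E. D : C ==> E : C ==> D \<subseteq> E | E \<subseteq> D" and CF: "C \<subseteq> F" using that by (auto simp: subset.chain_def)
   obtain D0 where D0: "D0 : C" using \<open>C ~= {}\<close> by auto
   have pC: "phom D" if "D : C" for D using CF that by (auto simp: F_def)
   have two: "EX D:C. a : D & b : D" if "a : \<Union>C" "b : \<Union>C" for a b using that ch by blast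
   have "phom (\<Union>C)" unfolding phom_def
   proof (intro conjI allI impI)
    show "(0, 0) : \<Union>C" "(1, 1) : \<Union>C" using phomD(1,2)[OF pC[OF D0]] D0 by auto
    fix x y assume "(x, y) : \<Union>C"
    thus "(- x, - y) : \<Union>C" using phomD(5)[OF pC] by blast
   next
    fix x y x' y' assume "(x, y) : \<Union>C & (x', y') : \<Union>C"
    then obtain D where "D : C" "(x, y) : D" "(x', y') : D" using two by blast
    thus "(x + x', y + y') : \<Union>C" "(x * x', y * y') : \<Union>C" using phomD(3,4)[OF pC] by blast+
   next
    fix x y y' assume "(x, y) : \<Union>C & (x, y') : \<Union>C"
    then obtain D where "D : C" "(x, y) : D" "(x, y') : D" using two by blast
    thus "y = y'" using phomD(7)[OF pC] by blast
   qed
   thus ?thesis using D0 CF by (auto simp: F_def)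
  qed
  ultimately obtain D where D: "D : F" and max: "!!E. E : F ==> D \<subseteq> E ==> E = D"
   using subset_Zorn_nonempty[of F] by blast
  have pD: "phom D" and HD: "H \<subseteq> D" using D by (auto simp: F_def)
  have total: "EX w. (z, w) : D" for z
  proof -
   have Q': "(r, r) : D" if "r : \<rat>" for r using Q HD that by blast
   obtain f g where "pcoeffs D f g" "lead_coeff f = 1" and fg: "lead_coeff g = 1" "degree f > 0"
    "degree g = degree f" "poly f z = 0"
    "ALL p q w. pcoeffs D p q --> poly p z = 0 --> poly g w = 0 --> poly q w = 0"
    using phom_min_poly[OF alg pD Q', of z thesis] by blast
   obtain w where w: "poly g w = 0" using alg_closed_imp_poly_has_root[of g] fg by auto
   then obtain E where "phom E" "D \<subseteq> E" "(z, w) : E" using phom_extend[OF pD, of z w] fg by blast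
   thus ?thesis using max[of E] HD by (auto simp: F_def)
  qed
  define h where "h z = (THE w. (z, w) : D)" for z
  have hD: "(z, h z) : D" for z unfolding h_def by (rule theI') (use total phomD(7)[OF pD] in blast)
  have hI: "h z = w" if "(z, w) : D" for z w using phomD(7)[OF pD hD that] .
  have "is_hom h" unfolding is_hom_def
   using hI[OF phomD(2)[OF pD]] hI[OF phomD(3)[OF pD hD hD]] hI[OF phomD(4)[OF pD hD hD]] by auto
  thus thesis using that hI HD by blast
qed

text \<open>Surjectivity: an integer polynomial is fixed by \<open>h\<close>, so \<open>h\<close>
  maps its finite root set injectively into itself and hence onto itself.\<close>

lemma hom_bij:
  fixes h :: "'a::{field_char_0} => 'a"
  assumes alg: "!!z::'a. algebraic z" and h: "is_hom h"
  shows "bij h"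
proof -
  have inj: "inj h" using is_hom_field(2)[OF h] by (auto simp: inj_def)
  have "EX x. h x = z" for z
  proof -
   obtain p where p: "!!i. coeff p i : \<int>" "p ~= 0" "poly p z = 0" using alg[of z] by (auto simp: algebraic_def)
   define R where "R = {x. poly p x = 0}"
   have fx: "h c = c" if "c : \<int>" for c
    using that is_homD(5,10)[OF h] by (auto elim!: Ints_cases) (metis int_cases2 of_int_minus of_int_of_nat_eq)
   have "map_poly h p = p" using p(1) fx is_homD(4)[OF h] by (auto simp: poly_eq_iff coeff_map_poly)
   hence "h ` R \<subseteq> R" using poly_map_hom[OF h, of p] is_homD(4)[OF h] by (auto simp: R_def)
   moreover have "finite R" unfolding R_def by (rule poly_roots_finite[OF p(2)])
   ultimately have "h ` R = R" using inj by (metis endo_inj_surj inj_on_subset subset_UNIV)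
   thus ?thesis using p(3) R_def by (metis (mono_tags, lifting) imageE mem_Collect_eq)
  qed
  thus ?thesis using inj by (auto simp: bij_def surj_def) (metis)
qed

lemma Gal_UNIV_iff:
  fixes h :: "'a::field_char_0 => 'a"
  assumes "!!z::'a. algebraic z"
  shows "h : Gal K UNIV \<longleftrightarrow> is_hom h & (ALL a:K. h a = a)" using hom_bij[OF assms, of h]
  by (auto simp: Gal_def ring_iso_def ring_hom_def ring_on_simps is_hom_def bij_betw_def)

lemma Gal_iff: "h : Gal K M \<longleftrightarrow> h : extensional M & bij_betw h M M & h 1 = 1 &
    (ALL a:M. ALL b:M. h (a + b) = h a + h b & h (a * b) = h a * h b) & (ALL a:K. h a = a)"
  by (auto simp: Gal_def ring_iso_def ring_hom_def ring_on_simps bij_betw_def)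

lemma Gal_mono: "K \<subseteq> K' ==> Gal K' M \<subseteq> Gal K M" by (auto simp: Gal_def)

lemma Gal_extend:
  fixes K M :: "'a::{alg_closed_field, field_char_0} set"
  assumes alg: "!!z::'a. algebraic z" and M: "subf M" "K \<subseteq> M" and t: "t : Gal K M"
  obtains s where "s : Gal K UNIV" "!!z. z : M ==> s z = t z"
proof -
  have t': "t 1 = 1" "!!a b. a : M ==> b : M ==> t (a + b) = t a + t b"
   "!!a b. a : M ==> b : M ==> t (a * b) = t a * t b" "!!a. a : K ==> t a = a" using t by (auto simp: Gal_iff)
  note m = subrD[OF subf_subr[OF M(1)]]
  have t0: "t 0 = 0" using t'(2)[OF m(1) m(1)] by simp
  have tm: "t (- a) = - t a" if "a : M" for a using t'(2)[OF that m(5)[OF that]] t0 by (simp add: add_eq_0_iff)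
  define H where "H = (%x. (x, t x)) ` M"
  have H: "phom H" unfolding phom_def H_def by (auto simp: t0 t' tm m image_iff)
  have Q: "(r, r) : H" if "r : \<rat>" for r
  proof -
   have tn: "t (of_nat n) = of_nat n" for n by (induction n) (auto simp: t0 t' m)
   have ti: "t (of_int n) = of_int n" for n by (cases n rule: int_cases2) (auto simp: tn tm m)
   from that obtain a b where r: "r = of_int a / of_int b" "b ~= 0" by (auto elim!: Rats_cases')
   have rM: "r : M" using Rats_subf[OF M(1)] that by auto
   have "t (of_int b * r) = of_int b * t r" using t'(3) m rM ti by metis
   moreover have "of_int b * r = of_int a" using r by simp
   ultimately have "of_int b * t r = of_int b * r" using ti by metis
   moreover have "of_int b ~= (0::'a)" using r by simp
   ultimately have "t r = r" by (metis mult_left_cancel)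
   thus ?thesis using rM by (auto simp: H_def image_iff)
  qed
  obtain s where "is_hom s" "!!x y. (x, y) : H ==> s x = y" using phom_extend_UNIV[OF alg H Q] by blast
  moreover hence "s z = t z" if "z : M" for z using that by (auto simp: H_def)
  ultimately show thesis using that[of s] t'(4) M(2) by (auto simp: Gal_UNIV_iff[OF alg] subset_iff)
qed

text \<open>In characteristic 0 the second highest coefficient recovers \<open>z\<close>;
  \<open>Gal_moves\<close> uses it against a minimal polynomial with only one root.\<close>

lemma coeff_linear_power_sub1:
  fixes z :: "'a::comm_ring_1"
  shows "coeff ([:- z, 1:] ^ Suc n) n = of_nat (Suc n) * (- z)" "coeff ([:- z, 1:] ^ n) n = 1"
proof -
  have d: "coeff ([:- z, 1:] ^ n) i = 0" if "i > n" for i n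
   using degree_linear_power[of "-z" n] that coeff_eq_0 by (metis (no_types, lifting) degree_linear_power)
  show l: "coeff ([:- z, 1:] ^ n) n = 1" for n by (rule coeff_linear_power)
  show "coeff ([:- z, 1:] ^ Suc n) n = of_nat (Suc n) * (- z)"
  proof (induction n)
   case (Suc n)
   have "coeff ([:- z, 1:] ^ Suc (Suc n)) (Suc n) = - z * coeff ([:- z, 1:] ^ Suc n) (Suc n) + coeff ([:- z, 1:] ^ Suc n) n"
    by (subst power_Suc) (simp add: mult_pCons_left)
   thus ?case using Suc l[of "Suc n"] by (simp add: algebra_simps)
  qed simp
qed

text \<open>If the minimal polynomial over \<open>K\<close> had \<open>z\<close> as its only root,
  it would be a power of X - z, and its second highest coefficient would put \<open>z\<close> into
  \<open>K\<close>. A second root is the image of \<open>z\<close> under an automorphism.\<close>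

lemma Gal_moves:
  fixes K :: "'a::{alg_closed_field, field_char_0} set"
  assumes alg: "!!z::'a. algebraic z" and K: "subf K" and z: "z ~: K"
  obtains s where "s : Gal K UNIV" "s z ~= z"
proof -
  note k = subrD[OF subf_subr[OF K]]
  define H where "H = (%x. (x, x)) ` K"
  have H: "phom H" unfolding phom_def H_def by (auto simp: k image_iff)
  have Q: "(r, r) : H" if "r : \<rat>" for r using Rats_subf[OF K] that by (auto simp: H_def)
  obtain f g where fg: "pcoeffs H f g" "lead_coeff f = 1" "lead_coeff g = 1" "degree f > 0"
    "degree g = degree f" "poly f z = 0"
    "ALL p q w. pcoeffs H p q --> poly p z = 0 --> poly g w = 0 --> poly q w = 0"
   using phom_min_poly[OF alg H Q, of z thesis] by blast
  have gf: "g = f" and fK: "coeff f i : K" for i using fg(1) by (auto simp: pcoeffs_def H_def poly_eq_iff image_iff)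
  have "EX w. poly f w = 0 & w ~= z"
  proof (rule ccontr)
   assume no: "\<nexists>w. poly f w = 0 & w ~= z"
   have "f ~= 0" using fg(4) by auto
   from alg_closed_imp_factorization[OF this]
   obtain A where A: "size A = degree f" "f = smult (lead_coeff f) (\<Prod>x\<in>#A. [:-x, 1:])" by blast
   have "x = z" if xA: "x :# A" for x
   proof -
    obtain B where "A = add_mset x B" using multi_member_split[OF xA] by blast
    hence "(\<Prod>y\<in>#A. [:-y, 1:]) = [:-x, 1:] * (\<Prod>y\<in>#B. [:-y, 1:])"
     by (simp only: image_mset_add_mset prod_mset.add_mset)
    hence "f = smult (lead_coeff f) ([:-x, 1:] * (\<Prod>y\<in>#B. [:-y, 1:]))" using A(2) by (rule subst)
    hence "poly f x = lead_coeff f * (poly [:-x, 1:] x * poly (\<Prod>y\<in>#B. [:-y, 1:]) x)"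
     by (metis poly_mult poly_smult)
    hence "poly f x = 0" by simp
    thus ?thesis using no by auto
   qed
   hence "set_mset A \<subseteq> {z}" by auto
   from set_mset_subset_singletonD[OF this] have "A = replicate_mset (degree f) z" using A(1) by simp
   hence "(\<Prod>x\<in>#A. [:-x, 1:]) = [:-z, 1:] ^ degree f" by simp
   hence ff: "f = [:-z, 1:] ^ degree f" using A(2) unfolding fg(2) by simp
   obtain d where d: "degree f = Suc d" using fg(4) gr0_implies_Suc by blast
   hence "coeff f (degree f - 1) = of_nat (degree f) * (- z)" using coeff_linear_power_sub1(1)[of z d] ff by simp
   hence "z = - (coeff f (degree f - 1) / of_nat (degree f))" using fg(4) by (simp add: field_simps)
   thus False using z fK k subf_divide[OF K] by metis
  qed
  then obtain w where w: "poly f w = 0" "w ~= z" by blast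
  then obtain E where E: "phom E" "H \<subseteq> E" "(z, w) : E" using phom_extend[OF H, of z w] fg(7) gf by blast
  obtain s where s: "is_hom s" "!!x y. (x, y) : E ==> s x = y" using phom_extend_UNIV[OF alg E(1)] Q E(2) by (metis subsetD)
  have "s : Gal K UNIV" using s E by (auto simp: Gal_UNIV_iff[OF alg] H_def)
  thus thesis using that s(2)[OF E(3)] w by auto
qed

subsection \<open>Galois extensions\<close>

lemma Gal_UNIV_D:
  fixes s :: "'a::field_char_0 => 'a"
  assumes alg: "!!z::'a. algebraic z" and s: "s : Gal K UNIV"
  shows "is_hom s" "bij s" "!!a. a : K ==> s a = a" using s hom_bij[OF alg] by (auto simp: Gal_UNIV_iff[OF alg])

lemma Gal_UNIV_comp:
  fixes s :: "'a::field_char_0 => 'a"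
  assumes alg: "!!z::'a. algebraic z"
  shows "s : Gal K UNIV ==> t : Gal K UNIV ==> (%x. s (t x)) : Gal K UNIV"
   "s : Gal K UNIV ==> s ^^ n : Gal K UNIV" "s : Gal K UNIV ==> inv_into UNIV s : Gal K UNIV"
proof -
  show c: "(%x. s (t x)) : Gal K UNIV" if "s : Gal K UNIV" "t : Gal K UNIV" for s t
   using that by (auto simp: Gal_UNIV_iff[OF alg] is_hom_def)
  show "s ^^ n : Gal K UNIV" if s: "s : Gal K UNIV"
  proof (induction n)
   case 0
   thus ?case by (auto simp: Gal_UNIV_iff[OF alg] is_hom_def)
  next
   case (Suc n)
   thus ?case using c[OF s Suc] by (simp add: o_def)
  qed
  show "inv_into UNIV s : Gal K UNIV" if s: "s : Gal K UNIV"
  proof -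
   note h = Gal_UNIV_D[OF alg s]
   have i: "inv_into UNIV s (s x) = x" "s (inv_into UNIV s x) = x" for x
    using h(2) by (auto simp: bij_is_inj bij_is_surj surj_f_inv_f)
   note hh = is_homD[OF h(1)]
   have "inv_into UNIV s 1 = 1" "inv_into UNIV s (a + b) = inv_into UNIV s a + inv_into UNIV s b" "inv_into UNIV s (a * b) = inv_into UNIV s a * inv_into UNIV s b" for a b
    using i(1)[of 1] i(1)[of "inv_into UNIV s a + inv_into UNIV s b"] i(1)[of "inv_into UNIV s a * inv_into UNIV s b"] by (simp_all add: hh i(2))
   moreover have "inv_into UNIV s a = a" if "a : K" for a using i(1)[of a] h(3)[OF that] by simp
   ultimately show ?thesis by (auto simp: Gal_UNIV_iff[OF alg] is_hom_def)
  qed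
qed

section \<open>Pro-l extensions tested on elements\<close>

lemma Gal_fix_subf:
  fixes s :: "'a::field_char_0 => 'a"
  assumes "is_hom s" shows "subf {z. s z = z}"
  using is_homD[OF assms] is_hom_field[OF assms] by (auto simp: subf_def subr_def)

lemma funpow_fix_mult: "(f ^^ n) z = z ==> (f ^^ (n * k)) z = z" by (induction k) (auto simp: funpow_add)

text \<open>The orbit of \<open>z\<close> under \<open>s\<close> has length dividing a power of
  \<open>l\<close>. This elementwise condition replaces the statement that \<open>s\<close> acts
  through a pro-l group.\<close>

definition l_torsion_at :: "nat => ('a => 'a) => 'a set" where "l_torsion_at l s = {z. EX e. (s ^^ (l ^ e)) z = z}"

lemma l_torsion_common:
  assumes "finite Z" "Z \<subseteq> l_torsion_at l s"
  shows "EX e. ALL z:Z. (s ^^ (l ^ e)) z = z" using assms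
proof (induction Z rule: finite_induct)
  case (insert z Z)
  then obtain e d where e: "!!z. z : Z ==> (s ^^ (l ^ e)) z = z" "(s ^^ (l ^ d)) z = z"
   by (auto simp: l_torsion_at_def)
  have "(s ^^ (l ^ (e + d))) x = x" if "x : insert z Z" for x
   using that e funpow_fix_mult[of "l ^ e" s x "l ^ d"] funpow_fix_mult[of "l ^ d" s x "l ^ e"]
   by (auto simp: power_add mult.commute)
  thus ?case by blast
qed auto

text \<open>Two elements have a common exponent, for which both are fixed by one and the same
  automorphism; the fixed points of an automorphism form a field. Membership may therefore be
  checked on generators.\<close>

lemma l_torsion_at_subf:
  fixes s :: "'a::field_char_0 => 'a"
  assumes alg: "!!z::'a. algebraic z" and s: "s : Gal K UNIV"
  shows "subf (l_torsion_at l s)" "K \<subseteq> l_torsion_at l s"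
proof -
  have fixf: "subf {z. (s ^^ n) z = z}" for n
   by (rule Gal_fix_subf) (rule Gal_UNIV_D(1)[OF alg Gal_UNIV_comp(2)[OF alg s]])
  have two: "EX e. (s ^^ (l ^ e)) a = a & (s ^^ (l ^ e)) b = b"
   if "a : l_torsion_at l s" "b : l_torsion_at l s" for a b using l_torsion_common[of "{a, b}" l s] that by auto
  have op: "f a b : l_torsion_at l s"
   if ab: "a : l_torsion_at l s" "b : l_torsion_at l s" and that:
    "!!F. subf F ==> a : F ==> b : F ==> f a b : F" for f :: "'a => 'a => 'a" and a b
  proof -
   obtain e where "(s ^^ (l ^ e)) a = a & (s ^^ (l ^ e)) b = b" using two[OF ab] by blast
   thus ?thesis using that[OF fixf[of "l ^ e"]] by (auto simp: l_torsion_at_def)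
  qed
  have c: "z : l_torsion_at l s" if "!!F. subf F ==> z : F" for z
   using that[OF fixf[of "l ^ 0"]] by (auto simp: l_torsion_at_def intro: exI[of _ 0])
  show "subf (l_torsion_at l s)" unfolding subf_def
  proof (intro conjI subrI ballI)
   show "0 : l_torsion_at l s" "1 : l_torsion_at l s" by (auto intro!: c dest: subf_subr subrD)
   fix a b assume ab: "a : l_torsion_at l s" "b : l_torsion_at l s"
   show "a + b : l_torsion_at l s" "a * b : l_torsion_at l s" "- a : l_torsion_at l s"
    using op[OF ab, of "(+)"] op[OF ab, of "(*)"] op[OF ab, of "%x y. - x"] by (meson subf_subr subrD)+
  next
   fix a assume a: "a : l_torsion_at l s"
   show "inverse a : l_torsion_at l s" using op[OF a a, of "%x y. inverse x"] by (meson subf_inverse)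
  qed
  show "K \<subseteq> l_torsion_at l s" using Gal_UNIV_D(3)[OF alg s] by (auto simp: l_torsion_at_def intro!: exI[of _ 0])
qed

lemma adjoin_subf:
  fixes K :: "'a::field set"
  shows "subf (adjoin K S)" "K \<union> S \<subseteq> adjoin K S" "subf F ==> K \<union> S \<subseteq> F ==> adjoin K S \<subseteq> F"
proof -
  interpret f: field "ring_on (UNIV :: 'a set)"
   using field_from_type_algebra[where 'a = 'a] by (simp add: ring_of_type_algebra_def)
  show "subf (adjoin K S)"
   unfolding adjoin_def subfield_iff[symmetric] by (rule f.generate_field_is_subfield) (simp add: ring_on_simps)
  show "K \<union> S \<subseteq> adjoin K S" unfolding adjoin_def by (auto intro: generate_field.incl)
  show "subf F ==> K \<union> S \<subseteq> F ==> adjoin K S \<subseteq> F"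
   unfolding adjoin_def subfield_iff[symmetric] by (rule f.generate_field_min_subfield1) (auto simp: ring_on_simps)
qed

definition gal_stable :: "'a::field set => 'a set => bool" where "gal_stable K M \<longleftrightarrow> (ALL s:Gal K UNIV. s ` M \<subseteq> M)"

lemma adjoin_stable:
  fixes K :: "'a::{field_char_0} set"
  assumes alg: "!!z::'a. algebraic z" and S: "!!s z. s : Gal K UNIV ==> z : S ==> s z : S"
  shows "gal_stable K (adjoin K S)" unfolding gal_stable_def
proof
  fix s assume s: "s : Gal K UNIV"
  note h = Gal_UNIV_D[OF alg s]
  have "subf {z. s z : adjoin K S}" using is_homD[OF h(1)] is_hom_field(3)[OF h(1)] adjoin_subf(1)[of K S]
   by (auto simp: subf_def subr_def)
  moreover have "K \<union> S \<subseteq> {z. s z : adjoin K S}" using adjoin_subf(2)[of K S] h(3) S[OF s] by auto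
  ultimately show "s ` adjoin K S \<subseteq> adjoin K S" using adjoin_subf(3) by blast
qed

lemma Gal_restrict:
  fixes K :: "'a::{field_char_0} set"
  assumes alg: "!!z::'a. algebraic z" and st: "gal_stable K M" "K \<subseteq> M" "subf M" and s: "s : Gal K UNIV"
  shows "restrict s M : Gal K M"
proof -
  note h = Gal_UNIV_D[OF alg s] and m = subrD[OF subf_subr[OF st(3)]]
  have "s ` M \<subseteq> M" "inv_into UNIV s ` M \<subseteq> M" using st(1) s Gal_UNIV_comp(3)[OF alg s] by (auto simp: gal_stable_def)
  hence "s ` M = M" using h(2) by (metis bij_is_surj image_inv_f_f bij_is_inj image_f_inv_f image_mono subset_antisym)
  hence "bij_betw s M M" using h(2) by (auto simp: bij_betw_def bij_is_inj intro: inj_on_subset)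
  thus ?thesis using is_homD[OF h(1)] h(3) st(2) m by (auto simp: Gal_iff bij_betw_restrict_eq)
qed

lemma galois_ext_stable:
  fixes K :: "'a::{alg_closed_field, field_char_0} set"
  assumes alg: "!!z::'a. algebraic z" and st: "gal_stable K M" "K \<subseteq> M" "subf M" "subf K"
  shows "galois_ext K M"
proof -
  have "z : K" if z: "z : M" "ALL t:Gal K M. t z = z" for z
  proof (rule ccontr)
   assume "z ~: K"
   then obtain s where s: "s : Gal K UNIV" "s z ~= z" using Gal_moves[OF alg st(4)] by blast
   thus False using Gal_restrict[OF alg st(1-3) s(1)] z by force
  qed
  thus ?thesis using st by (auto simp: galois_ext_def subfield_iff Gal_iff)
qed

definition gal_group :: "'a::field set => 'a set => ('a => 'a) monoid" where
  "gal_group K M = \<lparr>carrier = Gal K M, monoid.mult = (%f g. restrict (%x. f (g x)) M), one = restrict (%x. x) M\<rparr>"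

lemma gal_group_group:
  assumes KM: "K \<subseteq> M" "subf M" shows "group (gal_group K M)"
proof (rule groupI)
  note m = subrD[OF subf_subr[OF KM(2)]]
  have inM: "f x : M" if "f : Gal K M" "x : M" for f x using that by (auto simp: Gal_iff bij_betw_def)
  show "\<one>\<^bsub>gal_group K M\<^esub> : carrier (gal_group K M)"
   using KM m by (auto simp: gal_group_def Gal_iff bij_betw_def inj_on_def)
  fix f assume f: "f : carrier (gal_group K M)"
  hence f': "f : Gal K M" by (simp add: gal_group_def)
  show "\<one>\<^bsub>gal_group K M\<^esub> \<otimes>\<^bsub>gal_group K M\<^esub> f = f"
   using f' inM[OF f'] by (auto simp: gal_group_def Gal_iff extensional_def restrict_def)
  define g where "g = restrict (inv_into M f) M"
  have bij: "bij_betw f M M" using f' by (simp add: Gal_iff)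
  have gM: "g x : M" "f (g x) = x" if "x : M" for x
   using bij that by (auto simp: g_def bij_betw_def inv_into_into f_inv_into_f)
  have gf: "g (f x) = x" if "x : M" for x using bij that inM[OF f' that] by (auto simp: g_def bij_betw_def)
  have inj: "a = b" if "f a = f b" "a : M" "b : M" for a b using gf that by metis
  have "g : Gal K M" unfolding Gal_iff
  proof (intro conjI ballI)
   show "g : extensional M" by (simp add: g_def)
   show "bij_betw g M M" by (rule bij_betw_byWitness[of M f]) (use gM gf inM[OF f'] in auto)
   show "g 1 = 1" using gf[OF m(2)] f' by (simp add: Gal_iff)
   show "g a = a" if "a : K" for a using gf[of a] that KM f' by (auto simp: Gal_iff)
   fix a b assume ab: "a : M" "b : M"
   show "g (a + b) = g a + g b" "g (a * b) = g a * g b" by (rule inj; use ab gM m f' in \<open>simp add: Gal_iff\<close>)+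
  qed
  moreover have "g \<otimes>\<^bsub>gal_group K M\<^esub> f = \<one>\<^bsub>gal_group K M\<^esub>" using gf by (auto simp: gal_group_def restrict_def)
  ultimately show "EX g:carrier (gal_group K M). g \<otimes>\<^bsub>gal_group K M\<^esub> f = \<one>\<^bsub>gal_group K M\<^esub>"
   by (auto simp: gal_group_def)
  fix h assume "h : carrier (gal_group K M)"
  hence h: "h : Gal K M" by (simp add: gal_group_def)
  have "bij_betw (%x. f (h x)) M M" using bij_betw_trans[of h M M f M] f' h by (simp add: Gal_iff o_def)
  thus "f \<otimes>\<^bsub>gal_group K M\<^esub> h : carrier (gal_group K M)"
   using f' h KM m inM[OF h] by (auto simp: gal_group_def Gal_iff bij_betw_restrict_eq subset_iff)
  fix k assume "k : carrier (gal_group K M)"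
  thus "f \<otimes>\<^bsub>gal_group K M\<^esub> h \<otimes>\<^bsub>gal_group K M\<^esub> k = f \<otimes>\<^bsub>gal_group K M\<^esub> (h \<otimes>\<^bsub>gal_group K M\<^esub> k)"
   using inM by (auto simp: gal_group_def restrict_def)
qed

lemma gal_group_pow:
  assumes f: "f : Gal K M" and x: "x : M"
  shows "(f [^]\<^bsub>gal_group K M\<^esub> (n::nat)) x = (f ^^ n) x"
proof -
  have inM: "(f ^^ n) x : M" if "x : M" for x n using that f by (induction n) (auto simp: Gal_iff bij_betw_def)
  show ?thesis using x
  proof (induction n arbitrary: x)
   case 0
   thus ?case by (simp add: nat_pow_def gal_group_def)
  next
   case (Suc n)
   thus ?case using inM[of x 1] by (simp add: nat_pow_def gal_group_def funpow_swap1)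
  qed
qed

lemma funpow_coprime_fix:
  assumes "(f ^^ m) z = z" "(f ^^ n) z = z" "coprime m n" "m ~= 0"
  shows "f z = z"
proof -
  obtain x y where "m * x = n * y + gcd m n" using bezout_nat[OF assms(4)] by blast
  hence xy: "m * x = n * y + 1" using assms(3) by simp
  have "(f ^^ (n * y + 1)) z = z" using funpow_fix_mult[OF assms(1), of x] xy by simp
  moreover have "(f ^^ (n * y + 1)) z = f ((f ^^ (n * y)) z)" by (simp add: funpow_swap1)
  ultimately show ?thesis using funpow_fix_mult[OF assms(2), of y] by simp
qed

text \<open>If a prime r other than \<open>l\<close> divided the order of a finite quotient, a Sylow
  r-subgroup would contain a nontrivial \<open>t\<close>. Extended to the whole field,
  \<open>t\<close> has an l-power iterate fixing any given element; together with its r-power order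
  this fixes the element under \<open>t\<close> itself, so \<open>t\<close> is trivial.\<close>

lemma pro_ext_intro:
  fixes K :: "'a::{alg_closed_field, field_char_0} set"
  assumes alg: "!!z::'a. algebraic z" and l: "prime l" and st: "gal_stable K M" "K \<subseteq> M" "subf M" "subf K"
   and tor: "!!s. s : Gal K UNIV ==> M \<subseteq> l_torsion_at l s"
  shows "pro_ext l K M" unfolding pro_ext_def
proof (intro conjI allI impI)
  show "galois_ext K M" by (rule galois_ext_stable[OF alg st])
  fix L assume LM: "L \<subseteq> M" "galois_ext K L & finite (Gal K L)"
  hence L: "L \<subseteq> M" "galois_ext K L" and fin: "finite (Gal K L)" by auto
  have KL: "K \<subseteq> L" "subf L" using L by (auto simp: galois_ext_def subfield_iff)
  interpret G: group "gal_group K L" by (rule gal_group_group[OF KL])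
  have order: "Coset.order (gal_group K L) = card (Gal K L)" by (simp add: Coset.order_def gal_group_def)
  have pos: "card (Gal K L) > 0" using G.one_closed fin by (auto simp: gal_group_def card_gt_0_iff)
  have "r = l" if r: "prime r" "r dvd card (Gal K L)" for r
  proof (rule ccontr)
   assume rl: "r ~= l"
   define a where "a = multiplicity r (card (Gal K L))"
   have a: "a > 0" using r pos by (simp add: a_def prime_multiplicity_gt_zero_iff)
   obtain m where m: "card (Gal K L) = r ^ a * m" using multiplicity_dvd[of r] a_def by (metis dvdE)
   obtain H where H: "subgroup H (gal_group K L)" "card H = r ^ a"
    using sylow_thm[OF r(1) G.is_group, of a m] m fin order by (auto simp: gal_group_def)
   have "card H > 1" using H(2) a one_less_power[OF prime_gt_1_nat[OF r(1)]] by metis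
   have finH: "finite H" using \<open>card H > 1\<close> card.infinite by fastforce
   obtain t where t: "t : H" "t ~= \<one>\<^bsub>gal_group K L\<^esub>"
   proof -
    have "~ H \<subseteq> {\<one>\<^bsub>gal_group K L\<^esub>}" using \<open>card H > 1\<close> card_mono[of "{\<one>\<^bsub>gal_group K L\<^esub>}" H] by auto
    thus thesis using that by blast
   qed
   interpret Hg: group "(gal_group K L)\<lparr>carrier := H\<rparr>" using H(1) G.subgroup_imp_group by blast
   have "t [^]\<^bsub>(gal_group K L)\<lparr>carrier := H\<rparr>\<^esub> Coset.order ((gal_group K L)\<lparr>carrier := H\<rparr>) = \<one>\<^bsub>(gal_group K L)\<lparr>carrier := H\<rparr>\<^esub>"
    by (rule Hg.pow_order_eq_1) (use t in auto)
   hence tp: "t [^]\<^bsub>gal_group K L\<^esub> (r ^ a) = \<one>\<^bsub>gal_group K L\<^esub>"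
    using H(2) by (simp add: Coset.order_def nat_pow_def)
   have tG: "t : Gal K L" using t H(1) subgroup.subset by (force simp: gal_group_def)
   have "t z = z" if z: "z : L" for z
   proof -
    have 1: "(t ^^ (r ^ a)) z = z" using gal_group_pow[OF tG z, of "r ^ a"] tp z by (simp add: gal_group_def)
    obtain s where s: "s : Gal K UNIV" "!!z. z : L ==> s z = t z" using Gal_extend[OF alg KL(2,1) tG] by blast
    obtain e where e: "(s ^^ (l ^ e)) z = z" using tor[OF s(1)] z L by (auto simp: l_torsion_at_def)
    have "(s ^^ n) z = (t ^^ n) z & (t ^^ n) z : L" for n
     by (induction n) (use s(2) tG z in "auto simp: Gal_iff bij_betw_def")
    hence 2: "(t ^^ (l ^ e)) z = z" using e by simp
    have "coprime (r ^ a) (l ^ e)" using r(1) l rl by (simp add: primes_coprime)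
    thus ?thesis using funpow_coprime_fix[OF 1 2] r(1) by (auto simp: prime_gt_0_nat)
   qed
   hence "t = restrict (%x. x) L" using tG by (auto simp: Gal_iff extensional_def restrict_def)
   thus False using t by (simp add: gal_group_def)
  qed
  moreover define y where "y = card (Gal K L) div l ^ multiplicity l (card (Gal K L))"
  have y: "card (Gal K L) = l ^ multiplicity l (card (Gal K L)) * y" unfolding y_def by (simp add: multiplicity_dvd)
  moreover have "~ l dvd y" unfolding y_def by (rule multiplicity_decompose) (use pos prime_gt_1_nat[OF l] in auto)
  ultimately have "~ r dvd y" if "prime r" for r using that by (metis dvd_mult)
  hence "y = 1" using prime_factor_nat by blast
  thus "EX e. card (Gal K L) = l ^ e" using y by auto
qed

text \<open>The orbit of \<open>z\<close> generates a Galois extension \<open>L\<close> of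
  \<open>K\<close> inside \<open>M\<close> with finite group, of l-power order by assumption; the
  restriction of \<open>s\<close> to \<open>L\<close> has l-power order by Lagrange.\<close>

lemma pro_ext_torsion:
  fixes K :: "'a::{alg_closed_field, field_char_0} set"
  assumes alg: "!!z::'a. algebraic z" and pe: "pro_ext l K M" and s: "s : Gal K UNIV"
  shows "M \<subseteq> l_torsion_at l s"
proof
  fix z assume z: "z : M"
  have ge: "galois_ext K M" using pe by (simp add: pro_ext_def)
  hence KM: "K \<subseteq> M" "subf M" "subf K" and fixed: "{z : M. ALL \<sigma>:Gal K M. \<sigma> z = z} = K"
   by (auto simp: galois_ext_def subfield_iff)
  interpret G: group "gal_group K M" by (rule gal_group_group[OF KM(1,2)])
  define Orb where "Orb = (%t. t z) ` Gal K M"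
  have id: "restrict (%x. x) M : Gal K M" using G.one_closed by (simp add: gal_group_def)
  have zO: "z : Orb" unfolding Orb_def by (rule image_eqI[OF _ id]) (use z in simp)
  have OM: "Orb \<subseteq> M" using z by (auto simp: Orb_def Gal_iff intro: bij_betw_apply)
  have homext: "EX h. is_hom h & (ALL x:M. h x = t x)" if "t : Gal K M" for t
   using Gal_extend[OF alg KM(2,1) that] Gal_UNIV_D(1)[OF alg] by metis
  have finO: "finite Orb"
  proof -
   obtain p where p: "!!i. coeff p i : \<rat>" "p ~= 0" "poly p z = 0" using alg[of z] by (auto simp: algebraic_altdef)
   have "poly p (t z) = 0" if t: "t : Gal K M" for t
   proof -
    obtain u where u: "u : Gal K UNIV" "!!x. x : M ==> u x = t x" using Gal_extend[OF alg KM(2,1) t] by blast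
    note h = Gal_UNIV_D[OF alg u(1)]
    have "map_poly u p = p" using p(1) h(3) Rats_subf[OF KM(3)] is_homD(4)[OF h(1)]
     by (auto simp: poly_eq_iff coeff_map_poly)
    thus ?thesis using poly_map_hom[OF h(1), of p z] p(3) u(2)[OF z] is_homD(4)[OF h(1)] by simp
   qed
   hence "Orb \<subseteq> {x. poly p x = 0}" by (auto simp: Orb_def)
   thus ?thesis using poly_roots_finite[OF p(2)] finite_subset by blast
  qed
  \<comment> \<open>\<open>galois_ext\<close> speaks only of automorphisms of \<open>M\<close>. That
    automorphisms of the whole closure preserve the orbit is read off from the polynomial with the
    orbit as its roots: its coefficients are fixed by \<open>Gal K M\<close> and so lie in
    \<open>K\<close>.\<close>
  have Ost: "u w : Orb" if u: "u : Gal K UNIV" and w: "w : Orb" for u w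
  proof -
   define f where "f = (\<Prod>x\<in>Orb. [:- x, 1:])"
   have "coeff f i : K" for i
   proof -
    have "coeff f i : M" unfolding f_def using OM by (induction Orb arbitrary: i rule: infinite_finite_induct)
      (use subrD[OF subf_subr[OF KM(2)]] in "auto simp: coeff_pCons split: nat.splits")
    moreover have "t (coeff f i) = coeff f i" if t: "t : Gal K M" for t
    proof -
     obtain h where h: "is_hom h" "!!x. x : M ==> h x = t x" using homext[OF t] by blast
     have "bij_betw t Orb Orb"
     proof -
      have "t ` Orb \<subseteq> Orb"
      proof
       fix y assume "y : t ` Orb"
       then obtain r where r: "r : Gal K M" "y = t (r z)" by (auto simp: Orb_def)
       hence tr: "restrict (%x. t (r x)) M : Gal K M" using G.m_closed[of t r] t by (simp add: gal_group_def)
       show "y : Orb" unfolding Orb_def by (rule image_eqI[OF _ tr]) (use r z in simp)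
      qed
      moreover have "inj_on t Orb" using t OM by (auto simp: Gal_iff bij_betw_def intro: inj_on_subset)
      ultimately show ?thesis using finO by (simp add: bij_betw_def endo_inj_surj)
     qed
     hence "(\<Prod>x\<in>Orb. [:- t x, 1:]) = f" unfolding f_def by (rule prod.reindex_bij_betw)
     moreover have "map_poly h f = (\<Prod>x\<in>Orb. [:- t x, 1:])"
      unfolding f_def is_homD(9)[OF is_hom_map_poly[OF h(1)]]
      by (rule prod.cong) (use h OM is_homD[OF h(1)] in "auto simp: map_poly_pCons")
     ultimately have "h (coeff f i) = coeff f i" using is_homD(4)[OF h(1)] by (metis coeff_map_poly)
     thus ?thesis using h(2) \<open>coeff f i : M\<close> by simp
    qed
    ultimately show ?thesis using fixed by blast
   qed
   note h = Gal_UNIV_D[OF alg u]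
   have "map_poly u f = f" using \<open>!!i. coeff f i : K\<close> h(3) is_homD(4)[OF h(1)]
    by (auto simp: poly_eq_iff coeff_map_poly)
   moreover have "poly f w = 0" using w finO by (auto simp: f_def poly_prod)
   ultimately have "poly f (u w) = 0" using poly_map_hom[OF h(1), of f w] is_homD(4)[OF h(1)] by simp
   thus ?thesis using finO by (auto simp: f_def poly_prod)
  qed
  define L where "L = adjoin K Orb"
  have L: "subf L" "K \<subseteq> L" "Orb \<subseteq> L" "L \<subseteq> M"
   using adjoin_subf[of K Orb] adjoin_subf(3)[OF KM(2)] OM KM(1) by (auto simp: L_def)
  have stL: "gal_stable K L" unfolding L_def by (rule adjoin_stable[OF alg]) (rule Ost)
  have geL: "galois_ext K L" by (rule galois_ext_stable[OF alg stL L(2,1) KM(3)])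
  \<comment> \<open>Automorphisms of \<open>L\<close> embed into the self-maps of the finite
    orbit.\<close>
  have "finite (Gal K L)"
  proof (rule finite_imageD)
   have "t x : Orb" if t: "t : Gal K L" "x : Orb" for t x
   proof -
    obtain u where "u : Gal K UNIV" "!!x. x : L ==> u x = t x" using Gal_extend[OF alg L(1,2) t(1)] by blast
    thus ?thesis using Ost[of u x] t(2) L(3) by auto
   qed
   hence "(%t. restrict t Orb) ` Gal K L \<subseteq> Orb \<rightarrow>\<^sub>E Orb" by auto
   thus "finite ((%t. restrict t Orb) ` Gal K L)" by (rule finite_subset) (use finO in "simp add: finite_PiE")
   show "inj_on (%t. restrict t Orb) (Gal K L)"
   proof (rule inj_onI)
    fix t t' assume t: "t : Gal K L" "t' : Gal K L" "restrict t Orb = restrict t' Orb"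
    obtain u where u: "u : Gal K UNIV" "!!x. x : L ==> u x = t x" using Gal_extend[OF alg L(1,2) t(1)] by blast
    obtain v where v: "v : Gal K UNIV" "!!x. x : L ==> v x = t' x" using Gal_extend[OF alg L(1,2) t(2)] by blast
    define w where "w = (%x. inv_into UNIV v (u x))"
    have w: "w : Gal K UNIV" unfolding w_def by (rule Gal_UNIV_comp(1)[OF alg Gal_UNIV_comp(3)[OF alg v(1)] u(1)])
    have "x : {x. w x = x}" if "x : Orb" for x
    proof -
     have "u x = v x" using t(3) that u v L(3) by (metis restrict_apply' subsetD)
     thus ?thesis using Gal_UNIV_D(2)[OF alg v(1)] by (simp add: w_def bij_is_inj)
    qed
    hence "L \<subseteq> {x. w x = x}" unfolding L_def
     using Gal_UNIV_D[OF alg w] by (intro adjoin_subf(3) Gal_fix_subf) auto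
    hence "u x = v x" if "x : L" for x
    proof -
     have "v (inv_into UNIV v (u x)) = u x"
      using Gal_UNIV_D(2)[OF alg v(1)] by (simp add: bij_is_surj surj_f_inv_f)
     moreover have "inv_into UNIV v (u x) = x" using \<open>L \<subseteq> {x. w x = x}\<close> that by (auto simp: w_def)
     ultimately show ?thesis by simp
    qed
    hence "t x = t' x" if "x : L" for x using that u(2) v(2) by metis
    moreover have "t : extensional L" "t' : extensional L" using t(1,2) by (simp_all add: Gal_iff)
    ultimately show "t = t'" by (intro extensionalityI)
   qed
  qed
  then obtain e where e: "card (Gal K L) = l ^ e" using pe L(4) geL by (auto simp: pro_ext_def)
  interpret GL: group "gal_group K L" by (rule gal_group_group[OF L(2,1)])
  define t where "t = restrict s L"
  have t: "t : Gal K L" unfolding t_def by (rule Gal_restrict[OF alg stL L(2,1) s])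
  have zL: "z : L" using zO L by auto
  have "t [^]\<^bsub>gal_group K L\<^esub> (l ^ e) = \<one>\<^bsub>gal_group K L\<^esub>"
   using GL.pow_order_eq_1[of t] t e by (simp add: Coset.order_def gal_group_def)
  hence te: "(t ^^ (l ^ e)) z = z" using gal_group_pow[OF t zL, of "l ^ e"] zL by (simp add: gal_group_def)
  have "(s ^^ n) z = (t ^^ n) z & (t ^^ n) z : L" for n
   by (induction n) (use stL s zL in "auto simp: t_def gal_stable_def")
  from this[of "l ^ e"] show "z : l_torsion_at l s" using te by (auto simp: l_torsion_at_def)
qed

lemma cyclotomic_subf: "subf (cyclotomic l k)" "k \<subseteq> cyclotomic l k" "z ^ (l ^ m) = 1 ==> z : cyclotomic l k"
  unfolding cyclotomic_def using adjoin_subf[of k "{z. EX m. z ^ (l ^ m) = 1}"] by auto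

text \<open>The elements with l-power orbits form a field, so the compositum inherits the property
  from its constituents.\<close>

lemma max_pro_ext_torsion:
  fixes k :: "'a::{alg_closed_field, field_char_0} set"
  assumes alg: "!!z::'a. algebraic z" and s: "s : Gal (cyclotomic l k) UNIV"
  shows "max_pro_ext l k \<subseteq> l_torsion_at l s" unfolding max_pro_ext_def
  by (rule adjoin_subf(3)) (use l_torsion_at_subf[OF alg s, of l] pro_ext_torsion[OF alg _ s, of l] in auto)

lemma max_pro_ext_maximal:
  "pro_ext l (cyclotomic l k) M ==> unramified_away l (cyclotomic l k) M ==> M \<subseteq> max_pro_ext l k"
  unfolding max_pro_ext_def by (rule order.trans[OF _ order.trans[OF Un_upper2 adjoin_subf(2)]]) auto

subsection \<open>Points of projective schemes\<close>

text \<open>An induction over polynomials with several evaluation points at once. Taking for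
  \<open>S\<close> the pairs congruent modulo an ideal, or the quadruples with controlled second
  difference, gives \<open>evh_congruent\<close> and \<open>ev_second_difference\<close> with no
  expansion of the polynomial.\<close>

lemma ev_family_closed:
  fixes x :: "'i => 'v => 'b::comm_ring_1"
  assumes "p : polys R V" and c: "!!c. c : R ==> (%i. h c) : S" and v: "!!v. v : V ==> (%i. x i v) : S"
   and z: "(%i. 0) : S" and o: "(%i. 1) : S" and a: "!!f g. f : S ==> g : S ==> (%i. f i + g i) : S"
   and m: "!!f g. f : S ==> g : S ==> (%i. f i * g i) : S"
  shows "(%i. evh h (x i) p) : S"
proof -
  have pw: "(%i. f i ^ n) : S" if "f : S" for f n by (induction n) (auto simp: o intro!: m that)
  have sm: "(%i. \<Sum>j\<in>F. f j i) : S" if "!!j. j : F ==> f j : S" for f and F :: "('v \<Rightarrow>\<^sub>0 nat) set"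
   using that by (induction F rule: infinite_finite_induct) (auto simp: z intro!: a)
  have pr: "(%i. \<Prod>j\<in>F. f j i) : S" if "!!j. j : F ==> f j : S" for f and F :: "'v set"
   using that by (induction F rule: infinite_finite_induct) (auto simp: o intro!: m)
  show ?thesis unfolding evh_def mev_def using assms(1) by (intro sm m c pr pw v) (auto simp: polys_def)
qed

lemma biforms_polys: "f : biforms R N N' d e ==> f : polys R ({..N} <+> {..N'})" by (auto simp: biforms_def)

lemma ev_biforms_scale:
  assumes "f : biforms R N N' d e"
  shows "ev (case_sum (%i. c * P i) (%i. c' * Q i)) f = c ^ d * c' ^ e * ev (case_sum P Q) f"
proof -
  have "mev (case_sum (%i. c * P i) (%i. c' * Q i)) \<mu> = c ^ d * c' ^ e * mev (case_sum P Q) \<mu>"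
   if "\<mu> : keys f" for \<mu>
  proof -
   let ?A = "{..N} <+> {..N'}"
   have k: "keys \<mu> \<subseteq> ?A" and d: "(\<Sum>i\<le>N. lookup \<mu> (Inl i)) = d" and e: "(\<Sum>i\<le>N'. lookup \<mu> (Inr i)) = e"
    using assms that by (auto simp: biforms_def polys_def)
   have split: "mev x \<mu> = (\<Prod>i\<le>N. x (Inl i) ^ lookup \<mu> (Inl i)) * (\<Prod>i\<le>N'. x (Inr i) ^ lookup \<mu> (Inr i))" for x :: "nat + nat => 'a"
    by (subst mev_superset[OF _ k]) (auto simp: prod.Plus)
   show ?thesis by (simp add: split power_mult_distrib prod.distrib power_sum[symmetric] d e)
  qed
  thus ?thesis unfolding ev_evh evh_def sum_distrib_left by (intro sum.cong) (auto simp: algebra_simps)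
qed

lemma normalise_scale: "c ~= 0 ==> normalise (%i. c * v i) = normalise v" by (auto simp: normalise_def)

lemma normalise_as_scale:
  assumes "v i ~= (0::'a::field)"
  obtains c where "c ~= 0" "normalise v = (%i. c * v i)"
proof
  have "v (LEAST j. v j ~= 0) ~= 0" using assms by (rule LeastI)
  thus "inverse (v (LEAST j. v j ~= 0)) ~= 0" by simp
  show "normalise v = (%i. inverse (v (LEAST j. v j ~= 0)) * v i)" by (auto simp: normalise_def field_simps)
qed

lemma normalise_eqD:
  assumes "normalise v = normalise w" "v i ~= (0::'a::field)" "w j = 1"
  shows "v = (%i. v j * w i)"
proof -
  obtain c where c: "c ~= 0" "normalise v = (%i. c * v i)" using assms(2) by (rule normalise_as_scale)
  have "w j ~= 0" using assms(3) by simp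
  then obtain d where d: "d ~= 0" "normalise w = (%i. d * w i)" by (rule normalise_as_scale)
  have e: "c * v i = d * w i" for i using assms(1) c(2) d(2) by metis
  have "v i = v j * w i" for i
  proof -
   have "c * v i = c * (v j * w i)" using e[of i] e[of j] assms(3) by (simp add: mult.assoc[symmetric])
   thus ?thesis using c(1) by simp
  qed
  thus ?thesis by blast
qed

lemma normalise_hom:
  assumes "is_hom h" shows "normalise (%i. h (v i)) = (%i. h (normalise v i))"
  using is_hom_field[OF assms] by (simp add: normalise_def fun_eq_iff)

lemma cone_iff: "P : cone V \<longleftrightarrow> (ALL i>amb V. P i = 0) & (EX i<=amb V. P i ~= 0) & (ALL h:eqs V. ev P h = 0)"
  by (auto simp: cone_def fibre_def)

lemma cone_scale:
  assumes V: "proj_scheme R V" and c: "c ~= 0" and P: "P : cone V"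
  shows "(%i. c * P i) : cone (V :: 'a::field scheme)"
proof -
  have "ev (%i. c * P i) h = 0" if h: "h : eqs V" for h
  proof -
   obtain d where "h : forms R (amb V) d" using V h by (auto simp: proj_scheme_def)
   thus ?thesis using P h by (simp add: ev_evh evh_forms_scale) (simp add: cone_iff ev_evh)
  qed
  thus ?thesis using P c by (auto simp: cone_iff)
qed

lemma points_iff:
  assumes V: "proj_scheme R (V :: 'a::field scheme)"
  shows "P : points V \<longleftrightarrow> P : cone V & normalise P = P"
proof
  assume "P : points V"
  then obtain Q where Q: "Q : cone V" "P = normalise Q" by (auto simp: points_def)
  then obtain i where "Q i ~= 0" by (auto simp: cone_iff)
  then obtain c where c: "c ~= 0" "normalise Q = (%i. c * Q i)" by (rule normalise_as_scale)
  thus "P : cone V & normalise P = P" using cone_scale[OF V c(1) Q(1)] normalise_scale[OF c(1), of Q] Q(2) by metis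
next
  assume "P : cone V & normalise P = P"
  thus "P : points V" unfolding points_def by (metis imageI)
qed

lemma points_rep:
  assumes V: "proj_scheme R (V :: 'a::field scheme)" and P: "P : cone V"
  obtains c where "c ~= 0" "normalise P : points V" "normalise P = (%i. c * P i)"
proof -
  obtain i where "P i ~= 0" using P by (auto simp: cone_iff)
  then obtain c where c: "c ~= 0" "normalise P = (%i. c * P i)" by (rule normalise_as_scale)
  show thesis by (rule that[OF c(1) _ c(2)]) (use P in "simp only: points_def imageI")
qed

lemma ev_hom_polys:
  assumes "is_hom h" "p : polys R V" "!!c. c : R ==> h c = c"
  shows "ev (%v. h (x v)) p = h (ev x p)"
  unfolding ev_evh evh_hom[OF assms(1)] by (rule evh_cong_polys[OF assms(2)]) (auto simp: assms(3))

lemma cone_hom: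
  assumes V: "proj_scheme R (V :: 'a::field scheme)" and h: "is_hom h" "!!c. c : R ==> h c = c" and P: "P : cone V"
  shows "(%i. h (P i)) : cone V"
proof -
  have "ev (%i. h (P i)) e = 0" if e: "e : eqs V" for e
  proof -
   obtain d where "e : forms R (amb V) d" using V e by (auto simp: proj_scheme_def)
   from ev_hom_polys[OF h(1) forms_polys[OF this] h(2)] show ?thesis
    using P e is_homD(4)[OF h(1)] by (simp add: cone_iff)
  qed
  thus ?thesis using P is_hom_field(1)[OF h(1)] by (auto simp: cone_iff)
qed

lemma points_hom:
  assumes V: "proj_scheme R (V :: 'a::field scheme)" and h: "is_hom h" "!!c. c : R ==> h c = c"
   and P: "P : points V"
  shows "(%i. h (P i)) : points V"
  using P cone_hom[OF V h] normalise_hom[OF h(1), of P] by (simp add: points_iff[OF V])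

lemma forms_mono: "R \<subseteq> R' ==> forms R N d \<subseteq> forms R' N d" by (auto simp: polys_def forms_def)

lemma proj_scheme_mono: "R \<subseteq> R' ==> proj_scheme R V ==> proj_scheme R' V"
  using forms_mono[of R R'] by (fastforce simp: proj_scheme_def)

text \<open>At the generic geometric point the map is given near \<open>(A, B)\<close> by forms with
  coefficients in \<open>R\<close>, which \<open>h\<close> fixes; so applying \<open>h\<close> to
  coordinates commutes with the map.\<close>

lemma bimorphism_equivariant:
  assumes b: "bimorphism R V Y Z \<phi>" and g: "(UNIV, {0}) : geom_points R"
   and V: "proj_scheme R' V" "proj_scheme R' Y" "R' \<subseteq> R0" "R \<subseteq> R0"
   and h: "is_hom h" "!!c. c : R0 ==> h c = c" and A: "A : points V" and B: "B : points Y"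
  shows "\<phi> (%i. h (A i)) (%i. h (B i)) = (%i. h (\<phi> A B i))"
proof -
  have hR: "!!c. c : R' ==> h c = c" "!!c. c : R ==> h c = c" using h(2) V by auto
  have c: "A : fibre (UNIV, {0}) V" "B : fibre (UNIV, {0}) Y"
   using A B points_iff[OF V(1)] points_iff[OF V(2)] by (auto simp: cone_def)
  have "ALL P:fibre (UNIV, {0}) V. ALL Q:fibre (UNIV, {0}) Y. EX d e F.
     (ALL i. F i : biforms R (amb V) (amb Y) d e) & (ALL i>amb Z. F i = 0) &
     (EX i. ev (case_sum P Q) (F i) ~: {0}) &
     (ALL A:points V. ALL B:points Y. (EX i. ev (case_sum A B) (F i) ~= 0) -->
       \<phi> A B = normalise (%i. ev (case_sum A B) (F i)))" using b g unfolding bimorphism_def by fast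
  then obtain d e F where F: "!!i. F i : biforms R (amb V) (amb Y) d e" "EX i. ev (case_sum A B) (F i) ~: {0}"
   and n: "!!A B. A : points V ==> B : points Y ==> (EX i. ev (case_sum A B) (F i) ~= 0) ==>
       \<phi> A B = normalise (%i. ev (case_sum A B) (F i))" using c by meson
  have e: "ev (case_sum (%i. h (A i)) (%i. h (B i))) (F i) = h (ev (case_sum A B) (F i))" for i
  proof -
   have "case_sum (%i. h (A i)) (%i. h (B i)) = (%v. h (case_sum A B v))"
    by (auto simp: fun_eq_iff split: sum.splits)
   thus ?thesis using ev_hom_polys[OF h(1) biforms_polys[OF F(1)] hR(2)] by simp
  qed
  have "\<phi> (%i. h (A i)) (%i. h (B i)) = normalise (%i. h (ev (case_sum A B) (F i)))"
   using n[OF points_hom[OF V(1) h(1) hR(1) A] points_hom[OF V(2) h(1) hR(1) B]] F(2)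
   by (simp add: e is_hom_field(1)[OF h(1)])
  also have "... = (%i. h (\<phi> A B i))" using n[OF A B] F(2) by (simp add: normalise_hom[OF h(1)])
  finally show ?thesis .
qed

lemma morphism_equivariant:
  assumes b: "morphism R V Z \<phi>" and g: "(UNIV, {0}) : geom_points R" and V: "proj_scheme R' V" "R' \<subseteq> R0" "R \<subseteq> R0"
   and h: "is_hom h" "!!c. c : R0 ==> h c = c" and A: "A : points V"
  shows "\<phi> (%i. h (A i)) = (%i. h (\<phi> A i))"
proof -
  have hR: "!!c. c : R' ==> h c = c" "!!c. c : R ==> h c = c" using h(2) V by auto
  have c: "A : fibre (UNIV, {0}) V" using A points_iff[OF V(1)] by (auto simp: cone_def)
  have "ALL P:fibre (UNIV, {0}) V. EX d F.
     (ALL i. F i : forms R (amb V) d) & (ALL i>amb Z. F i = 0) & (EX i. ev P (F i) ~: {0}) &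
     (ALL A:points V. (EX i. ev A (F i) ~= 0) --> \<phi> A = normalise (%i. ev A (F i)))"
   using b g unfolding morphism_def by fast
  then obtain d F where F: "!!i. F i : forms R (amb V) d" "EX i. ev A (F i) ~: {0}"
   and n: "!!A. A : points V ==> (EX i. ev A (F i) ~= 0) ==> \<phi> A = normalise (%i. ev A (F i))" using c by meson
  have e: "ev (%i. h (A i)) (F i) = h (ev A (F i))" for i
   using ev_hom_polys[OF h(1) forms_polys[OF F(1)] hR(2)] by simp
  have "\<phi> (%i. h (A i)) = normalise (%i. h (ev A (F i)))"
   using n[OF points_hom[OF V(1) h(1) hR(1) A]] F(2) by (simp add: e is_hom_field(1)[OF h(1)])
  also have "... = (%i. h (\<phi> A i))" using n[OF A] F(2) by (simp add: normalise_hom[OF h(1)])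
  finally show ?thesis .
qed

subsection \<open>Valuation rings above a prime\<close>

text \<open>The primitive integer polynomial of \<open>z\<close> works: if all its coefficients lay
  in \<open>q\<close>, the least positive integer in \<open>q\<close> would divide them, hence the
  content 1.\<close>

lemma primitive_relation:
  fixes z :: "'a::field_char_0"
  assumes z: "algebraic z" and A: "subr A" "ideal_on A q" "1 ~: q"
  shows "EX p. (ALL i. coeff p i : \<int>) & poly p z = 0 & (EX i. coeff p i ~: q)"
proof -
  note q = ideal_onD[OF A(2)] and qm = ideal_on_minus[OF A(1,2)] and a = subrD[OF A(1)]
  obtain p0 :: "int poly" where p0: "p0 ~= 0" "poly (map_poly of_int p0) z = 0" using algebraicE'[OF z] by metis
  define p1 where "p1 = primitive_part p0"
  have p1: "smult (content p0) p1 = p0" "content p1 = 1" "p1 ~= 0"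
   using p0(1) by (auto simp: p1_def content_times_primitive_part)
  have ih: "is_hom (of_int :: int => 'a)" by (simp add: is_hom_def)
  have sm: "map_poly of_int (smult c r) = smult (of_int c) (map_poly of_int r :: 'a poly)" for c r
   by (rule poly_eqI) (simp add: coeff_map_poly)
  have root: "poly (map_poly of_int p1) z = 0"
  proof -
   have "of_int (content p0) * poly (map_poly of_int p1) z = 0"
    using p0(2) sm[of "content p0" p1] p1(1) by (metis poly_smult)
   thus ?thesis using p0(1) by simp
  qed
  have "EX i. (of_int (coeff p1 i) :: 'a) ~: q"
  proof (rule ccontr)
   assume "\<nexists>i. (of_int (coeff p1 i) :: 'a) ~: q"
   hence all: "!!i. (of_int (coeff p1 i) :: 'a) : q" by auto
   define S where "S n \<longleftrightarrow> n > 0 & (of_nat n :: 'a) : q" for n :: nat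
   obtain i where i: "coeff p1 i ~= 0" using p1(3) leading_coeff_0_iff by blast
   have "S (nat \<bar>coeff p1 i\<bar>)"
    using all[of i] i qm(1)[OF all[of i]] by (cases "coeff p1 i >= 0") (auto simp: S_def)
   then obtain n where n: "S n" and min: "!!m. S m ==> n <= m" using LeastI[of S] Least_le[of S] by blast
   have "int n dvd c" if c: "(of_int c :: 'a) : q" for c
   proof -
    have "c mod int n = c - (c div int n) * int n" by (simp add: minus_div_mult_eq_mod)
    hence "(of_int (c mod int n) :: 'a) = of_int c - of_int (c div int n) * of_nat n" by simp
    moreover have "of_int (c div int n) * of_nat n : q" using n q(4) a(11) by (auto simp: S_def)
    ultimately have "(of_int (c mod int n) :: 'a) : q" using qm(2)[OF c] by simp
    moreover have "0 <= c mod int n" "c mod int n < int n" using n by (auto simp: S_def)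
    moreover have "S (nat (c mod int n))" if "c mod int n > 0" using calculation(1) that by (simp add: S_def)
    ultimately have "~ (c mod int n > 0)" using min[of "nat (c mod int n)"] by linarith
    thus ?thesis using \<open>0 <= c mod int n\<close> by (simp add: dvd_eq_mod_eq_0)
   qed
   hence "int n dvd content p1" using all by (simp add: const_poly_dvd_iff flip: const_poly_dvd_iff_dvd_content)
   hence "n = 1" using p1(2) by simp
   thus False using n A(3) by (simp add: S_def)
  qed
  thus ?thesis using root by (intro exI[of _ "map_poly of_int p1"]) (auto simp: coeff_map_poly)
qed

lemma fraction_not_both:
  fixes u :: "'a::field_char_0"
  assumes alg: "!!z::'a. algebraic z" and R: "subr R" and M: "subf M" and A: "A = int_closure R \<inter> M"
   and q: "ideal_on A q" "1 ~: q" and u: "u : M"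
  shows "EX a:A. EX b:A. ~ (a : q & b : q) & b * u = a"
proof -
  have sA: "subr A" unfolding A by (intro subr_Int int_closure_subr(1) R subf_subr[OF M])
  obtain p where p: "!!i. coeff p i : \<int>" "poly p u = 0" "EX i. coeff p i ~: q"
   using primitive_relation[OF alg sA q] by blast
  have "coeff p i : A" for i using p(1)[of i] subrD(11)[OF sA] by (auto simp: Ints_def)
  thus ?thesis using fraction_not_both_in[OF R M A q(1) u _ p(2,3)] by blast
qed

text \<open>The zero prime gives this point: every element is a fraction of elements integral over
  \<open>R\<close>, because it is algebraic over the rationals.\<close>

lemma geom_generic:
  assumes alg: "!!z::'a::field_char_0. algebraic z" and R: "subr R"
  shows "(UNIV, {0::'a}) : geom_points R"
proof -
  let ?A = "int_closure R"
  have A: "subr ?A" by (rule int_closure_subr(1)[OF R])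
  have i: "ideal_on ?A {0}" using subrD[OF A] by (auto simp: ideal_on_def)
  hence "primeideal {0} (ring_on ?A)" unfolding primeideal_iff[OF A] by (auto simp: prime_on_def)
  moreover have "loc ?A {0} = UNIV"
  proof -
   have "u : loc ?A {0}" for u
   proof -
    obtain a b where ab: "a : ?A" "b : ?A" "~ (a = 0 & b = 0)" "b * u = a"
     using fraction_not_both[OF alg R subf_UNIV, of ?A "{0}" u] i by auto
    hence "u = a / b" "b ~= 0" by (auto simp: field_simps)
    thus ?thesis using ab by (auto simp: loc_def)
   qed
   thus ?thesis by auto
  qed
  moreover have "loc_max ?A {0} = {0}" using subrD(2)[OF A] by (auto simp: loc_max_def intro!: exI[of _ 1])
  ultimately show ?thesis unfolding geom_points_def by fastforce
qed

lemma loc_subr: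
  assumes A: "subr A" and q: "prime_on A q"
  shows "subr (loc A q)" "A \<subseteq> loc A q" "ideal_on (loc A q) (loc_max A q)" "1 ~: loc_max A q"
   "q \<subseteq> loc_max A q" "loc_max A q \<inter> A \<subseteq> q" "!!a. a : A ==> a ~: q ==> inverse a : loc A q"
proof -
  note a = subrD[OF A]
  have i: "ideal_on A q" and o: "1 ~: q" and p: "!!a b. a : A ==> b : A ==> a * b : q ==> a : q | b : q"
   using q by (auto simp: prime_on_def)
  note q = ideal_onD[OF i]
  have I: "z : loc A q" if "a : A" "b : A" "b ~: q" "z * b = a" for z a b
   using that q(2) unfolding loc_def by (intro CollectI exI[of _ a] exI[of _ b]) (auto simp: field_simps)
  have IM: "z : loc_max A q" if "a : q" "b : A" "b ~: q" "z * b = a" for z a b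
   using that q(2) unfolding loc_max_def by (intro CollectI exI[of _ a] exI[of _ b]) (auto simp: field_simps)
  have E: "EX a b. a : A & b : A & b ~: q & z * b = a" if "z : loc A q" for z
  proof -
   from that obtain a b where "z = a / b" "a : A" "b : A" "b ~: q" by (auto simp: loc_def)
   thus ?thesis using q(2) by (intro exI[of _ a] exI[of _ b]) auto
  qed
  have EM: "EX a b. a : q & b : A & b ~: q & z * b = a" if "z : loc_max A q" for z
  proof -
   from that obtain a b where "z = a / b" "a : q" "b : A" "b ~: q" by (auto simp: loc_max_def)
   thus ?thesis using q(2) by (intro exI[of _ a] exI[of _ b]) auto
  qed
  show "A \<subseteq> loc A q" using I[of _ 1] a o by auto
  show "subr (loc A q)"
  proof (rule subrI)
   show "0 : loc A q" "1 : loc A q" using I[of 0 1] I[of 1 1] a o by auto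
   fix x y assume "x : loc A q" "y : loc A q"
   then obtain b d where b: "b : A" "b ~: q" "x * b : A" and d: "d : A" "d ~: q" "y * d : A" using E by metis
   have bd: "b * d : A" "b * d ~: q" using b d a(4)[of b d] p[of b d] by auto
   have m: "(x * b) * d + (y * d) * b : A" "(x * b) * (y * d) : A" "- (x * b) : A" using a(3,4,5) b d by blast+
   show "x + y : loc A q" by (rule I[OF m(1) bd]) (simp add: algebra_simps)
   show "x * y : loc A q" by (rule I[OF m(2) bd]) (simp add: algebra_simps)
   show "- x : loc A q" by (rule I[OF m(3) b(1,2)]) simp
  qed
  show "ideal_on (loc A q) (loc_max A q)" unfolding ideal_on_def
  proof (intro conjI ballI)
   show "loc_max A q \<subseteq> loc A q" using q by (auto simp: loc_def loc_max_def)
   show "0 : loc_max A q" using IM[of 0 1] a o q by auto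
  next
   fix x y assume "x : loc_max A q" "y : loc_max A q"
   then obtain b d where b: "b : A" "b ~: q" "x * b : q" and d: "d : A" "d ~: q" "y * d : q" using EM by metis
   have bd: "b * d : A" "b * d ~: q" using b d a(4)[of b d] p[of b d] by auto
   have "(x * b) * d + (y * d) * b : q" using q b d by auto
   thus "x + y : loc_max A q" by (rule IM[OF _ bd]) (auto simp: algebra_simps)
  next
   fix x y assume "x : loc A q" "y : loc_max A q"
   then obtain b d where b: "b : A" "b ~: q" "x * b : A" and d: "d : A" "d ~: q" "y * d : q" using E EM by metis
   have bd: "b * d : A" "b * d ~: q" using b d a(4)[of b d] p[of b d] by auto
   have "(x * b) * (y * d) : q" using q b d by auto
   thus "x * y : loc_max A q" by (rule IM[OF _ bd]) (auto simp: algebra_simps)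
  qed
  show "1 ~: loc_max A q" using EM[of 1] by auto
  show "q \<subseteq> loc_max A q" using IM[of _ 1] a o by auto
  show "loc_max A q \<inter> A \<subseteq> q" using EM p by fastforce
  show "inverse c : loc A q" if c: "c : A" "c ~: q" for c by (rule I[OF a(2) c]) (metis c(2) q(2) left_inverse)
qed

text \<open>A valuation ring \<open>V\<close> dominating the localisation at \<open>q\<close> is not
  visibly of the form demanded by \<open>geom_points\<close>. Its maximal ideal is therefore
  contracted to the integral closure of \<open>R\<close>, which is localised there;
  \<open>fraction_not_both\<close> shows that the result is again a valuation ring. The clause on
  fractions brings elements of \<open>W\<close> in \<open>M\<close> back to
  \<open>integers M\<close>, where inertia is defined.\<close>

lemma val_ring_above:
  fixes M k :: "'a::field_char_0 set"
  assumes alg: "!!z::'a. algebraic z" and M: "subf M" and k: "subf k" "k \<subseteq> M" and q: "prime_on (integers M) q"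
  defines "R \<equiv> loc (integers k) (q \<inter> k)"
  obtains W where "val_ring W" "(W, vmax W) : geom_points R" "R \<subseteq> W"
   "!!a. a : integers M ==> a ~: q ==> inverse a : W"
   "!!z. z : W ==> z : M ==> EX a:integers M. EX b:integers M. b ~: q & z = a / b"
   "loc_max (integers M) q \<subseteq> vmax W" "prime_on (integers k) (q \<inter> k)" "subr R" "R \<subseteq> k"
proof -
  let ?O = "integers M"
  have sO: "subr ?O" and sk: "subr (integers k)" using M k by (auto intro: integers_subr)
  have qi: "ideal_on ?O q" "1 ~: q" using q by (auto simp: prime_on_def)
  note qI = ideal_onD[OF qi(1)]
  have kO: "integers k = ?O \<inter> k" using k by (auto simp: integers_def)
  have p: "prime_on (integers k) (q \<inter> k)"
   using q subrD[OF subf_subr[OF k(1)]] unfolding kO by (auto simp: prime_on_def ideal_on_def)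
  note Lq = loc_subr[OF sO q] and Lp = loc_subr[OF sk p, folded R_def]
  have RA: "R \<subseteq> loc ?O q" unfolding R_def loc_def kO by blast
  have Rk: "R \<subseteq> k" unfolding R_def loc_def kO using subf_divide[OF k(1)] by auto
  obtain V where V: "val_ring V" "loc ?O q \<subseteq> V" "loc_max ?O q \<subseteq> vmax V" using chevalley[OF Lq(1,3,4)] by blast
  note Vm = val_ring_max_ideal[OF V(1)]
  have sV: "subr V" using V by (simp add: val_ring_def)
  let ?B = "int_closure R"
  note B = int_closure_subr[OF Lp(1)]
  have BV: "?B \<subseteq> V" using V RA by (auto simp: int_closure_iff_val[OF Lp(1)])
  define Q where "Q = vmax V \<inter> ?B"
  have Q: "prime_on ?B Q"
  proof -
   have "ideal_on ?B Q" using ideal_onD[OF Vm(1)] subrD[OF B(1)] BV by (auto simp: ideal_on_def Q_def)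
   moreover have "a : Q | b : Q" if "a : ?B" "b : ?B" "a * b : Q" for a b
   proof (rule ccontr)
    assume "~ (a : Q | b : Q)"
    hence "inverse a : V" "a ~= 0" "inverse b : V" "b ~= 0" using that BV by (auto simp: Q_def vmax_def)
    hence "inverse (a * b) : V" "a * b ~= 0" using subrD(4)[OF sV] by auto
    thus False using that(3) by (auto simp: Q_def vmax_def)
   qed
   ultimately show ?thesis using Vm(2) by (auto simp: prime_on_def Q_def)
  qed
  define W where "W = loc ?B Q"
  note LW = loc_subr[OF B(1) Q, folded W_def]
  have OB: "?O \<subseteq> ?B"
  proof -
   have "\<int> \<subseteq> R" using subrD(11)[OF Lp(1)] by (auto simp: Ints_def)
   thus ?thesis using int_closure_mono[of \<int> R] by (auto simp: integers_eq)
  qed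
  have dich: "z : W | (inverse z : loc_max ?B Q & z ~= 0)" for z
  proof -
   obtain a b where ab: "a : ?B" "b : ?B" "~ (a : Q & b : Q)" "b * z = a"
    using fraction_not_both[OF alg Lp(1) subf_UNIV, of ?B Q z] Q by (auto simp: prime_on_def)
   have Q0: "0 : Q" using Q by (auto simp: prime_on_def ideal_on_def)
   show ?thesis
   proof (cases "b : Q")
    case False
    hence "z = a / b" using ab Q0 by (auto simp: field_simps)
    thus ?thesis using ab False by (auto simp: W_def loc_def)
   next
    case True
    hence "a ~: Q" "a ~= 0" using ab Q0 by auto
    hence "inverse z = b / a" "z ~= 0" using ab by (auto simp: field_simps)
    thus ?thesis using ab True \<open>a ~: Q\<close> by (auto simp: loc_max_def)
   qed
  qed
  have mW: "loc_max ?B Q \<subseteq> W" using ideal_onD(1)[OF LW(3)] .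
  have vW: "val_ring W" using LW(1) dich mW by (auto simp: val_ring_def)
  have vm: "vmax W = loc_max ?B Q"
  proof
   show "vmax W \<subseteq> loc_max ?B Q"
   proof
    fix z assume z: "z : vmax W"
    show "z : loc_max ?B Q"
    proof (cases "z = 0")
     case False
     hence "inverse z ~: W" using z by (simp add: vmax_def)
     thus ?thesis using dich[of "inverse z"] by auto
    qed (use ideal_onD(2)[OF LW(3)] in simp)
   qed
   show "loc_max ?B Q \<subseteq> vmax W"
   proof
    fix z assume z: "z : loc_max ?B Q"
    have "inverse z ~: W" if "z ~= 0"
    proof
     assume "inverse z : W"
     hence "inverse z * z : loc_max ?B Q" using ideal_onD(4)[OF LW(3)] z by blast
     thus False using LW(4) that by simp
    qed
    thus "z : vmax W" using z mW by (auto simp: vmax_def)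
   qed
  qed
  have geom: "(W, vmax W) : geom_points R" unfolding geom_points_def
  proof (intro CollectI exI[of _ Q] conjI)
   show "(W, vmax W) = (loc ?B Q, loc_max ?B Q)" unfolding vm by (simp add: W_def)
  qed (use Q primeideal_iff[OF B(1)] in simp)
  have notQ: "a ~: Q" if "a : ?O" "a ~: q" for a
  proof -
   have "inverse a : V" "a ~= 0" using Lq(7)[OF that] V(2) that qI(2) by auto
   thus ?thesis by (auto simp: Q_def vmax_def)
  qed
  have qQ: "q \<subseteq> Q" using Lq(5) V(3) OB qI(1) by (auto simp: Q_def)
  have lm: "loc_max ?O q \<subseteq> vmax W" unfolding vm loc_max_def using notQ qQ OB by blast
  have inv: "inverse a : W" if "a : ?O" "a ~: q" for a using LW(7)[of a] notQ[OF that] that OB by auto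
  have frac: "EX a:?O. EX b:?O. b ~: q & z = a / b" if z: "z : W" "z : M" for z
  proof -
   obtain a b where ab: "a : ?O" "b : ?O" "~ (a : q & b : q)" "b * z = a"
    using fraction_not_both[OF alg subr_Ints M integers_eq qi z(2)] by blast
   show ?thesis
   proof (cases "b : q")
    case False
    hence "z = a / b" using ab qI(2) by (auto simp: field_simps)
    thus ?thesis using ab False by auto
   next
    case True
    hence "a ~: q" "a ~= 0" using ab qI(2) by auto
    hence "inverse z = b / a" "z ~= 0" using ab by (auto simp: field_simps)
    hence "inverse z : loc_max ?O q" using True ab \<open>a ~: q\<close> by (auto simp: loc_max_def)
    hence "z ~: W" using lm \<open>z ~= 0\<close> by (auto simp: vmax_def)
    thus ?thesis using z by simp
   qed
  qed
  have RW: "R \<subseteq> W" using B(2) LW(2) by auto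
  show thesis by (rule that[OF vW geom RW inv frac lm p Lp(1) Rk])
qed

subsection \<open>Torsion points and reduction\<close>

text \<open>Used to make homogeneous coordinates integral with one unit entry: divide by the entry
  of least valuation. The dichotomy is asked of the quotients only, because in \<open>center\<close>
  the ring is a valuation ring of \<open>F\<close> and not of the surrounding field.\<close>

lemma max_quotient:
  assumes sV: "subr V" and S: "finite S" "j0 : S" "f j0 ~= 0"
   and d: "!!i j. i : S ==> j : S ==> f i / f j : V | f j / f i : V"
  shows "EX j:S. f j ~= 0 & (ALL i:S. f i / f j : V)"
proof -
  have "EX j:T. f j ~= 0 & (ALL i:T. f i / f j : V)" if "finite T" "T \<subseteq> S" "EX i:T. f i ~= 0" for T using that
  proof (induction T rule: finite_induct)
   case (insert x T)
   show ?case
   proof (cases "EX i:T. f i ~= 0")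
    case False
    thus ?thesis using insert.prems subrD(1,2)[OF sV] by (intro bexI[of _ x]) auto
   next
    case True
    then obtain j where j: "j : T" "f j ~= 0" "!!i. i : T ==> f i / f j : V" using insert by auto
    show ?thesis
    proof (cases "f x / f j : V")
     case True
     thus ?thesis using j by (intro bexI[of _ j]) auto
    next
     case False
     hence x: "f x ~= 0" and jx: "f j / f x : V" using d[of x j] insert.prems(1) j(1) subrD(1)[OF sV] by auto
     have "f i / f x : V" if "i : T" for i using subrD(4)[OF sV j(3)[OF that] jx] j(2) by simp
     thus ?thesis using x subrD(2)[OF sV] by (intro bexI[of _ x]) auto
    qed
   qed
  qed auto
  thus ?thesis using S by blast
qed

lemma val_ring_max_quotient:
  assumes "val_ring V" "finite S" "j0 : S" "f j0 ~= 0"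
  shows "EX j:S. f j ~= 0 & (ALL i:S. f i / f j : V)"
proof (rule max_quotient)
  show "f i / f j : V | f j / f i : V" for i j
   using assms(1) inverse_divide[of "f i" "f j"] unfolding val_ring_def by metis
qed (use assms in "auto simp: val_ring_def")

lemma ideal_on_principal:
  assumes "subr W" "x : W" shows "ideal_on W ((%s. x * s) ` W)" unfolding ideal_on_def
proof (intro conjI ballI)
  note w = subrD[OF assms(1)]
  show "(%s. x * s) ` W \<subseteq> W" using w(4) assms(2) by auto
  show "0 : (%s. x * s) ` W" by (rule image_eqI[of _ _ 0]) (use w(1) in auto)
  fix a b assume "a : (%s. x * s) ` W" "b : (%s. x * s) ` W"
  then obtain s t where "a = x * s" "b = x * t" "s : W" "t : W" by auto
  thus "a + b : (%s. x * s) ` W" by (intro image_eqI[of _ _ "s + t"]) (use w(3) in "auto simp: ring_distribs")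
next
  note w = subrD[OF assms(1)]
  fix a b assume "a : W" "b : (%s. x * s) ` W"
  then obtain t where "b = x * t" "t : W" by auto
  thus "a * b : (%s. x * s) ` W" using \<open>a : W\<close> by (intro image_eqI[of _ _ "a * t"]) (use w(4) in auto)
qed

lemma evh_congruent:
  fixes p :: "('v, 'a::comm_ring_1) mpol" and h :: "'a => 'b::field"
  assumes W: "subr W" "ideal_on W m" and p: "p : polys R V" "!!c. c : R ==> h c : W"
   and x: "!!v. v : V ==> x v : W" "!!v. v : V ==> y v : W" "!!v. v : V ==> x v - y v : m"
  shows "evh h x p - evh h y p : m" "evh h x p : W" "evh h y p : W"
proof -
  note w = subrD[OF W(1)] and i = ideal_onD[OF W(2)]
  let ?S = "{f :: bool => 'b. f True : W & f False : W & f True - f False : m}"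
  have "(%b. evh h (if b then x else y) p) : ?S"
  proof (rule ev_family_closed[OF p(1)])
   fix f g assume fg: "f : ?S" "g : ?S"
   have e: "f True + g True - (f False + g False) = (f True - f False) + (g True - g False)" by simp
   have "f True + g True - (f False + g False) : m" unfolding e using fg i(3) by blast
   thus "(%i. f i + g i) : ?S" using fg w(3) by blast
   have e: "f True * g True - f False * g False = f True * (g True - g False) + g False * (f True - f False)"
    by (simp add: algebra_simps)
   have "f True * g True - f False * g False : m" unfolding e using fg i(3,4) by blast
   thus "(%i. f i * g i) : ?S" using fg w(4) by blast
  qed (use p x w i in auto)
  thus "evh h x p - evh h y p : m" "evh h x p : W" "evh h y p : W" by auto
qed

lemma ev_congruent_pair:
  fixes p :: "(nat + nat, 'a::field) mpol"
  assumes W: "subr W" "ideal_on W m" and p: "p : polys R V" "R \<subseteq> W"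
   and x: "!!i. P i : W" "!!i. Q i : W" "!!i. P' i : W" "!!i. Q' i : W" "!!i. P i - P' i : m" "!!i. Q i - Q' i : m"
  shows "ev (case_sum P Q) p - ev (case_sum P' Q') p : m" "ev (case_sum P Q) p : W" "ev (case_sum P' Q') p : W"
proof -
  have "case_sum P Q w : W" "case_sum P' Q' w : W" "case_sum P Q w - case_sum P' Q' w : m" for w
   using x by (auto split: sum.splits)
  from evh_congruent[where h = "%a. a" and x = "case_sum P Q" and y = "case_sum P' Q'", OF W p(1) _ this]
  show "ev (case_sum P Q) p - ev (case_sum P' Q') p : m" "ev (case_sum P Q) p : W" "ev (case_sum P' Q') p : W"
   using p(2) by (auto simp: ev_evh)
qed

text \<open>At the four corners of a parallelogram with sides \<open>\<pi> * a\<close> and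
  \<open>\<pi> * b\<close> the variables have values c, c + \<pi> s, c + \<pi> t and c + \<pi> s +
  \<pi> t + \<pi>^2 u. Quadruples of this shape are closed under sums and products, so the mixed
  difference of any polynomial is divisible by \<pi>^2.\<close>

lemma ev_second_difference:
  fixes p :: "('v, 'a::field) mpol"
  assumes W: "subr W" "\<pi> : W" and p: "p : polys R V" "R \<subseteq> W"
   and x: "!!v. v : V ==> x v : W" "!!v. v : V ==> a v : W" "!!v. v : V ==> b v : W"
   and ab: "!!v. v : V ==> a v * b v = 0"
  shows "EX w:W. ev (%v. x v + \<pi> * a v + \<pi> * b v) p - ev (%v. x v + \<pi> * a v) p
    - ev (%v. x v + \<pi> * b v) p + ev x p = \<pi> * \<pi> * w"
proof -
  note w = subrD[OF W(1)]
  let ?S = "{f :: nat => 'a. EX c:W. EX s:W. EX t:W. EX u:W. f 0 = c & f 1 = c + \<pi> * s & f 2 = c + \<pi> * t &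
    f 3 = c + \<pi> * s + \<pi> * t + \<pi> * \<pi> * u}"
  let ?x = "%i::nat. if i = 0 then x else if i = 1 then (%v. x v + \<pi> * a v) else
   if i = 2 then (%v. x v + \<pi> * b v) else (%v. x v + \<pi> * a v + \<pi> * b v)"
  have "(%i. evh (%a. a) (?x i) p) : ?S"
  proof (rule ev_family_closed[OF p(1)])
   fix f g assume "f : ?S" "g : ?S"
   then obtain c s t u c' s' t' u' where f: "c : W" "s : W" "t : W" "u : W" "f 0 = c" "f 1 = c + \<pi> * s"
     "f 2 = c + \<pi> * t" "f 3 = c + \<pi> * s + \<pi> * t + \<pi> * \<pi> * u"
    and g: "c' : W" "s' : W" "t' : W" "u' : W" "g 0 = c'" "g 1 = c' + \<pi> * s'"
     "g 2 = c' + \<pi> * t'" "g 3 = c' + \<pi> * s' + \<pi> * t' + \<pi> * \<pi> * u'" by blast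
   show "(%i. f i + g i) : ?S"
    by (intro CollectI bexI[of _ "c + c'"] bexI[of _ "s + s'"] bexI[of _ "t + t'"] bexI[of _ "u + u'"])
     (use f g w(3) in "simp_all add: algebra_simps")
   \<comment> \<open>The coefficients of the product of two quadruples; \<open>?u\<close> collects
     the terms divisible by \<pi>^2 that \<open>?s\<close> and \<open>?t\<close> have not
     absorbed.\<close>
   let ?s = "c * s' + s * c' + \<pi> * s * s'"
   let ?t = "c * t' + t * c' + \<pi> * t * t'"
   let ?u = "c * u' + u * c' + s * t' + t * s' + \<pi> * (s * u' + t * u' + u * s' + u * t') + \<pi> * \<pi> * u * u'"
   have "?s : W" "?t : W" "?u : W" by (intro w(3) w(4) f g W(2))+
   thus "(%i. f i * g i) : ?S" by (intro CollectI bexI[of _ "c * c'"] bexI[of _ ?s] bexI[of _ ?t] bexI[of _ ?u])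
     (use f(5-) g(5-) w(4)[OF f(1) g(1)] in "simp_all add: algebra_simps")
  next
   fix v assume v: "v : V"
   show "(%i. ?x i v) : ?S" by (intro CollectI bexI[of _ "x v"] bexI[of _ "a v"] bexI[of _ "b v"] bexI[of _ 0])
     (use x[OF v] w in simp_all)
  next
   fix c assume "c : R"
   thus "(%i. c) : ?S" by (intro CollectI bexI[of _ c] bexI[of _ 0]) (use p w in auto)
  next
   show "(%i. 0) : ?S" by (intro CollectI bexI[of _ 0]) (use w in auto)
   show "(%i. 1) : ?S" by (intro CollectI bexI[of _ 1] bexI[of _ 0]) (use w in auto)
  qed
  then obtain c s t u where "c : W" "u : W" "evh (%a. a) (?x 0) p = c" "evh (%a. a) (?x 1) p = c + \<pi> * s"
   "evh (%a. a) (?x 2) p = c + \<pi> * t" "evh (%a. a) (?x 3) p = c + \<pi> * s + \<pi> * t + \<pi> * \<pi> * u" by blast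
  thus ?thesis by (intro bexI[of _ u]) (auto simp: ev_evh)
qed

text \<open>\<open>v\<close> represents the zero section in integral coordinates with one of them
  equal to 1; it is the origin of the local coordinates.\<close>

locale reduction =
  fixes R W :: "'a::field set" and V :: "'a scheme" and H :: "(nat => 'a) monoid" and v :: "nat => 'a" and i0 :: nat
  assumes vW: "val_ring W" and geom: "(W, vmax W) : geom_points R" and RW: "R \<subseteq> W"
   and proj: "proj_scheme R V" and grp: "comm_group H" and car: "carrier H = points V"
   and bim: "bimorphism R V V V (%A B. A \<otimes>\<^bsub>H\<^esub> B)" and v: "!!i. v i : W" "v i0 = 1" "normalise v = \<one>\<^bsub>H\<^esub>"
begin

abbreviation "m \<equiv> vmax W"

lemma W: "subr W" using vW by (simp add: val_ring_def)
lemma mi: "ideal_on W m" "1 ~: m" using val_ring_max_ideal[OF vW] by auto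
lemma unit: "z : W ==> z ~: m ==> inverse z : W & z ~= 0" by (auto simp: vmax_def)

sublocale comm_group H by (rule grp)

text \<open>Points carry normalised coordinates, which may fail to be integral. Reduction modulo
  \<open>m\<close> needs representatives scaled differently.\<close>

definition rep :: "(nat => 'a) => (nat => 'a) => bool" where
  "rep P A \<longleftrightarrow> A : points V & normalise P = A & (EX i. P i ~= 0)"

lemma rep_scale: "rep P A ==> c ~= 0 ==> rep (%i. c * P i) A" by (auto simp: rep_def normalise_scale)

lemma rep_cone: assumes "rep P A" shows "P : cone V" "EX c. c ~= 0 & P = (%i. c * A i)"
proof -
  obtain i where "P i ~= 0" using assms by (auto simp: rep_def)
  then obtain c where c: "c ~= 0" "normalise P = (%i. c * P i)" by (rule normalise_as_scale)
  hence "A x = c * P x" for x using assms unfolding rep_def by metis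
  hence P: "P = (%i. inverse c * A i)" using c(1) by auto
  moreover have "A : cone V" using assms points_iff[OF proj] by (auto simp: rep_def)
  ultimately show "P : cone V" using cone_scale[OF proj, of "inverse c" A] c by simp
  show "EX c. c ~= 0 & P = (%i. c * A i)" using P c by (intro exI[of _ "inverse c"]) simp
qed

lemma rep_fibre: "rep P A ==> (!!i. P i : W) ==> P i ~: m ==> P : fibre (W, m) V"
  using rep_cone(1)[of P A] ideal_onD(2)[OF mi(1)] by (auto simp: fibre_def cone_iff) (metis not_le)

lemma rep_v: "rep v \<one>\<^bsub>H\<^esub>" using v one_closed by (auto simp: rep_def car intro!: exI[of _ i0])

text \<open>Local formulas for the group law around a pair of residue points. The last clause is
  stated for arbitrary homogeneous coordinates, so that it applies to integral representatives and
  not only to normalised points.\<close>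

definition mult_forms :: "(nat => 'a) => (nat => 'a) => (nat => (nat + nat, 'a) mpol) => bool" where
  "mult_forms P Q F \<longleftrightarrow> (ALL i. F i : polys R ({..amb V} <+> {..amb V})) & (EX i. ev (case_sum P Q) (F i) ~: m) &
   (ALL A B A' B'. rep A' A --> rep B' B --> (EX i. ev (case_sum A' B') (F i) ~= 0) -->
     rep (%i. ev (case_sum A' B') (F i)) (A \<otimes>\<^bsub>H\<^esub> B))"

lemma mult_formsD:
  assumes "mult_forms P Q F"
  shows "F i : polys R ({..amb V} <+> {..amb V})" "EX i. ev (case_sum P Q) (F i) ~: m"
   "rep A' A ==> rep B' B ==> EX i. ev (case_sum A' B') (F i) ~= 0 ==>
     rep (%i. ev (case_sum A' B') (F i)) (A \<otimes>\<^bsub>H\<^esub> B)" using assms by (auto simp: mult_forms_def)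

lemma mult_local:
  assumes P: "P : fibre (W, m) V" and Q: "Q : fibre (W, m) V"
  shows "EX F. mult_forms P Q F"
proof -
  have "ALL P:fibre (W, m) V. ALL Q:fibre (W, m) V. EX d e F.
     (ALL i. F i : biforms R (amb V) (amb V) d e) & (ALL i>amb V. F i = 0) &
     (EX i. ev (case_sum P Q) (F i) ~: m) &
     (ALL A:points V. ALL B:points V. (EX i. ev (case_sum A B) (F i) ~= 0) -->
       A \<otimes>\<^bsub>H\<^esub> B = normalise (%i. ev (case_sum A B) (F i)))"
   using bspec[OF conjunct2[OF bim[unfolded bimorphism_def]] geom] by simp
  then obtain d e F where F: "!!i. F i : biforms R (amb V) (amb V) d e" "EX i. ev (case_sum P Q) (F i) ~: m"
   and n: "!!A B. A : points V ==> B : points V ==> (EX i. ev (case_sum A B) (F i) ~= 0) ==>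
       A \<otimes>\<^bsub>H\<^esub> B = normalise (%i. ev (case_sum A B) (F i))" using P Q by meson
  show ?thesis unfolding mult_forms_def
  proof (intro exI[of _ F] conjI allI impI)
   fix A B A' B' assume r: "rep A' A" "rep B' B" and nz: "EX i. ev (case_sum A' B') (F i) ~= 0"
   have AB: "A : points V" "B : points V" using r by (auto simp: rep_def)
   obtain c c' where c: "c ~= 0" "A' = (%i. c * A i)" "c' ~= 0" "B' = (%i. c' * B i)"
    using rep_cone(2)[OF r(1)] rep_cone(2)[OF r(2)] by blast
   have e: "ev (case_sum A' B') (F i) = (c ^ d * c' ^ e) * ev (case_sum A B) (F i)" for i
    unfolding c by (rule ev_biforms_scale[OF F(1)])
   have "A \<otimes>\<^bsub>H\<^esub> B = normalise (%i. ev (case_sum A' B') (F i))"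
   proof -
    obtain i where "ev (case_sum A' B') (F i) ~= 0" using nz by blast
    hence "ev (case_sum A B) (F i) ~= 0" using e[of i] by auto
    hence "A \<otimes>\<^bsub>H\<^esub> B = normalise (%i. ev (case_sum A B) (F i))" using n[OF AB] by blast
    thus ?thesis unfolding e using c by (simp add: normalise_scale)
   qed
   moreover have "A \<otimes>\<^bsub>H\<^esub> B : points V" using AB car m_closed by auto
   ultimately show "rep (%i. ev (case_sum A' B') (F i)) (A \<otimes>\<^bsub>H\<^esub> B)" using nz by (simp add: rep_def)
  qed (use F biforms_polys[OF F(1)] in auto)
qed

text \<open>Near the zero section, in coordinates centred there, addition is \<open>(a, b) \<mapsto> a + b\<close> up to terms of second order.\<close>

lemma mult_near_one:
  assumes \<pi>: "\<pi> : m" and a: "!!i. \<alpha> i : W" "\<alpha> i0 = 0" "rep (%i. v i + \<pi> * \<alpha> i) A"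
   and b: "!!i. \<beta> i : W" "\<beta> i0 = 0" "rep (%i. v i + \<pi> * \<beta> i) B"
  shows "EX \<gamma>. (ALL i. \<gamma> i : W) & \<gamma> i0 = 0 & rep (%i. v i + \<pi> * \<gamma> i) (A \<otimes>\<^bsub>H\<^esub> B) &
   (ALL i. EX w:W. \<gamma> i = \<alpha> i + \<beta> i + \<pi> * w)"
proof -
  note w = subrD[OF W] and I = ideal_onD[OF mi(1)] and Im = ideal_on_minus[OF W mi(1)]
  have \<pi>W: "\<pi> : W" using \<pi> I by auto
  have v0: "v i0 ~: m" using v(2) mi(2) by simp
  have fv: "v : fibre (W, m) V" by (rule rep_fibre[OF rep_v v(1) v0])
  obtain F where "mult_forms v v F" using mult_local[OF fv fv] by blast
  note F = mult_formsD(1,2)[OF this] and mul = mult_formsD(3)[OF this]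
  define a' b' where "a' i = v i + \<pi> * \<alpha> i" and "b' i = v i + \<pi> * \<beta> i" for i
  have a'W: "a' i : W" "b' i : W" for i unfolding a'_def b'_def using v(1) a(1) b(1) \<pi>W w by auto
  have ab0: "a' i0 = 1" "b' i0 = 1" using a b v by (auto simp: a'_def b'_def)
  have ra: "rep a' A" and rb: "rep b' B" using a(3) b(3) by (auto simp: a'_def[abs_def] b'_def[abs_def])
  have cong: "ev (case_sum x y) (F i) - ev (case_sum v v) (F i) : m & ev (case_sum x y) (F i) : W"
   if "x = v | x = a'" "y = v | y = b'" for x y i
  proof -
   have "a' i - v i : m" "b' i - v i : m" for i using I(6)[OF a(1) \<pi>] I(6)[OF b(1) \<pi>] by (auto simp: a'_def b'_def)
   hence "x j : W" "y j : W" "x j - v j : m" "y j - v j : m" for j using that v(1) a'W I(2) by auto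
   from ev_congruent_pair[where P = x and Q = y and P' = v and Q' = v, OF W mi(1) F(1) RW this(1,2) v(1) v(1) this(3,4)] show ?thesis by blast
  qed
  define n where "n = ev (case_sum v v) (F i0)"
  define p where "p = ev (case_sum a' v) (F i0)"
  define q where "q = ev (case_sum v b') (F i0)"
  define r where "r = ev (case_sum a' b') (F i0)"
  obtain i1 where i1: "ev (case_sum v v) (F i1) ~: m" using F(2) by blast
  \<comment> \<open>Both sides are homogeneous coordinates of the same product point, and comparison
    at \<open>i0\<close> gives the factor. The forms do not all vanish, because the value at index
    \<open>i1\<close> is congruent to one outside \<open>m\<close>.\<close>
  have scal: "ev (case_sum x y) (F i) = ev (case_sum x y) (F i0) * z i"
   if "x = v | x = a'" "y = v | y = b'" "rep x D" "rep y E" "rep z (D \<otimes>\<^bsub>H\<^esub> E)" "z i0 = 1" for x y z D E i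
  proof -
   have "ev (case_sum x y) (F i1) ~= 0"
   proof
    assume "ev (case_sum x y) (F i1) = 0"
    hence "- ev (case_sum v v) (F i1) : m" using cong[OF that(1,2), of i1] by simp
    thus False using i1 Im(1) by fastforce
   qed
   hence "rep (%i. ev (case_sum x y) (F i)) (D \<otimes>\<^bsub>H\<^esub> E)" by (intro mul that exI)
   hence "normalise (%i. ev (case_sum x y) (F i)) = normalise z" using that(5) by (simp add: rep_def)
   from normalise_eqD[OF this \<open>ev (case_sum x y) (F i1) ~= 0\<close> that(6)] show ?thesis by metis
  qed
  have A: "A : carrier H" "B : carrier H" using a(3) b(3) car by (auto simp: rep_def)
  have ev_n: "ev (case_sum v v) (F i) = n * v i" for i unfolding n_def by (rule scal) (use rep_v v in auto)
  have ev_p: "ev (case_sum a' v) (F i) = p * a' i" for i unfolding p_def by (rule scal) (use rep_v ra ab0 A in auto)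
  have ev_q: "ev (case_sum v b') (F i) = q * b' i" for i unfolding q_def by (rule scal) (use rep_v rb ab0 A in auto)
  have nW: "n : W" "p : W" "q : W" "r : W" unfolding n_def p_def q_def r_def using cong by auto
  have nm: "n ~: m"
  proof
   assume "n : m"
   hence "n * v i1 : m" using I v(1) by auto
   thus False using i1 ev_n by simp
  qed
  have pn: "EX s:W. p = n + \<pi> * s" and qn: "EX s:W. q = n + \<pi> * s"
  proof -
   let ?I = "(%s. \<pi> * s) ` W"
   have II: "ideal_on W ?I" by (rule ideal_on_principal[OF W \<pi>W])
   have "a' i - v i : ?I" "b' i - v i : ?I" "v i - v i : ?I" for i
    using a(1) b(1) ideal_onD(2)[OF II] by (auto simp: a'_def b'_def)
   hence "p - n : ?I" "q - n : ?I" unfolding p_def q_def n_def using v(1) a'W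
    by (intro ev_congruent_pair(1)[OF W II F(1) RW]; simp)+
   thus "EX s:W. p = n + \<pi> * s" "EX s:W. q = n + \<pi> * s" by (force simp: algebra_simps)+
  qed
  obtain s t where s: "s : W" "p = n + \<pi> * s" and t: "t : W" "q = n + \<pi> * t" using pn qn by blast
  \<comment> \<open>The mixed second difference in the directions \<open>(\<alpha>, 0)\<close> and
    \<open>(0, \<beta>)\<close>. The other three corners involve the identity as a factor, so their
    products are known.\<close>
  have "EX u:W. ev (case_sum a' b') (F i) = p * a' i + q * b' i - n * v i + \<pi> * \<pi> * u" for i
  proof -
   let ?x = "case_sum v v" and ?a = "case_sum \<alpha> (%i. 0)" and ?b = "case_sum (%i. 0) \<beta>"
   have "EX u:W. ev (%j. ?x j + \<pi> * ?a j + \<pi> * ?b j) (F i) - ev (%j. ?x j + \<pi> * ?a j) (F i)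
     - ev (%j. ?x j + \<pi> * ?b j) (F i) + ev ?x (F i) = \<pi> * \<pi> * u"
    by (rule ev_second_difference[OF W \<pi>W F(1) RW]) (use v(1) a(1) b(1) w in "auto split: sum.splits")
   moreover have "(%j. ?x j + \<pi> * ?a j + \<pi> * ?b j) = case_sum a' b'" "(%j. ?x j + \<pi> * ?a j) = case_sum a' v"
    "(%j. ?x j + \<pi> * ?b j) = case_sum v b'" by (auto simp: fun_eq_iff a'_def b'_def split: sum.splits)
   ultimately obtain u where u: "u : W" "ev (case_sum a' b') (F i) - ev (case_sum a' v) (F i)
     - ev (case_sum v b') (F i) + ev ?x (F i) = \<pi> * \<pi> * u" by auto
   thus ?thesis by (intro bexI[of _ u]) (auto simp: ev_p ev_q ev_n algebra_simps)
  qed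
  then obtain u where u: "!!i. u i : W" "!!i. ev (case_sum a' b') (F i) = p * a' i + q * b' i - n * v i + \<pi> * \<pi> * u i"
   by metis
  have rm: "r ~: m"
  proof
   assume "r : m"
   moreover have "r - n : m" unfolding r_def n_def using cong by blast
   ultimately have "r - (r - n) : m" by (rule Im(2))
   thus False using nm by simp
  qed
  have ri: "inverse r : W" "r ~= 0" using unit[OF nW(4) rm] by auto
  \<comment> \<open>Solved from \<open>key\<close>: the second-order remainder after the form values
    have been divided by \<open>r\<close>, their coordinate at \<open>i0\<close>.\<close>
  define g where "g i = inverse r * (u i - u i0 * (v i + \<pi> * \<alpha> i + \<pi> * \<beta> i) - t * \<alpha> i - s * \<beta> i)" for i
  have gW: "g i : W" for i unfolding g_def using u(1) v(1) a(1) b(1) \<pi>W ri s t by (intro w(4) w(6) w(3)) auto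
  have r: "r = p + q - n + \<pi> * \<pi> * u i0" using u(2)[of i0] ab0 v(2) by (simp add: r_def)
  have key: "ev (case_sum a' b') (F i) = r * (v i + \<pi> * (\<alpha> i + \<beta> i + \<pi> * g i))" for i
  proof -
   have "r * (\<pi> * \<pi> * g i) = \<pi> * \<pi> * (u i - u i0 * (v i + \<pi> * \<alpha> i + \<pi> * \<beta> i) - t * \<alpha> i - s * \<beta> i)"
    unfolding g_def using ri(2) by simp
   thus ?thesis unfolding u(2) a'_def b'_def by (simp add: algebra_simps r s t)
  qed
  have g0: "g i0 = 0" using v(2) a(2) b(2) by (simp add: g_def)
  have "rep (%i. ev (case_sum a' b') (F i)) (A \<otimes>\<^bsub>H\<^esub> B)" by (rule mul[OF ra rb]) (use ri(2) r_def in blast)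
  hence "rep (%i. inverse r * ev (case_sum a' b') (F i)) (A \<otimes>\<^bsub>H\<^esub> B)" by (rule rep_scale) (use ri in simp)
  hence "rep (%i. v i + \<pi> * (\<alpha> i + \<beta> i + \<pi> * g i)) (A \<otimes>\<^bsub>H\<^esub> B)" using ri(2) by (simp add: key mult.assoc[symmetric])
  thus ?thesis using gW g0 a(1,2) b(1,2) w \<pi>W by (intro exI[of _ "%i. \<alpha> i + \<beta> i + \<pi> * g i"]) auto
qed

text \<open>Iterates \<open>mult_near_one\<close>: the differential at the zero section of
  multiplication by \<open>n\<close> is the scalar \<open>n\<close>.\<close>

lemma pow_near_one:
  assumes \<pi>: "\<pi> : m" and a: "!!i. \<alpha> i : W" "\<alpha> i0 = 0" "rep (%i. v i + \<pi> * \<alpha> i) A"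
  shows "EX \<gamma>. (ALL i. \<gamma> i : W) & \<gamma> i0 = 0 & rep (%i. v i + \<pi> * \<gamma> i) (A [^]\<^bsub>H\<^esub> (n::nat)) &
   (ALL i. EX w:W. \<gamma> i = of_nat n * \<alpha> i + \<pi> * w)"
proof (induction n)
  case 0
  thus ?case using rep_v subrD(1)[OF W] by (intro exI[of _ "%i. 0"]) auto
next
  case (Suc n)
  then obtain \<gamma> where g: "!!i. \<gamma> i : W" "\<gamma> i0 = 0" "rep (%i. v i + \<pi> * \<gamma> i) (A [^]\<^bsub>H\<^esub> n)"
   "!!i. EX w:W. \<gamma> i = of_nat n * \<alpha> i + \<pi> * w" by auto
  obtain \<delta> where d: "!!i. \<delta> i : W" "\<delta> i0 = 0" "rep (%i. v i + \<pi> * \<delta> i) (A [^]\<^bsub>H\<^esub> n \<otimes>\<^bsub>H\<^esub> A)"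
   "!!i. EX w:W. \<delta> i = \<gamma> i + \<alpha> i + \<pi> * w" using mult_near_one[OF \<pi> g(1-3) a] by auto
  have "EX w:W. \<delta> i = of_nat (Suc n) * \<alpha> i + \<pi> * w" for i
  proof -
   obtain x y where "x : W" "\<gamma> i = of_nat n * \<alpha> i + \<pi> * x" "y : W" "\<delta> i = \<gamma> i + \<alpha> i + \<pi> * y"
    using g(4) d(4) by meson
   thus ?thesis using subrD(3)[OF W] by (intro bexI[of _ "x + y"]) (auto simp: algebra_simps)
  qed
  thus ?case using d by (intro exI[of _ \<delta>]) auto
qed

text \<open>\<open>\<pi>\<close> is the coordinate difference of least valuation, so the scaled
  vector \<open>\<alpha>\<close> has an entry 1. If the n-th multiple of the point is zero, that
  entry gives 0 = n + \<pi> w, and \<open>n\<close> would lie in the maximal ideal.\<close>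

lemma torsion_near_one:
  assumes b: "!!i. b i - v i : m" "b i0 = 1" "rep b B" and n: "(of_nat n :: 'a) ~: m" and B: "B [^]\<^bsub>H\<^esub> n = \<one>\<^bsub>H\<^esub>"
  shows "B = \<one>\<^bsub>H\<^esub>"
proof (cases "EX i<=amb V. b i ~= v i")
  case True
  note w = subrD[OF W] and I = ideal_onD[OF mi(1)]
  have out: "b i = 0" "v i = 0" if "i > amb V" for i
   using that rep_cone(1)[OF b(3)] rep_cone(1)[OF rep_v] by (auto simp: cone_iff)
  obtain j where j: "b j - v j ~= 0" "!!i. i <= amb V ==> (b i - v i) / (b j - v j) : W"
   using val_ring_max_quotient[OF vW, of "{..amb V}" _ "%i. b i - v i"] True by force
  define \<pi> where "\<pi> = b j - v j"
  define \<alpha> where "\<alpha> i = (b i - v i) / \<pi>" for i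
  have aW: "\<alpha> i : W" for i using j(2)[of i] out[of i] w(1) by (cases "i <= amb V") (auto simp: \<alpha>_def \<pi>_def)
  have a0: "\<alpha> i0 = 0" using b(2) v(2) by (simp add: \<alpha>_def)
  have e: "(%i. v i + \<pi> * \<alpha> i) = b" using j(1) by (auto simp: \<alpha>_def \<pi>_def)
  obtain \<gamma> where g: "\<gamma> i0 = 0" "rep (%i. v i + \<pi> * \<gamma> i) \<one>\<^bsub>H\<^esub>" "!!i. EX w:W. \<gamma> i = of_nat n * \<alpha> i + \<pi> * w"
   using pow_near_one[of \<pi> \<alpha> B n] b(1)[of j] aW a0 b(3) B unfolding e \<pi>_def[symmetric] by auto
  have "normalise (%i. v i + \<pi> * \<gamma> i) = normalise v" using g(2) v(3) by (simp add: rep_def)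
  from normalise_eqD[OF this, of i0 i0] have "(%i. v i + \<pi> * \<gamma> i) = v" using v(2) g(1) by simp
  hence "\<gamma> j = 0" using j(1) by (simp add: fun_eq_iff \<pi>_def)
  moreover obtain x where "x : W" "\<gamma> j = of_nat n * \<alpha> j + \<pi> * x" using g(3) by blast
  moreover have "\<alpha> j = 1" using j(1) by (simp add: \<alpha>_def \<pi>_def)
  ultimately have "of_nat n = - (\<pi> * x)" by (simp add: eq_neg_iff_add_eq_0)
  moreover have "- (\<pi> * x) : m" using I(6)[OF \<open>x : W\<close> b(1)[of j]] ideal_on_minus(1)[OF W mi(1)] by (simp add: \<pi>_def)
  ultimately show ?thesis using n by simp
next
  case False
  hence "b = v" using rep_cone(1)[OF b(3)] rep_cone(1)[OF rep_v] by (auto simp: cone_iff fun_eq_iff) (metis not_le)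
  thus ?thesis using b(3) v(3) by (simp add: rep_def)
qed

text \<open>The quotient of \<open>C\<close> by \<open>A\<close> reduces to the identity and is
  killed by \<open>n\<close>, so \<open>torsion_near_one\<close> applies. The representatives
  \<open>P\<close> and \<open>Q\<close> are integral with an entry outside \<open>m\<close>, since
  the local formulas for the product are taken at their residues.\<close>

lemma reduction_injective:
  assumes A: "rep P A" "!!i. P i : W" "P i1 ~: m" and B: "rep Q (inv\<^bsub>H\<^esub> A)" "!!i. Q i : W" "Q i2 ~: m"
   and C: "rep P' C" "!!i. P' i - P i : m" and n: "(of_nat n :: 'a) ~: m"
   and tor: "A [^]\<^bsub>H\<^esub> n = \<one>\<^bsub>H\<^esub>" "C [^]\<^bsub>H\<^esub> n = \<one>\<^bsub>H\<^esub>"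
  shows "C = A"
proof -
  note w = subrD[OF W] and I = ideal_onD[OF mi(1)] and Im = ideal_on_minus[OF W mi(1)]
  have P'W: "P' i : W" for i using w(3)[OF A(2)[of i] I(5)[OF C(2)[of i]]] by simp
  have Ac: "A : carrier H" "C : carrier H" using A C car by (auto simp: rep_def)
  have fP: "P : fibre (W, m) V" "Q : fibre (W, m) V" using rep_fibre A B by blast+
  obtain F where "mult_forms P Q F" using mult_local[OF fP] by blast
  note F = mult_formsD(1,2)[OF this] and mul = mult_formsD(3)[OF this]
  have cong: "ev (case_sum P' Q) (F i) - ev (case_sum P Q) (F i) : m" "ev (case_sum P' Q) (F i) : W"
   "ev (case_sum P Q) (F i) : W" for i
   using ev_congruent_pair[where P = P' and Q = Q and P' = P and Q' = Q, OF W mi(1) F(1) RW P'W B(2) A(2) B(2) C(2)] I(2)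
   by simp_all
  obtain j where j: "ev (case_sum P Q) (F j) ~: m" using F(2) by blast
  hence j0: "ev (case_sum P Q) (F j) ~= 0" using I(2) by metis
  have "rep (%i. ev (case_sum P Q) (F i)) \<one>\<^bsub>H\<^esub>" using mul[OF A(1) B(1)] j0 r_inv[OF Ac(1)] by auto
  hence "normalise (%i. ev (case_sum P Q) (F i)) = normalise v" using v by (simp add: rep_def)
  from normalise_eqD[OF this j0 v(2)] have ev: "!!i. ev (case_sum P Q) (F i) = ev (case_sum P Q) (F i0) * v i" by metis
  define c where "c = ev (case_sum P Q) (F i0)"
  have cm: "c ~: m" using ev[of j] j I(6)[OF v(1)[of j], of c] unfolding c_def by fastforce
  define d where "d = ev (case_sum P' Q) (F i0)"
  have dc: "d - c : m" "d : W" "c : W" using cong by (auto simp: c_def d_def)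
  have dm: "d ~: m"
  proof
   assume "d : m"
   hence "d - (d - c) : m" using dc Im(2) by blast
   thus False using cm by simp
  qed
  note di = unit[OF dc(2) dm]
  define b where "b i = inverse d * ev (case_sum P' Q) (F i)" for i
  have "rep (%i. ev (case_sum P' Q) (F i)) (C \<otimes>\<^bsub>H\<^esub> inv\<^bsub>H\<^esub> A)" by (rule mul[OF C(1) B(1)]) (use di d_def in blast)
  hence rb: "rep b (C \<otimes>\<^bsub>H\<^esub> inv\<^bsub>H\<^esub> A)" unfolding b_def[abs_def] by (rule rep_scale) (use di in simp)
  have "b i - v i : m" for i
  proof -
   have "b i - v i = inverse d * ((ev (case_sum P' Q) (F i) - ev (case_sum P Q) (F i)) - (d - c) * v i)"
    using di ev[of i] by (simp add: b_def c_def field_simps)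
   also have "... : m" by (intro I(4) Im(2) I(6) cong(1) dc(1) v(1)) (use di in simp)
   finally show ?thesis .
  qed
  moreover have "b i0 = 1" using di by (simp add: b_def d_def)
  moreover have "(C \<otimes>\<^bsub>H\<^esub> inv\<^bsub>H\<^esub> A) [^]\<^bsub>H\<^esub> n = \<one>\<^bsub>H\<^esub>" using tor Ac by (simp add: nat_pow_distrib nat_pow_inv)
  ultimately have "C \<otimes>\<^bsub>H\<^esub> inv\<^bsub>H\<^esub> A = \<one>\<^bsub>H\<^esub>" using torsion_near_one rb n by blast
  thus "C = A" using Ac by (metis inv_closed inv_equality inv_inv)
qed

end

section \<open>Inertia acts trivially on torsion in the case of good reduction\<close>

lemma loc_max_difference:
  fixes h :: "'a::field_char_0 => 'a"
  assumes h: "is_hom h" and sA: "subr A" and q: "prime_on A q" and hA: "!!z. z : A ==> h z - z : q"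
   and ab: "a : A" "b : A" "b ~: q"
  shows "h (a / b) - a / b : loc_max A q"
proof -
  have qi: "ideal_on A q" and qp: "!!a b. a : A ==> b : A ==> a * b : q ==> a : q | b : q"
   using q by (auto simp: prime_on_def)
  note I = ideal_onD[OF qi] and Im = ideal_on_minus[OF sA qi] and s = subrD[OF sA]
  have hb: "h b : A" using hA[OF ab(2)] ab(2) s(3)[of "h b - b" b] I(5) by auto
  have hbq: "h b ~: q"
  proof
   assume "h b : q"
   hence "h b - (h b - b) : q" using Im(2) hA[OF ab(2)] by blast
   thus False using ab by simp
  qed
  have nz: "b ~= 0" "h b ~= 0" using ab(3) hbq I(2) by auto
  have "h (a / b) - a / b = ((h a - a) * b - a * (h b - b)) / (b * h b)"
   using nz is_hom_field(4)[OF h] by (simp add: field_simps)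
  moreover have "(h a - a) * b - a * (h b - b) : q" by (intro Im(2) I(4) I(6) hA ab)
  moreover have "b * h b : A - q" using qp[OF ab(2) hb] hbq ab s(4)[OF ab(2) hb] by auto
  ultimately show ?thesis unfolding loc_max_def by blast
qed

text \<open>Through \<open>\<theta>\<close> the point \<open>P\<close> corresponds to a point
  \<open>Q\<close> of the good model. Its coordinates lie in \<open>M\<close>, because all
  automorphisms over \<open>M\<close> fix it, and can be scaled to be integral with a unit entry;
  inertia then changes them only modulo \<open>vmax W\<close>. So \<open>Q\<close> and its conjugate
  are torsion points with the same reduction, and \<open>l\<close> is a unit of
  \<open>W\<close>.\<close>

lemma good_reduction_inertia:
  fixes k M q :: "'a::{alg_closed_field, field_char_0} set"
  assumes alg: "!!z::'a. algebraic z" and k: "subf k" and M: "subf M" "k \<subseteq> M"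
   and q: "prime_on (integers M) q" and lq: "(of_nat l :: 'a) ~: q"
   and s: "s : Gal k UNIV" and inert: "!!z. z : integers M ==> s z - z : q"
   and good: "good_reduction k (q \<inter> k) J G" and ab: "abelian_variety k J G" and P: "P : torsion l G" "range P \<subseteq> M"
  shows "(%i. s (P i)) = P"
proof -
  let ?O = "integers M"
  define R where "R = loc (integers k) (q \<inter> k)"
  obtain W where W: "val_ring W" "(W, vmax W) : geom_points R" "R \<subseteq> W"
   and Winv: "!!a. a : ?O ==> a ~: q ==> inverse a : W"
   and Wfrac: "!!z. z : W ==> z : M ==> EX a:?O. EX b:?O. b ~: q & z = a / b" and Wmax: "loc_max ?O q \<subseteq> vmax W"
   and pk: "prime_on (integers k) (q \<inter> k)" and R: "subr R" "R \<subseteq> k"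
   by (rule val_ring_above[OF alg M(1) k M(2) q, folded R_def]) (rule that; (assumption | blast))
  have sO: "subr ?O" by (rule integers_subr[OF M(1)])
  have sW: "subr W" using W by (simp add: val_ring_def)
  have gR: "(UNIV, {0}) : geom_points R" by (rule geom_generic[OF alg R(1)])
  have gk: "(UNIV, {0}) : geom_points k" by (rule geom_generic[OF alg subf_subr[OF k]])
  obtain V H \<theta> where VH: "abelian_scheme R V H" and th: "\<theta> : iso H G" "morphism k V J \<theta>"
    "morphism k J V (inv_into (points V) \<theta>)" using good unfolding good_reduction_def R_def by blast
  have projV: "proj_scheme R V" and projJ: "proj_scheme k J"
   using VH ab by (auto simp: abelian_scheme_def smooth_projective_def)
  have H: "comm_group H" "carrier H = points V" "bimorphism R V V V (%A B. A \<otimes>\<^bsub>H\<^esub> B)"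
    "morphism R V V (%A. inv\<^bsub>H\<^esub> A)" using VH by (auto simp: abelian_scheme_def)
  have G: "comm_group G" "carrier G = points J" using ab by (auto simp: abelian_scheme_def)
  obtain v where v: "range v \<subseteq> R" "EX i. v i ~: vmax W" "normalise v = \<one>\<^bsub>H\<^esub>"
  proof -
   have "ALL (W, m):geom_points R. EX v. range v \<subseteq> R & (EX i. v i ~: m) & normalise v = \<one>\<^bsub>H\<^esub>"
    using VH unfolding abelian_scheme_def by (elim conjE)
   from bspec[OF this W(2)] show thesis using that by auto
  qed
  then obtain i0 where i0: "v i0 ~: vmax W" by blast
  have vvW: "v i : W" for i using v(1) W(3) by auto
  have vi: "inverse (v i0) : W" "v i0 ~= 0" using i0 vvW by (auto simp: vmax_def)
  interpret reduction R W V H "%i. inverse (v i0) * v i" i0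
  proof (rule reduction.intro)
   show "inverse (v i0) * v i : W" for i using subrD(4)[OF sW vi(1) vvW] .
   show "normalise (%i. inverse (v i0) * v i) = \<one>\<^bsub>H\<^esub>" using v(3) vi by (simp add: normalise_scale)
  qed (use W projV H vi in auto)
  define act where "act h A = (%i. h (A i))" for h :: "'a => 'a" and A :: "nat => 'a"
  have fixk: "!!c. c : k ==> h c = c" "is_hom h" if "h : Gal k UNIV" for h using Gal_UNIV_D[OF alg that] by auto
  have actV: "act h A : points V" if "h : Gal k UNIV" "A : points V" for h A
   unfolding act_def by (rule points_hom[OF projV fixk(2)[OF that(1)] _ that(2)]) (use fixk(1)[OF that(1)] R in auto)
  have mulV: "act h (A \<otimes>\<^bsub>H\<^esub> B) = act h A \<otimes>\<^bsub>H\<^esub> act h B" if "h : Gal k UNIV" "A : points V" "B : points V" for h A B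
   unfolding act_def
   by (rule bimorphism_equivariant[OF H(3) gR projV projV order_refl order_refl fixk(2)[OF that(1)] _ that(2,3), symmetric])
    (use fixk(1)[OF that(1)] R in auto)
  have invV: "act h (inv\<^bsub>H\<^esub> A) = inv\<^bsub>H\<^esub> (act h A)" if "h : Gal k UNIV" "A : points V" for h A unfolding act_def
   by (rule morphism_equivariant[OF H(4) gR projV order_refl order_refl fixk(2)[OF that(1)] _ that(2), symmetric])
    (use fixk(1)[OF that(1)] R in auto)
  have thE: "\<theta> (act h A) = act h (\<theta> A)" if "h : Gal k UNIV" "A : points V" for h A unfolding act_def
   by (rule morphism_equivariant[OF th(2) gk projV R(2) order_refl fixk(2)[OF that(1)] fixk(1)[OF that(1)] that(2)])
  let ?\<psi> = "inv_into (points V) \<theta>"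
  have psE: "?\<psi> (act h A) = act h (?\<psi> A)" if "h : Gal k UNIV" "A : points J" for h A unfolding act_def
   by (rule morphism_equivariant[OF th(3) gk projJ order_refl order_refl fixk(2)[OF that(1)] fixk(1)[OF that(1)] that(2)])
  have bij: "bij_betw \<theta> (points V) (points J)" using th(1) H(2) G(2) by (auto simp: iso_def)
  have PJ: "P : points J" using P G by (simp add: torsion_def)
  define Q where "Q = ?\<psi> P"
  have Q: "Q : points V" "\<theta> Q = P"
   using bij PJ unfolding Q_def by (auto simp: bij_betw_def inv_into_into f_inv_into_f)
  have inM: "range A \<subseteq> M" if "!!t. t : Gal M UNIV ==> act t A = A" for A
  proof
   fix z assume "z : range A"
   then obtain i where z: "z = A i" by auto
   show "z : M"
   proof (rule ccontr)
    assume "z ~: M"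
    then obtain t where t: "t : Gal M UNIV" "t z ~= z" using Gal_moves[OF alg M(1)] by blast
    thus False using that[OF t(1)] z by (metis act_def)
   qed
  qed
  have Mk: "t : Gal k UNIV" if "t : Gal M UNIV" for t using that Gal_mono[OF M(2)] by auto
  have Qfix: "act t Q = Q" if t: "t : Gal M UNIV" for t
  proof -
   have "act t P = P" using Gal_UNIV_D(3)[OF alg t] P(2) by (auto simp: act_def fun_eq_iff)
   thus ?thesis using psE[OF Mk[OF t] PJ] by (simp add: Q_def)
  qed
  have QM: "range Q \<subseteq> M" by (rule inM[OF Qfix])
  have Qi: "inv\<^bsub>H\<^esub> Q : points V" using Q(1) inv_closed car by auto
  have QiM: "range (inv\<^bsub>H\<^esub> Q) \<subseteq> M" by (rule inM) (use invV Mk Q(1) Qfix in simp)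
  have reps: "EX T j. rep T A & (ALL i. T i : W) & T j ~: vmax W & (ALL i. T i : M)"
   if A: "A : points V" "range A \<subseteq> M" for A
  proof -
   have c: "A : cone V" "normalise A = A" using A points_iff[OF proj] by auto
   then obtain j0 where j0: "j0 <= amb V" "A j0 ~= 0" by (auto simp: cone_iff)
   obtain j where j: "A j ~= 0" "!!i. i <= amb V ==> A i / A j : W"
    using val_ring_max_quotient[OF vW, of "{..amb V}" j0 A] j0 by auto
   have "rep A A" using A(1) c j0 by (auto simp: rep_def)
   hence "rep (%i. inverse (A j) * A i) A" by (rule rep_scale) (use j in simp)
   moreover have "inverse (A j) * A i : W" for i
    using j(2)[of i] c(1) subrD(1)[OF sW] by (cases "i <= amb V") (auto simp: cone_iff field_simps)
   moreover have "inverse (A j) * A j ~: vmax W" using j(1) mi(2) by simp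
   moreover have "inverse (A j) * A i : M" for i
    using A(2) subf_inverse[OF M(1)] subrD(4)[OF subf_subr[OF M(1)]] by blast
   ultimately show ?thesis by blast
  qed
  obtain T j where T: "rep T Q" "!!i. T i : W" "T j ~: vmax W" "!!i. T i : M" using reps[OF Q(1) QM] by blast
  obtain U j' where U: "rep U (inv\<^bsub>H\<^esub> Q)" "!!i. U i : W" "U j' ~: vmax W" using reps[OF Qi QiM] by blast
  have sh: "is_hom s" using fixk(2)[OF s] .
  have "rep (%i. s (T i)) (act s Q)"
   using T(1) actV[OF s Q(1)] normalise_hom[OF sh, of T] is_hom_field(1)[OF sh] by (auto simp: rep_def act_def)
  moreover have "s (T i) - T i : vmax W" for i
  proof -
   obtain a b where "a : ?O" "b : ?O" "b ~: q" "T i = a / b" using Wfrac[OF T(2,4)] by blast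
   thus ?thesis using loc_max_difference[OF sh sO q inert] Wmax by auto
  qed
  moreover obtain e where e: "P [^]\<^bsub>G\<^esub> (l ^ e) = \<one>\<^bsub>G\<^esub>" using P(1) by (auto simp: torsion_def)
  have "(of_nat (l ^ e) :: 'a) ~: vmax W"
  proof -
   have l: "(of_nat l :: 'a) : ?O" using subrD(10)[OF sO] .
   have "inverse (of_nat l :: 'a) ^ e : W" using subrD(7)[OF sW Winv[OF l lq]] .
   moreover have "0 : q" using q by (auto simp: prime_on_def ideal_on_def)
   hence "(of_nat l :: 'a) ~= 0" using lq by metis
   ultimately show ?thesis by (auto simp: vmax_def power_inverse)
  qed
  moreover have Qn: "Q [^]\<^bsub>H\<^esub> (l ^ e) = \<one>\<^bsub>H\<^esub>"
  proof -
   have gh: "group_hom H G \<theta>"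
    using th(1) H(1) G(1) by (auto simp: group_hom_def group_hom_axioms_def iso_def comm_group_def)
   have Qc: "Q : carrier H" using Q(1) car by simp
   have "\<theta> (Q [^]\<^bsub>H\<^esub> (l ^ e)) = \<theta> \<one>\<^bsub>H\<^esub>"
    using group_hom.hom_nat_pow[OF gh Qc, of "l ^ e"] Q(2) e group_hom.hom_one[OF gh] by simp
   thus ?thesis using bij Qc car nat_pow_closed one_closed by (metis bij_betw_def inj_onD)
  qed
  moreover have "act s Q [^]\<^bsub>H\<^esub> (l ^ e) = \<one>\<^bsub>H\<^esub>"
  proof -
   have Qc: "Q : carrier H" using Q(1) car by simp
   have gh: "group_hom H H (act s)"
    using actV[OF s] mulV[OF s] car by (auto simp: group_hom_def group_hom_axioms_def hom_def is_group)
   show ?thesis using group_hom.hom_nat_pow[OF gh Qc, of "l ^ e"] Qn group_hom.hom_one[OF gh] by simp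
  qed
  ultimately have "act s Q = Q" using reduction_injective[OF T(1-3) U] by blast
  hence "act s P = P" using thE[OF s Q(1)] Q(2) by simp
  thus ?thesis by (simp add: act_def)
qed

text \<open>The constant term of an integer equation for a nonzero element of \<open>q\<close>,
  chosen nonzero, is an integer lying in \<open>q\<close>.\<close>

lemma prime_below_nonzero:
  fixes k M :: "'a::field_char_0 set"
  assumes alg: "!!z::'a. algebraic z" and M: "subf M" and k: "subf k" and q: "prime_on (integers M) q" "q ~= {0}"
  shows "q \<inter> k ~= {0}"
proof -
  have sO: "subr (integers M)" by (rule integers_subr[OF M])
  have qi: "ideal_on (integers M) q" using q by (simp add: prime_on_def)
  note I = ideal_onD[OF qi]
  obtain x where x: "x : q" "x ~= 0" using q(2) I(2) by blast
  obtain p0 where p0: "coeff p0 0 ~= 0" "poly (map_poly of_int p0) x = 0"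
   using algebraicE'_nonzero[OF alg x(2)] by metis
  obtain c r where cr: "p0 = pCons c r" by (cases p0)
  have c0: "c ~= 0" using p0(1) cr by simp
  have "coeff (map_poly of_int r) i : integers M" for i using subrD(11)[OF sO] by (simp add: coeff_map_poly)
  hence "poly (map_poly of_int r) x : integers M" by (rule subr_poly[OF sO]) (use x I in auto)
  hence "- (poly (map_poly of_int r) x * x) : q" using I(4) x ideal_on_minus(1)[OF sO qi] by blast
  moreover have "of_int c = - (poly (map_poly of_int r) x * x)"
   using p0(2) c0 by (simp add: cr map_poly_pCons eq_neg_iff_add_eq_0 mult.commute)
  ultimately have "of_int c : q" by simp
  moreover have "of_int c : k" using subrD(11)[OF subf_subr[OF k]] .
  moreover have "of_int c ~= (0::'a)" using c0 by simp
  ultimately show ?thesis by blast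
qed

subsection \<open>Polynomials in two variables on a superelliptic curve\<close>

text \<open>An element of \<open>'a poly poly\<close> is read as a polynomial in y over the
  polynomials in x; \<open>j\<close> maps the latter to the target ring.\<close>

definition bev :: "('a::comm_ring_1 poly => 'b::comm_ring_1) => 'b => 'a poly poly => 'b" where
  "bev j y g = poly (map_poly j g) y"

lemma is_hom_bev: "is_hom j ==> is_hom (bev j y)"
  unfolding bev_def[abs_def] using is_hom_comp[OF is_hom_poly is_hom_map_poly] .

lemma bev_pCons: "is_hom j ==> bev j y (pCons a g) = j a + y * bev j y g"
  by (simp add: bev_def map_poly_pCons is_homD(4)[of j])

lemma bev_0: "is_hom j ==> bev j y 0 = 0" using is_homD(4)[OF is_hom_bev] .

lemma bev_const: "is_hom j ==> bev j y [:a:] = j a" by (simp add: bev_pCons bev_0)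

lemma bev_smult: "is_hom j ==> bev j y (smult a g) = j a * bev j y g"
  using is_homD(3)[OF is_hom_bev, of j y "[:a:]" g] by (simp add: bev_const)

lemma bev_monom: "is_hom j ==> bev j y (monom a n) = j a * y ^ n"
  by (simp add: bev_def map_poly_monom is_homD(4) poly_monom)

definition zev :: "'a::comm_ring_1 \<times> 'a => 'a poly poly => 'a" where "zev z = bev (%r. poly r (fst z)) (snd z)"

lemma is_hom_zev: "is_hom (zev z)" unfolding zev_def by (rule is_hom_bev[OF is_hom_poly])

text \<open>The substitution of \<open>w * y\<close> for y; for \<open>w\<close> an m-th root of
  unity it is a deck transformation of the covering.\<close>

definition rot :: "'a::comm_ring_1 => 'a poly poly => 'a poly poly" where "rot w g = pcompose g [:0, [:w:]:]"

lemma rot_pCons: "rot w (pCons a g) = pCons a (smult [:w:] (rot w g))" by (simp add: rot_def pcompose_pCons)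

lemma is_hom_rot: "is_hom (rot w)"
proof -
  have "rot w 1 = 1" by (simp add: one_pCons rot_def)
  thus ?thesis by (simp add: rot_def is_hom_def pcompose_add pcompose_mult)
qed

lemma coeff_rot: "coeff (rot w g) k = [:w ^ k:] * coeff g k"
proof (induction g arbitrary: k)
  case 0
  thus ?case by (simp add: rot_def)
next
  case (pCons a g)
  show ?case by (cases k) (simp_all add: rot_pCons pCons mult.commute)
qed

lemma degree_rot: "degree (rot w g) <= degree g" by (rule degree_le) (simp add: coeff_rot coeff_eq_0)

lemma bev_rot: "is_hom j ==> bev j y (rot w g) = bev j (j [:w:] * y) g"
proof (induction g)
  case 0
  thus ?case by (simp add: rot_def bev_0)
next
  case (pCons a g)
  thus ?case by (simp add: rot_pCons bev_pCons bev_smult algebra_simps)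
qed

lemma zev_rot: "zev (a, b) (rot w g) = zev (a, w * b) g" by (simp add: zev_def bev_rot[OF is_hom_poly])

lemma rot_rot: "rot w (rot u g) = rot (w * u) g"
  by (rule poly_eqI) (simp add: coeff_rot power_mult_distrib mult.commute)

lemma rot_1: "rot 1 g = g" by (rule poly_eqI) (simp add: coeff_rot one_pCons[symmetric])

text \<open>Finitely many exceptions are allowed because the birational map between \<open>C\<close>
  and the affine curve is controlled only off finite sets.\<close>

definition vanishes_ae :: "('a::comm_ring_1 \<times> 'a) set => 'a poly poly => bool" where
  "vanishes_ae Z g \<longleftrightarrow> finite {z:Z. zev z g ~= 0}"

lemma vanishes_ae_mult: "vanishes_ae Z g ==> vanishes_ae Z (g * h)" unfolding vanishes_ae_def
  by (erule finite_subset[rotated]) (auto simp: is_homD(3)[OF is_hom_zev])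

lemma vanishes_aeI: "(!!z. z : Z ==> zev z g = 0) ==> vanishes_ae Z g"
proof -
  assume "!!z. z : Z ==> zev z g = 0"
  hence "{z:Z. zev z g ~= 0} = {}" by blast
  thus ?thesis by (simp only: vanishes_ae_def finite.emptyI)
qed

lemma zev_smult: "zev z (smult a g) = poly a (fst z) * zev z g"
  unfolding zev_def by (rule bev_smult[OF is_hom_poly])

lemma zev_const: "zev z [:a:] = poly a (fst z)" unfolding zev_def by (rule bev_const[OF is_hom_poly])

text \<open>\<open>y0\<close> is an arbitrary m-th root of p/q in a field containing the polynomials
  in x. Evaluation at \<open>y0\<close> kills exactly the polynomials vanishing on the curve
  (\<open>bv_iff\<close>); irreducibility, in the form \<open>irr\<close>, is what makes the choice
  of the root immaterial.\<close>

locale superelliptic =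
  fixes p q :: "'a::{alg_closed_field, field_char_0} poly" and m :: nat and \<zeta> :: 'a
   and j :: "'a poly => 'b::field" and y0 :: 'b
  assumes j: "is_hom j" and j_inj: "!!r. j r = 0 ==> r = 0"
   and pq: "p ~= 0" "q ~= 0" and m: "m >= 1" and y0: "j q * y0 ^ m = j p"
   and zeta: "inj_on (%i. \<zeta> ^ i) {..<m}" "\<zeta> ^ m = 1" and irr: "!!g h. vanishes_ae (affine_curve m p q) (g * h) ==>
    vanishes_ae (affine_curve m p q) g | vanishes_ae (affine_curve m p q) h"
begin

abbreviation "Z \<equiv> affine_curve m p q"
abbreviation "va \<equiv> vanishes_ae Z"
abbreviation "bv \<equiv> bev j y0"

lemmas bv = is_homD[OF is_hom_bev[OF j, of y0]]
lemmas zv = is_homD[OF is_hom_zev]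
lemmas jh = is_homD[OF j]

lemma zeta_0: "\<zeta> ~= 0" using zeta(2) m by (auto simp: power_0_left)

lemma Z_rot: "(a, b) : Z ==> (a, \<zeta> ^ i * b) : Z"
  using zeta(2) by (auto simp: affine_curve_def power_mult_distrib power_mult[symmetric] mult.commute[of i])
   (metis mult_1 power_mult power_one)

lemma va_rot: assumes "va g" shows "va (rot (\<zeta> ^ i) g)"
proof -
  have "{z:Z. zev z (rot (\<zeta> ^ i) g) ~= 0} \<subseteq> (%(a, b). (a, b / \<zeta> ^ i)) ` {z:Z. zev z g ~= 0}"
  proof
   fix z assume z: "z : {z:Z. zev z (rot (\<zeta> ^ i) g) ~= 0}"
   obtain a b where ab: "z = (a, b)" by (cases z)
   show "z : (%(a, b). (a, b / \<zeta> ^ i)) ` {z:Z. zev z g ~= 0}"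
    by (rule image_eqI[of _ _ "(a, \<zeta> ^ i * b)"]) (use z ab zeta_0 Z_rot in "auto simp: zev_rot")
  qed
  thus ?thesis using assms unfolding vanishes_ae_def by (meson finite_imageI finite_subset)
qed

lemma rot_period: "rot (\<zeta> ^ (m * k)) g = g" by (simp add: power_mult zeta(2) rot_1)

lemma va_rot_iff: "va (rot (\<zeta> ^ i) g) \<longleftrightarrow> va g"
proof
  assume "va (rot (\<zeta> ^ i) g)"
  hence "va (rot (\<zeta> ^ (m * i - i)) (rot (\<zeta> ^ i) g))" by (rule va_rot)
  moreover have "m * i - i + i = m * i" using m by (metis le_add_diff_inverse2 mult_le_mono1 nat_mult_1)
  ultimately show "va g" by (simp add: rot_rot power_add[symmetric] rot_period)
qed (rule va_rot)

lemma infinite_fst: assumes "finite S" shows "EX z:Z. fst z ~: S & snd z ~= 0"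
proof -
  have "finite (S \<union> {a. poly p a = 0} \<union> {a. poly q a = 0})" using assms pq by (simp add: poly_roots_finite)
  from ex_new_if_finite[OF infinite_UNIV_char_0 this]
  obtain a where a: "a ~: S" "poly p a ~= 0" "poly q a ~= 0" by blast
  obtain b where b: "b ^ m = poly p a / poly q a" using nth_root_exists[of m "poly p a / poly q a"] m by auto
  hence "(a, b) : Z" using a by (simp add: affine_curve_def)
  moreover have "b ~= 0" using b a m by (auto simp: power_0_left)
  ultimately show ?thesis using a by force
qed

text \<open>Over a general abscissa all m rotations of \<open>g\<close> vanish at one point, so the
  specialised polynomial, of degree less than m, has the m distinct roots
  \<open>\<zeta> ^ i * b\<close>.\<close>

lemma va_small: assumes "va g" "degree g < m" shows "g = 0"
proof (rule ccontr)
  assume g: "g ~= 0"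
  define E where "E = (\<Union>i<m. fst ` {z:Z. zev z (rot (\<zeta> ^ i) g) ~= 0})"
  have "finite E" unfolding E_def using va_rot[OF assms(1)] by (auto simp: vanishes_ae_def)
  hence "finite (E \<union> {a. poly (lead_coeff g) a = 0})" using g by (simp add: poly_roots_finite)
  from infinite_fst[OF this] obtain z where "z : Z" "fst z ~: E" "poly (lead_coeff g) (fst z) ~= 0" "snd z ~= 0" by blast
  then obtain a b where ab: "(a, b) : Z" "a ~: E" "poly (lead_coeff g) a ~= 0" "b ~= 0" by (cases z) auto
  define h where "h = map_poly (%r. poly r a) g"
  have "coeff h (degree g) ~= 0" using ab by (simp add: h_def coeff_map_poly)
  hence h: "h ~= 0" by auto
  have dh: "degree h <= degree g" unfolding h_def by (rule degree_le) (simp add: coeff_map_poly coeff_eq_0)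
  have "poly h (\<zeta> ^ i * b) = 0" if "i < m" for i
  proof -
   have "zev (a, b) (rot (\<zeta> ^ i) g) = 0" using ab that unfolding E_def by force
   thus ?thesis by (simp add: zev_rot) (simp add: zev_def bev_def h_def)
  qed
  hence sub: "(%i. \<zeta> ^ i * b) ` {..<m} \<subseteq> {x. poly h x = 0}" by auto
  have "inj_on (%i. \<zeta> ^ i * b) {..<m}" using zeta(1) ab(4) by (auto simp: inj_on_def)
  hence "m = card ((%i. \<zeta> ^ i * b) ` {..<m})" by (simp add: card_image)
  also have "... <= card {x. poly h x = 0}" by (rule card_mono[OF poly_roots_finite[OF h] sub])
  also have "... <= degree h" by (rule card_poly_roots_bound[OF h])
  finally show False using dh assms(2) by simp
qed

definition curve_eq :: "'a poly poly" where "curve_eq = monom q m - [:p:]"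

lemma degree_curve_eq: "degree curve_eq = m" "curve_eq ~= 0"
proof -
  have c: "coeff curve_eq m = q" using m by (auto simp: curve_eq_def coeff_pCons split: nat.splits)
  have "degree curve_eq <= m" using m by (auto simp: curve_eq_def intro!: degree_diff_le degree_monom_le)
  thus "degree curve_eq = m" using c pq le_degree[of curve_eq m] by auto
  show "curve_eq ~= 0" using c pq by auto
qed

lemma curve_eq_vanishes: "bv curve_eq = 0" "z : Z ==> zev z curve_eq = 0"
proof -
  show "bv curve_eq = 0" using y0 by (simp add: curve_eq_def bv bev_monom[OF j] bev_const[OF j])
  assume "z : Z"
  thus "zev z curve_eq = 0"
   by (auto simp: curve_eq_def affine_curve_def zv) (auto simp: zev_def bev_monom[OF is_hom_poly] bev_const[OF is_hom_poly])
qed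

text \<open>Pseudo-division: the leading coefficient \<open>q\<close> of \<open>curve_eq\<close> is
  a polynomial in x, whence the factor \<open>a\<close>.\<close>

lemma reduce: "EX a s r. a ~= 0 & smult a g = curve_eq * s + r & degree r < m"
proof -
  obtain a s where "a ~= 0" "smult a g = curve_eq * s + pseudo_mod g curve_eq"
   using pseudo_mod(1)[OF degree_curve_eq(2), of g] by blast
  moreover have "degree (pseudo_mod g curve_eq) < m"
   using pseudo_mod(2)[OF degree_curve_eq(2), of g] degree_curve_eq m by auto
  ultimately show ?thesis by blast
qed

lemma rot_curve_eq: "rot (\<zeta> ^ i) curve_eq = curve_eq"
proof (rule poly_eqI)
  fix k
  have "(\<zeta> ^ i) ^ m = 1" using zeta(2) by (metis mult.commute power_mult power_one)
  moreover have "coeff curve_eq k = 0" if "k ~= m" "k ~= 0" using that by (cases k) (simp_all add: curve_eq_def)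
  ultimately show "coeff (rot (\<zeta> ^ i) curve_eq) k = coeff curve_eq k"
   by (cases "k = m"; cases "k = 0") (simp_all add: coeff_rot)
qed

lemma rot_fixed:
  assumes "degree r < m" "rot \<zeta> r = r" shows "EX n. r = [:n:]"
proof -
  have "coeff r k = 0" if k: "k > 0" for k
  proof (cases "k < m")
   case True
   have "\<zeta> ^ k ~= 1" using inj_onD[OF zeta(1), of k 0] True k m by auto
   moreover have "[:\<zeta> ^ k:] * coeff r k = coeff r k" using assms(2) coeff_rot by metis
   hence "[:\<zeta> ^ k - 1:] * coeff r k = 0" by (simp add: algebra_simps smult_diff_left)
   ultimately show ?thesis by auto
  next
   case False
   thus ?thesis by (intro coeff_eq_0) (use assms(1) in simp)
  qed
  hence "degree r = 0" by (meson degree_le le_zero_eq not_gr_zero)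
  thus ?thesis by (meson degree_eq_zeroE)
qed

text \<open>The product of the conjugates, that is, the norm to the rational functions of x.\<close>

definition normp :: "'a poly poly => 'a poly poly" where "normp g = (\<Prod>i<m. rot (\<zeta> ^ i) g)"

text \<open>The product is invariant under rotation, and so is its remainder by uniqueness of
  division; an invariant polynomial of degree less than m in y does not involve y.\<close>

lemma normp_reduce: "EX a s n. a ~= 0 & smult a (normp g) = curve_eq * s + [:n:]"
proof -
  obtain a s r where r: "a ~= 0" "smult a (normp g) = curve_eq * s + r" "degree r < m" using reduce by blast
  note rh = is_homD[OF is_hom_rot]
  have rn: "rot \<zeta> (normp g) = normp g"
  proof -
   have "rot \<zeta> (normp g) = (\<Prod>i<m. rot (\<zeta> ^ Suc i) g)" by (simp add: normp_def rh rot_rot)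
   also have "... = normp g"
   proof -
    obtain k where k: "m = Suc k" using m by (cases m) auto
    define f where "f i = rot (\<zeta> ^ i) g" for i
    have "f (Suc k) = f 0" using zeta(2) by (simp add: f_def k)
    hence "(\<Prod>i<Suc k. f (Suc i)) = (\<Prod>i<Suc k. f i)"
     by (subst (2) prod.lessThan_Suc_shift) (simp add: mult.commute)
    thus ?thesis by (simp only: f_def k[symmetric] normp_def)
   qed
   finally show ?thesis .
  qed
  have "rot \<zeta> (smult a (normp g)) = smult a (normp g)"
   using rh(3)[of \<zeta> "[:a:]" "normp g"] rn by (simp add: rot_pCons rot_def)
  hence "curve_eq * rot \<zeta> s + rot \<zeta> r = curve_eq * s + r" unfolding r(2) using rot_curve_eq[of 1] by (simp add: rh)
  hence e: "curve_eq * (rot \<zeta> s - s) = r - rot \<zeta> r" by (simp add: algebra_simps)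
  have "rot \<zeta> s - s = 0"
  proof (rule ccontr)
   assume n: "rot \<zeta> s - s ~= 0"
   have "degree (r - rot \<zeta> r) < m" using r(3) degree_rot[of \<zeta> r] by (meson degree_diff_less le_less_trans)
   moreover have "degree (curve_eq * (rot \<zeta> s - s)) >= m"
    using degree_mult_eq[OF degree_curve_eq(2) n] degree_curve_eq(1) by simp
   ultimately show False using e by simp
  qed
  hence "rot \<zeta> r = r" using e by simp
  then obtain n where "r = [:n:]" using rot_fixed r(3) by blast
  thus ?thesis using r by blast
qed

lemma va_const: "va [:a:] ==> a = 0" using va_small[of "[:a:]"] m by auto

lemma va_prod: "finite S ==> va (prod f S) ==> EX i:S. va (f i)"
proof (induction S rule: finite_induct)
  case empty
  thus ?case using va_const[of 1] by (simp add: one_pCons)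
next
  case (insert x S)
  thus ?case using irr[of "f x" "prod f S"] by auto
qed

text \<open>Evaluation at \<open>y0\<close> annihilates the norm, whose reduction \<open>n\<close>
  is then 0, so the norm vanishes on the curve. Irreducibility passes this to one conjugate of
  \<open>g\<close>, where \<open>va_small\<close> applies.\<close>

lemma bv_small: assumes "bv g = 0" "degree g < m" shows "g = 0"
proof -
  obtain a s n where n: "a ~= 0" "smult a (normp g) = curve_eq * s + [:n:]" using normp_reduce by blast
  have "normp g = rot (\<zeta> ^ 0) g * (\<Prod>i\<in>{..<m} - {0}. rot (\<zeta> ^ i) g)"
   unfolding normp_def using m by (subst prod.remove[of _ 0]) auto
  hence "bv (normp g) = 0" using assms(1) by (simp add: bv rot_1)
  hence "j n = 0" using arg_cong[OF n(2), of bv] curve_eq_vanishes(1) by (simp add: bv bev_smult[OF j] bev_const[OF j])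
  hence "n = 0" by (rule j_inj)
  hence "va ([:a:] * normp g)" using n(2) curve_eq_vanishes(2) by (intro vanishes_aeI) (simp add: zv)
  hence "va (normp g)" using irr va_const n(1) by blast
  then obtain i where "va (rot (\<zeta> ^ i) g)" unfolding normp_def using va_prod[of "{..<m}"] by blast
  thus ?thesis using va_small assms(2) by (simp add: va_rot_iff)
qed

text \<open>Both conditions pass to the remainder modulo \<open>curve_eq\<close>, up to the nonzero
  factor \<open>a\<close>; for a remainder of degree less than m each of them means that it is
  0.\<close>

lemma bv_iff: "bv g = 0 \<longleftrightarrow> va g"
proof -
  obtain a s r where r: "a ~= 0" "smult a g = curve_eq * s + r" "degree r < m" using reduce by blast
  have "bv g = 0 \<longleftrightarrow> j a * bv g = 0" using r(1) j_inj by auto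
  also have "j a * bv g = bv r"
   using arg_cong[OF r(2), of bv] curve_eq_vanishes(1) by (simp add: bv bev_smult[OF j])
  also have "bv r = 0 \<longleftrightarrow> r = 0" using bv_small r(3) bv(4) by auto
  also have "r = 0 \<longleftrightarrow> va r" using va_small r(3) by (auto intro: vanishes_aeI simp: zv)
  also have "va r \<longleftrightarrow> va ([:a:] * g)"
  proof -
   have "zev z r = zev z ([:a:] * g)" if "z : Z" for z
    using arg_cong[OF r(2), of "zev z"] curve_eq_vanishes(2)[OF that] by (simp add: zv)
   thus ?thesis unfolding vanishes_ae_def by (metis (no_types, lifting) Collect_cong)
  qed
  also have "va ([:a:] * g) \<longleftrightarrow> va g" using irr[of "[:a:]" g] va_const[of a] r(1) vanishes_ae_mult[of Z g "[:a:]"]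
   by (auto simp: mult.commute)
  finally show ?thesis .
qed

lemma bv_rot_iff: "bv (rot (\<zeta> ^ i) g) = 0 \<longleftrightarrow> bv g = 0" by (simp add: bv_iff va_rot_iff)

lemma normp_nonzero:
  assumes "bv g ~= 0"
  obtains a s n where "a ~= 0" "smult a (normp g) = curve_eq * s + [:n:]" "n ~= 0"
proof -
  obtain a s n where n: "a ~= 0" "smult a (normp g) = curve_eq * s + [:n:]" using normp_reduce by blast
  have "bv (normp g) ~= 0" using assms bv_rot_iff by (simp add: normp_def bv)
  hence "j a * bv (normp g) ~= 0" using j_inj n(1) by auto
  moreover have "j a * bv (normp g) = j n"
   using arg_cong[OF n(2), of bv] curve_eq_vanishes(1) by (simp add: bv bev_smult[OF j] bev_const[OF j])
  ultimately have "j n ~= 0" by metis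
  hence "n ~= 0" using jh(4) by auto
  thus thesis using that n by blast
qed

text \<open>At a zero of \<open>g\<close> the norm vanishes, and along the curve the norm is a
  nonzero polynomial in x up to a factor, so only finitely many abscissae occur.\<close>

lemma finite_zeros: assumes "bv g ~= 0" shows "finite {z:Z. zev z g = 0}"
proof -
  obtain a s n where n: "a ~= 0" "smult a (normp g) = curve_eq * s + [:n:]" "n ~= 0"
   using normp_nonzero[OF assms] by blast
  have "{z:Z. zev z g = 0} \<subseteq> (\<Union>a\<in>{a. poly n a = 0}. Pair a ` {b. b ^ m = poly p a / poly q a})"
  proof
   fix z assume z: "z : {z:Z. zev z g = 0}"
   have "normp g = rot (\<zeta> ^ 0) g * (\<Prod>i\<in>{..<m} - {0}. rot (\<zeta> ^ i) g)"
    unfolding normp_def using m by (subst prod.remove[of _ 0]) auto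
   hence "zev z (normp g) = 0" using z by (simp add: zv rot_1)
   hence "poly n (fst z) = 0" using arg_cong[OF n(2), of "zev z"] curve_eq_vanishes(2)[of z] z
    by (simp add: zv zev_smult zev_const)
   thus "z : (\<Union>a\<in>{a. poly n a = 0}. Pair a ` {b. b ^ m = poly p a / poly q a})"
    using z by (auto simp: affine_curve_def)
  qed
  moreover have "finite {b. b ^ m = c}" for c :: 'a
  proof -
   have "{b. b ^ m = c} = {b. poly (monom 1 m - [:c:]) b = 0}" by (auto simp: poly_monom)
   moreover have "coeff (monom 1 m - [:c:]) m = 1" using m by (auto simp: coeff_pCons split: nat.splits)
   hence "monom 1 m - [:c:] ~= 0" by (metis coeff_0 zero_neq_one)
   ultimately show ?thesis using poly_roots_finite by metis
  qed
  hence "finite (\<Union>a\<in>{a. poly n a = 0}. Pair a ` {b. b ^ m = poly p a / poly q a})"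
   using poly_roots_finite[OF n(3)] by (intro finite_UN_I finite_imageI)
  ultimately show ?thesis by (rule finite_subset)
qed

definition ffield :: "'b set" where "ffield = {bv g / bv h | g h. bv h ~= 0}"

lemma ffield_subf: "subf ffield" unfolding subf_def
proof (intro conjI subrI ballI)
  show "0 : ffield" "1 : ffield" unfolding ffield_def
   by (intro CollectI exI[of _ 0] exI[of _ 1]; simp add: bv) (intro CollectI exI[of _ 1]; simp add: bv)
  fix a b assume "a : ffield" "b : ffield"
  then obtain g h g' h' where a: "a = bv g / bv h" "bv h ~= 0" "b = bv g' / bv h'" "bv h' ~= 0"
   by (auto simp: ffield_def)
  show "a + b : ffield" unfolding ffield_def
   by (intro CollectI exI[of _ "g * h' + g' * h"] exI[of _ "h * h'"]) (simp add: a bv add_frac_eq)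
  show "a * b : ffield" unfolding ffield_def
   by (intro CollectI exI[of _ "g * g'"] exI[of _ "h * h'"]) (simp add: a bv)
  show "- a : ffield" unfolding ffield_def by (intro CollectI exI[of _ "- g"] exI[of _ "h"]) (simp add: a bv)
next
  fix a assume "a : ffield"
  then obtain g h where a: "a = bv g / bv h" "bv h ~= 0" by (auto simp: ffield_def)
  show "inverse a : ffield"
  proof (cases "bv g = 0")
   case True
   thus ?thesis using \<open>a : ffield\<close> a by simp
  next
   case False
   thus ?thesis unfolding ffield_def using a by (intro CollectI exI[of _ h] exI[of _ g]) simp
  qed
qed

lemma bv_ffield: "bv g : ffield" unfolding ffield_def by (intro CollectI exI[of _ g] exI[of _ 1]) (simp add: bv)

text \<open>The denominator is rationalised by multiplication with its conjugates.\<close>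

lemma ffield_reduced:
  assumes "x : ffield" shows "EX d r. d ~= 0 & degree r < m & x = bv r / j d"
proof -
  obtain g h where x: "x = bv g / bv h" "bv h ~= 0" using assms by (auto simp: ffield_def)
  obtain a s n where n: "a ~= 0" "smult a (normp h) = curve_eq * s + [:n:]" "n ~= 0"
   using normp_nonzero[OF x(2)] by blast
  define u where "u = (\<Prod>i\<in>{..<m} - {0}. rot (\<zeta> ^ i) h)"
  have "normp h = h * u" unfolding normp_def u_def using m by (subst prod.remove[of _ 0]) (auto simp: rot_1)
  hence "j a * (bv h * bv u) = j n"
   using arg_cong[OF n(2), of bv] curve_eq_vanishes(1) by (simp add: bv bev_smult[OF j] bev_const[OF j])
  moreover have jn: "j n ~= 0" "j a ~= 0" using j_inj n by auto
  ultimately have "bv u ~= 0" by auto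
  obtain a' s' r where r: "a' ~= 0" "smult a' (smult a (g * u)) = curve_eq * s' + r" "degree r < m" using reduce by blast
  have "j a' * (j a * (bv g * bv u)) = bv r"
   using arg_cong[OF r(2), of bv] curve_eq_vanishes(1) by (simp add: bv bev_smult[OF j] jh mult.assoc)
  moreover have "j a' ~= 0" using j_inj r by auto
  ultimately have "x = bv r / j (a' * n)"
   using x(2) jn \<open>bv u ~= 0\<close> \<open>j a * (bv h * bv u) = j n\<close>[symmetric] unfolding x(1) jh by (simp add: field_simps)
  thus ?thesis using r n by (intro exI[of _ "a' * n"] exI[of _ r]) auto
qed

end

section \<open>Algebraic dependence of two functions by counting dimensions\<close>

lemma linear_relation:
  fixes e :: "'a::field => 'b::field"
  assumes e: "is_hom e" and fin: "finite I" "finite B" and card: "card B < card I"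
   and span: "!!i. i : I ==> EX u. f i = (\<Sum>b\<in>B. e (u b) * b)"
  shows "EX c. (EX i:I. c i ~= 0) & (\<Sum>i\<in>I. e (c i) * f i) = 0"
proof (cases "inj_on f I")
  case False
  then obtain i k where ik: "i : I" "k : I" "i ~= k" "f i = f k" by (auto simp: inj_on_def)
  define c where "c x = (if x = i then 1 else if x = k then - 1 else 0 :: 'a)" for x
  have "(\<Sum>x\<in>I. e (c x) * f x) = (\<Sum>x\<in>{i, k}. e (c x) * f x)"
   by (rule sum.mono_neutral_right) (use fin ik in "auto simp: c_def is_homD[OF e]")
  also have "... = 0" using ik by (simp add: c_def is_homD[OF e])
  finally show ?thesis using ik by (intro exI[of _ c]) (auto simp: c_def)
next
  case True
  note h = is_homD[OF e]
  interpret vector_space "%c v. e c * v" by unfold_locales (auto simp: h algebra_simps)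
  have "f ` I \<subseteq> span B"
  proof
   fix x assume "x : f ` I"
   then obtain u where "x = (\<Sum>b\<in>B. e (u b) * b)" using span by blast
   thus "x : span B" by (simp add: span_sum span_scale span_base)
  qed
  moreover have "card (f ` I) > card B" using card card_image[OF True] by simp
  ultimately have "dependent (f ` I)" using independent_span_bound[OF fin(2)] by (meson leD)
  then obtain u where u: "EX v:f ` I. u v ~= 0" "(\<Sum>v\<in>f ` I. e (u v) * v) = 0"
   using dependent_finite[of "f ` I"] fin(1) by auto
  hence "(\<Sum>i\<in>I. e (u (f i)) * f i) = 0" by (simp add: sum.reindex[OF True])
  thus ?thesis using u(1) by (intro exI[of _ "%i. u (f i)"]) auto
qed

context superelliptic
begin

definition emb :: "'a => 'b" where "emb c = j [:c:]"

lemma emb_hom: "is_hom emb" unfolding emb_def is_hom_def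
proof (intro conjI allI)
  show "j [:1:] = 1" using jh(1) by (simp add: one_pCons)
  fix a b :: 'a
  show "j [:a + b:] = j [:a:] + j [:b:]" using jh(2)[of "[:a:]" "[:b:]"] by simp
  show "j [:a * b:] = j [:a:] * j [:b:]" using jh(3)[of "[:a:]" "[:b:]"] by (simp add: mult.commute)
qed

lemmas eh = is_homD[OF emb_hom]
lemmas ef = is_hom_field[OF emb_hom]

lemma j_sum: "degree r <= D ==> j r = (\<Sum>i\<le>D. emb (coeff r i) * j (monom 1 i))"
proof -
  assume D: "degree r <= D"
  have "r = (\<Sum>i\<le>D. monom (coeff r i) i)" by (rule poly_eqI) (use D in "auto simp: coeff_sum intro!: coeff_eq_0")
  also have "... = (\<Sum>i\<le>D. [:coeff r i:] * monom 1 i)" by (simp add: smult_monom)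
  finally show ?thesis unfolding emb_def by (metis (no_types, lifting) jh(3) jh(8) sum.cong)
qed

lemma bv_sum: "degree r < m ==> bv r = (\<Sum>k<m. j (coeff r k) * y0 ^ k)"
proof -
  assume "degree r < m"
  hence "r = (\<Sum>k<m. monom (coeff r k) k)" by (intro poly_eqI) (auto simp: coeff_sum coeff_eq_0)
  hence "bv r = bv (\<Sum>k<m. monom (coeff r k) k)" by simp
  thus ?thesis by (simp add: bv bev_monom[OF j])
qed

text \<open>Spanned over the constants by m (D + 1) elements, a number linear in \<open>D\<close>;
  \<open>algebraic_dependence\<close> compares this with a quadratic number of monomials.\<close>

definition bounded_part :: "nat => 'b set" where
  "bounded_part D = {bv r | r. degree r < m & (ALL k. degree (coeff r k) <= D)}"

lemma bounded_part_mono: "D <= E ==> bounded_part D \<subseteq> bounded_part E"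
  unfolding bounded_part_def by (blast intro: order.trans)

text \<open>\<open>d\<close> is a common denominator of the products of \<open>x\<close> with the
  powers of \<open>y0\<close>; after clearing it, multiplication raises degrees by a bound that does
  not depend on \<open>D\<close>.\<close>

lemma mult_bounded_part:
  assumes "x : ffield"
  shows "EX d c. d ~= 0 & (ALL D. ALL v:bounded_part D. j d * x * v : bounded_part (D + c))"
proof -
  have "EX d r. d ~= 0 & degree r < m & x * y0 ^ k = bv r / j d" for k
  proof (rule ffield_reduced)
   have "y0 ^ k = bv (monom 1 k)" by (simp add: bev_monom[OF j] jh)
   thus "x * y0 ^ k : ffield" using assms bv_ffield subrD(4)[OF subf_subr[OF ffield_subf]] by metis
  qed
  then obtain dd rr where d: "!!k. dd k ~= 0" "!!k. degree (rr k) < m" "!!k. x * y0 ^ k = bv (rr k) / j (dd k)"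
   by metis
  define d where "d = (\<Prod>k<m. dd k)"
  define R where "R k = smult (\<Prod>i\<in>{..<m} - {k}. dd i) (rr k)" for k
  have R: "j d * (x * y0 ^ k) = bv (R k)" if "k < m" for k
  proof -
   have "d = dd k * (\<Prod>i\<in>{..<m} - {k}. dd i)" unfolding d_def using that by (intro prod.remove) auto
   hence "j d = j (dd k) * j (\<Prod>i\<in>{..<m} - {k}. dd i)" by (simp only: jh)
   moreover have "j (dd k) ~= 0" using j_inj d(1) by auto
   ultimately show ?thesis by (simp add: d(3) R_def bev_smult[OF j] )
  qed
  have Rm: "degree (R k) < m" for k unfolding R_def using d(2)[of k] degree_smult_le le_less_trans by blast
  define c where "c = (\<Sum>k<m. \<Sum>i<m. degree (coeff (R k) i))"
  have cb: "degree (coeff (R k) i) <= c" if "k < m" for k i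
  proof (cases "i < m")
   case True
   have "degree (coeff (R k) i) <= (\<Sum>i<m. degree (coeff (R k) i))" by (rule member_le_sum) (use True in auto)
   also have "... <= c" unfolding c_def
    by (rule member_le_sum[of k "{..<m}" "%k. \<Sum>i<m. degree (coeff (R k) i)"]) (use that in auto)
   finally show ?thesis .
  next
   case False
   thus ?thesis using coeff_eq_0[of "R k" i] Rm[of k] by simp
  qed
  have "j d * x * v : bounded_part (D + c)" if "v : bounded_part D" for D v
  proof -
   from that obtain r where r: "v = bv r" "degree r < m" "!!k. degree (coeff r k) <= D"
    by (auto simp: bounded_part_def)
   define s where "s = (\<Sum>k<m. smult (coeff r k) (R k))"
   have "j d * x * v = (\<Sum>k<m. j (coeff r k) * (j d * (x * y0 ^ k)))"
    unfolding r(1) bv_sum[OF r(2)] sum_distrib_left by (rule sum.cong) (auto simp: mult_ac)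
   also have "... = bv s" by (simp add: s_def bv bev_smult[OF j] R)
   finally have "j d * x * v = bv s" .
   moreover have "degree s < m" unfolding s_def
    using Rm m by (intro degree_sum_less) (auto intro: le_less_trans[OF degree_smult_le])
   moreover have "degree (coeff s i) <= D + c" for i unfolding s_def coeff_sum coeff_smult
   proof (rule degree_sum_le)
    fix k assume "k : {..<m}"
    thus "degree (coeff r k * coeff (R k) i) <= D + c"
     using degree_mult_le[of "coeff r k" "coeff (R k) i"] r(3)[of k] cb[of k i] by (simp add: add_mono order.trans)
   qed simp
   ultimately show ?thesis unfolding bounded_part_def by blast
  qed
  moreover have "d ~= 0" using d(1) by (simp add: d_def)
  ultimately show ?thesis by blast
qed

lemma mult_power_bounded_part:
  assumes "!!D v. v : bounded_part D ==> x * v : bounded_part (D + c)" "v : bounded_part D"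
  shows "x ^ n * v : bounded_part (D + n * c)"
proof (induction n)
  case (Suc n)
  thus ?case using assms(1)[OF Suc] by (simp add: algebra_simps)
qed (use assms in simp)

definition pev :: "'b => 'a poly => 'b" where "pev x r = poly (map_poly emb r) x"

lemma pev_hom: "is_hom (pev x)"
  unfolding pev_def[abs_def] using is_hom_comp[OF is_hom_poly is_hom_map_poly[OF emb_hom]] .

text \<open>The transcendence degree of the function field is 1: there are more monomials in two functions
  than the growth of the denominators and degrees permits.\<close>

lemma algebraic_dependence:
  assumes x: "x : ffield" "w : ffield"
  shows "EX Q. Q ~= 0 & bev (pev x) w Q = 0"
proof -
  obtain d1 c1 where 1: "d1 ~= 0" "!!D v. v : bounded_part D ==> j d1 * x * v : bounded_part (D + c1)"
   using mult_bounded_part[OF x(1)] by blast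
  obtain d2 c2 where 2: "d2 ~= 0" "!!D v. v : bounded_part D ==> j d2 * w * v : bounded_part (D + c2)"
   using mult_bounded_part[OF x(2)] by blast
  have jm: "j r * v : bounded_part (D + degree r)" if "v : bounded_part D" for r v D
  proof -
   from that obtain s where s: "v = bv s" "degree s < m" "!!k. degree (coeff s k) <= D"
    by (auto simp: bounded_part_def)
   have "j r * v = bv (smult r s)" using s by (simp add: bev_smult[OF j])
   moreover have "degree (smult r s) < m" using s(2) degree_smult_le le_less_trans by blast
   moreover have "degree (coeff (smult r s) k) <= D + degree r" for k
    using degree_mult_le[of r "coeff s k"] s(3)[of k] by simp
   ultimately show ?thesis unfolding bounded_part_def by blast
  qed
  define d where "d = d1 * d2"
  define c where "c = c1 + c2 + degree d1 + degree d2 + degree d"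
  have jd: "j d ~= 0" using 1(1) 2(1) j_inj[of d] by (auto simp: d_def)
  have X: "j d * x * v : bounded_part (D + c)" if "v : bounded_part D" for v D
  proof -
   have "j d2 * (j d1 * x * v) : bounded_part (D + c1 + degree d2)" by (rule jm[OF 1(2)[OF that]])
   thus ?thesis using bounded_part_mono[of "D + c1 + degree d2" "D + c"] by (auto simp: d_def c_def jh mult_ac)
  qed
  have Y: "j d * w * v : bounded_part (D + c)" if "v : bounded_part D" for v D
  proof -
   have "j d1 * (j d2 * w * v) : bounded_part (D + c2 + degree d1)" by (rule jm[OF 2(2)[OF that]])
   thus ?thesis using bounded_part_mono[of "D + c2 + degree d1" "D + c"] by (auto simp: d_def c_def jh mult_ac)
  qed
  have E: "j d * v : bounded_part (D + c)" if "v : bounded_part D" for v D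
   using jm[OF that, of d] bounded_part_mono[of "D + degree d" "D + c"] by (auto simp: c_def)
  have one: "1 : bounded_part 0" unfolding bounded_part_def using m
   by (intro CollectI exI[of _ 1]) (auto simp: bv(1) coeff_1)
  \<comment> \<open>Large enough that the (n + 1)^2 monomials outnumber the m (2 n c + 1) elements
    spanning a space that contains them all after multiplication by
    \<open>j d ^ (2 * n)\<close>.\<close>
  define n where "n = m * (2 * c + 1)"
  have mono: "j d ^ (2 * n) * (x ^ i * w ^ k) : bounded_part (2 * n * c)" if ik: "i <= n" "k <= n" for i k
  proof -
   have "(j d * x) ^ i * ((j d * w) ^ k * (j d ^ (2 * n - i - k) * 1))
     : bounded_part (((0 + (2 * n - i - k) * c) + k * c) + i * c)" by (intro mult_power_bounded_part X Y E one)
   moreover have "((0 + (2 * n - i - k) * c) + k * c) + i * c = 2 * n * c"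
    using ik by (simp flip: add_mult_distrib)
   moreover have "(j d * x) ^ i * ((j d * w) ^ k * (j d ^ (2 * n - i - k) * 1)) = j d ^ (2 * n) * (x ^ i * w ^ k)"
   proof -
    have "2 * n = i + k + (2 * n - i - k)" using ik by simp
    hence "j d ^ (2 * n) = j d ^ i * j d ^ k * j d ^ (2 * n - i - k)" by (metis power_add)
    thus ?thesis by (simp add: power_mult_distrib mult_ac)
   qed
   ultimately show ?thesis by simp
  qed
  define D where "D = 2 * n * c"
  define B where "B = (%(i, k). j (monom 1 i) * y0 ^ k) ` ({..D} \<times> {..<m})"
  have span: "EX u. v = (\<Sum>b\<in>B. emb (u b) * b)" if "v : bounded_part D" for v
  proof -
   from that obtain r where r: "v = bv r" "degree r < m" "!!k. degree (coeff r k) <= D"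
    by (auto simp: bounded_part_def)
   define u where "u b = (\<Sum>(i, k)\<in>{z:{..D} \<times> {..<m}. (%(i, k). j (monom 1 i) * y0 ^ k) z = b}.
     coeff (coeff r k) i)" for b
   have "v = (\<Sum>k<m. \<Sum>i\<le>D. emb (coeff (coeff r k) i) * (j (monom 1 i) * y0 ^ k))" unfolding r(1) bv_sum[OF r(2)]
    by (rule sum.cong) (auto simp: j_sum[OF r(3)] sum_distrib_right mult.assoc)
   also have "... = (\<Sum>(i, k)\<in>{..D} \<times> {..<m}. emb (coeff (coeff r k) i) * (j (monom 1 i) * y0 ^ k))"
    by (subst sum.swap) (simp add: sum.cartesian_product)
   also have "... = (\<Sum>b\<in>B. \<Sum>(i, k)\<in>{z:{..D} \<times> {..<m}. (%(i, k). j (monom 1 i) * y0 ^ k) z = b}.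
     emb (coeff (coeff r k) i) * (j (monom 1 i) * y0 ^ k))" unfolding B_def by (rule sum.image_gen) simp
   also have "... = (\<Sum>b\<in>B. emb (u b) * b)"
    unfolding u_def by (rule sum.cong) (auto simp: eh sum_distrib_right split_beta intro!: sum.cong)
   finally show ?thesis by (intro exI[of _ u])
  qed
  have "card B <= card ({..D} \<times> {..<m})" unfolding B_def by (rule card_image_le) simp
  also have "... = (2 * n * c + 1) * m" by (simp add: D_def)
  also have "... < (n + 1) * (n + 1)"
  proof -
   have "n >= m" unfolding n_def by simp
   hence "(2 * n * c + 1) * m <= 2 * n * c * m + n" by (simp add: algebra_simps)
   also have "... <= n * (m * (2 * c + 1)) + n" by (simp add: algebra_simps)
   also have "... = n * n + n" by (simp add: n_def)
   finally show ?thesis by simp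
  qed
  also have "... = card ({..n} \<times> {..n})" by simp
  finally have card: "card B < card ({..n} \<times> {..n})" .
  have finB: "finite B" by (simp add: B_def)
  define f where "f z = j d ^ (2 * n) * (x ^ fst z * w ^ snd z)" for z :: "nat \<times> nat"
  have sp: "EX u. f z = (\<Sum>b\<in>B. emb (u b) * b)" if "z : {..n} \<times> {..n}" for z
   using span[of "f z"] mono[of "fst z" "snd z"] that by (auto simp: f_def D_def)
  have finI: "finite ({..n} \<times> {..n})" by simp
  from linear_relation[where f = f, OF emb_hom finI finB card sp]
  obtain u where u: "EX z:{..n} \<times> {..n}. u z ~= 0" "(\<Sum>z\<in>{..n} \<times> {..n}. emb (u z) * f z) = 0" by blast
  have "(\<Sum>z\<in>{..n} \<times> {..n}. emb (u z) * f z) = j d ^ (2 * n) * (\<Sum>z\<in>{..n} \<times> {..n}. emb (u z) * (x ^ fst z * w ^ snd z))"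
   unfolding f_def sum_distrib_left by (rule sum.cong) (auto simp: mult_ac)
  hence rel: "(\<Sum>z\<in>{..n} \<times> {..n}. emb (u z) * (x ^ fst z * w ^ snd z)) = 0" using u(2) jd by simp
  define Q where "Q = (\<Sum>z\<in>{..n} \<times> {..n}. monom (monom (u z) (fst z)) (snd z))"
  have "bev (pev x) w Q = (\<Sum>z\<in>{..n} \<times> {..n}. emb (u z) * (x ^ fst z * w ^ snd z))"
   unfolding Q_def is_homD(8)[OF is_hom_bev[OF pev_hom]]
   by (rule sum.cong) (auto simp: bev_monom[OF pev_hom] pev_def map_poly_monom eh poly_monom mult_ac)
  hence "bev (pev x) w Q = 0" using rel by simp
  moreover have "Q ~= 0"
  proof -
   obtain i k where ik: "i <= n" "k <= n" "u (i, k) ~= 0" using u(1) by auto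
   have "coeff (coeff Q k) i = (\<Sum>z\<in>{..n} \<times> {..n}. if z = (i, k) then u z else 0)"
    unfolding Q_def coeff_sum by (rule sum.cong) auto
   also have "... = u (i, k)" using ik by simp
   finally show ?thesis using ik by auto
  qed
  ultimately show ?thesis by blast
qed

subsection \<open>Automorphisms of the function field\<close>

text \<open>The extension of \<open>D\<close> to quotients. The choice of numerator and denominator
  is immaterial by \<open>ext_eval\<close> as soon as \<open>D\<close> is a homomorphism preserving
  the kernel of evaluation.\<close>

definition ext :: "('a poly poly => 'a poly poly) => 'b => 'b" where
  "ext D x = (SOME w. EX g h. bv h ~= 0 & x = bv g / bv h & w = bv (D g) / bv (D h))"

definition admissible :: "('a poly poly => 'a poly poly) => bool" where
  "admissible D \<longleftrightarrow> is_hom D & (ALL g. bv (D g) = 0 \<longleftrightarrow> bv g = 0)"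

lemma ext_eval:
  assumes D: "admissible D" and h: "bv h ~= 0"
  shows "ext D (bv g / bv h) = bv (D g) / bv (D h)"
proof -
  note Dh = is_homD[of D] and Dz = D[unfolded admissible_def]
  have Dhom: "is_hom D" using D by (simp add: admissible_def)
  have "EX g' h'. bv h' ~= 0 & bv g / bv h = bv g' / bv h' & ext D (bv g / bv h) = bv (D g') / bv (D h')"
   unfolding ext_def by (rule someI_ex) (use h in blast)
  then obtain g' h' where g': "bv h' ~= 0" "bv g / bv h = bv g' / bv h'" "ext D (bv g / bv h) = bv (D g') / bv (D h')"
   by blast
  have "bv (g * h' - g' * h) = 0" using g' h by (simp add: bv field_simps)
  hence "bv (D (g * h' - g' * h)) = 0" using Dz by blast
  hence "bv (D g) * bv (D h') = bv (D g') * bv (D h)" by (simp add: is_homD[OF Dhom] bv)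
  moreover have "bv (D h) ~= 0" "bv (D h') ~= 0" using Dz h g'(1) by auto
  ultimately show ?thesis unfolding g'(3) by (simp add: frac_eq_eq)
qed

lemma ext_bv: "admissible D ==> ext D (bv g) = bv (D g)"
  using ext_eval[of D 1 g] by (simp add: bv admissible_def is_homD(1)[of D])

lemma ext_hom:
  assumes D: "admissible D" and x: "x : ffield" "w : ffield"
  shows "ext D x : ffield" "ext D (x + w) = ext D x + ext D w" "ext D (x * w) = ext D x * ext D w"
proof -
  have Dhom: "is_hom D" and Dz: "!!g. bv (D g) = 0 \<longleftrightarrow> bv g = 0" using D by (auto simp: admissible_def)
  obtain g h g' h' where a: "x = bv g / bv h" "bv h ~= 0" "w = bv g' / bv h'" "bv h' ~= 0"
   using x by (auto simp: ffield_def)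
  show "ext D x : ffield" unfolding a(1) ext_eval[OF D a(2)] using Dz a(2) by (auto simp: ffield_def)
  have s: "x + w = bv (g * h' + g' * h) / bv (h * h')" and p: "x * w = bv (g * g') / bv (h * h')"
   using a by (simp_all add: bv add_frac_eq)
  have nz: "bv (h * h') ~= 0" using a by (simp add: bv)
  show "ext D (x + w) = ext D x + ext D w"
   unfolding s ext_eval[OF D nz] unfolding a(1,3) ext_eval[OF D a(2)] ext_eval[OF D a(4)]
   using Dz a by (simp add: is_homD[OF Dhom] bv add_frac_eq)
  show "ext D (x * w) = ext D x * ext D w"
   unfolding p ext_eval[OF D nz] unfolding a(1,3) ext_eval[OF D a(2)] ext_eval[OF D a(4)]
   by (simp add: is_homD[OF Dhom] bv)
qed

lemma ext_comp:
  assumes D: "admissible D" "admissible D'" and x: "x : ffield"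
  shows "ext D (ext D' x) = ext (%g. D (D' g)) x" "admissible (%g. D (D' g))"
proof -
  show a: "admissible (%g. D (D' g))" using D by (auto simp: admissible_def is_hom_def)
  obtain g h where gh: "x = bv g / bv h" "bv h ~= 0" using x by (auto simp: ffield_def)
  hence "bv (D' h) ~= 0" using D(2) by (auto simp: admissible_def)
  thus "ext D (ext D' x) = ext (%g. D (D' g)) x"
   using gh by (simp add: ext_eval[OF D(2)] ext_eval[OF D(1)] ext_eval[OF a])
qed

lemma ext_id: "x : ffield ==> ext (%g. g) x = x"
proof -
  assume "x : ffield"
  then obtain g h where gh: "x = bv g / bv h" "bv h ~= 0" by (auto simp: ffield_def)
  have "admissible (%g. g)" by (auto simp: admissible_def is_hom_def)
  thus ?thesis using gh by (simp add: ext_eval)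
qed

lemma ext_bij:
  assumes D: "admissible D" "admissible D'" and inv: "!!g. D (D' g) = g" "!!g. D' (D g) = g"
  shows "bij_betw (ext D) ffield ffield" by (rule bij_betw_byWitness[of _ "ext D'"])
   (use ext_comp[OF D] ext_comp[OF D(2,1)] ext_hom(1)[OF D(1)] ext_hom(1)[OF D(2)] ext_id in "auto simp: inv")

lemma ext_0: "admissible D ==> ext D 0 = 0" using ext_bv[of D 0] by (simp add: bv admissible_def is_homD(4)[of D])

lemma ext_1: "admissible D ==> ext D 1 = 1" using ext_bv[of D 1] by (simp add: bv admissible_def is_homD(1)[of D])

lemma rot_admissible: "admissible (rot (\<zeta> ^ i))" using is_hom_rot bv_rot_iff by (simp add: admissible_def)

definition \<delta> :: "'b => 'b" where "\<delta> = ext (rot \<zeta>)"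

lemma delta_adm: "admissible (rot \<zeta>)" using rot_admissible[of 1] by simp

lemma delta_pow: "x : ffield ==> (\<delta> ^^ i) x = ext (rot (\<zeta> ^ i)) x"
proof (induction i)
  case 0
  have "rot 1 = (%g :: 'a poly poly. g)" by (simp add: fun_eq_iff rot_1)
  thus ?case using ext_id[OF 0] by simp
next
  case (Suc i)
  have "(\<delta> ^^ Suc i) x = ext (rot \<zeta>) (ext (rot (\<zeta> ^ i)) x)" using Suc by (simp add: \<delta>_def)
  also have "... = ext (rot (\<zeta> ^ Suc i)) x"
   using ext_comp(1)[OF delta_adm rot_admissible Suc.prems, of i] by (simp add: rot_rot)
  finally show ?case .
qed

lemma delta_period: "x : ffield ==> (\<delta> ^^ m) x = x"
proof -
  assume x: "x : ffield"
  have "rot 1 = (%g :: 'a poly poly. g)" by (simp add: fun_eq_iff rot_1)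
  thus ?thesis using ext_id[OF x] delta_pow[OF x, of m] by (simp add: zeta(2))
qed

lemma delta_bij: "bij_betw \<delta> ffield ffield"
proof -
  obtain k where k: "m = Suc k" using m by (cases m) auto
  have "\<zeta> * \<zeta> ^ k = 1" "\<zeta> ^ k * \<zeta> = 1" using zeta(2) k by (auto simp: mult.commute)
  thus ?thesis unfolding \<delta>_def by (intro ext_bij[OF delta_adm rot_admissible[of k]]) (auto simp: rot_rot rot_1)
qed

lemma delta_hom: "x : ffield ==> \<delta> x : ffield" "x : ffield ==> w : ffield ==> \<delta> (x + w) = \<delta> x + \<delta> w"
  "x : ffield ==> w : ffield ==> \<delta> (x * w) = \<delta> x * \<delta> w" "\<delta> 1 = 1" "\<delta> 0 = 0" "\<delta> (j r) = j r" "\<delta> (emb c) = emb c"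
proof -
  show r: "\<delta> (j r) = j r" for r
   using ext_bv[OF delta_adm, of "[:r:]"] by (simp add: \<delta>_def bev_const[OF j] rot_pCons) (simp add: rot_def bev_const[OF j])
  show "\<delta> (emb c) = emb c" unfolding emb_def by (rule r)
qed (auto simp: \<delta>_def ext_hom[OF delta_adm] ext_0[OF delta_adm] ext_1[OF delta_adm])

text \<open>By \<open>bv_small\<close> the reduced numerator is unique, hence itself invariant, and
  an invariant polynomial of degree less than m does not involve y.\<close>

lemma delta_fixed:
  assumes x: "x : ffield" "\<delta> x = x" shows "EX n d. d ~= 0 & x = j n / j d"
proof -
  obtain d r where r: "d ~= 0" "degree r < m" "x = bv r / j d" using ffield_reduced[OF x(1)] by blast
  have jd: "j d ~= 0" using r(1) j_inj by auto
  have "\<delta> x = bv (rot \<zeta> r) / j d" unfolding \<delta>_def r(3) using ext_eval[OF delta_adm, of "[:d:]" r] jd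
   by (simp add: bev_const[OF j] rot_pCons) (simp add: rot_def bev_const[OF j])
  hence "bv (rot \<zeta> r - r) = 0" using x(2) r(3) jd by (simp add: bv field_simps)
  moreover have "degree (rot \<zeta> r - r) < m" using r(2) degree_rot[of \<zeta> r] by (meson degree_diff_less le_less_trans)
  ultimately have "rot \<zeta> r = r" using bv_small by fastforce
  then obtain n where "r = [:n:]" using rot_fixed r(2) by blast
  thus ?thesis using r by (auto simp: bev_const[OF j])
qed

text \<open>Hilbert 90 for the cyclic group generated by \<open>\<delta>\<close>, with Lagrange resolvents of powers of \<open>y\<close>.\<close>

lemma hilbert90:
  assumes f: "f : ffield" and nf: "(\<Prod>i<m. (\<delta> ^^ i) f) = 1"
  shows "EX g:ffield. g ~= 0 & f * \<delta> g = g"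
proof -
  note F = subrD[OF subf_subr[OF ffield_subf]]
  have dF: "(\<delta> ^^ i) x : ffield" if "x : ffield" for i x using that by (induction i) (auto intro: delta_hom(1))
  have dsum: "\<delta> (\<Sum>k\<in>S. h k) = (\<Sum>k\<in>S. \<delta> (h k))" if "!!k. h k : ffield" for h and S :: "nat set"
   by (induction S rule: infinite_finite_induct) (auto simp: delta_hom F(8) that)
  have dprod: "\<delta> (\<Prod>k\<in>S. h k) = (\<Prod>k\<in>S. \<delta> (h k))" if "!!k. h k : ffield" for h and S :: "nat set"
   by (induction S rule: infinite_finite_induct) (auto simp: delta_hom F(9) that)
  \<comment> \<open>The cocycle attached to \<open>f\<close>: the resolvent \<open>G c\<close> built
    from these partial products of conjugates satisfies \<open>f * \<delta> (G c) = G c\<close>, the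
    total product being 1.\<close>
  define a where "a k = (\<Prod>i<k. (\<delta> ^^ i) f)" for k
  have aF: "a k : ffield" for k unfolding a_def by (intro F(9) dF f)
  have aS: "f * \<delta> (a k) = a (Suc k)" for k
  proof -
   have "\<delta> (a k) = (\<Prod>i<k. (\<delta> ^^ Suc i) f)" unfolding a_def using dprod[of "%i. (\<delta> ^^ i) f"] dF[OF f] by simp
   thus ?thesis unfolding a_def by (subst prod.lessThan_Suc_shift) simp
  qed
  define G where "G c = (\<Sum>k<m. a k * (\<delta> ^^ k) c)" for c
  have G: "f * \<delta> (G c) = G c" "G c : ffield" if c: "c : ffield" for c
  proof -
   show "G c : ffield" unfolding G_def by (intro F(8) F(4) aF dF c)
   have t: "a k * (\<delta> ^^ k) c : ffield" for k by (intro F(4) aF dF c)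
   have "f * \<delta> (G c) = (\<Sum>k<m. a (Suc k) * (\<delta> ^^ Suc k) c)" unfolding G_def dsum[OF t] sum_distrib_left
    by (rule sum.cong) (simp_all add: delta_hom(3)[OF aF dF[OF c]] aS[symmetric] mult.assoc)
   also have "... + a 0 * (\<delta> ^^ 0) c = (\<Sum>k<Suc m. a k * (\<delta> ^^ k) c)"
    by (subst sum.lessThan_Suc_shift) (simp add: add.commute)
   also have "... = G c + a m * (\<delta> ^^ m) c" by (simp add: G_def)
   finally show "f * \<delta> (G c) = G c" using nf delta_period[OF c] by (simp add: a_def)
  qed
  have y: "y0 ^ i = bv (monom 1 i)" for i by (simp add: bev_monom[OF j] jh)
  have yF: "y0 ^ i : ffield" for i unfolding y by (rule bv_ffield)
  have dy: "(\<delta> ^^ k) (y0 ^ i) = emb (\<zeta> ^ k) ^ i * y0 ^ i" for k i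
  proof -
   have "rot (\<zeta> ^ k) (monom 1 i) = smult [:(\<zeta> ^ k) ^ i:] (monom 1 i)" by (rule poly_eqI) (auto simp: coeff_rot)
   moreover have "j [:(\<zeta> ^ k) ^ i:] = emb (\<zeta> ^ k) ^ i" using eh(7)[of "\<zeta> ^ k" i] by (simp add: emb_def)
   ultimately show ?thesis using delta_pow[OF yF, of k i] ext_bv[OF rot_admissible, of k "monom 1 i"]
    by (simp add: y bev_smult[OF j])
  qed
  have y0nz: "y0 ~= 0" using y0 pq(1) m j_inj[of p] by (auto simp: power_0_left)
  \<comment> \<open>If the resolvents of 1, y, ..., y^(m - 1) all vanished, dividing them by these
    powers and adding up would leave only the term with k = 0, by orthogonality of the characters of
    the cyclic group; that term is m, nonzero in characteristic 0.\<close>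
  have "EX i<m. G (y0 ^ i) ~= 0"
  proof (rule ccontr)
   assume no: "~ (EX i<m. G (y0 ^ i) ~= 0)"
   have "(\<Sum>k<m. a k * emb (\<zeta> ^ k) ^ i) = 0" if "i < m" for i
   proof -
    have "G (y0 ^ i) = (\<Sum>k<m. a k * emb (\<zeta> ^ k) ^ i) * y0 ^ i"
     by (simp add: G_def dy sum_distrib_right mult.assoc)
    thus ?thesis using no that y0nz by auto
   qed
   hence "0 = (\<Sum>i<m. \<Sum>k<m. a k * emb (\<zeta> ^ k) ^ i)" by simp
   also have "... = (\<Sum>k<m. a k * (\<Sum>i<m. emb (\<zeta> ^ k) ^ i))" by (subst sum.swap) (simp add: sum_distrib_left)
   also have "... = (\<Sum>k<m. if k = 0 then a 0 * of_nat m else 0)"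
   proof (rule sum.cong)
    fix k assume k: "k : {..<m}"
    show "a k * (\<Sum>i<m. emb (\<zeta> ^ k) ^ i) = (if k = 0 then a 0 * of_nat m else 0)"
    proof (cases "k = 0")
     case False
     have "\<zeta> ^ k ~= 1" using inj_onD[OF zeta(1), of k 0] k m False by auto
     hence "emb (\<zeta> ^ k) ~= 1" using ef(2)[of "\<zeta> ^ k" 1] eh(1) by simp
     moreover have "emb (\<zeta> ^ k) ^ m = 1"
     proof -
      have "(\<zeta> ^ k) ^ m = 1" using zeta(2) by (metis mult.commute power_mult power_one)
      thus ?thesis using eh(7)[of "\<zeta> ^ k" m] eh(1) by simp
     qed
     ultimately have "(\<Sum>i<m. emb (\<zeta> ^ k) ^ i) = 0" by (simp add: geometric_sum)
     thus ?thesis using False by simp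
    qed (simp add: eh)
   qed simp
   also have "... = of_nat m" using m by (simp add: a_def)
   finally have "emb (of_nat m) = 0" by (simp add: eh)
   thus False using ef(1) m by simp
  qed
  then obtain i where "G (y0 ^ i) ~= 0" by blast
  thus ?thesis using G[OF yF[of i]] by blast
qed

end

subsection \<open>Local rings of a smooth curve\<close>

text \<open>Gaussian elimination over a local ring: \<open>r\<close> relations with independent residues between \<open>r + 1\<close>
  generators of an ideal leave a single generator.\<close>

lemma eliminate:
  fixes e :: "'a::field => 'b::field"
  assumes e: "is_hom e" and O: "subr RR" "ideal_on RR M" "!!x. x : RR ==> x ~: M ==> inverse x : RR" "!!c. e c : RR" "1 ~: M"
  shows "finite J ==> card J = Suc r ==> (!!i k. i < r ==> k : J ==> A i k : RR & A i k - e (a i k) : M) ==>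
   (!!i. i < r ==> (\<Sum>k\<in>J. A i k * z k) = 0) ==>
   (!!c. ALL k:J. (\<Sum>i<r. c i * a i k) = (0::'a) ==> ALL i<r. c i = 0) ==> EX k:J. ALL i:J. EX w:RR. z i = w * z k"
proof (induction r arbitrary: J A a)
  case 0
  then obtain k where "J = {k}" by (auto simp: card_1_singleton_iff)
  thus ?case using subrD(2)[OF O(1)] by (auto intro!: bexI[of _ 1])
next
  case (Suc r)
  note o = subrD[OF O(1)] and I = ideal_onD[OF O(2)] and Im = ideal_on_minus[OF O(1,2)]
  note eh = is_homD[OF e] and ef = is_hom_field[OF e]
  have "EX k:J. a r k ~= 0"
  proof (rule ccontr)
   assume "~ (EX k:J. a r k ~= 0)"
   hence "ALL k:J. (\<Sum>i<Suc r. (if i = r then 1 else 0) * a i k) = 0" by simp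
   from Suc.prems(5)[OF this] show False by auto
  qed
  then obtain k0 where k0: "k0 : J" "a r k0 ~= 0" by blast
  have unit: "A r k0 ~= 0 & inverse (A r k0) : RR & inverse (A r k0) - e (inverse (a r k0)) : M"
  proof -
   have A: "A r k0 : RR" "A r k0 - e (a r k0) : M" using Suc.prems(3)[of r k0] k0 by auto
   have "A r k0 ~: M"
   proof
    assume "A r k0 : M"
    hence "A r k0 - (A r k0 - e (a r k0)) : M" using A Im(2) by blast
    hence "e (inverse (a r k0)) * e (a r k0) : M" using I(4) O(4) by simp
    thus False using k0 O(5) ef by simp
   qed
   hence nz: "A r k0 ~= 0" "inverse (A r k0) : RR" using I(2) O(3) A by auto
   have ei: "e (inverse (a r k0)) = inverse (e (a r k0))" "e (a r k0) ~= 0" using ef(1) ef(3) k0 by auto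
   have "inverse (A r k0) - e (inverse (a r k0)) = - (inverse (A r k0) * e (inverse (a r k0)) * (A r k0 - e (a r k0)))"
    unfolding ei(1) using nz ei(2) by (simp add: field_simps)
   moreover have "... : M" by (intro Im(1) I(4) o(4) nz O(4) A)
   ultimately show ?thesis using nz by simp
  qed
  define q where "q k = A r k * inverse (A r k0)" for k
  define q' where "q' k = a r k * inverse (a r k0)" for k
  have q: "q k : RR & q k - e (q' k) : M" if "k : J" for k
  proof -
   have A: "A r k : RR" "A r k - e (a r k) : M" using Suc.prems(3)[of r k] that by auto
   have "q k - e (q' k) = (A r k - e (a r k)) * inverse (A r k0) + e (a r k) * (inverse (A r k0) - e (inverse (a r k0)))"
    by (simp add: q_def q'_def eh algebra_simps)
   moreover have "... : M" by (intro I(3) I(6) I(4) A O(4)) (use unit in auto)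
   ultimately show ?thesis using A unit o(4) by (simp add: q_def)
  qed
  let ?J = "J - {k0}"
  define B where "B i k = A i k - A i k0 * q k" for i k
  define b where "b i k = a i k - a i k0 * q' k" for i k
  have zk0: "z k0 = - (\<Sum>k\<in>?J. q k * z k)"
  proof -
   have "A r k0 * z k0 + (\<Sum>k\<in>?J. A r k * z k) = 0"
    using Suc.prems(4)[of r] sum.remove[OF Suc.prems(1) k0(1), of "%k. A r k * z k"] by simp
   hence "z k0 = - (inverse (A r k0) * (\<Sum>k\<in>?J. A r k * z k))" using unit by (simp add: field_simps add_eq_0_iff)
   thus ?thesis by (simp add: q_def sum_distrib_left mult_ac)
  qed
  have "EX k:?J. ALL i:?J. EX w:RR. z i = w * z k"
  proof (rule Suc.IH[of ?J B b])
   show "finite ?J" "card ?J = Suc r" using Suc.prems(1,2) k0 by auto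
   show "B i k : RR & B i k - e (b i k) : M" if ik: "i < r" "k : ?J" for i k
   proof -
    have A: "A i k : RR" "A i k - e (a i k) : M" "A i k0 : RR" "A i k0 - e (a i k0) : M"
     using Suc.prems(3)[of i k] Suc.prems(3)[of i k0] ik k0 by auto
    have qq: "q k : RR" "q k - e (q' k) : M" using q[of k] ik by auto
    have e: "B i k - e (b i k) = (A i k - e (a i k)) - ((A i k0 - e (a i k0)) * q k + e (a i k0) * (q k - e (q' k)))"
     by (simp add: B_def b_def eh algebra_simps)
    have "B i k - e (b i k) : M" unfolding e by (intro Im(2) I(3) I(6) I(4) A qq O(4))
    moreover have "B i k : RR" unfolding B_def by (intro o(6) o(4) A qq)
    ultimately show ?thesis by blast
   qed
   show "(\<Sum>k\<in>?J. B i k * z k) = 0" if i: "i < r" for i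
   proof -
    have "(\<Sum>k\<in>?J. B i k * z k) = (\<Sum>k\<in>?J. A i k * z k) + A i k0 * z k0"
     unfolding zk0 by (simp add: B_def left_diff_distrib sum_subtractf sum_distrib_left mult.assoc)
    thus ?thesis using Suc.prems(4)[of i] i sum.remove[OF Suc.prems(1) k0(1), of "%k. A i k * z k"]
     by (simp add: add.commute)
   qed
   show "ALL i<r. c i = 0" if c: "ALL k:?J. (\<Sum>i<r. c i * b i k) = 0" for c
   proof -
    \<comment> \<open>A dependence between the reduced rows becomes one between the original rows,
      the coefficient of row \<open>r\<close> being chosen to cancel column
      \<open>k0\<close>.\<close>
    define d where "d i = (if i = r then - (\<Sum>i<r. c i * a i k0) * inverse (a r k0) else c i)" for i
    have "(\<Sum>i<Suc r. d i * a i k) = (\<Sum>i<r. c i * b i k)" for k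
     by (simp add: d_def b_def q'_def right_diff_distrib sum_subtractf sum_distrib_right sum_distrib_left mult_ac)
    moreover have "(\<Sum>i<r. c i * b i k0) = 0" using k0 by (simp add: b_def q'_def)
    ultimately have "ALL k:J. (\<Sum>i<Suc r. d i * a i k) = 0" using c by (metis Diff_iff singletonD)
    from Suc.prems(5)[OF this] have "d i = 0" if "i < r" for i using that by simp
    thus ?thesis by (metis d_def less_irrefl)
   qed
  qed
  then obtain k w where k: "k : ?J" "!!i. i : ?J ==> w i : RR & z i = w i * z k" by metis
  have "z k0 = (- (\<Sum>i\<in>?J. q i * w i)) * z k" unfolding zk0 using k(2) by (simp add: sum_distrib_right mult.assoc)
  moreover have "- (\<Sum>i\<in>?J. q i * w i) : RR" by (intro o(5) o(8) o(4)) (use q k in auto)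
  ultimately show ?case using k by (metis Diff_iff singletonD)
qed

text \<open>\<open>Xg\<close> is the generic point of the curve, with coordinates in a field
  containing \<open>F\<close>. The local theory is thereby separated from the affine model: it uses
  only that forms vanish at the generic point exactly when they vanish on the curve, that any two
  functions are algebraically dependent, and smoothness.\<close>

locale function_field =
  fixes C :: "'a::{alg_closed_field, field_char_0} scheme" and emb :: "'a => 'b::field"
   and F :: "'b set" and Xg :: "nat => 'b"
  assumes emb: "is_hom emb" and F: "subf F" and proj: "proj_scheme UNIV C" and Xg: "!!i. i > amb C ==> Xg i = 0"
   and generic: "!!d f. f : forms UNIV (amb C) d ==> evh emb Xg f = 0 \<longleftrightarrow> (ALL P:cone C. ev P f = 0)"
   and quotients: "F = {evh emb Xg f / evh emb Xg g | f g d. f : forms UNIV (amb C) d & g : forms UNIV (amb C) d &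
     evh emb Xg g ~= 0}" and nontrivial: "~ F \<subseteq> range emb"
   and dependence: "!!x w. x : F ==> w : F ==> EX Q. Q ~= 0 & bev (%r. poly (map_poly emb r) x) w Q = 0"
   and smooth: "!!P. P : cone C ==> EX R. smooth_at R C 1 (UNIV, {0}) P"
begin

abbreviation "eX \<equiv> evh emb Xg"
abbreviation "form \<equiv> %d f. f : forms UNIV (amb C) d"

lemmas eh = is_homD[OF emb]
lemmas ef = is_hom_field[OF emb]
lemmas xh = is_homD[OF is_hom_evh[OF emb, of Xg]]
lemmas vh = is_homD[OF is_hom_ev]
lemmas Fr = subrD[OF subf_subr[OF F]]

definition regular :: "(nat => 'a) => 'b set" ("\<O>") where
  "\<O> P = {eX f / eX g | f g d. form d f & form d g & ev P g ~= 0}"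

definition vanishing :: "(nat => 'a) => 'b set" ("\<M>") where
  "\<M> P = {eX f / eX g | f g d. form d f & form d g & ev P g ~= 0 & ev P f = 0}"

lemma eX_nonzero: "P : cone C ==> form d g ==> ev P g ~= 0 ==> eX g ~= 0" using generic by blast

lemma eX_zero: "P : cone C ==> form d g ==> eX g = 0 ==> ev P g = 0" using generic by blast

context
  fixes P assumes P: "P : cone C"
begin

lemma local_value:
  assumes "form d f" "form d g" "ev P g ~= 0" "form d' f'" "form d' g'" "ev P g' ~= 0" "eX f / eX g = eX f' / eX g'"
  shows "ev P f = 0 \<longleftrightarrow> ev P f' = 0"
proof -
  have nz: "eX g ~= 0" "eX g' ~= 0" using assms eX_nonzero[OF P] by auto
  have "form (d + d') (f * g' - f' * g)"
   using forms_minus'[OF forms_mult[OF assms(1,5)]] forms_mult[OF assms(4,2)] by (simp add: add.commute)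
  moreover have "eX (f * g' - f' * g) = 0" using assms(7) nz by (simp add: xh field_simps)
  ultimately have "ev P (f * g' - f' * g) = 0" using eX_zero[OF P] by blast
  thus ?thesis using assms(3,6) by (auto simp: vh)
qed

lemma local_ring: "subr (\<O> P)" "ideal_on (\<O> P) (\<M> P)" "1 ~: \<M> P" "!!x. x : \<O> P ==> x ~: \<M> P ==> inverse x : \<O> P"
  "!!c. emb c : \<O> P" "\<O> P \<subseteq> F" "!!x. x : \<O> P ==> EX c. x - emb c : \<M> P"
proof -
  have O: "EX f g d. form d f & form d g & ev P g ~= 0 & eX g ~= 0 & x = eX f / eX g" if "x : \<O> P" for x
   using that eX_nonzero[OF P] unfolding regular_def by blast
  have M: "EX f g d. form d f & form d g & ev P g ~= 0 & eX g ~= 0 & x = eX f / eX g & ev P f = 0" if "x : \<M> P" for x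
   using that eX_nonzero[OF P] unfolding vanishing_def by blast
  have OI: "x : \<O> P" if "form d f" "form d g" "ev P g ~= 0" "x = eX f / eX g" for x d f g
   using that unfolding regular_def by blast
  have MI: "x : \<M> P" if "form d f" "form d g" "ev P g ~= 0" "ev P f = 0" "x = eX f / eX g" for x d f g
   using that unfolding vanishing_def by blast
  note fm = forms_mult
  have sum: "form (d + d') (f * g' + f' * g)" if "form d f" "form d g" "form d' f'" "form d' g'" for d d' and f g f' g' :: "(nat, 'a) mpol"
   using forms_add'[OF fm[OF that(1,4)]] fm[OF that(3,2)] by (simp add: add.commute)
  show c: "emb c : \<O> P" for c by (rule OI[OF forms_const[of c] forms_one])
    (simp_all add: evh_single[OF emb] eh xh vh)
  show "subr (\<O> P)"
  proof (rule subrI)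
   show "0 : \<O> P" "1 : \<O> P" using c[of 0] c[of 1] by (simp_all add: eh)
   fix x w assume "x : \<O> P" "w : \<O> P"
   then obtain f g d f' g' d' where a: "form d f" "form d g" "ev P g ~= 0" "eX g ~= 0" "x = eX f / eX g"
    "form d' f'" "form d' g'" "ev P g' ~= 0" "eX g' ~= 0" "w = eX f' / eX g'" using O by metis
   have g: "form (d + d') (g * g')" "ev P (g * g') ~= 0" using fm a by (auto simp: vh)
   show "x + w : \<O> P" by (rule OI[OF sum g(1,2)]) (use a in "simp_all add: xh add_frac_eq")
   show "x * w : \<O> P" by (rule OI[OF fm g(1,2)]) (use a in "simp_all add: xh")
   show "- x : \<O> P" by (rule OI[OF forms_uminus[OF a(1)] a(2,3)]) (use a in "simp_all add: xh")
  qed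
  show "ideal_on (\<O> P) (\<M> P)" unfolding ideal_on_def
  proof (intro conjI ballI)
   show "\<M> P \<subseteq> \<O> P" unfolding regular_def vanishing_def by blast
   show "0 : \<M> P" by (rule MI[OF forms_zero forms_one]) (auto simp: vh)
   fix x w assume "x : \<M> P" "w : \<M> P"
   then obtain f g d f' g' d' where a: "form d f" "form d g" "ev P g ~= 0" "eX g ~= 0" "x = eX f / eX g" "ev P f = 0"
    "form d' f'" "form d' g'" "ev P g' ~= 0" "eX g' ~= 0" "w = eX f' / eX g'" "ev P f' = 0" using M by metis
   have g: "form (d + d') (g * g')" "ev P (g * g') ~= 0" using fm a by (auto simp: vh)
   show "x + w : \<M> P" by (rule MI[OF sum g(1,2)]) (use a in "simp_all add: xh vh add_frac_eq")
  next
   fix x w assume "x : \<O> P" "w : \<M> P"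
   then obtain f g d f' g' d' where a: "form d f" "form d g" "ev P g ~= 0" "eX g ~= 0" "x = eX f / eX g"
    "form d' f'" "form d' g'" "ev P g' ~= 0" "eX g' ~= 0" "w = eX f' / eX g'" "ev P f' = 0" using O M by metis
   have g: "form (d + d') (g * g')" "ev P (g * g') ~= 0" using fm a by (auto simp: vh)
   show "x * w : \<M> P" by (rule MI[OF fm g(1,2)]) (use a in "simp_all add: xh vh")
  qed
  show "1 ~: \<M> P"
  proof
   assume "1 : \<M> P"
   then obtain f g d where a: "form d f" "form d g" "ev P g ~= 0" "1 = eX f / eX g" "ev P f = 0" using M by metis
   have "ev P f = 0 \<longleftrightarrow> ev P 1 = 0"
    by (rule local_value[OF a(1-3) forms_one forms_one]) (use a in "simp_all add: vh xh")
   thus False using a by (simp add: vh)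
  qed
  show "inverse x : \<O> P" if xO: "x : \<O> P" and xM: "x ~: \<M> P" for x
  proof -
   obtain f g d where a: "form d f" "form d g" "ev P g ~= 0" "x = eX f / eX g" using O[OF xO] by metis
   have "ev P f ~= 0" using MI[OF a(1-3)] a(4) xM by blast
   thus ?thesis using OI[OF a(2,1)] a(4) by simp
  qed
  show "\<O> P \<subseteq> F"
  proof
   fix x assume "x : \<O> P"
   thus "x : F" using O[of x] unfolding quotients by blast
  qed
  show "EX c. x - emb c : \<M> P" if x: "x : \<O> P" for x
  proof -
   obtain f g d where a: "form d f" "form d g" "ev P g ~= 0" "eX g ~= 0" "x = eX f / eX g" using O[OF x] by metis
   let ?c = "ev P f / ev P g"
   let ?h = "f - single 0 ?c * g"
   have "form d ?h" by (intro forms_minus' forms_const_mult a)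
   moreover have "ev P ?h = 0" using a(3) by (simp add: vh) (simp add: ev_evh evh_single[OF is_hom_id])
   moreover have "x - emb ?c = eX ?h / eX g" using a(4,5) by (simp add: xh evh_single[OF emb] field_simps)
   ultimately show ?thesis using MI[OF _ a(2,3)] by blast
  qed
qed

lemmas Or = subrD[OF local_ring(1)]
lemmas Mi = ideal_onD[OF local_ring(2)]
lemmas Mm = ideal_on_minus[OF local_ring(1,2)]

lemma emb_M: "emb c : \<M> P ==> c = 0"
proof (rule ccontr)
  assume c: "emb c : \<M> P" "c ~= 0"
  hence "emb (inverse c) * emb c : \<M> P" using Mi(4) local_ring(5) by blast
  thus False using c ef local_ring(3) by simp
qed

lemma unit_iff: "x : \<O> P ==> x : \<M> P \<longleftrightarrow> x = 0 | inverse x ~: \<O> P"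
proof -
  assume x: "x : \<O> P"
  have "inverse x ~: \<O> P" if "x : \<M> P" "x ~= 0"
  proof
   assume "inverse x : \<O> P"
   hence "inverse x * x : \<M> P" using Mi(4) that by blast
   thus False using that local_ring(3) by simp
  qed
  thus ?thesis using x local_ring(4)[OF x] Mi(2) by blast
qed

lemma form_quotient:
  assumes "form d f" "j <= amb C" "P j ~= 0"
  shows "eX f / Xg j ^ d : \<O> P" "eX f / Xg j ^ d : \<M> P \<longleftrightarrow> ev P f = 0" "Xg j ~= 0"
proof -
  define v where "v = (single (single j 1) 1 :: (nat, 'a) mpol)"
  have v: "form 1 v" "eX v = Xg j" "ev P v = P j"
   using forms_var[OF assms(2)] by (auto simp: v_def evh_single[OF emb] eh ev_evh evh_single[OF is_hom_id] simp del: One_nat_def)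
  have vd: "form d (v ^ d)" "eX (v ^ d) = Xg j ^ d" "ev P (v ^ d) ~= 0"
   using forms_power[OF v(1), of d] v assms(3) by (auto simp: xh vh)
  show "Xg j ~= 0" using eX_nonzero[OF P v(1)] v assms(3) by auto
  show O: "eX f / Xg j ^ d : \<O> P" unfolding regular_def using assms(1) vd by force
  show "eX f / Xg j ^ d : \<M> P \<longleftrightarrow> ev P f = 0"
  proof
   assume "eX f / Xg j ^ d : \<M> P"
   then obtain f' g' d' where a: "form d' f'" "form d' g'" "ev P g' ~= 0" "eX f / Xg j ^ d = eX f' / eX g'" "ev P f' = 0"
    unfolding vanishing_def by blast
   thus "ev P f = 0" using local_value[OF assms(1) vd(1,3) a(1-3)] vd(2) by simp
  next
   assume "ev P f = 0"
   thus "eX f / Xg j ^ d : \<M> P" unfolding vanishing_def using assms(1) vd by force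
  qed
qed

context
  fixes j assumes j: "j <= amb C" "P j = 1"
begin

definition u :: "nat => 'b" where "u i = Xg i / Xg j"

lemma u: "u i : \<O> P" "u i - emb (P i) : \<M> P" "u j = 1" "i > amb C ==> u i = 0" "Xg j ~= 0"
proof -
  show Xj: "Xg j ~= 0" by (rule form_quotient(3)[OF forms_one j(1)]) (use j in simp)
  thus "u j = 1" by (simp add: u_def)
  show z: "i > amb C ==> u i = 0" for i by (simp add: u_def Xg)
  show "u i : \<O> P" "u i - emb (P i) : \<M> P"
  proof -
   have "u i : \<O> P & u i - emb (P i) : \<M> P"
   proof (cases "i <= amb C")
    case True
    define v where "v k = (single (single k 1) 1 :: (nat, 'a) mpol)" for k
    have v: "form 1 (v k)" "eX (v k) = Xg k" "ev P (v k) = P k" if "k <= amb C" for k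
     using forms_var[OF that] by (auto simp: v_def evh_single[OF emb] eh ev_evh evh_single[OF is_hom_id] simp del: One_nat_def)
    have "eX (v i) / Xg j ^ 1 : \<O> P" by (rule form_quotient(1)[OF v(1)[OF True] j(1)]) (use j in simp)
    moreover have "form 1 (v i - single 0 (P i) * v j)" by (intro forms_minus' forms_const_mult v(1) True j)
    from form_quotient(2)[OF this j(1)] have "(Xg i - emb (P i) * Xg j) / Xg j : \<M> P"
     using True j v by (simp add: xh vh evh_single[OF emb]) (simp add: ev_evh evh_single[OF is_hom_id])
    ultimately show ?thesis using v(2)[OF True] Xj by (simp add: u_def diff_divide_distrib)
   next
    case False
    thus ?thesis using z[of i] P Or(1) Mi(2) eh by (simp add: cone_iff)
   qed
   thus "u i : \<O> P" "u i - emb (P i) : \<M> P" by auto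
  qed
qed

lemma eX_u: "form d f ==> eX f = Xg j ^ d * evh emb u f"
proof -
  have "Xg = (%i. Xg j * u i)" using u(5) by (auto simp: u_def)
  thus "form d f ==> eX f = Xg j ^ d * evh emb u f" using evh_forms_scale[of f UNIV "amb C" d emb "Xg j" u] by simp
qed

text \<open>An exact first-order expansion around \<open>P\<close>: higher terms are absorbed into
  the coefficients \<open>A\<close>, whose residues are the partial derivatives.\<close>

lemma taylor_mono:
  fixes \<mu> :: "nat \<Rightarrow>\<^sub>0 nat"
  assumes "keys \<mu> \<subseteq> {..amb C}"
  shows "EX A. (ALL v. A v : \<O> P & A v - emb (dmev v P \<mu>) : \<M> P) &
   mev u \<mu> = emb (mev P \<mu>) + (\<Sum>v\<le>amb C. A v * (u v - emb (P v)))"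
proof (induction \<mu> rule: mono_induct)
  case zero
  thus ?case using Or(1) Mi(2) by (intro exI[of _ "%_. 0"]) (auto simp: eh)
next
  case (step w \<nu>)
  have w: "w <= amb C" using step(1) assms by auto
  obtain A where A: "!!v. A v : \<O> P" "!!v. A v - emb (dmev v P \<nu>) : \<M> P"
   "mev u \<nu> = emb (mev P \<nu>) + (\<Sum>v\<le>amb C. A v * (u v - emb (P v)))" using step.IH by auto
  define B where "B v = (if w = v then mev u \<nu> else 0) + emb (P w) * A v" for v
  have s: "(\<Sum>v\<le>amb C. A v * (u v - emb (P v))) : \<M> P" by (intro ideal_on_sum[OF local_ring(2)] Mi(4) A u)
  have mO: "mev u \<nu> : \<O> P" unfolding A(3) using Or(3) local_ring(5) Mi(5)[OF s] by blast
  have md: "mev u \<nu> - emb (mev P \<nu>) : \<M> P" unfolding A(3) using s by simp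
  have "B v : \<O> P" for v unfolding B_def using mO Or A(1) local_ring(5) by auto
  moreover have "B v - emb (dmev v P (single w 1 + \<nu>)) : \<M> P" for v
  proof -
   have "B v - emb (dmev v P (single w 1 + \<nu>)) =
     (if w = v then mev u \<nu> - emb (mev P \<nu>) else 0) + emb (P w) * (A v - emb (dmev v P \<nu>))"
    unfolding dmev_step by (simp add: B_def eh algebra_simps)
   moreover have "... : \<M> P" by (intro Mi(3) Mi(4) A local_ring(5)) (use md Mi(2) in auto)
   ultimately show ?thesis by simp
  qed
  moreover have "mev u (single w 1 + \<nu>) = emb (mev P (single w 1 + \<nu>)) + (\<Sum>v\<le>amb C. B v * (u v - emb (P v)))"
  proof -
   have "(\<Sum>v\<le>amb C. B v * (u v - emb (P v))) =
     (\<Sum>v\<le>amb C. (if w = v then mev u \<nu> * (u v - emb (P v)) else 0) + emb (P w) * (A v * (u v - emb (P v))))"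
    by (rule sum.cong) (auto simp: B_def algebra_simps)
   also have "... = mev u \<nu> * (u w - emb (P w)) + emb (P w) * (\<Sum>v\<le>amb C. A v * (u v - emb (P v)))"
    using w by (simp add: sum.distrib sum_distrib_left)
   also have "(\<Sum>v\<le>amb C. A v * (u v - emb (P v))) = mev u \<nu> - emb (mev P \<nu>)" using A(3) by simp
   finally have e: "(\<Sum>v\<le>amb C. B v * (u v - emb (P v))) =
     mev u \<nu> * (u w - emb (P w)) + emb (P w) * (mev u \<nu> - emb (mev P \<nu>))" .
   have "mev u (single w 1 + \<nu>) = u w * mev u \<nu>" "emb (mev P (single w 1 + \<nu>)) = emb (P w) * emb (mev P \<nu>)"
    by (simp_all only: mev_add mev_single power_one_right eh(3))
   thus ?thesis unfolding e by (simp only:) (simp add: algebra_simps)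
  qed
  ultimately show ?case by blast
qed

lemma taylor:
  assumes "f : polys UNIV {..amb C}"
  shows "EX A. (ALL v. A v : \<O> P & A v - emb (ev_deriv v P f) : \<M> P) &
   evh emb u f = emb (ev P f) + (\<Sum>v\<le>amb C. A v * (u v - emb (P v)))"
proof -
  let ?K = "keys f" and ?c = "lookup f"
  have "ALL \<mu>:?K. EX A. (ALL v. A v : \<O> P & A v - emb (dmev v P \<mu>) : \<M> P) &
   mev u \<mu> = emb (mev P \<mu>) + (\<Sum>v\<le>amb C. A v * (u v - emb (P v)))"
   using assms by (intro ballI taylor_mono) (auto simp: polys_def)
  from bchoice[OF this] obtain A where A0: "ALL \<mu>:?K. (ALL v. A \<mu> v : \<O> P & A \<mu> v - emb (dmev v P \<mu>) : \<M> P) &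
   mev u \<mu> = emb (mev P \<mu>) + (\<Sum>v\<le>amb C. A \<mu> v * (u v - emb (P v)))" by blast
  have A: "!!\<mu> v. \<mu> : ?K ==> A \<mu> v : \<O> P & A \<mu> v - emb (dmev v P \<mu>) : \<M> P"
   "!!\<mu>. \<mu> : ?K ==> mev u \<mu> = emb (mev P \<mu>) + (\<Sum>v\<le>amb C. A \<mu> v * (u v - emb (P v)))" using A0 by blast+
  define B where "B v = (\<Sum>\<mu>\<in>?K. emb (?c \<mu>) * A \<mu> v)" for v
  have "B v : \<O> P" for v unfolding B_def by (intro Or(8) Or(4) local_ring(5)) (use A in auto)
  moreover have "B v - emb (ev_deriv v P f) : \<M> P" for v
  proof -
   have "B v - emb (ev_deriv v P f) = (\<Sum>\<mu>\<in>?K. emb (?c \<mu>) * (A \<mu> v - emb (dmev v P \<mu>)))"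
    by (simp add: B_def ev_deriv_dmev eh right_diff_distrib sum_subtractf)
   also have "... : \<M> P" by (intro ideal_on_sum[OF local_ring(2)] Mi(4) local_ring(5)) (use A in auto)
   finally show ?thesis .
  qed
  moreover have "evh emb u f = emb (ev P f) + (\<Sum>v\<le>amb C. B v * (u v - emb (P v)))"
  proof -
   have "evh emb u f = (\<Sum>\<mu>\<in>?K. emb (?c \<mu>) * (emb (mev P \<mu>) + (\<Sum>v\<le>amb C. A \<mu> v * (u v - emb (P v)))))"
    unfolding evh_def by (rule sum.cong) (auto simp: A(2))
   also have "... = emb (ev P f) + (\<Sum>\<mu>\<in>?K. \<Sum>v\<le>amb C. emb (?c \<mu>) * A \<mu> v * (u v - emb (P v)))"
    by (simp add: ring_distribs sum.distrib ev_evh evh_def eh sum_distrib_left mult.assoc)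
   also have "(\<Sum>\<mu>\<in>?K. \<Sum>v\<le>amb C. emb (?c \<mu>) * A \<mu> v * (u v - emb (P v))) = (\<Sum>v\<le>amb C. B v * (u v - emb (P v)))"
    unfolding B_def sum_distrib_right by (rule sum.swap)
   finally show ?thesis .
  qed
  ultimately show ?thesis by blast
qed

text \<open>By the Taylor expansion every function vanishing at \<open>P\<close> is a combination of
  the coordinate differences. The equations \<open>fs\<close> provide one relation fewer than there
  are differences besides the \<open>j\<close>-th, with the Jacobian matrix as residue matrix, so
  \<open>eliminate\<close> leaves a single generator.\<close>

lemma principal_aux: "EX i<=amb C. \<M> P = (%w. w * (u i - emb (P i))) ` \<O> P"
proof -
  obtain R where R: "smooth_at R C 1 (UNIV, {0}) P" using smooth[OF P] by blast
  obtain fs where fs: "length fs + 1 = amb C" "set fs \<subseteq> ideal_of R C \<inter> (\<Union>e. forms R (amb C) e)"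
   and ind: "ALL c. range c \<subseteq> UNIV & (ALL k<=amb C. (\<Sum>i<length fs. c i * ev_deriv k P (fs ! i)) : {0}) -->
    (ALL i<length fs. c i : {0})" using R unfolding smooth_at_def prod.case by (elim exE conjE) (rule that)
  have indep: "ALL i<length fs. c i = 0" if "ALL k<=amb C. (\<Sum>i<length fs. c i * ev_deriv k P (fs ! i)) = 0" for c
   using ind[rule_format, of c] that by simp
  have fsd: "EX d. form d (fs ! i)" if "i < length fs" for i using fs(2) nth_mem[OF that] forms_UNIV by blast
  have fs0: "ev Q (fs ! i) = 0" if i: "i < length fs" and Q: "Q : cone C" for i Q
  proof -
   have "fs ! i : ideal_of R C" using fs(2) nth_mem[OF i] by blast
   then obtain c where "fs ! i = (\<Sum>h\<in>eqs C. c h * h)" by (auto simp: ideal_of_def)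
   thus ?thesis using Q by (simp add: vh cone_iff)
  qed
  have fsX: "evh emb u (fs ! i) = 0" if i: "i < length fs" for i
  proof -
   obtain d where d: "form d (fs ! i)" using fsd[OF i] by blast
   hence "eX (fs ! i) = 0" using generic fs0[OF i] by blast
   thus ?thesis using eX_u[OF d] u(5) by simp
  qed
  have "ALL i:{..<length fs}. EX A. (ALL v. A v : \<O> P & A v - emb (ev_deriv v P (fs ! i)) : \<M> P) &
   0 = (\<Sum>v\<le>amb C. A v * (u v - emb (P v)))"
  proof
   fix i assume "i : {..<length fs}"
   hence i: "i < length fs" by simp
   obtain d where d: "form d (fs ! i)" using fsd[OF i] by blast
   from taylor[OF forms_polys[OF d]] show "EX A. (ALL v. A v : \<O> P & A v - emb (ev_deriv v P (fs ! i)) : \<M> P) &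
    0 = (\<Sum>v\<le>amb C. A v * (u v - emb (P v)))" unfolding fsX[OF i] fs0[OF i P] by (simp add: eh)
  qed
  from bchoice[OF this] obtain A where A0: "ALL i:{..<length fs}. (ALL v. A i v : \<O> P & A i v - emb (ev_deriv v P (fs ! i)) : \<M> P) &
   0 = (\<Sum>v\<le>amb C. A i v * (u v - emb (P v)))" by blast
  have A: "!!i v. i < length fs ==> A i v : \<O> P & A i v - emb (ev_deriv v P (fs ! i)) : \<M> P"
   "!!i. i < length fs ==> 0 = (\<Sum>v\<le>amb C. A i v * (u v - emb (P v)))" using A0 by auto
  let ?J = "{..amb C} - {j}"
  let ?z = "%v. u v - emb (P v)"
  have zj: "?z j = 0" using u(3) j by (simp add: eh)
  have sJ: "(\<Sum>v\<le>amb C. B v * ?z v) = (\<Sum>v\<in>?J. B v * ?z v)" for B using j zj by (subst sum.remove[of _ j]) auto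
  have "EX k:?J. ALL i:?J. EX w:\<O> P. ?z i = w * ?z k"
  proof (rule eliminate[OF emb local_ring(1,2,4,5,3), where r = "length fs"
     and A = A and a = "%i v. ev_deriv v P (fs ! i)"])
   show "card ?J = Suc (length fs)" using fs(1) j by simp
   show "A i k : \<O> P & A i k - emb (ev_deriv k P (fs ! i)) : \<M> P" if "i < length fs" for i k
    using A(1)[OF that] by blast
   show "(\<Sum>k\<in>?J. A i k * ?z k) = 0" if "i < length fs" for i using A(2)[OF that] sJ by metis
   show "ALL i<length fs. c i = 0" if c: "ALL k:?J. (\<Sum>i<length fs. c i * ev_deriv k P (fs ! i)) = 0" for c
   proof (rule indep)
    \<comment> \<open>Euler's identity expresses column \<open>j\<close> of the Jacobian matrix
      through the others, so the rows stay independent when it is omitted.\<close>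
    have eul: "(\<Sum>v\<in>?J. P v * ev_deriv v P (fs ! i)) = - ev_deriv j P (fs ! i)" if i: "i < length fs" for i
    proof -
     obtain d where d: "form d (fs ! i)" using fsd[OF i] by blast
     have "(\<Sum>v\<le>amb C. P v * ev_deriv v P (fs ! i)) = 0" using euler_identity[OF d, of P] fs0[OF i P] by simp
     thus ?thesis using j by (subst (asm) sum.remove[of _ j]) (auto simp: eq_neg_iff_add_eq_0 add.commute)
    qed
    have "(\<Sum>i<length fs. c i * ev_deriv j P (fs ! i)) = - (\<Sum>i<length fs. c i * (\<Sum>v\<in>?J. P v * ev_deriv v P (fs ! i)))"
     by (simp add: eul flip: sum_negf)
    also have "... = - (\<Sum>v\<in>?J. P v * (\<Sum>i<length fs. c i * ev_deriv v P (fs ! i)))"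
     unfolding sum_distrib_left by (subst sum.swap) (simp add: mult_ac)
    also have "... = 0" using c by simp
    finally show "ALL k<=amb C. (\<Sum>i<length fs. c i * ev_deriv k P (fs ! i)) = 0" using c by auto
   qed
   show "finite ?J" by (rule finite_Diff) simp
  qed
  then obtain k where k0: "k : ?J" "ALL i:?J. EX w. w : \<O> P & ?z i = w * ?z k" by blast
  from bchoice[OF k0(2)] obtain w where "ALL i:?J. w i : \<O> P & ?z i = w i * ?z k" by blast
  hence k: "k : ?J" "!!i. i : ?J ==> w i : \<O> P & ?z i = w i * ?z k" using k0(1) by blast+
  have "\<M> P = (%w. w * ?z k) ` \<O> P"
  proof
   show "(%w. w * ?z k) ` \<O> P \<subseteq> \<M> P" using Mi(4) u(2) by auto
   show "\<M> P \<subseteq> (%w. w * ?z k) ` \<O> P"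
   proof
    fix x assume "x : \<M> P"
    then obtain f g d where a: "form d f" "form d g" "ev P g ~= 0" "x = eX f / eX g" "ev P f = 0"
     unfolding vanishing_def by blast
    obtain B where B: "!!v. B v : \<O> P" "evh emb u f = (\<Sum>v\<le>amb C. B v * ?z v)"
     using taylor[OF forms_polys[OF a(1)]] a(5) by (auto simp: eh)
    have "B v * ?z v = B v * w v * ?z k" if "v : ?J" for v using k(2)[OF that] by (simp only: mult.assoc)
    hence "(\<Sum>v\<in>?J. B v * ?z v) = (\<Sum>v\<in>?J. B v * w v * ?z k)" by (rule sum.cong[OF refl])
    hence "evh emb u f = (\<Sum>v\<in>?J. B v * w v) * ?z k" by (simp only: B(2) sJ sum_distrib_right)
    moreover have "x = (1 / evh emb u g) * evh emb u f"
     unfolding a(4) eX_u[OF a(1)] eX_u[OF a(2)] using u(5) by simp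
    moreover have "1 / evh emb u g : \<O> P"
    proof -
     have "eX g / Xg j ^ d : \<O> P" "eX g / Xg j ^ d ~: \<M> P"
      using form_quotient(1,2)[OF a(2) j(1)] j(2) a(3) by auto
     moreover have "eX g / Xg j ^ d = evh emb u g" using eX_u[OF a(2)] u(5) by simp
     ultimately show ?thesis using local_ring(4) by (simp add: inverse_eq_divide)
    qed
    moreover have "(\<Sum>v\<in>?J. B v * w v) : \<O> P" by (intro Or(8) Or(4) B) (use k in auto)
    ultimately have e: "x = (1 / evh emb u g * (\<Sum>v\<in>?J. B v * w v)) * ?z k"
     and p: "1 / evh emb u g * (\<Sum>v\<in>?J. B v * w v) : \<O> P" using Or(4) by (simp_all only: mult.assoc)
    show "x : (%w. w * ?z k) ` \<O> P" using e p by blast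
   qed
  qed
  thus ?thesis using k(1) by auto
qed

end
end

end

section \<open>Uniformisers and orders at the points of the curve\<close>

context function_field
begin

lemma normalised_coordinate:
  assumes "P : points C" shows "EX j<=amb C. P j = 1" "P : cone C" "normalise P = P"
proof -
  show c: "P : cone C" "normalise P = P" using points_iff[OF proj] assms by auto
  then obtain i where i: "i <= amb C" "P i ~= 0" by (auto simp: cone_iff)
  define j where "j = (LEAST j. P j ~= 0)"
  have "P j ~= 0" unfolding j_def using i(2) by (rule LeastI)
  moreover have "P j = P j / P j" using fun_cong[OF c(2), of j] by (simp add: normalise_def j_def)
  moreover have "j <= amb C" using c(1) \<open>P j ~= 0\<close> by (metis cone_iff not_le)
  ultimately show "EX j<=amb C. P j = 1" by auto
qed

lemma ring_scale: "c ~= 0 ==> \<O> (%i. c * P i) = \<O> P" "c ~= 0 ==> \<M> (%i. c * P i) = \<M> P"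
proof -
  assume c: "c ~= 0"
  have "ev (%i. c * P i) f = 0 \<longleftrightarrow> ev P f = 0" if "form d f" for d f
   using evh_forms_scale[OF that, of "%a. a" c P] c by (simp add: ev_evh)
  note e = this
  show "\<O> (%i. c * P i) = \<O> P" unfolding regular_def using e by blast
  show "\<M> (%i. c * P i) = \<M> P" unfolding vanishing_def using e by blast
qed

lemma M_eq: assumes P: "P : cone C" shows "\<M> P = {x : \<O> P. x = 0 | inverse x ~: \<O> P}"
  using unit_iff[OF P] Mi(5)[OF P] by blast

text \<open>An element of the function field, in contrast to the form called
  \<open>uniformizer\<close> in the definitions; \<open>uniformizer_iff\<close> relates the
  two.\<close>

definition uniformiser :: "(nat => 'a) => 'b => bool" where "uniformiser P t \<longleftrightarrow> t ~= 0 & \<M> P = (%w. w * t) ` \<O> P"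

text \<open>A zero generator would make every local function constant, hence the coordinate ratios
  and all of \<open>F\<close>, contrary to \<open>nontrivial\<close>. The generator comes from a
  linear form \<open>L\<close>, as the comparison with vanishing orders of forms requires.\<close>

lemma principal:
  assumes P: "P : points C"
  shows "EX L. form 1 L & ev P L = 0 & (ALL j<=amb C. P j = 1 --> uniformiser P (eX L / Xg j))"
proof -
  note c = normalised_coordinate[OF P]
  obtain j where j: "j <= amb C" "P j = 1" using c(1) by blast
  note uu = u[OF c(2) j]
  obtain i where i: "i <= amb C" "\<M> P = (%w. w * (Xg i / Xg j - emb (P i))) ` \<O> P"
   using principal_aux[OF c(2) j] unfolding u_def[OF c(2) j] by blast
  define L where "L = single (single i 1) 1 - single 0 (P i) * (single (single j 1) 1 :: (nat, 'a) mpol)"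
  have L: "form 1 L" unfolding L_def by (intro forms_minus' forms_const_mult forms_var i j)
  have eL: "eX L = Xg i - emb (P i) * Xg j" by (simp add: L_def xh evh_single[OF emb] eh del: One_nat_def)
  have vL: "ev P L = 0"
   by (simp add: L_def vh del: One_nat_def) (simp add: ev_evh evh_single[OF is_hom_id] j(2) del: One_nat_def)
  have nz: "eX L ~= 0"
  proof
   assume "eX L = 0"
   hence M0: "\<M> P = {0}" using i(2) eL uu(5) Or(1)[OF c(2)] by (auto simp: image_iff field_simps)
   have "x : range emb" if x: "x : \<O> P" for x using local_ring(7)[OF c(2) x] M0 by auto
   hence uc: "!!k. Xg k / Xg j : range emb" using uu(1) unfolding u_def[OF c(2) j] by blast
   have closed: "evh emb (%k. Xg k / Xg j) f : range emb" if "form d f" for d f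
   proof (rule evh_closed[OF forms_polys[OF that]])
    show "0 : range emb" "1 : range emb" using eh(4) eh(1) by (metis rangeI)+
   next
    fix a b assume "a : range emb" "b : range emb"
    then obtain a' b' where "a = emb a'" "b = emb b'" by auto
    thus "a + b : range emb" "a * b : range emb" using eh(2)[of a' b'] eh(3)[of a' b'] by (metis rangeI)+
   qed (use uc in auto)
   have "F \<subseteq> range emb"
   proof
    fix x assume "x : F"
    then obtain f g d where a: "form d f" "form d g" "eX g ~= 0" "x = eX f / eX g" unfolding quotients by blast
    have "x = evh emb (%k. Xg k / Xg j) f / evh emb (%k. Xg k / Xg j) g"
     using eX_u[OF c(2) j a(1)] eX_u[OF c(2) j a(2)] a(4) uu(5) unfolding u_def[OF c(2) j] by simp
    moreover obtain a' b' where "evh emb (%k. Xg k / Xg j) f = emb a'" "evh emb (%k. Xg k / Xg j) g = emb b'"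
     using closed[OF a(1)] closed[OF a(2)] by blast
    ultimately show "x : range emb" using ef(4)[of a' b'] by (metis rangeI)
   qed
   thus False using nontrivial by blast
  qed
  have "uniformiser P (eX L / Xg k)" if k: "k <= amb C" "P k = 1" for k
  proof -
   have "\<M> P = (%w. w * (eX L / Xg j)) ` \<O> P" using i(2) eL uu(5) by (simp add: diff_divide_distrib)
   moreover have X: "Xg j ~= 0" "Xg k ~= 0" using uu(5) u(5)[OF c(2) k] by auto
   have jk: "Xg j / Xg k : \<O> P" "Xg k / Xg j : \<O> P"
    using u(1)[OF c(2) k, of j] uu(1)[of k] unfolding u_def[OF c(2) k] u_def[OF c(2) j] by auto
   moreover have "(%w. w * (eX L / Xg j)) ` \<O> P = (%w. w * (eX L / Xg k)) ` \<O> P"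
   proof (intro subset_antisym image_subsetI)
    fix w assume w: "w : \<O> P"
    show "w * (eX L / Xg j) : (%w. w * (eX L / Xg k)) ` \<O> P"
     using X by (intro image_eqI[OF _ Or(4)[OF c(2) w jk(2)]]) simp
    show "w * (eX L / Xg k) : (%w. w * (eX L / Xg j)) ` \<O> P"
     using X by (intro image_eqI[OF _ Or(4)[OF c(2) w jk(1)]]) simp
   qed
   ultimately show ?thesis using nz X by (auto simp: uniformiser_def)
  qed
  thus ?thesis using L vL by blast
qed

lemma uniformiser_exists: "P : points C ==> EX t. uniformiser P t" using principal normalised_coordinate(1) by blast

definition pev :: "'b => 'a poly => 'b" where "pev x r = poly (map_poly emb r) x"

lemma pev_hom: "is_hom (pev x)"
  unfolding pev_def[abs_def] using is_hom_comp[OF is_hom_poly is_hom_map_poly[OF emb]] .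

lemma pev_pCons: "pev x (pCons a r) = emb a + x * pev x r" by (simp add: pev_def map_poly_pCons eh)

lemma pev_const: "pev x [:a:] = emb a" by (simp add: pev_def map_poly_pCons eh)

lemma pev_in: "subr V ==> range emb \<subseteq> V ==> x : V ==> pev x r : V"
  unfolding pev_def by (rule subr_poly) (auto simp: coeff_map_poly eh)

text \<open>A relation of least degree in \<open>w\<close> has a nonzero constant term; otherwise it
  could be divided by \<open>w\<close>.\<close>

lemma dependence_nonzero:
  assumes "x : F" "w : F" "w ~= 0"
  shows "EX Q. coeff Q 0 ~= 0 & bev (pev x) w Q = 0"
proof -
  obtain Q0 where "Q0 ~= 0 & bev (pev x) w Q0 = 0" using dependence[OF assms(1,2)] by (auto simp: pev_def[abs_def])
  then obtain Q where Q: "Q ~= 0 & bev (pev x) w Q = 0"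
   and min: "!!Q'. Q' ~= 0 & bev (pev x) w Q' = 0 ==> degree Q <= degree Q'"
   using ex_has_least_nat[of "%Q. Q ~= 0 & bev (pev x) w Q = 0" Q0 degree] by blast
  obtain a Q' where Q': "Q = pCons a Q'" by (cases Q)
  have "a ~= 0"
  proof
   assume "a = 0"
   hence "Q' ~= 0" "bev (pev x) w Q' = 0"
    using Q assms(3) by (auto simp: Q' bev_pCons[OF pev_hom] is_homD(4)[OF pev_hom])
   thus False using min[of Q'] by (simp add: Q')
  qed
  thus ?thesis using Q by (intro exI[of _ Q]) (simp add: Q')
qed

lemma poly_split: "c ~= 0 ==> EX n d. coeff d 0 ~= 0 & c = monom 1 n * (d :: 'a poly)"
proof (induction c)
  case (pCons a c)
  show ?case
  proof (cases "a = 0")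
   case True
   then obtain n d where "coeff d 0 ~= 0" "c = monom 1 n * d" using pCons by auto
   thus ?thesis using True by (intro exI[of _ "Suc n"] exI[of _ d]) (simp add: monom_Suc)
  qed (auto intro!: exI[of _ 0] exI[of _ "pCons a c"])
qed simp

text \<open>\<open>x\<close> is algebraic over the field generated by the uniformiser.\<close>

lemma order_bounded:
  assumes P: "P : points C" and t: "uniformiser P t" and x: "x : \<O> P" "x ~= 0"
  shows "EX n. x ~: (%w. w * t ^ n) ` \<O> P"
proof (rule ccontr)
  assume "\<nexists>n. x ~: (%w. w * t ^ n) ` \<O> P"
  hence all: "!!n. EX w:\<O> P. x = w * t ^ n" by auto
  note c = normalised_coordinate[OF P]
  have tM: "t : \<M> P" "t ~= 0" using t Or(2)[OF c(2)] unfolding uniformiser_def by (auto simp: image_iff)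
  have tO: "t : \<O> P" by (rule Mi(5)[OF c(2) tM(1)])
  have rO: "range emb \<subseteq> \<O> P" using local_ring(5)[OF c(2)] by auto
  have "t : F" "x : F" using tO x(1) local_ring(6)[OF c(2)] by auto
  then obtain Q where Q: "coeff Q 0 ~= 0" "bev (pev t) x Q = 0" using dependence_nonzero x(2) by blast
  obtain c0 Q' where Q': "Q = pCons c0 Q'" by (cases Q)
  have "c0 ~= 0" using Q(1) Q' by simp
  from poly_split[OF this] obtain n d where d: "coeff d 0 ~= 0" "c0 = monom 1 n * d" by blast
  obtain a d' where ad: "d = pCons a d'" by (cases d)
  \<comment> \<open>One more power of \<open>t\<close> than divides the constant term
    \<open>c0\<close> at \<open>t\<close>: cancelling \<open>t ^ n\<close> in the relation puts the
    nonzero constant \<open>a\<close> into the maximal ideal.\<close>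
  obtain w where w: "w : \<O> P" "x = w * t ^ Suc n" using all by blast
  have bO: "bev (pev t) x Q' : \<O> P" unfolding bev_def by (rule subr_poly[OF local_ring(1)[OF c(2)] _ x(1)])
    (simp add: coeff_map_poly is_homD(4)[OF pev_hom] pev_in[OF local_ring(1)[OF c(2)] rO tO])
  have "pev t c0 = t ^ n * (emb a + t * pev t d')"
   unfolding d(2) is_homD(3)[OF pev_hom] ad pev_pCons by (simp add: pev_def map_poly_monom eh poly_monom)
  moreover have "pev t c0 + x * bev (pev t) x Q' = 0" using Q(2) by (simp add: Q' bev_pCons[OF pev_hom])
  ultimately have "t ^ n * (emb a + t * (pev t d' + w * bev (pev t) x Q')) = 0" by (simp add: w(2) algebra_simps)
  hence "emb a + t * (pev t d' + w * bev (pev t) x Q') = 0" using tM(2) by simp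
  hence "emb a = - (t * (pev t d' + w * bev (pev t) x Q'))" by (simp only: eq_neg_iff_add_eq_0)
  hence "emb a = - (pev t d' + w * bev (pev t) x Q') * t" by (simp only: mult.commute[of t] minus_mult_left)
  moreover have "- (pev t d' + w * bev (pev t) x Q') : \<O> P"
   by (intro Or(5)[OF c(2)] Or(3)[OF c(2)] Or(4)[OF c(2)] w bO pev_in[OF local_ring(1)[OF c(2)] rO tO])
  ultimately have "emb a : \<M> P" using Mi(4)[OF c(2) _ tM(1)] by metis
  hence "a = 0" by (rule emb_M[OF c(2)])
  thus False using d(1) ad by simp
qed

lemma regular_factor:
  assumes P: "P : points C" and t: "uniformiser P t" and x: "x : \<O> P" "x ~= 0"
  shows "EX n w. w : \<O> P & w ~: \<M> P & x = t ^ n * w"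
proof -
  note c = normalised_coordinate[OF P]
  obtain n where n: "x ~: (%w. w * t ^ n) ` \<O> P" using order_bounded[OF assms] by blast
  define N where "N = (LEAST n. x ~: (%w. w * t ^ n) ` \<O> P)"
  have N: "x ~: (%w. w * t ^ N) ` \<O> P" unfolding N_def using n by (rule LeastI)
  have "x : (%w. w * t ^ 0) ` \<O> P" using x(1) by (auto simp: image_iff)
  hence "N ~= 0" using N by metis
  then obtain k where k: "N = Suc k" by (cases N) auto
  have "x : (%w. w * t ^ k) ` \<O> P" using not_less_Least[of k "%n. x ~: (%w. w * t ^ n) ` \<O> P"] k by (auto simp: N_def)
  then obtain w where w: "w : \<O> P" "x = w * t ^ k" by blast
  have "w ~: \<M> P"
  proof
   assume "w : \<M> P"
   then obtain v where "v : \<O> P" "w = v * t" using t by (auto simp: uniformiser_def)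
   thus False using N w k by (auto simp: image_iff mult_ac)
  qed
  thus ?thesis using w by (auto simp: mult.commute)
qed

lemma unit_mult:
  assumes P: "P : cone C" and "x : \<O> P" "x ~: \<M> P" "w : \<O> P" "w ~: \<M> P"
  shows "x * w : \<O> P" "x * w ~: \<M> P" "inverse x : \<O> P" "inverse x ~: \<M> P" "x ~= 0"
proof -
  have i: "inverse x : \<O> P" "inverse w : \<O> P" "x ~= 0" "w ~= 0" using local_ring(4)[OF P] Mi(2)[OF P] assms by auto
  thus "inverse x : \<O> P" "x ~= 0" by auto
  show "x * w : \<O> P" using Or(4)[OF P] assms by blast
  show "x * w ~: \<M> P" using M_eq[OF P] i Or(4)[OF P i(1,2)] by auto
  show "inverse x ~: \<M> P" using M_eq[OF P] i assms by auto
qed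

lemma factor:
  assumes P: "P : points C" and t: "uniformiser P t" and x: "x : F" "x ~= 0"
  shows "EX n::int. EX w. w : \<O> P & w ~: \<M> P & x = t powi n * w"
proof -
  note c = normalised_coordinate[OF P]
  obtain j where j: "j <= amb C" "P j = 1" using c(1) by blast
  obtain f g d where a: "form d f" "form d g" "eX g ~= 0" "x = eX f / eX g" using x(1) unfolding quotients by blast
  have Xj: "Xg j ~= 0" using u(5)[OF c(2) j] .
  have "eX f / Xg j ^ d : \<O> P" "eX f / Xg j ^ d ~= 0" "eX g / Xg j ^ d : \<O> P" "eX g / Xg j ^ d ~= 0"
   using form_quotient(1)[OF c(2) _ j(1)] a j x(2) Xj by auto
  then obtain n w n' w' where w: "w : \<O> P" "w ~: \<M> P" "eX f / Xg j ^ d = t ^ n * w"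
   "w' : \<O> P" "w' ~: \<M> P" "eX g / Xg j ^ d = t ^ n' * w'" using regular_factor[OF P t] by metis
  have t0: "t ~= 0" using t by (simp add: uniformiser_def)
  have "x = (eX f / Xg j ^ d) / (eX g / Xg j ^ d)" using a(4) Xj by simp
  also have "... = t powi (int n - int n') * (w * inverse w')"
   unfolding w(3) w(6) using t0 by (simp add: power_int_diff field_simps)
  finally have "x = t powi (int n - int n') * (w * inverse w')" .
  moreover have "w * inverse w' : \<O> P" "w * inverse w' ~: \<M> P"
   using unit_mult[OF c(2) w(1,2) unit_mult(3,4)[OF c(2) w(4,5) w(4,5)]] by auto
  ultimately show ?thesis by blast
qed

text \<open>Two uniformisers differ by a unit, so comparison of the two sides makes a power of one
  of them a unit, which forces exponent 0.\<close>

lemma factor_unique: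
  assumes P: "P : points C" and t: "uniformiser P t" "uniformiser P t'"
   and w: "w : \<O> P" "w ~: \<M> P" "w' : \<O> P" "w' ~: \<M> P" and e: "t powi n * w = t' powi n' * w'"
  shows "n = n'"
proof -
  note c = normalised_coordinate[OF P]
  have t0: "t ~= 0" "t' ~= 0" using t by (auto simp: uniformiser_def)
  have tM: "t : \<M> P" "t' : \<M> P" using t Or(2)[OF c(2)] unfolding uniformiser_def by (auto simp: image_iff)
  obtain v where v: "v : \<O> P" "t' = v * t" using tM(2) t(1) by (auto simp: uniformiser_def)
  obtain v' where v': "v' : \<O> P" "t = v' * t'" using tM(1) t(2) by (auto simp: uniformiser_def)
  have "v' * v = 1" using v v' t0 by (metis mult.assoc mult_cancel_right1)
  hence vn: "v ~: \<M> P" using Mi(4)[OF c(2) v'(1), of v] local_ring(3)[OF c(2)] by auto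
  have unit_pow: "v powi k : \<O> P & v powi k ~: \<M> P" for k :: int
  proof -
   have "v ^ n : \<O> P & v ^ n ~: \<M> P" for n
    by (induction n) (use Or(2)[OF c(2)] local_ring(3)[OF c(2)] unit_mult[OF c(2) v(1) vn] in auto)
   moreover hence "inverse (v ^ n) : \<O> P & inverse (v ^ n) ~: \<M> P" for n using unit_mult(3,4)[OF c(2)] by blast
   ultimately show ?thesis by (simp add: power_int_def power_inverse)
  qed
  define r where "r = v powi n' * w' * inverse w"
  have w0: "w ~= 0" "v ~= 0" using w vn Mi(2)[OF c(2)] by auto
  have r: "r : \<O> P" "r ~: \<M> P" unfolding r_def using unit_mult[OF c(2)] unit_pow[of n'] w by (metis)+
  have "t powi n = t powi n' * r"
   using e w0 t0 unfolding v(2) r_def by (simp add: power_int_mult_distrib field_simps)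
  hence "t powi (n - n') = r" using t0 by (simp add: power_int_diff field_simps)
  moreover have "t powi k : \<M> P" if kp: "k > 0" for k :: int
  proof -
   have "nat k = Suc (nat k - 1)" using kp by simp
   then obtain i where "nat k = Suc i" by blast
   hence "t powi k = t ^ i * t" using kp by (simp add: power_int_def)
   thus ?thesis using Mi(4)[OF c(2) Or(7)[OF c(2) Mi(5)[OF c(2) tM(1)]] tM(1)] by metis
  qed
  moreover have "inverse r = t powi (n' - n)" using calculation(1) t0 by (metis minus_diff_eq power_int_minus)
  ultimately show ?thesis using r unit_mult(4)[OF c(2) r r] by (metis diff_gt_0_iff_gt linorder_neqE_linordered_idom)
qed

definition ord :: "(nat => 'a) => 'b => int" where
  "ord P x = (THE n. EX t w. uniformiser P t & w : \<O> P & w ~: \<M> P & x = t powi n * w)"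

lemma ord_eqI:
  assumes "P : points C" "uniformiser P t" "w : \<O> P" "w ~: \<M> P" "x = t powi n * w"
  shows "ord P x = n" unfolding ord_def
proof (rule the_equality)
  show "EX t w. uniformiser P t & w : \<O> P & w ~: \<M> P & x = t powi n * w" using assms by blast
  fix k assume "EX t w. uniformiser P t & w : \<O> P & w ~: \<M> P & x = t powi k * w"
  then obtain t' w' where a: "uniformiser P t'" "w' : \<O> P" "w' ~: \<M> P" "x = t' powi k * w'" by blast
  show "k = n" by (rule factor_unique[OF assms(1) a(1) assms(2) a(2,3) assms(3,4)]) (use a(4) assms(5) in simp)
qed

lemma ord_factor:
  assumes "P : points C" "uniformiser P t" "x : F" "x ~= 0"
  shows "EX w. w : \<O> P & w ~: \<M> P & x = t powi (ord P x) * w"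
proof -
  obtain n w where w: "w : \<O> P" "w ~: \<M> P" and e: "x = t powi n * w"
   using factor[OF assms] by (elim exE conjE) (rule that)
  have "ord P x = n" by (rule ord_eqI[OF assms(1,2) w e])
  thus ?thesis using w e by (intro exI[of _ w]) simp
qed

lemma ord_mult:
  assumes P: "P : points C" and x: "x : F" "x ~= 0" "w : F" "w ~= 0"
  shows "ord P (x * w) = ord P x + ord P w"
proof -
  obtain t where t: "uniformiser P t" using uniformiser_exists[OF P] by blast
  obtain a where a: "a : \<O> P" "a ~: \<M> P" "x = t powi (ord P x) * a" using ord_factor[OF P t x(1,2)] by blast
  obtain b where b: "b : \<O> P" "b ~: \<M> P" "w = t powi (ord P w) * b" using ord_factor[OF P t x(3,4)] by blast
  note c = normalised_coordinate[OF P]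
  have "x * w = (t powi (ord P x) * a) * (t powi (ord P w) * b)" using a(3) b(3) by simp
  also have "... = t powi (ord P x + ord P w) * (a * b)" using t by (simp add: power_int_add uniformiser_def)
  finally show ?thesis by (rule ord_eqI[OF P t unit_mult(1,2)[OF c(2) a(1,2) b(1,2)]])
qed

lemma ord_unit: "P : points C ==> x : \<O> P ==> x ~: \<M> P ==> ord P x = 0"
  using uniformiser_exists ord_eqI[of P _ x x 0] by auto

lemma ord_emb: "P : points C ==> c ~= 0 ==> ord P (emb c) = 0"
  using ord_unit local_ring(5) emb_M normalised_coordinate(2) by metis

lemma ord_inverse:
  assumes P: "P : points C" and x: "x : F" "x ~= 0" shows "ord P (inverse x) = - ord P x"
proof -
  have "ord P (x * inverse x) = ord P x + ord P (inverse x)"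
   using ord_mult[OF P x subf_inverse[OF F x(1)]] x(2) by simp
  moreover have "ord P 1 = 0" using ord_emb[OF P, of 1] by (simp add: eh)
  ultimately show ?thesis using x by simp
qed

lemma ord_divide:
  assumes P: "P : points C" and x: "x : F" "x ~= 0" "w : F" "w ~= 0"
  shows "ord P (x / w) = ord P x - ord P w"
  unfolding divide_inverse using ord_mult[OF P x(1,2) subf_inverse[OF F x(3)]] ord_inverse[OF P x(3,4)] x(4) by simp

lemma ord_prod:
  assumes P: "P : points C" and x: "!!i. i : S ==> f i : F" "!!i. i : S ==> f i ~= 0"
  shows "ord P (\<Prod>i\<in>S. f i) = (\<Sum>i\<in>S. ord P (f i))" using x
proof (induction S rule: infinite_finite_induct)
  case (insert i S)
  thus ?case using ord_mult[OF P, of "f i" "\<Prod>i\<in>S. f i"] Fr(9)[of S f] by auto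
qed (use ord_emb[OF P, of 1] in "simp_all add: eh")

lemma ord_power_int:
  assumes P: "P : points C" and x: "x : F" "x ~= 0"
  shows "ord P (x powi n) = n * ord P x" "x powi n : F"
proof -
  have 1: "ord P 1 = 0" using ord_emb[OF P, of 1] by (simp add: eh)
  have p: "ord P (w ^ k) = int k * ord P w" if "w : F" "w ~= 0" for w k
  proof (induction k)
   case (Suc k)
   have "ord P (w * w ^ k) = ord P w + ord P (w ^ k)"
    by (rule ord_mult[OF P that Fr(7)[OF that(1)]]) (use that in simp)
   thus ?case using Suc by (simp add: algebra_simps)
  qed (use 1 in simp)
  show "ord P (x powi n) = n * ord P x"
   using p[OF x] p[of "inverse x" "nat (- n)"] ord_inverse[OF P x] subf_inverse[OF F x(1)] x(2)
   by (auto simp: power_int_def)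
  show "x powi n : F" using Fr(7)[OF x(1)] Fr(7)[OF subf_inverse[OF F x(1)]] by (auto simp: power_int_def)
qed

lemma ord_iff:
  assumes P: "P : points C" and x: "x : F" "x ~= 0"
  shows "ord P x >= 0 \<longleftrightarrow> x : \<O> P" "ord P x > 0 \<longleftrightarrow> x : \<M> P"
proof -
  note c = normalised_coordinate[OF P]
  obtain t where t: "uniformiser P t" using uniformiser_exists[OF P] by blast
  have tM: "t : \<M> P" using t Or(2)[OF c(2)] unfolding uniformiser_def by (auto simp: image_iff)
  have tO: "t : \<O> P" using Mi(5)[OF c(2) tM] .
  have pos: "w : \<M> P" if w: "w : F" "w ~= 0" "ord P w > 0" for w
  proof -
   obtain a where a: "a : \<O> P" "w = t powi (ord P w) * a" using ord_factor[OF P t w(1,2)] by blast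
   obtain i where i: "ord P w = int (Suc i)" using w(3) by (metis gr0_implies_Suc zero_less_imp_eq_int)
   have "w = (t ^ i * a) * t" using a(2) unfolding i power_int_of_nat by (simp add: mult_ac)
   thus ?thesis using Mi(4)[OF c(2) Or(4)[OF c(2) Or(7)[OF c(2) tO] a(1)] tM] by metis
  qed
  have zero: "w : \<O> P & w ~: \<M> P" if w: "w : F" "w ~= 0" "ord P w = 0" for w
   using ord_factor[OF P t w(1,2)] w(3) by auto
  have neg: "w ~: \<O> P" if w: "w : F" "w ~= 0" "ord P w < 0" for w
  proof -
   have "inverse w : \<M> P" using pos[of "inverse w"] ord_inverse[OF P w(1,2)] w subf_inverse[OF F w(1)] by auto
   thus ?thesis using M_eq[OF c(2)] w(2) by auto
  qed
  show "ord P x >= 0 \<longleftrightarrow> x : \<O> P" using pos[OF x] zero[OF x] neg[OF x] Mi(5)[OF c(2)]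
   by (cases "ord P x" "0 :: int" rule: linorder_cases) auto
  show "ord P x > 0 \<longleftrightarrow> x : \<M> P" using pos[OF x] zero[OF x] neg[OF x] Mi(5)[OF c(2)]
   by (cases "ord P x" "0 :: int" rule: linorder_cases) auto
qed

lemma finite_support:
  assumes fin: "!!d f. form d f ==> eX f ~= 0 ==> finite {P:points C. ev P f = 0}" and x: "x : F" "x ~= 0"
  shows "finite {P:points C. ord P x ~= 0}"
proof -
  obtain f g d where a: "form d f" "form d g" "eX g ~= 0" "x = eX f / eX g" using x(1) unfolding quotients by blast
  have "ord P x = 0" if P: "P : points C" "ev P f ~= 0" "ev P g ~= 0" for P
  proof -
   note c = normalised_coordinate[OF P(1)]
   have "x : \<O> P" unfolding regular_def using a P(3) by blast
   moreover have "inverse x : \<O> P" unfolding regular_def using a P(2) by force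
   ultimately show ?thesis using ord_unit[OF P(1)] M_eq[OF c(2)] x(2) by auto
  qed
  hence "{P:points C. ord P x ~= 0} \<subseteq> {P:points C. ev P f = 0} \<union> {P:points C. ev P g = 0}" by blast
  moreover have "eX f ~= 0" using a x(2) by auto
  ultimately show ?thesis using fin a by (meson finite_UnI finite_subset)
qed

subsection \<open>Vanishing orders of forms\<close>

lemma uniformizer_iff:
  assumes P: "P : points C" and t: "form e t" and j: "j <= amb C" "P j = 1"
  shows "uniformizer C P t \<longleftrightarrow> uniformiser P (eX t / Xg j ^ e)"
proof -
  note c = normalised_coordinate[OF P]
  note fq = form_quotient[OF c(2) _ j(1)]
  have Xj: "Xg j ~= 0" using u(5)[OF c(2) j] .
  let ?\<tau> = "eX t / Xg j ^ e"
  define v where "v = (single (single j 1) 1 :: (nat, 'a) mpol)"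
  have v: "form 1 v" "eX v = Xg j" "ev P v = 1"
   using forms_var[OF j(1)] by (auto simp: v_def evh_single[OF emb] eh ev_evh evh_single[OF is_hom_id] j(2) simp del: One_nat_def)
  have vd: "form d (v ^ d)" for d using forms_power[OF v(1), of d] by simp
  have cone_eq: "(ALL Q:cone C. ev Q h * ev Q a = ev Q t * ev Q b) \<longleftrightarrow> eX h * eX a = eX t * eX b"
   if "form d (h * a)" "form d (t * b)" for d h a b
  proof -
   have "eX (h * a - t * b) = 0 \<longleftrightarrow> (ALL Q:cone C. ev Q (h * a - t * b) = 0)"
    by (rule generic[OF forms_minus'[OF that]])
   thus ?thesis by (simp add: xh vh)
  qed
  show ?thesis
  proof
   assume U: "uniformizer C P t"
   have tP: "ev P t = 0" using U by (simp add: uniformizer_def)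
   have tM: "?\<tau> : \<M> P" using fq(2)[OF t] j tP by simp
   have sub: "\<M> P \<subseteq> (%w. w * ?\<tau>) ` \<O> P"
   proof
    fix x assume "x : \<M> P"
    then obtain f g d where a: "form d f" "form d g" "ev P g ~= 0" "x = eX f / eX g" "ev P f = 0"
     unfolding vanishing_def by blast
    have gX: "eX g ~= 0" using eX_nonzero[OF c(2) a(2,3)] .
    obtain h b dh db where h: "form dh h" "form db b" "ev P h ~= 0" "!!Q. Q : cone C ==> ev Q h * ev Q f = ev Q t * ev Q b"
     using U a(1,5) unfolding uniformizer_def by blast
    have hX: "eX h ~= 0" using eX_nonzero[OF c(2) h(1,3)] .
    show "x : (%w. w * ?\<tau>) ` \<O> P"
    proof (cases "eX f = 0")
     case True
     thus ?thesis using a(4) Or(1)[OF c(2)] by (intro image_eqI[of _ _ 0]) auto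
    next
     case False
     hence "eX (h * f) ~= 0" using hX by (simp add: xh)
     then obtain Q where Q: "Q : cone C" "ev Q (h * f) ~= 0" using generic[OF forms_mult[OF h(1) a(1)]] by blast
     \<comment> \<open>\<open>uniformizer\<close> allows forms \<open>h\<close> and \<open>b\<close>
       of any degrees. The identity holds on the whole cone, so comparing it at 2 Q and at Q gives
       2^i = 2^j for the two total degrees, which are therefore equal in characteristic 0.\<close>
     have deg: "dh + d = e + db"
     proof -
      have "infinite (UNIV - {0 :: 'a})" using infinite_UNIV_char_0 by (simp add: infinite_remove)
      have scal: "s ^ (dh + d) = s ^ (e + db)" if s: "s ~= 0" for s :: 'a
      proof -
       have "ev (%i. s * Q i) (h * f) = ev (%i. s * Q i) (t * b)"
        using h(4)[OF cone_scale[OF proj s Q(1)]] by (simp add: vh)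
       hence "s ^ (dh + d) * ev Q (h * f) = s ^ (e + db) * ev Q (t * b)"
        using evh_forms_scale[OF forms_mult[OF h(1) a(1)], of "%a. a" s Q]
         evh_forms_scale[OF forms_mult[OF t h(2)], of "%a. a" s Q] by (simp add: ev_evh)
       moreover have "ev Q (h * f) = ev Q (t * b)" using h(4)[OF Q(1)] by (simp add: vh)
       ultimately show ?thesis using Q(2) by simp
      qed
      have "(2::'a) ^ (dh + d) = 2 ^ (e + db)" by (rule scal) simp
      hence "(of_nat (2 ^ (dh + d)) :: 'a) = of_nat (2 ^ (e + db))" by simp
      hence "(2::nat) ^ (dh + d) = 2 ^ (e + db)" by (simp only: of_nat_eq_iff)
      thus ?thesis by (rule power_inject_exp[THEN iffD1, rotated]) simp
     qed
     have "eX h * eX f = eX t * eX b"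
      using cone_eq[OF forms_mult[OF h(1) a(1)]] forms_mult[OF t h(2)] deg h(4) by auto
     hence "eX f = eX t * eX b / eX h" using hX by (simp add: field_simps)
     hence "x = (eX (b * v ^ e) / eX (h * g)) * ?\<tau>" unfolding a(4) using gX hX Xj by (simp add: xh v(2))
     moreover have "eX (b * v ^ e) / eX (h * g) : \<O> P"
     proof -
      have "form (dh + d) (b * v ^ e)" using forms_mult[OF h(2) vd[of e]] deg by (simp add: add.commute)
      moreover have "form (dh + d) (h * g)" "ev P (h * g) ~= 0" using forms_mult[OF h(1) a(2)] h(3) a(3) by (auto simp: vh)
      ultimately show ?thesis unfolding regular_def by blast
     qed
     ultimately show ?thesis by blast
    qed
   qed
   have "?\<tau> ~= 0"
   proof
    assume "?\<tau> = 0"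
    hence "\<M> P \<subseteq> {0}" using sub by auto
    moreover obtain t' where "uniformiser P t'" using uniformiser_exists[OF P] by blast
    hence "t' : \<M> P" "t' ~= 0" using Or(2)[OF c(2)] unfolding uniformiser_def by (auto simp: image_iff)
    ultimately show False by blast
   qed
   thus "uniformiser P ?\<tau>" unfolding uniformiser_def using sub Mi(4)[OF c(2) _ tM] by blast
  next
   assume U: "uniformiser P ?\<tau>"
   have tM: "?\<tau> : \<M> P" using U Or(2)[OF c(2)] unfolding uniformiser_def by (auto simp: image_iff)
   have tP: "ev P t = 0" using fq(2)[OF t] j tM by simp
   have "EX h d. form d h & (EX b d'. form d' b & ev P h ~= 0 & (ALL Q:cone C. ev Q h * ev Q a = ev Q t * ev Q b))"
    if a: "form d a" "ev P a = 0" for d a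
   proof -
    have "eX a / Xg j ^ d : \<M> P" using fq(2)[OF a(1)] j a(2) by simp
    then obtain w where w: "w : \<O> P" "eX a / Xg j ^ d = w * ?\<tau>" using U by (auto simp: uniformiser_def)
    obtain f g d' where fg: "form d' f" "form d' g" "ev P g ~= 0" "w = eX f / eX g" using w(1) unfolding regular_def by blast
    have gX: "eX g ~= 0" using eX_nonzero[OF c(2) fg(2,3)] .
    have eq: "eX (g * v ^ e) * eX a = eX t * eX (f * v ^ d)"
     using w(2) fg(4) gX Xj by (simp add: xh v(2) field_simps)
    have f1: "form (d' + e + d) (g * v ^ e * a)" by (rule forms_mult[OF forms_mult[OF fg(2) vd] a(1)])
    have f2: "form (d' + e + d) (t * (f * v ^ d))"
     using forms_mult[OF t forms_mult[OF fg(1) vd[of d]]] by (simp add: add_ac)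
    have "ALL Q:cone C. ev Q (g * v ^ e) * ev Q a = ev Q t * ev Q (f * v ^ d)" using cone_eq[OF f1 f2] eq by blast
    moreover have "ev P (g * v ^ e) ~= 0" using fg(3) v(3) by (simp add: vh)
    ultimately show ?thesis using forms_mult[OF fg(2) vd[of e]] forms_mult[OF fg(1) vd[of d]] by blast
   qed
   thus "uniformizer C P t" unfolding uniformizer_def using t tP by blast
  qed
qed

text \<open>The definition counts with forms on the cone; division by powers of the coordinate that
  is 1 at \<open>P\<close> turns its defining identity into a factorisation of the kind that
  determines \<open>ord\<close>.\<close>

lemma vanishing_order_ord:
  assumes P: "P : points C" and f: "form d f" "eX f ~= 0" and j: "j <= amb C" "P j = 1"
  shows "int (vanishing_order C P f) = ord P (eX f / Xg j ^ d)"
proof -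
  note c = normalised_coordinate[OF P]
  note fq = form_quotient[OF c(2) _ j(1)]
  have Xj: "Xg j ~= 0" using u(5)[OF c(2) j] .
  let ?\<phi> = "eX f / Xg j ^ d"
  have phi: "?\<phi> : \<O> P" "?\<phi> ~= 0" using fq(1)[OF f(1)] j f(2) Xj by auto
  hence phiF: "?\<phi> : F" using local_ring(6)[OF c(2)] by auto
  define v where "v = (single (single j 1) 1 :: (nat, 'a) mpol)"
  have v: "form 1 v" "eX v = Xg j" "ev P v = 1"
   using forms_var[OF j(1)] by (auto simp: v_def evh_single[OF emb] eh ev_evh evh_single[OF is_hom_id] j(2) simp del: One_nat_def)
  have vd: "form d (v ^ d)" for d using forms_power[OF v(1), of d] by simp
  define good where "good n \<longleftrightarrow> (EX t. uniformizer C P t &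
    (EX h:\<Union>d. forms UNIV (amb C) d. EX u:\<Union>d. forms UNIV (amb C) d.
     ev P h ~= 0 & ev P u ~= 0 & (ALL Q:cone C. ev Q h * ev Q f = ev Q t ^ n * ev Q u)))" for n :: nat
  have uniq: "ord P ?\<phi> = int n" if "good n" for n
  proof -
   obtain t h w e dh dw where t: "uniformizer C P t" "form e t" "form dh h" "form dw w" "ev P h ~= 0" "ev P w ~= 0"
    "!!Q. Q : cone C ==> ev Q h * ev Q f = ev Q t ^ n * ev Q w"
    using \<open>good n\<close> unfolding good_def uniformizer_def by blast
   have tu: "uniformiser P (eX t / Xg j ^ e)" using uniformizer_iff[OF P t(2) j] t(1) by blast
   have hX: "eX h ~= 0" "eX w ~= 0" using eX_nonzero[OF c(2)] t by blast+
   hence "eX (h * f) ~= 0" using f(2) by (simp add: xh)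
   then obtain Q where Q: "Q : cone C" "ev Q (h * f) ~= 0" using generic[OF forms_mult[OF t(3) f(1)]] by blast
   have twf: "form (n * e + dw) (t ^ n * w)" by (rule forms_mult[OF forms_power[OF t(2)] t(4)])
   have deg: "dh + d = n * e + dw"
   proof -
    have s: "(2::'a) ~= 0" by simp
    have "ev (%i. 2 * Q i) (h * f) = ev (%i. 2 * Q i) (t ^ n * w)"
     using t(7)[OF cone_scale[OF proj s Q(1)]] by (simp add: vh)
    hence "2 ^ (dh + d) * ev Q (h * f) = 2 ^ (n * e + dw) * ev Q (t ^ n * w)"
     using evh_forms_scale[OF forms_mult[OF t(3) f(1)], of "%a. a" 2 Q]
      evh_forms_scale[OF twf, of "%a. a" 2 Q] by (simp add: ev_evh)
    moreover have "ev Q (h * f) = ev Q (t ^ n * w)" using t(7)[OF Q(1)] by (simp add: vh)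
    ultimately have "(2::'a) ^ (dh + d) = 2 ^ (n * e + dw)" using Q(2) by simp
    hence "(of_nat (2 ^ (dh + d)) :: 'a) = of_nat (2 ^ (n * e + dw))" by simp
    hence "(2::nat) ^ (dh + d) = 2 ^ (n * e + dw)" by (simp only: of_nat_eq_iff)
    thus ?thesis by (rule power_inject_exp[THEN iffD1, rotated]) simp
   qed
   have "form (dh + d) (h * f - t ^ n * w)" using forms_minus'[OF forms_mult[OF t(3) f(1)]] twf deg by simp
   moreover have "ev Q (h * f - t ^ n * w) = 0" if "Q : cone C" for Q using t(7)[OF that] by (simp add: vh)
   ultimately have "eX (h * f - t ^ n * w) = 0" using generic by blast
   hence eq: "eX h * eX f = eX t ^ n * eX w" by (simp add: xh)
   define r where "r = (eX w / Xg j ^ dw) * inverse (eX h / Xg j ^ dh)"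
   have "eX w / Xg j ^ dw : \<O> P" "eX w / Xg j ^ dw ~: \<M> P" "eX h / Xg j ^ dh : \<O> P" "eX h / Xg j ^ dh ~: \<M> P"
    using fq(1,2)[OF t(4)] fq(1,2)[OF t(3)] j t(5,6) by auto
   hence r: "r : \<O> P" "r ~: \<M> P" unfolding r_def using unit_mult[OF c(2)] by metis+
   have "?\<phi> = (eX t / Xg j ^ e) ^ n * r"
   proof -
    have "Xg j ^ dh * Xg j ^ d = (Xg j ^ e) ^ n * Xg j ^ dw"
    proof -
     have "dh + d = e * n + dw" using deg by (simp add: mult.commute)
     hence "Xg j ^ (dh + d) = Xg j ^ (e * n + dw)" by (simp only:)
     thus ?thesis by (simp only: power_add power_mult)
    qed
    note k = this
    have "(eX t / Xg j ^ e) ^ n * r = (eX t ^ n * eX w) * Xg j ^ dh / (((Xg j ^ e) ^ n * Xg j ^ dw) * eX h)"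
     by (simp add: r_def power_divide mult.assoc)
    also have "... = (eX h * eX f) * Xg j ^ dh / ((Xg j ^ dh * Xg j ^ d) * eX h)" by (simp only: eq k)
    also have "... = ?\<phi>" using hX Xj by simp
    finally show ?thesis by simp
   qed
   thus ?thesis by (intro ord_eqI[OF P tu r]) simp
  qed
  have ex: "good (nat (ord P ?\<phi>))"
  proof -
   obtain L where L: "form 1 L" "uniformiser P (eX L / Xg j)" using principal[OF P] j by blast
   have LU: "uniformizer C P L" using uniformizer_iff[OF P L(1) j] L(2) by simp
   define n where "n = nat (ord P ?\<phi>)"
   have "ord P ?\<phi> >= 0" using ord_iff(1)[OF P phiF phi(2)] phi(1) by blast
   hence n: "ord P ?\<phi> = int n" by (simp add: n_def)
   obtain w where w: "w : \<O> P" "w ~: \<M> P" "?\<phi> = (eX L / Xg j) ^ n * w"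
    using ord_factor[OF P L(2) phiF phi(2)] unfolding n by auto
   obtain a b e where ab: "form e a" "form e b" "ev P b ~= 0" "w = eX a / eX b" using w(1) unfolding regular_def by blast
   have aP: "ev P a ~= 0" using w(2) ab unfolding vanishing_def by blast
   have bX: "eX b ~= 0" using eX_nonzero[OF c(2) ab(2,3)] .
   have f1: "form (e + n + d) (b * v ^ n * f)" by (rule forms_mult[OF forms_mult[OF ab(2) vd] f(1)])
   have f2: "form (e + n + d) (L ^ n * (a * v ^ d))"
    using forms_mult[OF forms_power[OF L(1), of n] forms_mult[OF ab(1) vd[of d]]] by (simp add: add_ac)
   have "eX (b * v ^ n * f - L ^ n * (a * v ^ d)) = 0"
    using w(3) ab(4) bX Xj by (simp add: xh v(2) field_simps power_divide)
   hence "ALL Q:cone C. ev Q (b * v ^ n * f - L ^ n * (a * v ^ d)) = 0" using generic[OF forms_minus'[OF f1 f2]] by blast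
   hence "ALL Q:cone C. ev Q (b * v ^ n) * ev Q f = ev Q L ^ n * ev Q (a * v ^ d)" by (simp add: vh)
   moreover have "ev P (b * v ^ n) ~= 0" "ev P (a * v ^ d) ~= 0" using ab(3) aP v(3) by (auto simp: vh)
   ultimately show ?thesis unfolding good_def n_def[symmetric]
    using LU forms_mult[OF ab(2) vd[of n]] forms_mult[OF ab(1) vd[of d]] by blast
  qed
  have "vanishing_order C P f = nat (ord P ?\<phi>)"
   unfolding vanishing_order_def good_def[symmetric] by (rule the_equality[where P = good, OF ex]) (use uniq in auto)
  thus ?thesis using ord_iff(1)[OF P phiF phi(2)] phi(1) by simp
qed

text \<open>Numerator and denominator have the same degree, so the powers of a coordinate used to
  dehomogenise them cancel in the quotient.\<close>

lemma principal_iff: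
  assumes D: "keys D \<subseteq> points C"
  shows "principal C D \<longleftrightarrow> (EX x:F. x ~= 0 & (ALL P:points C. lookup D P = ord P x))"
proof -
  have nz: "(EX P:points C. ev P f ~= 0) \<longleftrightarrow> eX f ~= 0" if f: "form d f" for d f
  proof -
   have "(EX P:points C. ev P f ~= 0) \<longleftrightarrow> (EX P:cone C. ev P f ~= 0)"
   proof
    assume "EX P:cone C. ev P f ~= 0"
    then obtain P where P: "P : cone C" "ev P f ~= 0" by blast
    obtain c where c: "c ~= 0" "normalise P : points C" "normalise P = (%i. c * P i)" by (rule points_rep[OF proj P(1)])
    have "ev (normalise P) f ~= 0" unfolding c(3) using evh_forms_scale[OF f, of "%a. a" c P] c(1) P(2) by (simp add: ev_evh)
    thus "EX P:points C. ev P f ~= 0" using c(2) by blast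
   qed (use normalised_coordinate(2) in blast)
   thus ?thesis using generic[OF f] by blast
  qed
  have o: "int (vanishing_order C P f) - int (vanishing_order C P g) = ord P (eX f / eX g)"
   if a: "form d f" "form d g" "eX f ~= 0" "eX g ~= 0" and P: "P : points C" for f g d P
  proof -
   note c = normalised_coordinate[OF P]
   obtain j where j: "j <= amb C" "P j = 1" using c(1) by blast
   have Xj: "Xg j ~= 0" using u(5)[OF c(2) j] .
   have "eX f / Xg j ^ d : F" "eX g / Xg j ^ d : F"
    using form_quotient(1)[OF c(2) a(1) j(1)] form_quotient(1)[OF c(2) a(2) j(1)] j(2) local_ring(6)[OF c(2)] by auto
   hence "ord P ((eX f / Xg j ^ d) / (eX g / Xg j ^ d)) = ord P (eX f / Xg j ^ d) - ord P (eX g / Xg j ^ d)"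
    using a Xj by (intro ord_divide[OF P]) auto
   thus ?thesis using vanishing_order_ord[OF P a(1,3) j] vanishing_order_ord[OF P a(2,4) j] Xj by simp
  qed
  show ?thesis
  proof
   assume "principal C D"
   then obtain f g d where a: "form d f" "form d g" "EX P:points C. ev P g ~= 0" "EX P:points C. ev P f ~= 0"
    "!!P. P : points C ==> lookup D P = int (vanishing_order C P f) - int (vanishing_order C P g)"
    unfolding principal_def rat_fun_def by blast
   have n: "eX f ~= 0" "eX g ~= 0" using a nz by blast+
   have "eX f / eX g : F" unfolding quotients using a(1,2) n by blast
   thus "EX x:F. x ~= 0 & (ALL P:points C. lookup D P = ord P x)"
    using n a(5) o[OF a(1,2) n] by (intro bexI[of _ "eX f / eX g"]) auto
  next
   assume "EX x:F. x ~= 0 & (ALL P:points C. lookup D P = ord P x)"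
   then obtain x where x: "x : F" "x ~= 0" "!!P. P : points C ==> lookup D P = ord P x" by blast
   obtain f g d where a: "form d f" "form d g" "eX g ~= 0" "x = eX f / eX g" using x(1) unfolding quotients by blast
   have n: "eX f ~= 0" using a x(2) by auto
   have "rat_fun UNIV C (f, g)" using a nz[OF a(2)] by (auto simp: rat_fun_def)
   moreover have "EX P:points C. ev P f ~= 0" using nz[OF a(1)] n by blast
   moreover have "ALL P:points C. lookup D P = int (vanishing_order C P f) - int (vanishing_order C P g)"
    using x(3) o[OF a(1,2) n a(3)] a(4) by simp
   ultimately show "principal C D" unfolding principal_def using D by blast
  qed
qed

end

subsection \<open>Valuation rings and automorphisms of the function field\<close>

context function_field
begin

text \<open>The relative version of \<open>val_ring_max_ideal\<close>: the dichotomy is available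
  only for elements of \<open>F\<close>, a proper subfield of the ambient field in general.\<close>

lemma nonunits_ideal:
  assumes V: "subr V" "V \<subseteq> F" "!!x. x : F ==> x : V | inverse x : V"
  defines "N \<equiv> {x : V. x = 0 | inverse x ~: V}"
  shows "ideal_on V N" "1 ~: N" "!!x w. x : V ==> w : V ==> x * w : N ==> x : N | w : N"
proof -
  note o = subrD[OF V(1)]
  have mult: "x * w : N" if x: "x : V" and w: "w : N" for x w
  proof (rule ccontr)
   assume "x * w ~: N"
   hence a: "x * w ~= 0" "inverse (x * w) : V" using o(4)[OF x, of w] w by (auto simp: N_def)
   hence "x * inverse (x * w) : V" by (intro o(4) x)
   thus False using w a by (auto simp: N_def field_simps)
  qed
  have add: "x + w : N" if x: "x : N" and w: "w : N" for x w
  proof (cases "x = 0 | w = 0")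
   case False
   hence xw: "x ~= 0" "w ~= 0" "x : V" "w : V" using x w by (auto simp: N_def)
   have "x / w : F" using subf_divide[OF F] V(2) xw by blast
   hence "x / w : V | w / x : V" using V(3)[of "x / w"] by auto
   thus ?thesis
   proof
    assume "x / w : V"
    hence "(x / w + 1) * w : N" by (intro mult w o(3) o(2))
    moreover have "(x / w + 1) * w = x + w" using xw by (simp add: distrib_right)
    ultimately show ?thesis by simp
   next
    assume "w / x : V"
    hence "(w / x + 1) * x : N" by (intro mult x o(3) o(2))
    moreover have "(w / x + 1) * x = x + w" using xw by (simp add: distrib_right)
    ultimately show ?thesis by simp
   qed
  qed (use x w in auto)
  show "ideal_on V N" unfolding ideal_on_def using add mult o(1) by (auto simp: N_def)
  show "1 ~: N" using o(2) by (simp add: N_def)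
  fix x w assume a: "x : V" "w : V" "x * w : N"
  show "x : N | w : N"
  proof (rule ccontr)
   assume "~ (x : N | w : N)"
   hence "x ~= 0" "w ~= 0" "inverse x : V" "inverse w : V" using a by (auto simp: N_def)
   thus False using a(3) o(4)[of "inverse x" "inverse w"] by (auto simp: N_def)
  qed
qed

text \<open>For a nonunit \<open>t\<close> of \<open>V\<close>, the relation between
  \<open>w\<close> and \<open>t\<close> with nonzero constant term becomes modulo \<open>t\<close> a
  polynomial equation for the residue of \<open>w\<close> over the constants. These are
  algebraically closed, and primality of the nonunits picks a linear factor.\<close>

lemma residue:
  assumes V: "subr V" "V \<subseteq> F" "!!x. x : F ==> x : V | inverse x : V" "range emb \<subseteq> V" "V ~= F" and w: "w : V"
  defines "N \<equiv> {x : V. x = 0 | inverse x ~: V}"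
  shows "EX c. w - emb c : N"
proof -
  note o = subrD[OF V(1)]
  have N: "ideal_on V N" "1 ~: N" "!!x w. x : V ==> w : V ==> x * w : N ==> x : N | w : N"
   unfolding N_def using nonunits_ideal[OF V(1,2)] V(3) by blast+
  obtain t' where t': "t' : F" "t' ~: V" using V(2,5) by blast
  define t where "t = inverse t'"
  have t: "t : N" "t ~= 0" "t : F" using V(3)[OF t'(1)] t' o(1) subf_inverse[OF F t'(1)] by (auto simp: t_def N_def)
  hence tV: "t : V" by (simp add: N_def)
  obtain Q where Q: "coeff Q 0 ~= 0" "bev (pev w) t Q = 0" using dependence_nonzero[of w t] w V(2) t by blast
  obtain r Q' where r: "Q = pCons r Q'" by (cases Q)
  have bV: "bev (pev w) t Q' : V" unfolding bev_def
   by (rule subr_poly[OF V(1) _ tV]) (simp add: coeff_map_poly is_homD(4)[OF pev_hom] pev_in[OF V(1,4) w])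
  have "pev w r + t * bev (pev w) t Q' = 0" using Q(2) by (simp add: r bev_pCons[OF pev_hom])
  hence "pev w r = - bev (pev w) t Q' * t" by (simp add: eq_neg_iff_add_eq_0 mult.commute)
  moreover have "- bev (pev w) t Q' * t : N" by (intro ideal_onD(4)[OF N(1)] o(5) bV t)
  ultimately have "pev w r : N" by simp
  moreover have "r ~= 0" using Q(1) r by simp
  ultimately show ?thesis
  proof (induction "degree r" arbitrary: r)
   case 0
   then obtain a where a: "r = [:a:]" "a ~= 0" by (metis degree_eq_zeroE pCons_0_0)
   have "emb (inverse a) * emb a : N" using 0(2) V(4) by (intro ideal_onD(4)[OF N(1)]) (auto simp: a(1) pev_const)
   thus ?case using a(2) ef N(2) by simp
  next
   case (Suc d)
   obtain c where "poly r c = 0" using alg_closed_imp_poly_has_root[of r] Suc(2) by auto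
   then obtain r' where r': "r = [:- c, 1:] * r'" by (metis poly_eq_0_iff_dvd dvdE)
   have nz: "r' ~= 0" using Suc.prems(2) r' by auto
   have "degree r = Suc (degree r')" unfolding r' using nz by (subst degree_mult_eq) auto
   hence dr: "d = degree r'" using Suc(2) by simp
   have "pev w r = (w - emb c) * pev w r'"
    unfolding r' is_homD(3)[OF pev_hom] by (simp add: pev_pCons is_homD(4)[OF pev_hom] eh del: mult_pCons_left)
   moreover have "w - emb c : V" "pev w r' : V" using o(6)[OF w] V(4) pev_in[OF V(1,4) w] by auto
   ultimately have "w - emb c : N | pev w r' : N" using N(3) Suc.prems(1) by metis
   thus ?case using Suc(1)[OF dr _ nz] by blast
  qed
qed

text \<open>Passing from the ratios over \<open>Xg j\<close> to those over a coordinate that does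
  not vanish at \<open>P\<close> multiplies all residues by one constant, so \<open>c\<close> and
  \<open>P\<close> are proportional.\<close>

lemma center_unique:
  assumes P: "P : points C" and j: "Xg j ~= 0" and c: "!!i. Xg i / Xg j - emb (c i) : \<M> P"
  shows "normalise c = P"
proof -
  note n = normalised_coordinate[OF P]
  obtain j' where j': "j' <= amb C" "P j' = 1" using n(1) by blast
  note uu = u[OF n(2) j', unfolded u_def[OF n(2) j']]
  have wO: "Xg j' / Xg j : \<O> P"
  proof -
   have "Xg j' / Xg j - emb (c j') + emb (c j') : \<O> P"
    by (intro Or(3)[OF n(2)] Mi(5)[OF n(2) c] local_ring(5)[OF n(2)])
   thus ?thesis by simp
  qed
  have e: "c i = P i * c j'" for i
  proof -
   have "emb (c i) - emb (P i) * emb (c j') = (Xg i / Xg j' - emb (P i)) * (Xg j' / Xg j)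
     + emb (P i) * (Xg j' / Xg j - emb (c j')) - (Xg i / Xg j - emb (c i))"
    using uu(5) j by (simp add: field_simps)
   also have "... : \<M> P"
    by (rule Mm(2)[OF n(2) Mi(3)[OF n(2) Mi(6)[OF n(2) wO uu(2)] Mi(4)[OF n(2) local_ring(5)[OF n(2)] c]] c])
   finally have "emb (c i - P i * c j') : \<M> P" by (simp add: eh)
   from emb_M[OF n(2) this] show ?thesis by simp
  qed
  have "emb (1 - c j) : \<M> P" using c[of j] j by (simp add: eh)
  from emb_M[OF n(2) this] have "c j = 1" by simp
  hence "c j' ~= 0" using e[of j] by auto
  hence s: "normalise (%i. c j' * P i) = normalise P" by (rule normalise_scale)
  have "c = (%i. c j' * P i)"
  proof
   show "c i = c j' * P i" for i using e[of i] by (simp only: mult.commute)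
  qed
  hence "normalise c = normalise (%i. c j' * P i)" by (rule arg_cong)
  hence "normalise c = normalise P" using s by simp
  thus ?thesis using n(3) by simp
qed

lemma regular_inj: "P : points C ==> Q : points C ==> \<O> P = \<O> Q ==> P = Q"
proof -
  assume P: "P : points C" and Q: "Q : points C" and e: "\<O> P = \<O> Q"
  note n = normalised_coordinate[OF P]
  have "\<M> P = \<M> Q" using M_eq[OF n(2)] M_eq[OF normalised_coordinate(2)[OF Q]] e by simp
  moreover obtain j where j: "j <= amb C" "P j = 1" using n(1) by blast
  ultimately have "normalise P = Q"
   using u[OF n(2) j, unfolded u_def[OF n(2) j]] by (intro center_unique[OF Q, of j]) auto
  thus ?thesis using n(3) by simp
qed

lemma regular_proper: "P : points C ==> \<O> P ~= F"
proof
  assume P: "P : points C" and e: "\<O> P = F"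
  note n = normalised_coordinate[OF P]
  obtain t where "uniformiser P t" using uniformiser_exists[OF P] by blast
  hence t: "t : \<M> P" "t ~= 0" using Or(2)[OF n(2)] unfolding uniformiser_def by (auto simp: image_iff)
  hence "t : F" using Mi(5)[OF n(2)] e by auto
  hence "inverse t : \<O> P" using subf_inverse[OF F] e by auto
  thus False using t M_eq[OF n(2)] by auto
qed

lemma regular_valuation: "P : points C ==> x : F ==> x : \<O> P | inverse x : \<O> P"
proof -
  assume P: "P : points C" and x: "x : F"
  show ?thesis
  proof (cases "x = 0")
   case True
   thus ?thesis using Or(1)[OF normalised_coordinate(2)[OF P]] by simp
  next
   case False
   hence "ord P x >= 0 | ord P (inverse x) >= 0" using ord_inverse[OF P x] by linarith
   thus ?thesis using ord_iff(1)[OF P] x subf_inverse[OF F x] False by auto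
  qed
qed

lemma Xg_quotient: "Xg j ~= 0 ==> Xg i / Xg j : F"
proof -
  assume j: "Xg j ~= 0"
  show ?thesis
  proof (cases "i <= amb C")
   case True
   have J: "j <= amb C" using Xg j by (meson not_le)
   define v where "v k = (single (single k 1) 1 :: (nat, 'a) mpol)" for k
   have v: "form 1 (v k)" "eX (v k) = Xg k" if "k <= amb C" for k
    using forms_var[OF that] by (auto simp: v_def evh_single[OF emb] eh simp del: One_nat_def)
   thus ?thesis using True J j unfolding quotients by (intro CollectI exI[of _ "v i"] exI[of _ "v j"] exI[of _ 1]) auto
  qed (use Fr(1) Xg in auto)
qed

lemma generic_nonzero: "EX j<=amb C. Xg j ~= 0"
proof (rule ccontr)
  assume "~ ?thesis"
  hence z: "Xg = (%_. 0)" using Xg by (metis not_le)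
  have "F \<subseteq> range emb"
  proof
   fix x assume "x : F"
   then obtain f g d where a: "form d f" "form d g" "eX g ~= 0" "x = eX f / eX g" unfolding quotients by blast
   have "eX h : range emb" if "form d h" for h
   proof (rule evh_closed[OF forms_polys[OF that]])
    show "0 : range emb" "1 : range emb" using eh(4) eh(1) by (metis rangeI)+
    fix a b assume "a : range emb" "b : range emb"
    then obtain a' b' where "a = emb a'" "b = emb b'" by auto
    thus "a + b : range emb" "a * b : range emb" using eh(2)[of a' b'] eh(3)[of a' b'] by (metis rangeI)+
   next
    show "Xg v : range emb" for v using eh(4) z by (metis rangeI)
   qed auto
   then obtain a' b' where "eX f = emb a'" "eX g = emb b'" using a(1,2) by blast
   thus "x : range emb" using a(4) ef(4)[of a' b'] by (metis rangeI)
  qed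
  thus False using nontrivial by blast
qed

text \<open>Dividing the generic coordinates by the one of least valuation and taking residues
  yields a point whose local ring is dominated by \<open>V\<close>. Equality follows because that
  local ring is itself a valuation ring of \<open>F\<close>.\<close>

lemma center:
  assumes V: "subr V" "V \<subseteq> F" "!!x. x : F ==> x : V | inverse x : V" "range emb \<subseteq> V" "V ~= F"
  shows "EX P:points C. \<O> P = V"
proof -
  define N where "N = {x : V. x = 0 | inverse x ~: V}"
  note o = subrD[OF V(1)]
  have N: "ideal_on V N" "1 ~: N" unfolding N_def using nonunits_ideal(1,2)[OF V(1,2)] V(3) by blast+
  note I = ideal_onD[OF N(1)] and Im = ideal_on_minus[OF V(1) N(1)]
  obtain j0 where j0: "j0 : {..amb C}" "Xg j0 ~= 0" using generic_nonzero by auto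
  have "EX j:{..amb C}. Xg j ~= 0 & (ALL i:{..amb C}. Xg i / Xg j : V)"
  proof (rule max_quotient[where f = Xg, OF V(1) _ j0])
   fix i j
   show "Xg i / Xg j : V | Xg j / Xg i : V"
    using Xg_quotient[of j i] V(3)[of "Xg i / Xg j"] o(1) by (cases "Xg j = 0") auto
  qed simp
  then obtain j where j: "j <= amb C" "Xg j ~= 0" "!!i. i <= amb C ==> Xg i / Xg j : V" by auto
  have jV: "Xg i / Xg j : V" for i using j(3)[of i] Xg[of i] o(1) by (cases "i <= amb C") auto
  have "EX c. Xg i / Xg j - emb c : N" for i using residue[OF V jV] unfolding N_def .
  then obtain c0 where c0: "!!i. Xg i / Xg j - emb (c0 i) : N" by metis
  define c where "c i = (if i <= amb C then c0 i else 0)" for i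
  have c: "Xg i / Xg j - emb (c i) : N" for i using c0[of i] Xg[of i] I(2) by (auto simp: c_def eh)
  have embN: "a = 0" if "emb a : N" for a
  proof (rule ccontr)
   assume "a ~= 0"
   hence "emb (inverse a) * emb a = 1" using ef by simp
   thus False using I(4)[of "emb (inverse a)" "emb a"] that V(4) N(2) by auto
  qed
  have cj: "c j = 1"
  proof -
   have "emb (1 - c j) : N" using c[of j] j by (simp add: eh)
   thus ?thesis using embN by force
  qed
  have val: "evh emb (%i. Xg i / Xg j) f - emb (ev c f) : N" "evh emb (%i. Xg i / Xg j) f : V" if f: "form d f" for d f
  proof -
   have "evh emb (%i. Xg i / Xg j) f - evh emb (%i. emb (c i)) f : N"
    by (rule evh_congruent(1)[OF V(1) N(1) forms_polys[OF f]]) (use V(4) jV c in auto)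
   moreover have "evh emb (%i. emb (c i)) f = emb (ev c f)"
    using evh_hom[OF emb, of "%a. a" c f] by (simp add: ev_evh)
   ultimately show "evh emb (%i. Xg i / Xg j) f - emb (ev c f) : N" by simp
   show "evh emb (%i. Xg i / Xg j) f : V"
    by (rule evh_congruent(2)[OF V(1) N(1) forms_polys[OF f], where y = "%i. emb (c i)"]) (use V(4) jV c in auto)
  qed
  have scale: "eX f = Xg j ^ d * evh emb (%i. Xg i / Xg j) f" if "form d f" for d f
   using evh_forms_scale[OF that, of emb "Xg j" "%i. Xg i / Xg j"] j(2) by simp
  have cc: "c : cone C"
  proof -
   have "ev c h = 0" if h: "h : eqs C" for h
   proof -
    obtain d where d: "form d h" using proj h unfolding proj_scheme_def by blast
    have "eX h = 0" using generic[OF d] h by (auto simp: cone_iff)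
    hence "evh emb (%i. Xg i / Xg j) h = 0" using scale[OF d] j(2) by simp
    hence "emb (- ev c h) : N" using val(1)[OF d] by (simp add: eh)
    thus ?thesis using embN by force
   qed
   thus ?thesis using cj j(1) by (auto simp: cone_iff c_def intro!: exI[of _ j])
  qed
  obtain s where s: "s ~= 0" "normalise c : points C" "normalise c = (%i. s * c i)" by (rule points_rep[OF proj cc])
  have unit: "inverse (evh emb (%i. Xg i / Xg j) g) : V" "evh emb (%i. Xg i / Xg j) g ~= 0" if g: "form d g" "ev c g ~= 0" for d g
  proof -
   have "evh emb (%i. Xg i / Xg j) g ~: N"
   proof
    assume "evh emb (%i. Xg i / Xg j) g : N"
    from Im(2)[OF this val(1)[OF g(1)]] have "emb (ev c g) : N" by simp
    thus False using embN g(2) by blast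
   qed
   thus "inverse (evh emb (%i. Xg i / Xg j) g) : V" "evh emb (%i. Xg i / Xg j) g ~= 0"
    using val(2)[OF g(1)] by (auto simp: N_def)
  qed
  have OV: "\<O> c \<subseteq> V" "\<M> c \<subseteq> N"
  proof -
   have q: "eX f / eX g = evh emb (%i. Xg i / Xg j) f * inverse (evh emb (%i. Xg i / Xg j) g)"
    if "form d f" "form d g" for d f g using scale[OF that(1)] scale[OF that(2)] j(2) by (simp add: divide_inverse)
   show "\<O> c \<subseteq> V"
   proof
    fix x assume "x : \<O> c"
    then obtain f g d where a: "form d f" "form d g" "ev c g ~= 0" "x = eX f / eX g" unfolding regular_def by blast
    thus "x : V" using q[OF a(1,2)] o(4)[OF val(2)[OF a(1)] unit(1)[OF a(2,3)]] by simp
   qed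
   show "\<M> c \<subseteq> N"
   proof
    fix x assume "x : \<M> c"
    then obtain f g d where a: "form d f" "form d g" "ev c g ~= 0" "x = eX f / eX g" "ev c f = 0" unfolding vanishing_def by blast
    have "evh emb (%i. Xg i / Xg j) f : N" using val(1)[OF a(1)] a(5) by (simp add: eh)
    thus "x : N" using q[OF a(1,2)] I(6)[OF unit(1)[OF a(2,3)]] a(4) by simp
   qed
  qed
  define P where "P = normalise c"
  have P: "P : points C" "\<O> P = \<O> c" "\<M> P = \<M> c" using s ring_scale[OF s(1), of c] by (auto simp: P_def)
  note n = normalised_coordinate[OF P(1)]
  have "V \<subseteq> \<O> P"
  proof
   fix x assume x: "x : V"
   show "x : \<O> P"
   proof (rule ccontr)
    assume xP: "x ~: \<O> P"
    hence "inverse x : \<O> P" "x ~= 0" using regular_valuation[OF P(1)] x V(2) Or(1)[OF n(2)] by auto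
    hence "inverse x : \<M> P" using M_eq[OF n(2)] xP by auto
    hence "x * inverse x : N" using I(4)[OF x] OV(2) P(3) by blast
    thus False using \<open>x ~= 0\<close> N(2) by simp
   qed
  qed
  thus ?thesis using P OV(1) by blast
qed

text \<open>A nonconstant \<open>x\<close> satisfies no polynomial equation over the constants, so
  \<open>inverse x\<close> generates a proper ideal in the ring it generates over the constants. A
  valuation ring dominating this ideal does not contain \<open>x\<close>, and \<open>center\<close>
  finds the corresponding point.\<close>

lemma no_poles_constant:
  assumes x: "x : F" and all: "!!P. P : points C ==> x : \<O> P" shows "x : range emb"
proof (rule ccontr)
  assume nc: "x ~: range emb"
  hence x0: "x ~= 0" using eh(4) by (metis rangeI)
  have sr: "subr (range emb)"
  proof (rule subrI)
   show "0 : range emb" "1 : range emb" using eh(4) eh(1) by (metis rangeI)+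
   fix a b assume "a : range emb" "b : range emb"
   then obtain a' b' where "a = emb a'" "b = emb b'" by auto
   thus "a + b : range emb" "a * b : range emb" "- a : range emb"
    using eh(2)[of a' b'] eh(3)[of a' b'] eh(5)[of a'] by (metis rangeI)+
  qed
  define t where "t = inverse x"
  define A where "A = ring_adj (range emb) t"
  have A: "subr A" "range emb \<subseteq> A" "t : A" using subr_ring_adj[OF sr] by (auto simp: A_def)
  define I where "I = (%w. w * t) ` A"
  have II: "ideal_on A I" unfolding ideal_on_def
  proof (intro conjI ballI)
   show "I \<subseteq> A" using subrD(4)[OF A(1) _ A(3)] by (auto simp: I_def)
   show "0 : I" unfolding I_def by (rule image_eqI[OF _ subrD(1)[OF A(1)]]) simp
   fix a b assume "a : I" "b : I"
   then obtain a' b' where "a' : A" "a = a' * t" "b' : A" "b = b' * t" by (auto simp: I_def)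
   hence "a + b = (a' + b') * t" "a' + b' : A" using subrD(3)[OF A(1)] by (auto simp: algebra_simps)
   thus "a + b : I" unfolding I_def by blast
  next
   fix a b assume "a : A" "b : I"
   then obtain b' where "b' : A" "b = b' * t" by (auto simp: I_def)
   hence "a * b = (a * b') * t" "a * b' : A" using subrD(4)[OF A(1)] \<open>a : A\<close> by (auto simp: algebra_simps)
   thus "a * b : I" unfolding I_def by blast
  qed
  have alg: "x : range emb" if p0: "p ~= 0" and r: "pev x p = 0" for p using that
  proof (induction "degree p" arbitrary: p)
   case 0
   then obtain a where a: "p = [:a:]" by (metis degree_eq_zeroE)
   thus ?case using 0 ef(1) by (auto simp: pev_const)
  next
   case (Suc d)
   obtain c where "poly p c = 0" using alg_closed_imp_poly_has_root[of p] Suc(2) by auto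
   then obtain p' where p': "p = [:- c, 1:] * p'" by (metis poly_eq_0_iff_dvd dvdE)
   have nz: "p' ~= 0" using Suc.prems(1) p' by auto
   have "degree p = Suc (degree p')" unfolding p' using nz by (subst degree_mult_eq) auto
   hence dr: "d = degree p'" using Suc(2) by simp
   have "pev x p = (x - emb c) * pev x p'"
    unfolding p' is_homD(3)[OF pev_hom] by (simp add: pev_pCons is_homD(4)[OF pev_hom] eh del: mult_pCons_left)
   hence "x = emb c | pev x p' = 0" using Suc.prems(2) by auto
   thus ?case using Suc(1)[OF dr nz] by blast
  qed
  have I1: "1 ~: I"
  proof
   assume "1 : I"
   then obtain w where w: "w : A" "1 = w * t" by (auto simp: I_def)
   hence "x : A" using x0 by (auto simp: t_def field_simps)
   then obtain q where q: "x = poly q t" "!!i. coeff q i : range emb" unfolding A_def ring_adj_def by blast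
   define r where "r = map_poly (inv_into UNIV emb) q"
   have i0: "inv_into UNIV emb 0 = 0" using ef(2) eh(4) by (metis f_inv_into_f rangeI)
   have "map_poly emb r = q" by (rule poly_eqI) (simp add: r_def coeff_map_poly eh i0 f_inv_into_f[OF q(2)])
   hence pr: "pev t r = x" using q(1) by (simp add: pev_def)
   define D where "D = Suc (degree r)"
   have "x ^ degree r * pev t r = pev x (reflect_poly r)"
   proof -
    have "pev x (reflect_poly r) = poly (reflect_poly (map_poly emb r)) x"
     unfolding pev_def by (rule arg_cong[of _ _ "%q. poly q x"])
      (rule poly_eqI, auto simp: coeff_reflect_poly coeff_map_poly eh degree_map_poly ef(1))
    also have "... = x ^ degree (map_poly emb r) * poly (map_poly emb r) (inverse x)"
     using poly_reflect_poly_nz[OF x0, of "map_poly emb r"] .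
    also have "degree (map_poly emb r) = degree r" by (rule degree_map_poly) (use ef(1) in auto)
    finally show ?thesis by (simp add: pev_def t_def)
   qed
   note e = this
   have pm: "pev x (monom 1 D) = x ^ D" by (simp add: pev_def map_poly_monom eh poly_monom)
   have "pev x (monom 1 D - reflect_poly r) = 0"
    unfolding is_homD(6)[OF pev_hom] pm using e pr by (simp add: D_def mult.commute)
   moreover have "monom 1 D - reflect_poly r ~= 0"
   proof
    assume "monom 1 D - reflect_poly r = 0"
    hence "degree (reflect_poly r) = D" by (metis degree_monom_eq eq_iff_diff_eq_0 zero_neq_one)
    thus False using degree_reflect_poly_le[of r] by (simp add: D_def)
   qed
   ultimately show False using alg nc by blast
  qed
  obtain V where V: "val_ring V" "A \<subseteq> V" "I \<subseteq> vmax V" by (rule chevalley[OF A(1) II I1])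
  have tI: "t : I" unfolding I_def by (rule image_eqI[OF _ subrD(2)[OF A(1)]]) simp
  hence xV: "x ~: V" using V(3) x0 by (auto simp: vmax_def t_def)
  have "EX P:points C. \<O> P = V \<inter> F"
  proof (rule center)
   show "subr (V \<inter> F)" using V(1) F by (auto simp: val_ring_def intro: subr_Int subf_subr)
   show "!!x. x : F ==> x : V \<inter> F | inverse x : V \<inter> F" using V(1) subf_inverse[OF F] by (auto simp: val_ring_def)
   obtain P0 where "P0 : cone C" using generic[OF forms_one] eh xh(1) by (auto simp: vh)
   thus "range emb \<subseteq> V \<inter> F" using A(2) V(2) local_ring(5,6) by fast
   show "V \<inter> F ~= F" using xV x by blast
  qed auto
  thus False using all xV by blast
qed

text \<open>Automorphisms of the function field acting on the constants through \<open>s\<close>.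
  Both \<delta>, with \<open>s\<close> the identity, and the Galois automorphisms are of this kind,
  so one theory of the action on points serves for both.\<close>

definition compatible :: "('b => 'b) => ('a => 'a) => bool" where
  "compatible \<alpha> s \<longleftrightarrow> bij_betw \<alpha> F F & (ALL x:F. ALL w:F. \<alpha> (x + w) = \<alpha> x + \<alpha> w) &
    (ALL x:F. ALL w:F. \<alpha> (x * w) = \<alpha> x * \<alpha> w) & (ALL c. \<alpha> (emb c) = emb (s c)) & surj s"

lemma emb_F: "emb c : F"
proof -
  obtain P0 where "P0 : cone C" using generic[OF forms_one] eh xh(1) by (auto simp: vh)
  thus ?thesis using local_ring(5,6) by blast
qed

lemma compatibleD:
  assumes a: "compatible \<alpha> s"
  shows "x : F ==> \<alpha> x : F" "x : F ==> w : F ==> \<alpha> (x + w) = \<alpha> x + \<alpha> w" "x : F ==> w : F ==> \<alpha> (x * w) = \<alpha> x * \<alpha> w"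
   "\<alpha> (emb c) = emb (s c)" "\<alpha> 0 = 0" "\<alpha> 1 = 1" "x : F ==> \<alpha> (- x) = - \<alpha> x" "x : F ==> \<alpha> x = 0 \<longleftrightarrow> x = 0"
   "x : F ==> \<alpha> (inverse x) = inverse (\<alpha> x)" "y : F ==> EX x:F. y = \<alpha> x"
   "x : F ==> w : F ==> \<alpha> x = \<alpha> w ==> x = w" "x : F ==> \<alpha> (x powi n) = \<alpha> x powi n" "x : F ==> w : F ==> \<alpha> (x - w) = \<alpha> x - \<alpha> w"
proof -
  have b: "bij_betw \<alpha> F F" using a by (simp add: compatible_def)
  show im: "!!x. x : F ==> \<alpha> x : F" using b by (auto simp: bij_betw_def)
  show inj: "!!x w. x : F ==> w : F ==> \<alpha> x = \<alpha> w ==> x = w" using b by (auto simp: bij_betw_def inj_on_def)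
  show "y : F ==> EX x:F. y = \<alpha> x" using b by (auto simp: bij_betw_def)
  show ad: "!!x w. x : F ==> w : F ==> \<alpha> (x + w) = \<alpha> x + \<alpha> w" and mu: "!!x w. x : F ==> w : F ==> \<alpha> (x * w) = \<alpha> x * \<alpha> w"
   and "\<alpha> (emb c) = emb (s c)" using a by (auto simp: compatible_def)
  show z: "\<alpha> 0 = 0" using ad[of 0 0] Fr(1) by (metis add.right_neutral add_left_cancel)
  have "\<alpha> 1 ~= 0" using inj[of 1 0] z Fr(1,2) by auto
  thus o: "\<alpha> 1 = 1" using mu[of 1 1] Fr(2) by simp
  show mi: "!!x. x : F ==> \<alpha> (- x) = - \<alpha> x" using ad[of _ "- _"] z Fr(5) by (metis add_eq_0_iff)
  show "x : F ==> w : F ==> \<alpha> (x - w) = \<alpha> x - \<alpha> w" using ad[of x "- w"] mi[of w] Fr(5) by simp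
  show nz: "!!x. x : F ==> \<alpha> x = 0 \<longleftrightarrow> x = 0" using inj[of _ 0] z Fr(1) by auto
  show iv: "!!x. x : F ==> \<alpha> (inverse x) = inverse (\<alpha> x)"
  proof -
   fix x assume x: "x : F"
   show "\<alpha> (inverse x) = inverse (\<alpha> x)"
   proof (cases "x = 0")
    case False
    hence "\<alpha> x * \<alpha> (inverse x) = 1" using mu[OF x subf_inverse[OF F x]] o by simp
    thus ?thesis by (metis inverse_unique)
   qed (simp add: z)
  qed
  have pw: "\<alpha> (x ^ k) = \<alpha> x ^ k" if "x : F" for x k by (induction k) (use that o mu Fr(7) in auto)
  show "x : F ==> \<alpha> (x powi n) = \<alpha> x powi n"
   using pw[of x] pw[of "inverse x"] iv[of x] subf_inverse[OF F] by (auto simp: power_int_def)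
qed

definition act :: "('b => 'b) => (nat => 'a) => nat => 'a" where "act \<alpha> P = (THE Q. Q : points C & \<O> Q = \<alpha> ` \<O> P)"

text \<open>The image of a local ring is again a valuation ring of \<open>F\<close> containing the
  constants, hence by \<open>center\<close> the local ring of a point, which is unique by
  \<open>regular_inj\<close>.\<close>

lemma act:
  assumes a: "compatible \<alpha> s" and P: "P : points C"
  shows "act \<alpha> P : points C" "\<O> (act \<alpha> P) = \<alpha> ` \<O> P" "\<M> (act \<alpha> P) = \<alpha> ` \<M> P"
   "x : F ==> x ~= 0 ==> ord (act \<alpha> P) (\<alpha> x) = ord P x"
proof -
  note n = normalised_coordinate[OF P]
  note c = compatibleD[OF a]
  have OF: "!!x. x : \<O> P ==> x : F" using local_ring(6)[OF n(2)] by blast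
  have "EX Q:points C. \<O> Q = \<alpha> ` \<O> P"
  proof (rule center)
   show "subr (\<alpha> ` \<O> P)"
   proof (rule subrI)
    show "0 : \<alpha> ` \<O> P" "1 : \<alpha> ` \<O> P" using c(5,6) Or(1,2)[OF n(2)] by (metis imageI)+
    fix x w assume "x : \<alpha> ` \<O> P" "w : \<alpha> ` \<O> P"
    then obtain x' w' where e: "x' : \<O> P" "x = \<alpha> x'" "w' : \<O> P" "w = \<alpha> w'" by blast
    show "x + w : \<alpha> ` \<O> P" unfolding e c(2)[OF OF[OF e(1)] OF[OF e(3)], symmetric] by (intro imageI Or(3)[OF n(2)] e)
    show "x * w : \<alpha> ` \<O> P" unfolding e c(3)[OF OF[OF e(1)] OF[OF e(3)], symmetric] by (intro imageI Or(4)[OF n(2)] e)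
    show "- x : \<alpha> ` \<O> P" unfolding e c(7)[OF OF[OF e(1)], symmetric] by (intro imageI Or(5)[OF n(2)] e)
   qed
   show "\<alpha> ` \<O> P \<subseteq> F" using OF c(1) by blast
   fix x assume "x : F"
   then obtain x' where x': "x' : F" "x = \<alpha> x'" using c(10) by blast
   thus "x : \<alpha> ` \<O> P | inverse x : \<alpha> ` \<O> P" using regular_valuation[OF P x'(1)] c(9)[OF x'(1)] by force
  next
   show "range emb \<subseteq> \<alpha> ` \<O> P"
   proof
    fix x assume "x : range emb"
    then obtain b where "x = emb b" by blast
    moreover obtain b' where "b = s b'" using a unfolding compatible_def surj_def by blast
    ultimately have "x = \<alpha> (emb b')" using c(4) by simp
    thus "x : \<alpha> ` \<O> P" using local_ring(5)[OF n(2)] by blast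
   qed
   show "\<alpha> ` \<O> P ~= F"
   proof
    assume e: "\<alpha> ` \<O> P = F"
    obtain x where x: "x : F" "x ~: \<O> P" using regular_proper[OF P] local_ring(6)[OF n(2)] by blast
    then obtain x' where "x' : \<O> P" "\<alpha> x = \<alpha> x'" using e c(1)[OF x(1)] by auto
    thus False using c(11)[OF x(1) OF] x by blast
   qed
  qed
  then obtain Q where "Q : points C" "\<O> Q = \<alpha> ` \<O> P" by blast
  hence "EX! Q. Q : points C & \<O> Q = \<alpha> ` \<O> P" by (intro ex1I[of _ Q]) (blast, metis regular_inj)
  from theI'[OF this] show Q: "act \<alpha> P : points C" "\<O> (act \<alpha> P) = \<alpha> ` \<O> P" unfolding act_def by blast+
  note n' = normalised_coordinate[OF Q(1)]
  have iO: "\<alpha> x : \<alpha> ` \<O> P \<longleftrightarrow> x : \<O> P" if "x : F" for x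
  proof
   assume "\<alpha> x : \<alpha> ` \<O> P"
   then obtain w where "w : \<O> P" "\<alpha> x = \<alpha> w" by blast
   thus "x : \<O> P" using c(11)[OF that OF] by metis
  qed (rule imageI)
  show M: "\<M> (act \<alpha> P) = \<alpha> ` \<M> P"
  proof (rule subset_antisym; rule subsetI)
   fix y assume y: "y : \<M> (act \<alpha> P)"
   hence "y : \<alpha> ` \<O> P" using Mi(5)[OF n'(2)] Q(2) by blast
   then obtain x where x: "x : \<O> P" "y = \<alpha> x" by blast
   have "y = 0 | inverse y ~: \<alpha> ` \<O> P" using y unfolding M_eq[OF n'(2)] Q(2) by blast
   hence "x = 0 | inverse x ~: \<O> P"
    using c(8)[OF OF[OF x(1)]] iO[OF subf_inverse[OF F OF[OF x(1)]]] unfolding x(2) c(9)[OF OF[OF x(1)]] by blast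
   thus "y : \<alpha> ` \<M> P" using x M_eq[OF n(2)] by auto
  next
   fix y assume "y : \<alpha> ` \<M> P"
   then obtain x where x: "x : \<O> P" "y = \<alpha> x" "x = 0 | inverse x ~: \<O> P" using M_eq[OF n(2)] by auto
   have "y = 0 | inverse y ~: \<alpha> ` \<O> P"
    using x(3) c(5) iO[OF subf_inverse[OF F OF[OF x(1)]]] unfolding x(2) c(9)[OF OF[OF x(1)]] by metis
   thus "y : \<M> (act \<alpha> P)" unfolding M_eq[OF n'(2)] Q(2) using x(1,2) by blast
  qed
  show "ord (act \<alpha> P) (\<alpha> x) = ord P x" if x: "x : F" "x ~= 0"
  proof -
   obtain t where t: "uniformiser P t" using uniformiser_exists[OF P] by blast
   obtain w where w: "w : \<O> P" "w ~: \<M> P" "x = t powi ord P x * w" using ord_factor[OF P t x] by blast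
   have tM: "t : \<M> P" "t ~= 0" using t Or(2)[OF n(2)] unfolding uniformiser_def by (auto simp: image_iff)
   have tF: "t : F" "t ~= 0" using OF[OF Mi(5)[OF n(2) tM(1)]] tM(2) by auto
   have "uniformiser (act \<alpha> P) (\<alpha> t)" unfolding uniformiser_def Q(2) M
   proof
    show "\<alpha> t ~= 0" using c(8) tF by blast
    have "\<alpha> ` \<M> P = (%w. \<alpha> (w * t)) ` \<O> P" using t by (simp add: uniformiser_def image_image)
    also have "... = (%w. w * \<alpha> t) ` \<alpha> ` \<O> P" unfolding image_image by (rule image_cong[OF refl]) (use c(3) OF tF in blast)
    finally show "\<alpha> ` \<M> P = (%w. w * \<alpha> t) ` \<alpha> ` \<O> P" .
   qed
   moreover have "\<alpha> w : \<O> (act \<alpha> P)" using w(1) Q(2) by blast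
   moreover have "\<alpha> w ~: \<M> (act \<alpha> P)" unfolding M
   proof
    assume "\<alpha> w : \<alpha> ` \<M> P"
    then obtain v where v: "v : \<M> P" "\<alpha> w = \<alpha> v" by blast
    hence "w = v" using c(11)[OF OF[OF w(1)] OF] Mi(5)[OF n(2)] by metis
    thus False using v w(2) by simp
   qed
   moreover have "\<alpha> x = \<alpha> t powi ord P x * \<alpha> w"
    using w(3) c(3)[OF ord_power_int(2)[OF P tF] OF[OF w(1)]] c(12)[OF tF(1)] by metis
   ultimately show ?thesis by (rule ord_eqI[OF Q(1)])
  qed
qed

lemma act_eqI:
  assumes "compatible \<alpha> s" "P : points C" "Q : points C" "\<O> Q = \<alpha> ` \<O> P" shows "act \<alpha> P = Q"
  using regular_inj[OF act(1)[OF assms(1,2)] assms(3)] act(2)[OF assms(1,2)] assms(4) by simp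

lemma compatible_comp: "compatible \<alpha> s ==> compatible \<beta> s' ==> compatible (%x. \<alpha> (\<beta> x)) (%c. s (s' c))"
  using bij_betw_trans[of \<beta> F F \<alpha> F] comp_surj[of s' s] compatibleD(1)[of \<beta> s']
  unfolding compatible_def by (simp add: comp_def)

lemma act_comp:
  assumes "compatible \<alpha> s" "compatible \<beta> s'" "P : points C"
  shows "act \<alpha> (act \<beta> P) = act (%x. \<alpha> (\<beta> x)) P"
  using act_eqI[OF compatible_comp[OF assms(1,2)] assms(3) act(1)[OF assms(1) act(1)[OF assms(2,3)]]]
   act(2)[OF assms(1) act(1)[OF assms(2,3)]] act(2)[OF assms(2,3)] by (simp add: image_image)

lemma act_cong:
  assumes "P : points C" "!!x. x : F ==> \<alpha> x = \<beta> x" shows "act \<alpha> P = act \<beta> P"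
proof -
  have "\<alpha> ` \<O> P = \<beta> ` \<O> P"
   using local_ring(6)[OF normalised_coordinate(2)[OF assms(1)]] assms(2) by (intro image_cong) auto
  thus ?thesis by (simp add: act_def)
qed

lemma act_id: "P : points C ==> act (%x. x) P = P" using regular_inj unfolding act_def by (intro the_equality) auto

text \<open>Since the coordinate ratios are fixed, their residues at the image point are the images
  under \<open>s\<close> of their residues at \<open>P\<close>.\<close>

lemma act_coordinates:
  assumes a: "compatible \<alpha> s" "is_hom s" and fixX: "!!i j. Xg j ~= 0 ==> \<alpha> (Xg i / Xg j) = Xg i / Xg j" and P: "P : points C"
  shows "act \<alpha> P = (%i. s (P i))"
proof -
  note n = normalised_coordinate[OF P]
  obtain j where j: "j <= amb C" "P j = 1" using n(1) by blast
  note uu = u[OF n(2) j, unfolded u_def[OF n(2) j]]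
  have "normalise (%i. s (P i)) = act \<alpha> P"
  proof (rule center_unique[OF act(1)[OF a(1) P] uu(5)])
   fix i
   have "Xg i / Xg j - emb (s (P i)) = \<alpha> (Xg i / Xg j - emb (P i))"
    using compatibleD(13,4)[OF a(1)] Xg_quotient[OF uu(5)] emb_F fixX[OF uu(5)] by simp
   thus "Xg i / Xg j - emb (s (P i)) : \<M> (act \<alpha> P)" using act(3)[OF a(1) P] uu(2) by simp
  qed
  thus ?thesis using normalise_hom[OF a(2), of P] n(3) by simp
qed

end

subsection \<open>Cyclic coverings of the line\<close>

locale cyclic_cover = function_field C emb F Xg
  for C :: "'a::{alg_closed_field, field_char_0} scheme" and emb :: "'a => 'b::field" and F Xg +
  fixes \<delta> :: "'b => 'b" and m :: nat and x0 :: 'b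
  assumes delta: "compatible \<delta> (%c. c)" and m: "m >= 1" and period: "!!x. x : F ==> (\<delta> ^^ m) x = x"
   and x0: "x0 : F" "\<delta> x0 = x0" and transcendental: "!!r. pev x0 r = 0 ==> r = 0"
   and fixed: "!!x. x : F ==> \<delta> x = x ==> EX n d. d ~= 0 & x = pev x0 n / pev x0 d"
   and hilbert90: "!!f. f : F ==> (\<Prod>i<m. (\<delta> ^^ i) f) = 1 ==> EX g:F. g ~= 0 & f * \<delta> g = g"
   and finite_zeros: "!!d f. form d f ==> eX f ~= 0 ==> finite {P:points C. ev P f = 0}"
begin

lemmas dl = compatibleD[OF delta]

abbreviation "dp \<equiv> act \<delta>"

lemma compatible_id: "compatible (%x. x) (%c. c)" by (simp add: compatible_def bij_betw_def)

lemma delta_funpow: "compatible (\<delta> ^^ i) (%c. c)"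
proof (induction i)
  case 0
  show ?case using compatible_id by (simp add: id_def)
next
  case (Suc i)
  show ?case using compatible_comp[OF delta Suc] by (simp add: comp_def)
qed

lemmas dlp = compatibleD[OF delta_funpow]

lemma dp_points: "P : points C ==> dp P : points C" by (rule act(1)[OF delta])

lemma dp_funpow: "P : points C ==> (dp ^^ i) P = act (\<delta> ^^ i) P"
proof (induction i)
  case 0
  thus ?case using act_id by (simp add: id_def)
next
  case (Suc i)
  thus ?case using act_comp[OF delta delta_funpow] by (simp add: comp_def)
qed

lemma dp_funpow_points: "P : points C ==> (dp ^^ i) P : points C" using dp_funpow act(1)[OF delta_funpow] by simp

lemma dp_period: "P : points C ==> (dp ^^ m) P = P"
  using dp_funpow act_cong[of P "\<delta> ^^ m" "%x. x"] period act_id by simp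

lemma dp_inj: "inj_on dp (points C)"
proof (rule inj_on_inverseI)
  fix P assume P: "P : points C"
  have "(dp ^^ (m - 1)) (dp P) = (dp ^^ Suc (m - 1)) P" by (simp only: funpow_Suc_right comp_apply)
  thus "(dp ^^ (m - 1)) (dp P) = P" using dp_period[OF P] m by simp
qed

lemma ord_funpow: "P : points C ==> x : F ==> x ~= 0 ==> ord ((dp ^^ i) P) ((\<delta> ^^ i) x) = ord P x"
  using act(4)[OF delta_funpow] dp_funpow by simp

definition norm :: "'b => 'b" where "norm x = (\<Prod>i<m. (\<delta> ^^ i) x)"

lemma norm:
  assumes x: "x : F" "x ~= 0"
  shows "norm x : F" "norm x ~= 0" "\<delta> (norm x) = norm x"
   "P : points C ==> ord P (norm x) = (\<Sum>i<m. ord ((dp ^^ Suc i) P) x)"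
proof -
  have f: "(\<delta> ^^ i) x : F" "(\<delta> ^^ i) x ~= 0" for i using dlp(1)[OF x(1)] dlp(8)[OF x(1)] x(2) by auto
  show "norm x : F" unfolding norm_def by (intro Fr(9) f)
  show "norm x ~= 0" using f by (simp add: norm_def)
  have dprod: "\<delta> (\<Prod>i<k. (\<delta> ^^ i) x) = (\<Prod>i<k. (\<delta> ^^ Suc i) x)" for k
  proof (induction k)
   case (Suc k)
   have "(\<Prod>i<k. (\<delta> ^^ i) x) : F" by (intro Fr(9) f)
   thus ?case using dl(3)[OF _ f(1)[of k]] Suc by simp
  qed (simp add: dl(6))
  have "x * (\<Prod>i<m. (\<delta> ^^ Suc i) x) = (\<Prod>i<Suc m. (\<delta> ^^ i) x)" by (simp add: prod.lessThan_Suc_shift del: prod.lessThan_Suc)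
  also have "... = (\<Prod>i<m. (\<delta> ^^ i) x) * x" using period[OF x(1)] by simp
  finally show "\<delta> (norm x) = norm x" unfolding norm_def dprod using x(2) by (simp add: mult.commute)
  assume P: "P : points C"
  define h where "h i = ord ((dp ^^ Suc i) P) x" for i
  have "ord P (norm x) = (\<Sum>i<m. ord P ((\<delta> ^^ i) x))" unfolding norm_def by (rule ord_prod[OF P]) (use f in auto)
  \<comment> \<open>The order at \<open>P\<close> of the i-th conjugate is the order of
    \<open>x\<close> at the point i steps back in the orbit, which by periodicity is m - i steps
    ahead; reversing the sum runs through the orbit forwards.\<close>
  also have "... = (\<Sum>i<m. h (m - Suc i))"
  proof (rule sum.cong[OF refl])
   fix i assume "i : {..<m}"
   hence i: "i < m" by simp
   have "(dp ^^ i) ((dp ^^ (m - i)) P) = (dp ^^ (i + (m - i))) P" by (simp only: funpow_add comp_apply)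
   hence "(dp ^^ i) ((dp ^^ (m - i)) P) = P" using dp_period[OF P] i by simp
   hence "ord P ((\<delta> ^^ i) x) = ord ((dp ^^ (m - i)) P) x"
    using ord_funpow[OF dp_funpow_points[OF P] x, of i "m - i"] by simp
   thus "ord P ((\<delta> ^^ i) x) = h (m - Suc i)" using i by (simp add: h_def Suc_diff_Suc del: funpow.simps)
  qed
  also have "... = (\<Sum>i<m. h i)" by (rule sum.nat_diff_reindex)
  finally show "ord P (norm x) = (\<Sum>i<m. ord ((dp ^^ Suc i) P) x)" by (simp only: h_def)
qed

text \<open>\<open>None\<close> stands for the point at infinity.\<close>

definition xval :: "(nat => 'a) => 'a option" where
  "xval P = (if x0 : \<O> P then Some (THE a. x0 - emb a : \<M> P) else None)"

lemma xval_Some: "P : points C ==> xval P = Some a \<longleftrightarrow> x0 - emb a : \<M> P"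
proof -
  assume P: "P : points C"
  note n = normalised_coordinate[OF P]
  have uniq: "a = b" if "x0 - emb a : \<M> P" "x0 - emb b : \<M> P" for a b
  proof -
   have "emb (b - a) : \<M> P" using Mm(2)[OF n(2) that] by (simp add: eh)
   from emb_M[OF n(2) this] show ?thesis by simp
  qed
  have O: "x0 : \<O> P" if "x0 - emb a : \<M> P" for a
   using Or(3)[OF n(2) Mi(5)[OF n(2) that] local_ring(5)[OF n(2), of a]] by simp
  have ex: "EX a. x0 - emb a : \<M> P" if "x0 : \<O> P" by (rule local_ring(7)[OF n(2) that])
  show ?thesis
  proof
   assume "xval P = Some a"
   hence x: "x0 : \<O> P" "a = (THE a. x0 - emb a : \<M> P)" by (auto simp: xval_def split: if_splits)
   have "EX! a. x0 - emb a : \<M> P" using ex[OF x(1)] uniq by auto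
   from theI'[OF this] show "x0 - emb a : \<M> P" unfolding x(2) .
  next
   assume a: "x0 - emb a : \<M> P"
   have "(THE a. x0 - emb a : \<M> P) = a" by (rule the_equality) (use a uniq in auto)
   thus "xval P = Some a" using O[OF a] by (simp add: xval_def)
  qed
qed

lemma xval_None: "xval P = None \<longleftrightarrow> x0 ~: \<O> P" by (simp add: xval_def)

text \<open>The ramification index of x at the point: the order of a local parameter at the value of
  x, which is 1/x at infinity.\<close>

definition ram :: "(nat => 'a) => int" where
  "ram P = (case xval P of None => - ord P x0 | Some a => ord P (x0 - emb a))"

text \<open>The order at the point \<open>v\<close> of the line of the rational function given by
  \<open>n\<close>; pulled back to the curve it is multiplied by \<open>ram\<close>.\<close>

definition weight :: "'a option => 'a poly => int" where
  "weight v n = (case v of None => - int (degree n) | Some a => int (order a n))"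

lemma pev_X: "pev x0 [:- a, 1:] = x0 - emb a" by (simp add: pev_pCons pev_const eh is_homD(4)[OF pev_hom])

lemma x0_minus: "x0 - emb a : F" "x0 - emb a ~= 0"
proof -
  show "x0 - emb a : F" by (intro Fr(6) x0 emb_F)
  show "x0 - emb a ~= 0" using transcendental[of "[:- a, 1:]"] pev_X by auto
qed

lemma x0_nonzero: "x0 ~= 0" using x0_minus(2)[of 0] by (simp add: eh)

lemma ram_pos: "P : points C ==> ram P > 0"
  using xval_Some[of P] ord_iff(2)[OF _ x0_minus] ord_iff(1)[OF _ x0(1) x0_nonzero, of P] xval_None[of P]
  by (cases "xval P") (auto simp: ram_def)

lemma ord_pev:
  assumes P: "P : points C" and n: "n ~= 0"
  shows "ord P (pev x0 n) = weight (xval P) n * ram P"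
proof (cases "xval P")
  case None
  note c = normalised_coordinate[OF P]
  define t where "t = inverse x0"
  have "t : \<M> P"
  proof -
   have "x0 ~: \<O> P" using None xval_None by simp
   moreover hence "t : \<O> P" using regular_valuation[OF P x0(1)] by (auto simp: t_def)
   ultimately show ?thesis using M_eq[OF c(2)] by (auto simp: t_def)
  qed
  note tM = this
  have tO: "t : \<O> P" by (rule Mi(5)[OF c(2) tM])
  have rO: "range emb \<subseteq> \<O> P" using local_ring(5)[OF c(2)] by auto
  define q where "q = reflect_poly n"
  obtain a q' where q': "q = pCons a q'" by (cases q)
  have "coeff q 0 ~= 0" using n by (simp add: q_def)
  hence a: "a ~= 0" using q' by simp
  have e: "pev t q = emb a + pev t q' * t" by (simp add: q' pev_pCons mult.commute)
  have tm: "pev t q' * t : \<M> P" by (intro Mi(4)[OF c(2) _ tM] pev_in[OF local_ring(1)[OF c(2)] rO tO])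
  have uO: "pev t q : \<O> P" by (rule pev_in[OF local_ring(1)[OF c(2)] rO tO])
  have uM: "pev t q ~: \<M> P"
  proof
   assume "pev t q : \<M> P"
   hence "emb a : \<M> P" using Mm(2)[OF c(2) _ tm] e by force
   thus False using emb_M[OF c(2)] a by blast
  qed
  have eq: "pev x0 n = x0 ^ degree n * pev t q"
  proof -
   have "pev t q = poly (reflect_poly (map_poly emb n)) t"
    unfolding pev_def q_def by (rule arg_cong[of _ _ "%q. poly q t"])
     (rule poly_eqI, auto simp: coeff_reflect_poly coeff_map_poly eh degree_map_poly ef(1))
   also have "... = t ^ degree (map_poly emb n) * poly (map_poly emb n) (inverse t)"
    by (rule poly_reflect_poly_nz) (use x0_nonzero in "simp add: t_def")
   also have "degree (map_poly emb n) = degree n" by (rule degree_map_poly) (use ef(1) in auto)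
   finally have "pev t q = t ^ degree n * pev x0 n" by (simp add: pev_def t_def)
   thus ?thesis using x0_nonzero by (simp add: t_def field_simps)
  qed
  have uF: "pev t q : F" using uO local_ring(6)[OF c(2)] by blast
  have u0: "pev t q ~= 0" using uM Mi(2)[OF c(2)] by auto
  have "ord P (pev x0 n) = ord P (x0 powi int (degree n)) + ord P (pev t q)"
   unfolding eq using ord_mult[OF P Fr(7)[OF x0(1)] _ uF u0] x0_nonzero by simp
  also have "... = int (degree n) * ord P x0" using ord_power_int(1)[OF P x0(1) x0_nonzero, of "int (degree n)"] ord_unit[OF P uO uM] by simp
  finally show ?thesis by (simp add: weight_def ram_def None)
next
  case (Some a)
  note c = normalised_coordinate[OF P]
  have xa: "x0 - emb a : \<M> P" using Some xval_Some[OF P] by simp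
  have xO: "x0 : \<O> P" using Some xval_None[of P] by auto
  have rO: "range emb \<subseteq> \<O> P" using local_ring(5)[OF c(2)] by auto
  obtain q where q: "n = [:- a, 1:] ^ order a n * q" "~ [:- a, 1:] dvd q" using order_decomp[OF n, of a] by blast
  have qa: "poly q a ~= 0" using q(2) by (simp add: poly_eq_0_iff_dvd)
  have "poly (q - [:poly q a:]) a = 0" by simp
  then obtain r where "q - [:poly q a:] = [:- a, 1:] * r" by (metis poly_eq_0_iff_dvd dvdE)
  hence q': "q = [:poly q a:] + r * [:- a, 1:]" by (simp add: algebra_simps del: mult_pCons_left mult_pCons_right)
  have "pev x0 q = pev x0 ([:poly q a:] + r * [:- a, 1:])" using q' by simp
  also have "... = emb (poly q a) + pev x0 r * (x0 - emb a)"
   by (simp only: is_homD(2,3)[OF pev_hom] pev_const pev_X)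
  finally have e: "pev x0 q = emb (poly q a) + pev x0 r * (x0 - emb a)" .
  have tm: "pev x0 r * (x0 - emb a) : \<M> P" by (intro Mi(4)[OF c(2) _ xa] pev_in[OF local_ring(1)[OF c(2)] rO xO])
  have uO: "pev x0 q : \<O> P" by (rule pev_in[OF local_ring(1)[OF c(2)] rO xO])
  have uM: "pev x0 q ~: \<M> P"
  proof
   assume "pev x0 q : \<M> P"
   hence "emb (poly q a) : \<M> P" using Mm(2)[OF c(2) _ tm] e by force
   thus False using emb_M[OF c(2)] qa by blast
  qed
  have uF: "pev x0 q : F" using uO local_ring(6)[OF c(2)] by blast
  have u0: "pev x0 q ~= 0" using uM Mi(2)[OF c(2)] by auto
  have "pev x0 n = pev x0 ([:- a, 1:] ^ order a n * q)" using q(1) by simp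
  also have "... = (x0 - emb a) powi int (order a n) * pev x0 q"
   by (simp only: is_homD(3,7)[OF pev_hom] pev_X power_int_of_nat)
  finally have "ord P (pev x0 n) = ord P ((x0 - emb a) powi int (order a n) * pev x0 q)" by (rule arg_cong)
  also have "... = ord P ((x0 - emb a) powi int (order a n)) + ord P (pev x0 q)"
   by (rule ord_mult[OF P ord_power_int(2)[OF P x0_minus] _ uF u0]) (use x0_minus(2) in simp)
  finally have "ord P (pev x0 n) = int (order a n) * ord P (x0 - emb a)" using ord_power_int(1)[OF P x0_minus, of a "int (order a n)"] ord_unit[OF P uO uM] by simp
  thus ?thesis by (simp add: weight_def ram_def Some)
qed

lemma pev_F: "pev x0 n : F" by (rule pev_in[OF subf_subr[OF F] _ x0(1)]) (use emb_F in auto)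

subsection \<open>The fibres are orbits\<close>

text \<open>For each \<open>w\<close> the sum is a nonzero polynomial in \<open>s\<close>, and
  finitely many of these have finitely many zeros altogether. This provides hyperplanes avoiding a
  finite set of points.\<close>

lemma avoid_zeros:
  assumes "finite S" "!!w. w : S ==> EX i<=N. w i ~= (0::'a)"
  shows "EX s. ALL w:S. (\<Sum>i\<le>N. s ^ i * w i) ~= 0"
proof -
  define p where "p w = (\<Sum>i\<le>N. monom (w i) i)" for w :: "nat => 'a"
  have v: "poly (p w) s = (\<Sum>i\<le>N. s ^ i * w i)" for w s by (simp add: p_def poly_sum poly_monom mult.commute)
  have "p w ~= 0" if wS: "w : S" for w
  proof
   assume z: "p w = 0"
   obtain i where i: "i <= N" "w i ~= 0" using assms(2)[OF wS] by blast
   have "coeff (p w) i = w i" using i(1) by (simp add: p_def coeff_sum sum.delta' if_distrib cong: if_cong)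
   thus False using z i by simp
  qed
  hence "finite (\<Union>w\<in>S. {s. poly (p w) s = 0})" using assms(1) by (intro finite_UN_I poly_roots_finite) auto
  then obtain s where "s ~: (\<Union>w\<in>S. {s. poly (p w) s = 0})" using infinite_UNIV_char_0 by (metis UNIV_eq_I)
  thus ?thesis using v by auto
qed

definition linform :: "(nat => 'a) => (nat, 'a) mpol" where
  "linform c = (\<Sum>i\<le>amb C. single 0 (c i) * single (single i 1) 1)"

lemma linform: "form 1 (linform c)" "ev P (linform c) = (\<Sum>i\<le>amb C. c i * P i)"
proof -
  show "form 1 (linform c)" unfolding linform_def by (intro forms_sum forms_const_mult forms_var) auto
  show "ev P (linform c) = (\<Sum>i\<le>amb C. c i * P i)"
   by (simp add: linform_def vh del: One_nat_def) (simp add: ev_evh evh_single[OF is_hom_id] del: One_nat_def)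
qed

text \<open>A quotient of two linear forms: the numerator vanishes at \<open>P\<close> but at no
  point of \<open>S\<close>, the denominator at none of the points involved.\<close>

lemma separating_function:
  assumes S: "finite S" "S \<subseteq> points C" "S ~= {}" and T: "finite T" "T \<subseteq> points C" and P: "P : points C" "P ~: S"
  shows "EX \<psi>:F. \<psi> ~= 0 & \<psi> : \<M> P & (ALL Q:T. \<psi> : \<O> Q) & (ALL Q:S. \<psi> : \<O> Q & \<psi> ~: \<M> Q)"
proof -
  note n = normalised_coordinate[OF P(1)]
  obtain j where j: "j <= amb C" "P j = 1" using n(1) by blast
  define w where "w Q i = Q i - P i * Q j" for Q :: "nat => 'a" and i
  have w0: "EX i<=amb C. w Q i ~= 0" if Q: "Q : S" for Q
  proof (rule ccontr)
   assume "~ ?thesis"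
   hence a: "Q i = P i * Q j" if "i <= amb C" for i using that by (auto simp: w_def)
   have QC: "Q : points C" using Q S(2) by blast
   note nQ = normalised_coordinate[OF QC]
   have e: "Q i = Q j * P i" for i using a[of i] nQ(2) n(2) by (cases "i <= amb C") (auto simp: cone_iff mult.commute)
   obtain i where "Q i ~= 0" using nQ(2) by (auto simp: cone_iff)
   hence "Q j ~= 0" using e[of i] by auto
   hence "normalise (%i. Q j * P i) = normalise P" by (rule normalise_scale)
   moreover have "(%i. Q j * P i) = Q" using e by (intro ext) (rule sym)
   ultimately have "Q = P" using nQ(3) n(3) by simp
   thus False using Q P(2) by simp
  qed
  obtain s where s: "ALL w':w ` S. (\<Sum>i\<le>amb C. s ^ i * w' i) ~= 0"
   using avoid_zeros[of "w ` S" "amb C"] S(1) w0 by blast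
  \<comment> \<open>The correction in the coordinate \<open>j\<close>, where \<open>P j\<close> is
    1, makes the form vanish at \<open>P\<close>.\<close>
  define c where "c i = s ^ i - (if i = j then (\<Sum>i\<le>amb C. s ^ i * P i) else 0)" for i
  define L where "L = linform c"
  have Lv: "ev Q L = (\<Sum>i\<le>amb C. s ^ i * w Q i)" for Q
  proof -
   have "ev Q L = (\<Sum>i\<le>amb C. s ^ i * Q i - (if i = j then (\<Sum>i\<le>amb C. s ^ i * P i) * Q i else 0))"
    unfolding L_def linform by (rule sum.cong) (auto simp: c_def algebra_simps)
   also have "... = (\<Sum>i\<le>amb C. s ^ i * Q i) - (\<Sum>i\<le>amb C. s ^ i * P i) * Q j"
    using j(1) by (simp add: sum_subtractf sum.delta)
   also have "... = (\<Sum>i\<le>amb C. s ^ i * w Q i)"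
    by (simp add: w_def right_diff_distrib sum_subtractf sum_distrib_right mult.assoc)
   finally show ?thesis .
  qed
  have "EX i<=amb C. Q i ~= 0" if "Q : insert P (S \<union> T)" for Q
  proof -
   have "Q : points C" using that P S T by auto
   from normalised_coordinate(2)[OF this] show ?thesis by (auto simp: cone_iff)
  qed
  then obtain s' where s': "ALL Q:insert P (S \<union> T). (\<Sum>i\<le>amb C. s' ^ i * Q i) ~= 0"
   using avoid_zeros[of "insert P (S \<union> T)" "amb C"] S(1) T(1) by blast
  define L' where "L' = linform (%i. s' ^ i)"
  have L': "ev Q L' ~= 0" if "Q : insert P (S \<union> T)" for Q unfolding L'_def linform using s' that by blast
  have LS: "ev Q L ~= 0" if "Q : S" for Q unfolding Lv using s that by blast
  have LP: "ev P L = 0" using j(2) by (simp add: Lv w_def)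
  have f: "form 1 L" "form 1 L'" by (simp_all only: L_def L'_def linform)
  obtain Q0 where Q0: "Q0 : S" using S(3) by blast
  have nz: "eX L ~= 0" "eX L' ~= 0"
   using eX_nonzero[OF normalised_coordinate(2) f(1) LS[OF Q0]] eX_nonzero[OF n(2) f(2) L'] Q0 S(2) by auto
  let ?p = "eX L / eX L'"
  have "?p : \<M> P" unfolding vanishing_def using f LP L' by blast
  moreover have O: "?p : \<O> Q" if "Q : S \<union> T" for Q unfolding regular_def using f L'[of Q] that by blast
  moreover have "?p ~: \<M> Q" if Q: "Q : S" for Q
  proof -
   have "eX L' / eX L : \<O> Q" unfolding regular_def using f LS[OF Q] by blast
   thus ?thesis using M_eq[OF normalised_coordinate(2)] Q S(2) nz by force
  qed
  moreover have "?p : F" using calculation(1) Mi(5)[OF n(2)] local_ring(6)[OF n(2)] by blast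
  ultimately show ?thesis using nz by (intro bexI[of _ ?p]) auto
qed

text \<open>Otherwise some function vanishes at \<open>Q\<close>, is regular on the orbit of
  \<open>Q\<close> and is a unit on the orbit of \<open>P\<close>. Its norm is a rational function
  of x, and whether its order is 0 depends only on the value of x; yet this order is 0 at
  \<open>P\<close> and positive at \<open>Q\<close>.\<close>

lemma fibre_orbit:
  assumes P: "P : points C" and Q: "Q : points C" and e: "xval P = xval Q"
  shows "EX i. Q = (dp ^^ i) P"
proof (rule ccontr)
  assume no: "~ ?thesis"
  let ?S = "(%i. (dp ^^ i) P) ` {..m}" and ?T = "(%i. (dp ^^ i) Q) ` {..m}"
  have "EX \<psi>:F. \<psi> ~= 0 & \<psi> : \<M> Q & (ALL R:?T. \<psi> : \<O> R) & (ALL R:?S. \<psi> : \<O> R & \<psi> ~: \<M> R)"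
   by (rule separating_function) (use dp_funpow_points[OF P] dp_funpow_points[OF Q] Q no in auto)
  then obtain \<psi> where \<psi>: "\<psi> : F" "\<psi> ~= 0" "\<psi> : \<M> Q" "ALL R:?T. \<psi> : \<O> R" "ALL R:?S. \<psi> : \<O> R & \<psi> ~: \<M> R" by blast
  note nn = norm[OF \<psi>(1,2)]
  obtain n d where nd: "d ~= 0" "norm \<psi> = pev x0 n / pev x0 d" using fixed[OF nn(1,3)] by blast
  hence n: "n ~= 0" using nn(2) is_homD(4)[OF pev_hom] by auto
  have o: "ord R (norm \<psi>) = (weight (xval R) n - weight (xval R) d) * ram R" if R: "R : points C" for R
   unfolding nd(2) using ord_divide[OF R pev_F _ pev_F, of n d] transcendental n nd(1) ord_pev[OF R]
   by (auto simp: left_diff_distrib)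
  have "ord ((dp ^^ Suc i) P) \<psi> = 0" if "i < m" for i
  proof (rule ord_unit[OF dp_funpow_points[OF P]])
   have "(dp ^^ Suc i) P : ?S" using that by (intro imageI) simp
   thus "\<psi> : \<O> ((dp ^^ Suc i) P)" "\<psi> ~: \<M> ((dp ^^ Suc i) P)" using \<psi>(5) by blast+
  qed
  hence "ord P (norm \<psi>) = 0" unfolding nn(4)[OF P] by (intro sum.neutral) auto
  hence "weight (xval P) n = weight (xval P) d" using o[OF P] ram_pos[OF P] by simp
  hence "ord Q (norm \<psi>) = 0" using o[OF Q] e by simp
  moreover have "ord Q (norm \<psi>) > 0" unfolding nn(4)[OF Q]
  proof (rule sum_pos2[of _ "m - 1"])
   show "0 < ord ((dp ^^ Suc (m - 1)) Q) \<psi>" using dp_period[OF Q] m ord_iff(2)[OF Q \<psi>(1,2)] \<psi>(3) by (simp del: funpow.simps)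
   fix i assume "i : {..<m}"
   hence "(dp ^^ Suc i) Q : ?T" by (intro imageI) simp
   thus "0 <= ord ((dp ^^ Suc i) Q) \<psi>" using \<psi>(4) ord_iff(1)[OF dp_funpow_points[OF Q] \<psi>(1,2)] by blast
  qed (use m in auto)
  ultimately show False by simp
qed

end

lemma sum_binomial_step:
  fixes a :: "nat => int"
  shows "(\<Sum>i\<le>Suc k. of_nat (Suc k choose i) * a i) = (\<Sum>i\<le>k. of_nat (k choose i) * (a i + a (Suc i)))"
proof -
  have 1: "(\<Sum>i\<le>Suc k. of_nat (k choose i) * a i) = (\<Sum>i\<le>k. of_nat (k choose i) * a i)" by simp
  have 2: "(\<Sum>i\<le>Suc k. of_nat (k choose i) * a i) = a 0 + (\<Sum>i\<le>k. of_nat (k choose Suc i) * a (Suc i))"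
   by (subst sum.atMost_Suc_shift) simp
  have 3: "(\<Sum>i\<le>Suc k. of_nat (Suc k choose i) * a i) = a 0 + (\<Sum>i\<le>k. of_nat (Suc k choose Suc i) * a (Suc i))"
   by (subst sum.atMost_Suc_shift) simp
  have 4: "(\<Sum>i\<le>k. of_nat (Suc k choose Suc i) * a (Suc i)) =
    (\<Sum>i\<le>k. of_nat (k choose i) * a (Suc i)) + (\<Sum>i\<le>k. of_nat (k choose Suc i) * a (Suc i))"
   by (simp add: distrib_right sum.distrib)
  have 5: "(\<Sum>i\<le>k. of_nat (k choose i) * (a i + a (Suc i))) =
    (\<Sum>i\<le>k. of_nat (k choose i) * a i) + (\<Sum>i\<le>k. of_nat (k choose i) * a (Suc i))"
   by (simp add: distrib_left sum.distrib)
  show ?thesis unfolding 3 4 5 using 1 2 by linarith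
qed

text \<open>The product of \<open>i\<close> with the binomial coefficient is a multiple of
  \<open>l ^ n\<close>; a coefficient prime to \<open>l\<close> would force \<open>l ^ n\<close> to
  divide \<open>i\<close>.\<close>

lemma prime_dvd_choose_power:
  assumes l: "prime (l::nat)" and i: "0 < i" "i < l ^ n" shows "l dvd (l ^ n choose i)"
proof (rule ccontr)
  assume nd: "~ l dvd (l ^ n choose i)"
  obtain i' N where e: "i = Suc i'" "l ^ n = Suc N" using i by (metis gr0_implies_Suc less_zeroE not_gr_zero)
  have "i * (l ^ n choose i) = l ^ n * (N choose i')"
   using Suc_times_binomial_eq[of N i'] unfolding e by (simp add: mult.commute)
  hence "l ^ n dvd i * (l ^ n choose i)" by simp
  moreover have "coprime (l ^ n) (l ^ n choose i)" using nd l by (simp add: prime_imp_coprime coprime_power_left_iff)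
  ultimately have "l ^ n dvd i" by (simp add: coprime_dvd_mult_left_iff)
  thus False using i dvd_imp_le by fastforce
qed

subsection \<open>Divisors with principal difference under the cyclic group\<close>

context function_field
begin

text \<open>Divisors are represented here by integer functions on the points.\<close>

definition prin :: "((nat => 'a) => int) => bool" where
  "prin D \<longleftrightarrow> (EX x:F. x ~= 0 & (ALL P:points C. D P = ord P x))"

definition fin :: "((nat => 'a) => int) => bool" where "fin D \<longleftrightarrow> finite {P:points C. D P ~= 0}"

lemma prin_cong: "prin D ==> (!!P. P : points C ==> E P = D P) ==> prin E" by (simp add: prin_def)

lemma prin_0: "prin (%P. 0)" unfolding prin_def using ord_emb[of _ 1] Fr(2) by (intro bexI[of _ 1]) (auto simp: eh)

lemma prin_add: "prin D ==> prin E ==> prin (%P. D P + E P)"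
  unfolding prin_def using ord_mult Fr(4) by (metis (no_types, lifting) mult_eq_0_iff)

lemma prin_uminus: "prin D ==> prin (%P. - D P)"
  unfolding prin_def using ord_inverse subf_inverse[OF F] by (metis (no_types, lifting) inverse_nonzero_iff_nonzero)

lemma prin_minus: "prin D ==> prin E ==> prin (%P. D P - E P)"
  using prin_add[of D "%P. - E P"] prin_uminus[of E] by simp

lemma prin_sum: "(!!i. i : I ==> prin (D i)) ==> prin (%P. \<Sum>i\<in>I. D i P)"
  by (induction I rule: infinite_finite_induct) (auto intro: prin_0 prin_add)

lemma prin_times: "prin D ==> prin (%P. n * D P)"
proof -
  assume D: "prin D"
  then obtain x where x: "x : F" "x ~= 0" "!!P. P : points C ==> D P = ord P x" by (auto simp: prin_def)
  show ?thesis unfolding prin_def by (rule bexI[of _ "x powi n"])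
    (use x ord_power_int(1) Fr(7) subf_inverse[OF F] in "auto simp: power_int_def")
qed

lemma fin_comp:
  assumes "inj_on f (points C)" "f ` points C \<subseteq> points C" "fin D" shows "fin (%P. D (f P))"
proof -
  have "f ` {P:points C. D (f P) ~= 0} \<subseteq> {P:points C. D P ~= 0}" using assms(2) by auto
  hence "finite (f ` {P:points C. D (f P) ~= 0})" using assms(3) finite_subset unfolding fin_def by blast
  moreover have "inj_on f {P:points C. D (f P) ~= 0}" using assms(1) by (rule inj_on_subset) auto
  ultimately show ?thesis unfolding fin_def by (rule finite_imageD)
qed

lemma fin_minus: "fin D ==> fin E ==> fin (%P. D P - E P)"
  unfolding fin_def by (rule finite_subset[of _ "{P:points C. D P ~= 0} \<union> {P:points C. E P ~= 0}"]) auto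

end

context cyclic_cover
begin

definition \<Delta> :: "((nat => 'a) => int) => (nat => 'a) => int" where "\<Delta> D = (%P. D (dp P) - D P)"

lemma fin_Delta: "fin D ==> fin (\<Delta> D)" unfolding \<Delta>_def using dp_points by (intro fin_minus fin_comp[OF dp_inj]) auto

lemma prin_translate: assumes "prin D" shows "prin (%P. D (dp P))"
proof -
  obtain x where x: "x : F" "x ~= 0" "!!P. P : points C ==> D P = ord P x" using assms by (auto simp: prin_def)
  obtain y where y: "y : F" "x = \<delta> y" using dl(10)[OF x(1)] by blast
  have "y ~= 0" using x(2) y dl(8) by auto
  thus ?thesis unfolding prin_def using y x(3) dp_points act(4)[OF delta] by (intro bexI[of _ y]) auto
qed

lemma prin_Delta: "prin D ==> prin (\<Delta> D)" unfolding \<Delta>_def by (intro prin_minus prin_translate)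

lemma prin_Delta_pow: "prin D ==> prin ((\<Delta> ^^ i) D)" by (induction i) (auto intro: prin_Delta)

lemma Delta_times: "(\<Delta> ^^ i) (%P. c * D P) = (%P. c * (\<Delta> ^^ i) D P)"
  by (induction i) (auto simp: \<Delta>_def right_diff_distrib)

text \<open>Translation by \<open>dp\<close> is 1 + \<Delta>; this is the expansion of its k-th
  power.\<close>

lemma translate_binomial: "D ((dp ^^ k) P) = (\<Sum>i\<le>k. of_nat (k choose i) * (\<Delta> ^^ i) D P)"
proof (induction k arbitrary: D)
  case (Suc k)
  have a: "(\<Delta> ^^ i) (%P. D (dp P)) P = (\<Delta> ^^ i) D P + (\<Delta> ^^ Suc i) D P" for i P
  proof (induction i arbitrary: P)
   case (Suc i)
   show ?case unfolding funpow.simps comp_apply \<Delta>_def[of "(\<Delta> ^^ i) (%P. D (dp P))"] Suc by (simp add: \<Delta>_def)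
  qed (simp add: \<Delta>_def)
  have "D (dp ((dp ^^ k) P)) = (\<Sum>i\<le>k. of_nat (k choose i) * ((\<Delta> ^^ i) D P + (\<Delta> ^^ Suc i) D P))"
   using Suc.IH[of "%P. D (dp P)"] by (simp only: a)
  thus ?case unfolding sum_binomial_step by simp
qed simp

text \<open>The element \<open>(\<delta> - 1) ^ m\<close> of the group ring is divisible by \<open>l\<close>, since \<open>m\<close> is a power of \<open>l\<close>.\<close>

lemma Delta_nilpotent:
  assumes l: "prime l" and ml: "m = l ^ n" and D: "prin (%P. int l ^ M * D P)"
  shows "prin ((\<Delta> ^^ (m * M)) D)" using D
proof (induction M arbitrary: D)
  case (Suc M)
  define c where "c i = int (m choose i) div int l" for i
  have c: "int (m choose i) = int l * c i" if "i : {0<..<m}" for i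
   using prime_dvd_choose_power[OF l, of i n] that ml by (simp add: c_def)
  \<comment> \<open>The m-th power of translation is the identity. In the binomial expansion the
    terms for 0 and m are split off; the coefficients of all others are multiples of
    \<open>l\<close>.\<close>
  have main: "(\<Delta> ^^ m) D P = - (\<Sum>i\<in>{0<..<m}. int l * c i * (\<Delta> ^^ i) D P)" if P: "P : points C" for P
  proof -
   obtain k where k: "m = Suc k" using m by (cases m) auto
   have "D P = (\<Sum>i\<le>m. of_nat (m choose i) * (\<Delta> ^^ i) D P)" using translate_binomial[of D m P] dp_period[OF P] by simp
   also have "{..m} = insert 0 (insert m {0<..<m})" using m by auto
   also have "(\<Sum>i\<in>insert 0 (insert m {0<..<m}). of_nat (m choose i) * (\<Delta> ^^ i) D P)
    = D P + ((\<Delta> ^^ m) D P + (\<Sum>i\<in>{0<..<m}. of_nat (m choose i) * (\<Delta> ^^ i) D P))" using m by simp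
   also have "(\<Sum>i\<in>{0<..<m}. of_nat (m choose i) * (\<Delta> ^^ i) D P) = (\<Sum>i\<in>{0<..<m}. int l * c i * (\<Delta> ^^ i) D P)"
    by (rule sum.cong) (auto simp: c)
   finally show ?thesis by linarith
  qed
  have "prin (%P. - (\<Sum>i\<in>{0<..<m}. c i * (\<Delta> ^^ i) (%P. int l ^ Suc M * D P) P))"
   by (intro prin_uminus prin_sum prin_times prin_Delta_pow Suc.prems)
  hence "prin (%P. int l ^ M * (\<Delta> ^^ m) D P)"
  proof (rule prin_cong)
   fix P assume P: "P : points C"
   have "c i * (\<Delta> ^^ i) (%P. int l ^ Suc M * D P) P = int l ^ M * (int l * c i * (\<Delta> ^^ i) D P)" for i
    by (simp only: Delta_times) (simp add: mult_ac)
   thus "int l ^ M * (\<Delta> ^^ m) D P = - (\<Sum>i\<in>{0<..<m}. c i * (\<Delta> ^^ i) (%P. int l ^ Suc M * D P) P)"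
    by (simp only: main[OF P] sum_distrib_left mult_minus_right)
  qed
  hence "prin ((\<Delta> ^^ (m * M)) ((\<Delta> ^^ m) D))" by (rule Suc.IH)
  moreover have "m * Suc M = m * M + m" by simp
  ultimately show ?case by (simp only: funpow_add comp_apply)
qed simp

text \<open>\<open>sg\<close> is the action of \<open>s\<close> on the function field: it fixes x
  and the ratios of the generic coordinates. Its commuting with \<delta> reflects that
  \<open>s\<close> fixes the root of unity defining \<delta>.\<close>

definition galois :: "('a => 'a) => bool" where
  "galois s \<longleftrightarrow> is_hom s & (EX sg. compatible sg s & sg x0 = x0 & (ALL x:F. sg (\<delta> x) = \<delta> (sg x)) &
    (ALL i j. Xg j ~= 0 --> sg (Xg i / Xg j) = Xg i / Xg j))"

lemma galois_comp: assumes "galois s" "galois s'" shows "galois (%c. s (s' c))"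
proof -
  obtain f where f: "is_hom s" "compatible f s" "f x0 = x0" "ALL x:F. f (\<delta> x) = \<delta> (f x)"
   "ALL i j. Xg j ~= 0 --> f (Xg i / Xg j) = Xg i / Xg j" using assms(1) by (auto simp: galois_def)
  obtain g where g: "is_hom s'" "compatible g s'" "g x0 = x0" "ALL x:F. g (\<delta> x) = \<delta> (g x)"
   "ALL i j. Xg j ~= 0 --> g (Xg i / Xg j) = Xg i / Xg j" using assms(2) by (auto simp: galois_def)
  have "is_hom (%c. s (s' c))" using is_hom_comp[OF f(1) g(1)] by (simp add: comp_def)
  moreover have "compatible (%x. f (g x)) (%c. s (s' c))" by (rule compatible_comp[OF f(2) g(2)])
  moreover have "ALL x:F. f (g (\<delta> x)) = \<delta> (f (g x))" using f(4) g(4) compatibleD(1)[OF g(2)] by auto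
  ultimately show ?thesis unfolding galois_def using f(3,5) g(3,5) by (intro conjI exI[of _ "%x. f (g x)"]) auto
qed

lemma galois_funpow: "galois s ==> galois (s ^^ n)"
proof (induction n)
  case 0
  have "compatible (%x. x) (%c. c)" by (rule compatible_id)
  thus ?case using is_hom_id by (auto simp: galois_def id_def intro!: exI[of _ "%x. x"])
next
  case (Suc n)
  thus ?case using galois_comp[of s "s ^^ n"] by (simp add: comp_def)
qed

definition tr :: "('a => 'a) => (nat => 'a) => nat => 'a" where "tr s P = (%i. s (P i))"

lemma tr_funpow: "tr (s ^^ n) P = (tr s ^^ n) P"
proof (induction n)
  case (Suc n)
  have "tr (s ^^ Suc n) P = tr s (tr (s ^^ n) P)" by (simp add: tr_def)
  also have "... = (tr s ^^ Suc n) P" by (simp add: Suc)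
  finally show ?case .
qed (simp add: tr_def)

lemma galois:
  assumes s: "galois s"
  shows "P : points C ==> tr s P : points C" "inj_on (tr s) (points C)" "P : points C ==> xval (tr s P) = map_option s (xval P)"
   "P : points C ==> dp (tr s P) = tr s (dp P)" "prin D ==> prin (%P. D (tr s P))"
proof -
  obtain f where f: "is_hom s" "compatible f s" "f x0 = x0" "ALL x:F. f (\<delta> x) = \<delta> (f x)"
   "!!i j. Xg j ~= 0 ==> f (Xg i / Xg j) = Xg i / Xg j" using s by (auto simp: galois_def)
  note c = compatibleD[OF f(2)]
  have a: "tr s P = act f P" if "P : points C" for P using act_coordinates[OF f(2,1,5) that] by (simp add: tr_def)
  show pt: "tr s P : points C" if "P : points C" for P using a[OF that] act(1)[OF f(2) that] by simp
  show "inj_on (tr s) (points C)"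
   by (rule inj_onI) (use is_hom_field(2)[OF f(1)] in "auto simp: tr_def fun_eq_iff inj_def")
  show "xval (tr s P) = map_option s (xval P)" if P: "P : points C" for P
  proof (cases "xval P")
   case None
   have "x0 ~: f ` \<O> P"
   proof
    assume "x0 : f ` \<O> P"
    then obtain x where x: "x : \<O> P" "f x = f x0" using f(3) by auto
    hence "x = x0" using c(11)[OF _ x0(1)] local_ring(6)[OF normalised_coordinate(2)[OF P]] by blast
    thus False using None xval_None x by blast
   qed
   hence "xval (tr s P) = None" unfolding xval_None a[OF P] act(2)[OF f(2) P] .
   thus ?thesis using None by simp
  next
   case (Some b)
   hence "x0 - emb b : \<M> P" using xval_Some[OF P] by simp
   hence "f (x0 - emb b) : \<M> (tr s P)" unfolding a[OF P] act(3)[OF f(2) P] by (rule imageI)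
   moreover have "f (x0 - emb b) = x0 - emb (s b)" using c(13)[OF x0(1) emb_F] f(3) c(4) by simp
   ultimately have "x0 - emb (s b) : \<M> (tr s P)" by simp
   thus ?thesis using xval_Some[OF pt[OF P]] Some by simp
  qed
  show "dp (tr s P) = tr s (dp P)" if P: "P : points C" for P
  proof -
   have "dp (tr s P) = act (%x. \<delta> (f x)) P" unfolding a[OF P] by (rule act_comp[OF delta f(2) P])
   also have "... = act (%x. f (\<delta> x)) P" by (rule act_cong[OF P]) (use f(4) in auto)
   also have "... = tr s (dp P)" unfolding a[OF dp_points[OF P]] by (rule act_comp[OF f(2) delta P, symmetric])
   finally show ?thesis .
  qed
  show "prin (%P. D (tr s P))" if D: "prin D"
  proof -
   obtain x where x: "x : F" "x ~= 0" "!!P. P : points C ==> D P = ord P x" using D by (auto simp: prin_def)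
   obtain y where y: "y : F" "x = f y" using c(10)[OF x(1)] by blast
   have "y ~= 0" using x(2) y c(8) by auto
   thus ?thesis unfolding prin_def using y x(3) pt a act(4)[OF f(2)] by (intro bexI[of _ y]) auto
  qed
qed

text \<open>Finite branch values only; the fibre over infinity is mapped to itself by every
  \<open>tr s\<close>.\<close>

definition branch :: "'a set" where "branch = {v. EX P:points C. xval P = Some v & ord P (x0 - emb v) > 1}"

lemma fixed_multiple: "(s ^^ a) v = v ==> a dvd b ==> (s ^^ b) v = v"
proof -
  assume a: "(s ^^ a) v = v" and b: "a dvd b"
  then obtain k where "b = k * a" by (metis dvd_def mult.commute)
  moreover have "((s ^^ a) ^^ k) v = v" for k by (induction k) (auto simp: a)
  ultimately show ?thesis by (metis funpow_mult mult.commute)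
qed

text \<open>By Hilbert 90, \<open>D\<close> is up to a principal divisor invariant under the cyclic group. The pullbacks of the
  points of the line outside the branch locus are principal up to infinity, so only branch points remain.\<close>

lemma invariant_class:
  assumes l: "l >= 1" and s: "galois s" and br: "!!v. v : branch ==> EX e. (s ^^ (l ^ e)) v = v"
   and D: "fin D" "prin (\<Delta> D)"
  shows "EX e. prin (%P. D (tr (s ^^ (l ^ e)) P) - D P)"
proof -
  obtain f where f: "f : F" "f ~= 0" "!!P. P : points C ==> D (dp P) - D P = ord P f"
   using D(2) by (auto simp: prin_def \<Delta>_def)
  note nn = norm[OF f(1,2)]
  \<comment> \<open>The divisor of \<open>f\<close> is \<Delta> D, so the orders of \<open>f\<close>
    along an orbit telescope to 0. The norm then has neither zeros nor poles and is
    constant.\<close>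
  have "ord P (norm f) = 0" if P: "P : points C" for P
  proof -
   have "ord ((dp ^^ Suc i) P) f = D ((dp ^^ Suc (Suc i)) P) - D ((dp ^^ Suc i) P)" for i
    using f(3)[OF dp_funpow_points[OF P, of "Suc i"]] by simp
   hence "ord P (norm f) = (\<Sum>i<m. D ((dp ^^ Suc (Suc i)) P) - D ((dp ^^ Suc i) P))"
    unfolding nn(4)[OF P] by (simp del: funpow.simps)
   also have "... = D ((dp ^^ Suc m) P) - D ((dp ^^ Suc 0) P)"
    by (rule sum_lessThan_telescope[of "%i. D ((dp ^^ Suc i) P)"])
   also have "... = 0" using dp_period[OF P] by simp
   finally show ?thesis .
  qed
  hence "norm f : range emb" using no_poles_constant[OF nn(1)] ord_iff(1)[OF _ nn(1,2)] by auto
  then obtain c where c: "norm f = emb c" by blast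
  have c0: "c ~= 0" using c nn(2) by (auto simp: eh)
  \<comment> \<open>Division by an m-th root of the constant norm gives an element of norm 1, as
    Hilbert 90 requires.\<close>
  obtain b where b: "b ^ m = c" using nth_root_exists[of m c] m by auto
  have b0: "b ~= 0" using b c0 m by (auto simp: power_0_left)
  define f' where "f' = emb (inverse b) * f"
  have f': "f' : F" unfolding f'_def by (intro Fr(4) emb_F f)
  have "(\<delta> ^^ i) f' = emb (inverse b) * (\<delta> ^^ i) f" for i
   unfolding f'_def using dlp(3)[OF emb_F f(1)] dlp(4) by simp
  hence "(\<Prod>i<m. (\<delta> ^^ i) f') = emb (inverse b) ^ m * norm f" by (simp add: norm_def prod.distrib)
  also have "... = emb (inverse b ^ m * b ^ m)" by (simp add: c b eh)
  also have "inverse b ^ m * b ^ m = 1" using b0 by (simp flip: power_mult_distrib)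
  finally have "(\<Prod>i<m. (\<delta> ^^ i) f') = 1" by (simp add: eh)
  then obtain g where g: "g : F" "g ~= 0" "f' * \<delta> g = g" using hilbert90[OF f'] by blast
  have dg: "\<delta> g : F" "\<delta> g ~= 0" using dl(1,8) g by auto
  have of: "ord P f = ord P g - ord P (\<delta> g)" if P: "P : points C" for P
  proof -
   have "ord P f' = ord P (emb (inverse b)) + ord P f"
    unfolding f'_def by (rule ord_mult[OF P emb_F _ f(1,2)]) (use b0 ef(1) in simp)
   moreover have "ord P (emb (inverse b)) = 0" using ord_emb[OF P] b0 by simp
   moreover have "f' ~= 0" using g by auto
   hence "ord P g = ord P f' + ord P (\<delta> g)" using ord_mult[OF P f' _ dg] g(3) by simp
   ultimately show ?thesis by simp
  qed
  \<comment> \<open>The order of \<delta> g at \<open>dp P\<close> is the order of \<open>g\<close>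
    at \<open>P\<close>. Subtracting the divisor of \<delta> g, rather than that of
    \<open>g\<close>, therefore gives an invariant function.\<close>
  define E where "E P = D P - ord P (\<delta> g)" for P
  have finO: "fin (%P. ord P x)" if "x : F" "x ~= 0" for x
   unfolding fin_def by (rule finite_support[OF finite_zeros that])
  have fE: "fin E" unfolding E_def by (intro fin_minus D finO dg)
  have Einv: "E (dp P) = E P" if P: "P : points C" for P
   using f(3)[OF P] of[OF P] act(4)[OF delta P g(1,2)] by (simp add: E_def)
  define V where "V = {v. v ~: branch & (EX P:points C. xval P = Some v & E P ~= 0)}"
  have finV: "finite V"
  proof -
   have "V \<subseteq> (%P. the (xval P)) ` {P:points C. E P ~= 0}" unfolding V_def by force
   thus ?thesis using fE unfolding fin_def by (meson finite_imageI finite_subset)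
  qed
  define Ev where "Ev v = E (SOME P. P : points C & xval P = v)" for v
  have inv_const: "A P = A Q" if A: "!!P. P : points C ==> A (dp P) = A P" and P: "P : points C" and Q: "Q : points C"
   and e: "xval P = xval Q" for A :: "(nat => 'a) => int" and P Q
  proof -
   obtain i where "Q = (dp ^^ i) P" using fibre_orbit[OF P Q e] by blast
   moreover have "A ((dp ^^ i) P) = A P" for i by (induction i) (use A dp_funpow_points[OF P] in auto)
   ultimately show ?thesis by simp
  qed
  have Ev: "E P = Ev (xval P)" if P: "P : points C" for P
  proof -
   have "(SOME Q. Q : points C & xval Q = xval P) : points C & xval (SOME Q. Q : points C & xval Q = xval P) = xval P"
    by (rule someI[of "%Q. Q : points C & xval Q = xval P" P]) (use P in simp)
   thus ?thesis unfolding Ev_def using inv_const[of E, OF Einv P] by simp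
  qed
  \<comment> \<open>Outside the branch values x - v has order 1 over v, and it has order 0 over
    other finite values, so \<open>h\<close> cancels \<open>E\<close> on the fibres over
    \<open>V\<close>. What it contributes at infinity is harmless, as that fibre is stable.\<close>
  define h where "h = (\<Prod>v\<in>V. (x0 - emb v) powi Ev (Some v))"
  have hf: "(x0 - emb v) powi i : F" "(x0 - emb v) powi i ~= 0" if "P : points C" for v i P
   using ord_power_int(2)[OF that x0_minus] x0_minus(2) by auto
  obtain P0 where P0: "P0 : points C"
  proof -
   obtain Q where "Q : cone C" using generic[OF forms_one] eh xh(1) by (auto simp: vh)
   from points_rep[OF proj this] show thesis using that by blast
  qed
  have h: "h : F" "h ~= 0" unfolding h_def using hf[OF P0] finV by (auto intro: Fr(9))
  have dpw: "\<delta> ((x0 - emb v) powi i) = (x0 - emb v) powi i" for v i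
   using dl(12)[OF x0_minus(1)] dl(13)[OF x0(1) emb_F] x0(2) dl(4) by simp
  have dh: "\<delta> h = h"
  proof -
   have "\<delta> (\<Prod>v\<in>W. (x0 - emb v) powi Ev (Some v)) = (\<Prod>v\<in>W. (x0 - emb v) powi Ev (Some v))" for W
   proof (induction W rule: infinite_finite_induct)
    case (insert v W)
    have "(\<Prod>v\<in>W. (x0 - emb v) powi Ev (Some v)) : F" by (intro Fr(9) hf[OF P0])
    thus ?case using insert dl(3)[OF hf(1)[OF P0]] dpw by simp
   qed (auto simp: dl(6))
   thus ?thesis by (simp add: h_def)
  qed
  define E' where "E' P = E P - ord P h" for P
  have E'inv: "E' (dp P) = E' P" if P: "P : points C" for P
   using Einv[OF P] act(4)[OF delta P h] dh by (simp add: E'_def)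
  have fE': "fin E'" unfolding E'_def by (intro fin_minus fE finO h)
  have E'0: "E' P = 0" if P: "P : points C" and v: "xval P = Some v" "v ~: branch" for P v
  proof -
   have "ord P ((x0 - emb w) powi Ev (Some w)) = (if w = v then Ev (Some v) else 0)" for w
   proof (cases "w = v")
    case True
    have "ord P (x0 - emb v) > 0" using ram_pos[OF P] v by (simp add: ram_def)
    moreover have "~ ord P (x0 - emb v) > 1" using v P unfolding branch_def by blast
    ultimately show ?thesis using ord_power_int(1)[OF P x0_minus] True by simp
   next
    case False
    have "order v [:- w, 1:] = 0" by (rule order_0I) (use False in simp)
    hence "ord P (pev x0 [:- w, 1:]) = 0" using ord_pev[OF P, of "[:- w, 1:]"] v by (simp add: weight_def)
    thus ?thesis using ord_power_int(1)[OF P x0_minus] False by (simp add: pev_X)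
   qed
   hence "ord P h = (\<Sum>w\<in>V. if w = v then Ev (Some v) else 0)"
    unfolding h_def using ord_prod[OF P, of V "%v. (x0 - emb v) powi Ev (Some v)"] hf[OF P] by simp
   also have "... = (if v : V then Ev (Some v) else 0)" using finV by simp
   also have "... = E P" using Ev[OF P] v P by (auto simp: V_def)
   finally show ?thesis by (simp add: E'_def)
  qed
  define B where "B = {v. EX P:points C. xval P = Some v & E' P ~= 0}"
  have Bb: "B \<subseteq> branch" unfolding B_def using E'0 by blast
  have finB: "finite B"
  proof -
   have "B \<subseteq> (%P. the (xval P)) ` {P:points C. E' P ~= 0}" unfolding B_def by force
   thus ?thesis using fE' unfolding fin_def by (meson finite_imageI finite_subset)
  qed
  have "EX e. ALL v:B. (s ^^ (l ^ e)) v = v" using finB Bb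
  proof (induction B rule: finite_induct)
   case (insert v B)
   then obtain e where e: "ALL v:B. (s ^^ (l ^ e)) v = v" by auto
   obtain e' where e': "(s ^^ (l ^ e')) v = v" using br insert.prems by blast
   have "(s ^^ (l ^ (e + e'))) w = w" if wB: "w : insert v B" for w
   proof (cases "w = v")
    case True
    show ?thesis unfolding True power_add by (rule fixed_multiple[OF e']) simp
   next
    case False
    hence "(s ^^ (l ^ e)) w = w" using e wB by simp
    thus ?thesis unfolding power_add by (rule fixed_multiple) simp
   qed
   thus ?case by blast
  qed simp
  then obtain e where e: "!!v. v : B ==> (s ^^ (l ^ e)) v = v" by blast
  define t where "t = s ^^ (l ^ e)"
  have t: "galois t" unfolding t_def by (rule galois_funpow[OF s])
  note T = galois[OF t]
  have th: "is_hom t" using t by (simp add: galois_def)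
  \<comment> \<open>\<open>E'\<close> is constant on the fibres of x. Over infinity and over
    \<open>B\<close> the automorphism preserves the fibre; elsewhere \<open>E'\<close> vanishes
    before and after, since \<open>t\<close> is injective and fixes \<open>B\<close>
    pointwise.\<close>
  have same: "E' (tr t P) = E' P" if P: "P : points C" for P
  proof (cases "xval P")
   case None
   thus ?thesis using T(3)[OF P] by (intro inv_const[of E', OF E'inv T(1)[OF P] P]) auto
  next
   case (Some v)
   show ?thesis
   proof (cases "v : B")
    case True
    thus ?thesis using T(3)[OF P] e Some by (intro inv_const[of E', OF E'inv T(1)[OF P] P]) (auto simp: t_def)
   next
    case False
    have "t v ~: B"
    proof
     assume tv: "t v : B"
     hence "t (t v) = t v" using e by (simp add: t_def)
     hence "t v = v" using is_hom_field(2)[OF th] by (auto simp: inj_def)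
     thus False using tv False by simp
    qed
    moreover have "xval (tr t P) = Some (t v)" using T(3)[OF P] Some by simp
    ultimately have "E' (tr t P) = 0" using T(1)[OF P] unfolding B_def by blast
    moreover have "E' P = 0" using False P Some unfolding B_def by blast
    ultimately show ?thesis by simp
   qed
  qed
  have pw: "prin (%P. ord P (\<delta> g) + ord P h)" using dg h by (intro prin_add) (auto simp: prin_def)
  have "prin (%P. (ord (tr t P) (\<delta> g) + ord (tr t P) h) - (ord P (\<delta> g) + ord P h))"
   using T(5)[OF pw] pw by (intro prin_minus) auto
  hence "prin (%P. D (tr t P) - D P)" by (rule prin_cong) (use same in "force simp: E'_def E_def")
  thus ?thesis unfolding t_def by blast
qed

text \<open>Induction on the number of applications of \<Delta> that make \<open>D\<close>
  principal. Some iterate \<open>t\<close> fixes the class of \<Delta> D. As \<open>t\<close>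
  commutes with \<delta>, the class of D' = t D - D is invariant under \<delta>, so an iterate
  \<open>t'\<close> of \<open>t\<close> fixes it by \<open>invariant_class\<close>, and with it the
  class of D1 = t' D - D, a sum of translates of D'. Applying \<open>t'\<close> to \<open>D\<close>
  a further \<open>l ^ M\<close> times in all changes it by \<open>l ^ M\<close> times D1 up to
  principal divisors, which is principal because \<open>l ^ M\<close> kills the class of
  \<open>D\<close>.\<close>

theorem unipotent:
  assumes l: "prime l" and ml: "m = l ^ n" and s: "galois s" and br: "!!v. v : branch ==> EX e. (s ^^ (l ^ e)) v = v"
   and D: "fin D" "prin (%P. int l ^ M * D P)"
  shows "EX e. prin (%P. D (tr (s ^^ (l ^ e)) P) - D P)"
proof -
  have "EX e. prin (%P. D (tr (s ^^ (l ^ e)) P) - D P)"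
   if "fin D" "prin (%P. int l ^ M * D P)" "prin ((\<Delta> ^^ i) D)" for D i using that
  proof (induction i arbitrary: D)
   case 0
   have "prin (%P. D (tr s P) - D P)" using galois(5)[OF s 0(3)[simplified]] 0(3) by (intro prin_minus) auto
   thus ?case by (intro exI[of _ 0]) simp
  next
   case (Suc i)
   have pD: "prin (%P. int l ^ M * \<Delta> D P)"
    using prin_Delta_pow[OF Suc.prems(2), of 1] Delta_times[of 1 "int l ^ M" D] by simp
   have "prin ((\<Delta> ^^ i) (\<Delta> D))" using Suc.prems(3) by (simp only: funpow_Suc_right comp_apply)
   from Suc.IH[OF fin_Delta[OF Suc.prems(1)] pD this] obtain e where e: "prin (%P. \<Delta> D (tr (s ^^ (l ^ e)) P) - \<Delta> D P)" by blast
   define t where "t = s ^^ (l ^ e)"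
   have t: "galois t" unfolding t_def by (rule galois_funpow[OF s])
   note T = galois[OF t]
   define D' where "D' P = D (tr t P) - D P" for P
   have fD': "fin D'" unfolding D'_def
    by (rule fin_minus[OF fin_comp[OF T(2) _ Suc.prems(1)] Suc.prems(1)]) (use T(1) in auto)
   have "prin (\<Delta> D')" by (rule prin_cong[OF e]) (simp add: D'_def \<Delta>_def T(4) t_def[symmetric])
   moreover have "EX e. (t ^^ (l ^ e)) v = v" if "v : branch" for v
   proof -
    obtain e' where "(s ^^ (l ^ e')) v = v" using br[OF \<open>v : branch\<close>] by blast
    hence "(s ^^ (l ^ e * l ^ e')) v = v" by (rule fixed_multiple) simp
    thus ?thesis unfolding t_def funpow_mult by (metis mult.commute)
   qed
   ultimately obtain e' where e': "prin (%P. D' (tr (t ^^ (l ^ e')) P) - D' P)"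
    using invariant_class[OF _ t _ fD', of l] prime_gt_0_nat[OF l] by (metis One_nat_def Suc_leI)
   define r where "r = l ^ e'"
   define t' where "t' = t ^^ r"
   have t': "galois t'" unfolding t'_def by (rule galois_funpow[OF t])
   have tele: "A ((tr w ^^ k) P) - A P = (\<Sum>j<k. A (tr w ((tr w ^^ j) P)) - A ((tr w ^^ j) P))" for A :: "(nat => 'a) => int" and w k P
    using sum_lessThan_telescope[of "%j. A ((tr w ^^ j) P)" k] by simp
   have pts: "(tr w ^^ j) P : points C" if "galois w" "P : points C" for w j P
    using galois(1)[OF galois_funpow[OF that(1)] that(2)] by (simp add: tr_funpow)
   have prj: "prin (%P. A ((tr w ^^ j) P))" if "galois w" "prin A" for w j and A
    using galois(5)[OF galois_funpow[OF that(1)] that(2)] by (simp add: tr_funpow)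
   define D1 where "D1 P = D (tr t' P) - D P" for P
   \<comment> \<open>As \<open>t'\<close> is the r-th iterate of \<open>t\<close>, the difference
     telescopes into the translates of \<open>D'\<close>.\<close>
   have D1: "D1 P = (\<Sum>j<r. D' ((tr t ^^ j) P))" for P unfolding D1_def t'_def tr_funpow tele by (simp add: D'_def)
   have com: "tr t' ((tr t ^^ j) P) = (tr t ^^ j) (tr t' P)" for j P
    unfolding t'_def tr_funpow by (metis add.commute comp_apply funpow_add)
   have "prin (%P. \<Sum>j<r. (%P. D' (tr t' P) - D' P) ((tr t ^^ j) P))"
    by (intro prin_sum prj[OF t]) (use e' in "simp add: t'_def r_def")
   hence p1: "prin (%P. D1 (tr t' P) - D1 P)" by (rule prin_cong) (simp add: D1 com sum_subtractf)
   define q where "q = l ^ M"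
   have "prin (%P. D1 ((tr t' ^^ j) P) - D1 P)" for j
   proof -
    have "prin (%P. \<Sum>i<j. (%P. D1 (tr t' P) - D1 P) ((tr t' ^^ i) P))" by (intro prin_sum prj[OF t'] p1)
    thus ?thesis by (rule prin_cong) (simp add: tele)
   qed
   hence "prin (%P. \<Sum>j<q. (D1 ((tr t' ^^ j) P) - D1 P))" by (intro prin_sum)
   moreover have "prin (%P. int l ^ M * D (tr t' P) - int l ^ M * D P)"
    using galois(5)[OF t' Suc.prems(2)] Suc.prems(2) by (intro prin_minus) auto
   ultimately have "prin (%P. (\<Sum>j<q. (D1 ((tr t' ^^ j) P) - D1 P)) + (int l ^ M * D (tr t' P) - int l ^ M * D P))"
    by (rule prin_add)
   hence "prin (%P. D ((tr t' ^^ q) P) - D P)"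
   proof (rule prin_cong)
    fix P
    have "D ((tr t' ^^ q) P) - D P = (\<Sum>j<q. D1 ((tr t' ^^ j) P))" unfolding tele by (simp add: D1_def)
    also have "... = (\<Sum>j<q. (D1 ((tr t' ^^ j) P) - D1 P)) + int q * D1 P" by (simp add: sum_subtractf)
    finally show "D ((tr t' ^^ q) P) - D P = (\<Sum>j<q. (D1 ((tr t' ^^ j) P) - D1 P)) + (int l ^ M * D (tr t' P) - int l ^ M * D P)"
     by (simp add: q_def D1_def right_diff_distrib)
   qed
   moreover have "(tr t' ^^ q) P = tr (s ^^ (l ^ (e + e' + M))) P" for P
    unfolding tr_funpow[symmetric] t'_def t_def funpow_mult r_def q_def by (simp add: power_add mult_ac)
   ultimately show ?case by (intro exI[of _ "e + e' + M"]) simp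
  qed
  from this[OF D Delta_nilpotent[OF l ml D(2)]] show ?thesis .
qed

end

subsection \<open>The function field of the affine model\<close>

text \<open>The conditions of \<open>affine_model\<close> with the forms for x and y written out and
  the constants enlarged to the whole field. Rationality over k enters again in
  \<open>galois_automorphism\<close>.\<close>

locale affine_cover =
  fixes C :: "'a::{alg_closed_field, field_char_0} scheme" and m :: nat and p q :: "'a poly"
   and fx gx fy gy :: "(nat, 'a) mpol" and H :: "nat => (bool, 'a) mpol"
   and \<zeta> :: 'a and j :: "'a poly => 'b::field" and y0 :: 'b
  assumes proj: "proj_scheme UNIV C" and irreducible: "irreducible_fibre C (UNIV, {0})"
   and smooth: "!!P. P : cone C ==> EX R. smooth_at R C 1 (UNIV, {0}) P" and pq: "p ~= 0" "q ~= 0" and m: "m >= 1"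
   and x_forms: "EX d. fx : forms UNIV (amb C) d & gx : forms UNIV (amb C) d"
   and y_forms: "EX d. fy : forms UNIV (amb C) d & gy : forms UNIV (amb C) d" and H0: "!!i. i > amb C ==> H i = 0"
   and birational1: "finite {P : points C. ~ (ev P gx ~= 0 & ev P gy ~= 0 &
    (ev P fx / ev P gx, ev P fy / ev P gy) : affine_curve m p q &
    (EX i. ev2 (ev P fx / ev P gx, ev P fy / ev P gy) (H i) ~= 0) &
    normalise (%i. ev2 (ev P fx / ev P gx, ev P fy / ev P gy) (H i)) = P)}"
   and birational2: "finite {z : affine_curve m p q. ~ ((EX i. ev2 z (H i) ~= 0) &
    (EX P:points C. P = normalise (%i. ev2 z (H i)) & ev P gx ~= 0 & ev P gy ~= 0 &
     z = (ev P fx / ev P gx, ev P fy / ev P gy)))}"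
   and j: "is_hom j" and j_inj: "!!r. j r = 0 ==> r = 0" and y0: "j q * y0 ^ m = j p"
   and zeta: "inj_on (%i. \<zeta> ^ i) {..<m}" "\<zeta> ^ m = 1"
begin

abbreviation "Zc \<equiv> affine_curve m p q"
abbreviation "form \<equiv> %d f. f : forms UNIV (amb C) d"

definition xy :: "(nat => 'a) => 'a \<times> 'a" where "xy P = (ev P fx / ev P gx, ev P fy / ev P gy)"
definition \<theta> :: "'a \<times> 'a => nat => 'a" where "\<theta> z = normalise (%i. ev2 z (H i))"
definition bad1 :: "(nat => 'a) set" where "bad1 = {P : points C. ~ (ev P gx ~= 0 & ev P gy ~= 0 & xy P : Zc &
  (EX i. ev2 (xy P) (H i) ~= 0) & \<theta> (xy P) = P)}"
definition bad2 :: "('a \<times> 'a) set" where "bad2 = {z : Zc. ~ ((EX i. ev2 z (H i) ~= 0) &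
  (EX P:points C. P = \<theta> z & ev P gx ~= 0 & ev P gy ~= 0 & z = xy P))}"

lemma bad_finite: "finite bad1" "finite bad2"
  using birational1 birational2 by (simp_all add: bad1_def bad2_def xy_def \<theta>_def)

lemma good1: "P : points C ==> P ~: bad1 ==> ev P gx ~= 0 & ev P gy ~= 0 & xy P : Zc &
  (EX i. ev2 (xy P) (H i) ~= 0) & \<theta> (xy P) = P" by (auto simp: bad1_def)

lemma good2: "z : Zc ==> z ~: bad2 ==> (EX i. ev2 z (H i) ~= 0) & \<theta> z : points C & z = xy (\<theta> z)"
  by (auto simp: bad2_def)

lemmas vh = is_homD[OF is_hom_ev]

lemma infinite_points: "infinite (points C)"
proof
  assume f: "finite (points C)"
  have "Zc \<subseteq> bad2 \<union> xy ` points C" using good2 by blast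
  hence fZ: "finite Zc" using f bad_finite(2) by (meson finite_UnI finite_imageI finite_subset)
  have "UNIV - {a. poly q a = 0} \<subseteq> fst ` Zc"
  proof
   fix a assume a: "a : UNIV - {a. poly q a = 0}"
   obtain b where "b ^ m = poly p a / poly q a" using nth_root_exists[of m "poly p a / poly q a"] m by auto
   hence "(a, b) : Zc" using a by (simp add: affine_curve_def)
   thus "a : fst ` Zc" by force
  qed
  hence "finite (UNIV - {a. poly q a = 0})" using fZ by (meson finite_imageI finite_subset)
  hence "finite (UNIV :: 'a set)" using poly_roots_finite[OF pq(2)] by (metis finite_Diff2)
  thus False using infinite_UNIV_char_0 by blast
qed

lemma ev_scale: "form d f ==> ev (%i. c * P i) f = c ^ d * ev P f"
  using evh_forms_scale[of f UNIV "amb C" d "%a. a" c P] by (simp add: ev_evh)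

lemma normalise_zero: "form d f ==> v i ~= 0 ==> ev (normalise v) f = 0 \<longleftrightarrow> ev v f = 0"
proof -
  assume f: "form d f" and v: "v i ~= 0"
  obtain c where c: "c ~= 0" "normalise v = (%i. c * v i)" using v by (rule normalise_as_scale)
  show ?thesis unfolding c(2) using ev_scale[OF f, of c v] c(1) by simp
qed

lemma points_vanish: "form d f ==> (!!P. P : points C ==> ev P f = 0) ==> P : cone C ==> ev P f = 0"
proof -
  assume f: "form d f" and v: "!!P. P : points C ==> ev P f = 0" and P: "P : cone C"
  obtain i where "P i ~= 0" using P by (auto simp: cone_iff)
  thus ?thesis using normalise_zero[OF f] v[of "normalise P"] P by (auto simp: points_def)
qed

lemma cone_irreducible:
  assumes f: "form d f" and g: "form e g" and v: "!!P. P : cone C ==> ev P f * ev P g = 0"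
  shows "(ALL P:cone C. ev P f = 0) | (ALL P:cone C. ev P g = 0)"
  using irreducible f g v unfolding irreducible_fibre_def prod.case cone_def[symmetric] by blast

text \<open>For a point \<open>P'\<close> outside \<open>S\<close>, a product of linear forms
  vanishes on the points of \<open>S\<close> but not at \<open>P'\<close>. Its product with
  \<open>f\<close> vanishes everywhere, and irreducibility leaves only \<open>f\<close>.\<close>

lemma density:
  assumes f: "form d f" and S: "finite S" and v: "!!P. P : points C ==> P ~: S ==> ev P f = 0" and P: "P : cone C"
  shows "ev P f = 0"
proof -
  obtain P' where P': "P' : points C" "P' ~: S" using infinite_points S by (metis finite_subset subsetI)
  have c': "P' : cone C" "normalise P' = P'" using points_iff[OF proj] P'(1) by auto
  have sep: "EX L. form 1 L & ev Q L = 0 & ev P' L ~= 0" if Q: "Q : points C" "Q ~= P'" for Q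
  proof -
   have c: "Q : cone C" "normalise Q = Q" using points_iff[OF proj] Q(1) by auto
   obtain k where k: "k <= amb C" "Q k ~= 0" using c(1) by (auto simp: cone_iff)
   have "EX i<=amb C. P' i * Q k ~= Q i * P' k"
   proof (rule ccontr)
    assume "~ ?thesis"
    hence a: "P' i * Q k = Q i * P' k" if "i <= amb C" for i using that by auto
    have e: "P' i = (P' k / Q k) * Q i" for i
     using a[of i] c(1) c'(1) k(2) by (cases "i <= amb C") (auto simp: cone_iff field_simps)
    obtain i where i: "P' i ~= 0" using c'(1) by (auto simp: cone_iff)
    have "P' k / Q k ~= 0"
    proof
     assume z: "P' k / Q k = 0"
     show False using e[of i] i unfolding z by simp
    qed
    hence "normalise (%i. (P' k / Q k) * Q i) = normalise Q" by (rule normalise_scale)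
    moreover have "(%i. (P' k / Q k) * Q i) = P'" by (rule ext) (rule e[symmetric])
    ultimately show False using c(2) c'(2) Q(2) by simp
   qed
   then obtain i where i: "i <= amb C" "P' i * Q k ~= Q i * P' k" by blast
   define vv where "vv k = (single (single k 1) 1 :: (nat, 'a) mpol)" for k
   have vv: "form 1 (vv k)" "ev R (vv k) = R k" if "k <= amb C" for k R
    using forms_var[OF that] by (auto simp: vv_def ev_evh evh_single[OF is_hom_id] simp del: One_nat_def)
   have s: "ev R (single 0 a) = a" for R :: "nat => 'a" and a by (simp add: ev_evh evh_single[OF is_hom_id])
   let ?L = "single 0 (Q k) * vv i - single 0 (Q i) * vv k"
   have "form 1 ?L" by (intro forms_minus' forms_const_mult vv i k)
   thus ?thesis using vv(2)[OF i(1)] vv(2)[OF k(1)] s i(2) by (intro exI[of _ ?L]) (simp add: vh mult.commute)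
  qed
  have "EX g e. form e g & (ALL Q:T. ev Q g = 0) & ev P' g ~= 0" if "finite T" "T \<subseteq> points C - {P'}" for T
   using that
  proof (induction T rule: finite_induct)
   case empty
   show ?case by (intro exI[of _ 1] exI[of _ 0]) (simp add: forms_one vh)
  next
   case (insert Q T)
   then obtain g e where g: "form e g" "ALL Q:T. ev Q g = 0" "ev P' g ~= 0" by auto
   obtain L where L: "form 1 L" "ev Q L = 0" "ev P' L ~= 0" using sep[of Q] insert.prems by auto
   thus ?case using g by (intro exI[of _ "L * g"] exI[of _ "1 + e"]) (auto simp: vh intro: forms_mult simp del: One_nat_def)
  qed
  from this[of "S \<inter> points C"] obtain g e where g: "form e g" "ALL Q:S \<inter> points C. ev Q g = 0" "ev P' g ~= 0"
   using S P' by auto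
  have "ev R (f * g) = 0" if "R : points C" for R using v[OF that] g(2) that by (auto simp: vh)
  hence "ev R (f * g) = 0" if "R : cone C" for R using points_vanish[OF forms_mult[OF f g(1)]] that by blast
  hence "(ALL P:cone C. ev P f = 0) | (ALL P:cone C. ev P g = 0)" by (intro cone_irreducible[OF f g(1)]) (simp add: vh)
  thus ?thesis using c'(1) g(3) P by blast
qed

text \<open>Functions given by one quotient of forms off a finite set. Closure under sums and
  products converts polynomials in the coordinate functions x and y into such quotients.\<close>

definition rep :: "((nat => 'a) => 'a) => bool" where
  "rep \<phi> \<longleftrightarrow> (EX d f g S. form d f & form d g & finite S & (ALL P:points C - S. ev P g ~= 0 & \<phi> P = ev P f / ev P g))"

lemma rep_const: "rep (%P. c)" unfolding rep_def
  by (intro exI[of _ 0] exI[of _ "single 0 c"] exI[of _ 1] exI[of _ "{}"])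
   (simp add: forms_const forms_one vh, simp add: ev_evh evh_single[OF is_hom_id])

lemma rep_op: assumes "rep \<phi>" "rep \<psi>" shows "rep (%P. \<phi> P + \<psi> P)" "rep (%P. \<phi> P * \<psi> P)"
proof -
  obtain d f g S where a: "form d f" "form d g" "finite S" "!!P. P : points C ==> P ~: S ==> ev P g ~= 0 & \<phi> P = ev P f / ev P g"
   using assms(1) unfolding rep_def by auto
  obtain d' f' g' S' where b: "form d' f'" "form d' g'" "finite S'" "!!P. P : points C ==> P ~: S' ==> ev P g' ~= 0 & \<psi> P = ev P f' / ev P g'"
   using assms(2) unfolding rep_def by auto
  have fS: "finite (S \<union> S')" using a(3) b(3) by simp
  have gg: "form (d + d') (g * g')" by (rule forms_mult[OF a(2) b(2)])
  have s: "form (d + d') (f * g' + f' * g)"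
   using forms_add'[OF forms_mult[OF a(1) b(2)]] forms_mult[OF b(1) a(2)] by (simp add: add.commute)
  have t: "form (d + d') (f * f')" by (rule forms_mult[OF a(1) b(1)])
  have "ALL P:points C - (S \<union> S'). ev P (g * g') ~= 0 & \<phi> P + \<psi> P = ev P (f * g' + f' * g) / ev P (g * g')"
   using a(4) b(4) by (auto simp: vh add_frac_eq)
  thus "rep (%P. \<phi> P + \<psi> P)" unfolding rep_def using s gg fS by blast
  have "ALL P:points C - (S \<union> S'). ev P (g * g') ~= 0 & \<phi> P * \<psi> P = ev P (f * f') / ev P (g * g')"
   using a(4) b(4) by (auto simp: vh)
  thus "rep (%P. \<phi> P * \<psi> P)" unfolding rep_def using t gg fS by blast
qed

lemma zev_pCons: "zev z (pCons a g) = poly a (fst z) + snd z * zev z g"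
  unfolding zev_def by (rule bev_pCons[OF is_hom_poly])

lemma rep_zev: "rep (%P. zev (xy P) g)"
proof -
  have x: "rep (%P. fst (xy P))" "rep (%P. snd (xy P))"
  proof -
   obtain d where d: "form d fx" "form d gx" using x_forms by blast
   thus "rep (%P. fst (xy P))" unfolding rep_def using good1 bad_finite
    by (intro exI[of _ d] exI[of _ fx] exI[of _ gx] exI[of _ bad1]) (auto simp: xy_def)
   obtain d where d: "form d fy" "form d gy" using y_forms by blast
   thus "rep (%P. snd (xy P))" unfolding rep_def using good1 bad_finite
    by (intro exI[of _ d] exI[of _ fy] exI[of _ gy] exI[of _ bad1]) (auto simp: xy_def)
  qed
  have a: "rep (%P. poly a (fst (xy P)))" for a by (induction a) (auto intro!: rep_op rep_const x)
  show ?thesis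
  proof (induction g)
   case 0
   show ?case by (simp only: is_homD(4)[OF is_hom_zev] rep_const)
  next
   case (pCons b g)
   thus ?case unfolding zev_pCons by (intro rep_op x a)
  qed
qed

text \<open>Polynomials in x and y become quotients of forms on \<open>C\<close>. The birational
  maps lose only finitely many points, which \<open>density\<close> can ignore, so irreducibility
  passes from \<open>C\<close> to the affine curve.\<close>

lemma irr:
  assumes gh: "vanishes_ae Zc (g * h)" shows "vanishes_ae Zc g | vanishes_ae Zc h"
proof -
  obtain d f1 f2 S where a: "form d f1" "form d f2" "finite S" "!!P. P : points C ==> P ~: S ==> ev P f2 ~= 0 & zev (xy P) g = ev P f1 / ev P f2"
   using rep_zev[of g] unfolding rep_def by auto
  obtain d' f1' f2' S' where b: "form d' f1'" "form d' f2'" "finite S'"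
   "!!P. P : points C ==> P ~: S' ==> ev P f2' ~= 0 & zev (xy P) h = ev P f1' / ev P f2'"
   using rep_zev[of h] unfolding rep_def by auto
  let ?B = "{z:Zc. zev z (g * h) ~= 0}"
  have fin: "finite (bad1 \<union> S \<union> S' \<union> \<theta> ` ?B)" using a(3) b(3) bad_finite gh by (simp add: vanishes_ae_def)
  have "ev P (f1 * f1') = 0" if "P : points C" "P ~: bad1 \<union> S \<union> S' \<union> \<theta> ` ?B" for P
  proof -
   have g: "xy P : Zc" "\<theta> (xy P) = P" using good1[of P] that by auto
   have "xy P ~: ?B"
   proof
    assume "xy P : ?B"
    hence "\<theta> (xy P) : \<theta> ` ?B" by (rule imageI)
    hence "P : bad1 \<union> S \<union> S' \<union> \<theta> ` ?B" unfolding g(2) by (rule UnI2)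
    thus False using that(2) by contradiction
   qed
   hence "zev (xy P) g * zev (xy P) h = 0" using g(1) by (simp add: is_homD(3)[OF is_hom_zev])
   thus ?thesis using a(4)[of P] b(4)[of P] that by (auto simp: vh)
  qed
  hence "ev P (f1 * f1') = 0" if "P : cone C" for P using density[OF forms_mult[OF a(1) b(1)] fin] that by blast
  hence "(ALL P:cone C. ev P f1 = 0) | (ALL P:cone C. ev P f1' = 0)" by (intro cone_irreducible[OF a(1) b(1)]) (simp add: vh)
  moreover have "vanishes_ae Zc g" if fin: "finite S" and v: "!!P. P : points C ==> P ~: S ==> zev (xy P) g = 0" for g S
  proof -
   have "{z:Zc. zev z g ~= 0} \<subseteq> bad2 \<union> xy ` S"
   proof
    fix z assume z: "z : {z:Zc. zev z g ~= 0}"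
    show "z : bad2 \<union> xy ` S"
    proof (cases "z : bad2")
     case False
     hence "\<theta> z : points C" "z = xy (\<theta> z)" using good2 z by auto
     hence "\<theta> z : S" using v[of "\<theta> z"] z by auto
     thus ?thesis using \<open>z = xy (\<theta> z)\<close> by blast
    qed simp
   qed
   thus ?thesis unfolding vanishes_ae_def using fin bad_finite(2) by (meson finite_UnI finite_imageI finite_subset)
  qed
  moreover have pc: "P : cone C" if "P : points C" for P using points_iff[OF proj] that by blast
  ultimately show ?thesis using a(3,4) b(3,4) by (metis div_0)
qed

sublocale superelliptic p q m \<zeta> j y0 by unfold_locales (use j j_inj pq m y0 zeta irr in auto)

definition Hf :: "nat => 'a poly poly" where
  "Hf i = evh (%a. [:[:a:]:]) (%s. if s then [:0, 1:] else [:[:0, 1:]:]) (H i)"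

definition subst :: "(nat, 'a) mpol => 'a poly poly" where "subst f = evh (%a. [:[:a:]:]) Hf f"

text \<open>The generic point of \<open>C\<close>: the inverse birational map evaluated at the
  generic point (x, y0) of the affine curve.\<close>

definition Xg :: "nat => 'b" where "Xg i = bv (Hf i)"

lemma const_hom: "is_hom (%a. [:[:a:]:])" by (simp add: is_hom_def one_pCons)

lemma subst: "bv (subst f) = evh emb Xg f" "zev z (subst f) = ev (%i. ev2 z (H i)) f" "zev z (Hf i) = ev2 z (H i)"
proof -
  have b: "bv [:[:a:]:] = emb a" for a by (simp add: bev_const[OF j] emb_def)
  show "bv (subst f) = evh emb Xg f"
   unfolding subst_def evh_hom[OF is_hom_bev[OF j]] b by (simp add: Xg_def[abs_def])
  have z: "zev z [:[:a:]:] = a" for a by (simp add: zev_const)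
  show h: "zev z (Hf i) = ev2 z (H i)" for i
  proof -
   have "(%v. zev z (if v then [:0, 1:] else [:[:0, 1:]:])) = (%v. if v then snd z else fst z)"
    by (auto simp: fun_eq_iff zev_pCons is_homD(4)[OF is_hom_zev] zev_const)
   moreover have "ev2 z (H i) = ev (%v. if v then snd z else fst z) (H i)" by (cases z) (simp only: ev2_def prod.case fst_conv snd_conv)
   ultimately show ?thesis unfolding Hf_def evh_hom[OF is_hom_zev] z by (simp add: ev_evh)
  qed
  show "zev z (subst f) = ev (%i. ev2 z (H i)) f"
   unfolding subst_def evh_hom[OF is_hom_zev] z h by (simp add: ev_evh)
qed

lemma good_zero:
  assumes "z : Zc" "z ~: bad2" "form d f" shows "ev (%i. ev2 z (H i)) f = 0 \<longleftrightarrow> ev (\<theta> z) f = 0"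
proof -
  obtain i where "ev2 z (H i) ~= 0" using good2[OF assms(1,2)] by blast
  thus ?thesis unfolding \<theta>_def using normalise_zero[OF assms(3), of "%i. ev2 z (H i)" i] by simp
qed

text \<open>By \<open>bv_iff\<close> vanishing at the generic point means vanishing at almost all
  points of the affine curve, hence at almost all points of \<open>C\<close> under the birational
  map, and \<open>density\<close> removes the exceptions.\<close>

lemma generic: assumes f: "form d f" shows "evh emb Xg f = 0 \<longleftrightarrow> (ALL P:cone C. ev P f = 0)"
proof
  assume "evh emb Xg f = 0"
  hence "finite {z:Zc. ev (%i. ev2 z (H i)) f ~= 0}" (is "finite ?B")
   using bv_iff[of "subst f"] by (simp add: subst vanishes_ae_def)
  hence fin: "finite (bad1 \<union> \<theta> ` ?B)" using bad_finite by simp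
  have "ev P f = 0" if PB: "P : points C" "P ~: bad1 \<union> \<theta> ` ?B" for P
  proof -
   obtain i where g: "xy P : Zc" "\<theta> (xy P) = P" "ev2 (xy P) (H i) ~= 0" using good1[of P] PB by blast
   have "xy P ~: ?B"
   proof
    assume "xy P : ?B"
    hence "\<theta> (xy P) : \<theta> ` ?B" by (rule imageI)
    hence "P : bad1 \<union> \<theta> ` ?B" unfolding g(2) by (rule UnI2)
    thus False using PB(2) by contradiction
   qed
   hence "ev (%i. ev2 (xy P) (H i)) f = 0" using g(1) by simp
   thus ?thesis using normalise_zero[OF f, of "%i. ev2 (xy P) (H i)" i] g(2,3) by (simp add: \<theta>_def)
  qed
  thus "ALL P:cone C. ev P f = 0" using density[OF f fin] by blast
next
  assume v: "ALL P:cone C. ev P f = 0"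
  have "{z:Zc. zev z (subst f) ~= 0} \<subseteq> bad2"
   using good_zero[OF _ _ f] good2 v points_iff[OF proj] by (auto simp: subst)
  hence "va (subst f)" unfolding vanishes_ae_def using bad_finite(2) finite_subset by blast
  thus "evh emb Xg f = 0" using bv_iff[of "subst f"] by (simp add: subst)
qed

lemma bv_quotient:
  assumes f: "form d f" "form d g" and S: "finite S"
   and v: "!!P. P : points C ==> P ~: S ==> ev P g ~= 0 & zev (xy P) r = ev P f / ev P g"
  shows "evh emb Xg g ~= 0" "bv r = evh emb Xg f / evh emb Xg g"
proof -
  obtain P where P: "P : points C" "P ~: S" using infinite_points S by (metis finite_subset subsetI)
  show nz: "evh emb Xg g ~= 0" using generic[OF f(2)] v[OF P] P points_iff[OF proj] by auto
  have "{z:Zc. zev z (subst f - subst g * r) ~= 0} \<subseteq> bad2 \<union> xy ` S"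
  proof
   fix z assume z: "z : {z:Zc. zev z (subst f - subst g * r) ~= 0}"
   show "z : bad2 \<union> xy ` S"
   proof (cases "z : bad2 | \<theta> z : S")
    case True
    thus ?thesis using good2[of z] z by auto
   next
    case False
    have g: "\<theta> z : points C" "z = xy (\<theta> z)" "EX i. ev2 z (H i) ~= 0" using good2[of z] z False by auto
    have vz: "ev (\<theta> z) g ~= 0" "zev z r = ev (\<theta> z) f / ev (\<theta> z) g" using v[OF g(1)] False g(2) by auto
    have "form d (f - single 0 (zev z r) * g)" by (intro forms_minus' forms_const_mult f)
    moreover have s: "ev R (f - single 0 (zev z r) * g) = ev R f - zev z r * ev R g" for R
     by (simp add: vh) (simp add: ev_evh evh_single[OF is_hom_id])
    moreover have "ev (\<theta> z) (f - single 0 (zev z r) * g) = 0" unfolding s using vz by simp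
    ultimately have "ev (%i. ev2 z (H i)) f - zev z r * ev (%i. ev2 z (H i)) g = 0"
     using good_zero[where z = z and d = d and f = "f - single 0 (zev z r) * g"] z False by simp
    hence "zev z (subst f - subst g * r) = 0" by (simp add: is_homD(6,3)[OF is_hom_zev] subst mult.commute)
    thus ?thesis using z by simp
   qed
  qed
  hence "va (subst f - subst g * r)" unfolding vanishes_ae_def using bad_finite(2) S
   by (meson finite_UnI finite_imageI finite_subset)
  hence "bv (subst f - subst g * r) = 0" using bv_iff by blast
  hence "evh emb Xg f = evh emb Xg g * bv r" by (simp add: bv(6,3) subst)
  thus "bv r = evh emb Xg f / evh emb Xg g" using nz by simp
qed

lemma quotients: "ffield = {evh emb Xg f / evh emb Xg g | f g d. form d f & form d g & evh emb Xg g ~= 0}"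
proof
  show "{evh emb Xg f / evh emb Xg g | f g d. form d f & form d g & evh emb Xg g ~= 0} \<subseteq> ffield"
   unfolding subst(1)[symmetric] ffield_def by blast
  have r: "EX d f g. form d f & form d g & evh emb Xg g ~= 0 & bv s = evh emb Xg f / evh emb Xg g" for s
  proof -
   obtain d f g S where a: "form d f" "form d g" "finite S" "!!P. P : points C ==> P ~: S ==> ev P g ~= 0 & zev (xy P) s = ev P f / ev P g"
    using rep_zev[of s] unfolding rep_def by auto
   show ?thesis using bv_quotient[OF a] a(1,2) by blast
  qed
  show "ffield \<subseteq> {evh emb Xg f / evh emb Xg g | f g d. form d f & form d g & evh emb Xg g ~= 0}"
  proof
   fix x assume "x : ffield"
   then obtain s t where st: "bv t ~= 0" "x = bv s / bv t" unfolding ffield_def by blast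
   obtain d f g where a: "form d f" "form d g" "evh emb Xg g ~= 0" "bv s = evh emb Xg f / evh emb Xg g" using r by blast
   obtain d' f' g' where b: "form d' f'" "form d' g'" "evh emb Xg g' ~= 0" "bv t = evh emb Xg f' / evh emb Xg g'" using r by blast
   have e: "x = evh emb Xg (f * g') / evh emb Xg (g * f')" "evh emb Xg (g * f') ~= 0"
    using st a b by (auto simp: is_homD(3)[OF is_hom_evh[OF emb_hom]])
   moreover have "form (d + d') (f * g')" "form (d + d') (g * f')" using forms_mult a b by blast+
   ultimately show "x : {evh emb Xg f / evh emb Xg g | f g d. form d f & form d g & evh emb Xg g ~= 0}" by blast
  qed
qed

lemma finite_form_zeros: assumes f: "form d f" "evh emb Xg f ~= 0" shows "finite {P:points C. ev P f = 0}"
proof -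
  have "finite {z:Zc. zev z (subst f) = 0}" using finite_zeros[of "subst f"] f(2) by (simp add: subst)
  moreover have "{P:points C. ev P f = 0} \<subseteq> bad1 \<union> \<theta> ` {z:Zc. zev z (subst f) = 0}"
  proof
   fix P assume P: "P : {P:points C. ev P f = 0}"
   show "P : bad1 \<union> \<theta> ` {z:Zc. zev z (subst f) = 0}"
   proof (cases "P : bad1")
    case False
    then obtain i where g: "xy P : Zc" "\<theta> (xy P) = P" "ev2 (xy P) (H i) ~= 0" using good1[of P] P by auto
    have "ev (%i. ev2 (xy P) (H i)) f = 0"
     using normalise_zero[OF f(1), of "%i. ev2 (xy P) (H i)" i] g(2,3) P by (simp add: \<theta>_def)
    hence "xy P : {z:Zc. zev z (subst f) = 0}" using g(1) by (simp add: subst)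
    hence "\<theta> (xy P) : \<theta> ` {z:Zc. zev z (subst f) = 0}" by (rule imageI)
    thus ?thesis unfolding g(2) by (rule UnI2)
   qed simp
  qed
  ultimately show ?thesis using bad_finite(1) by (meson finite_UnI finite_imageI finite_subset)
qed

definition x0 :: 'b where "x0 = j [:0, 1:]"

lemma pev_x0: "poly (map_poly emb r) x0 = j r"
proof (induction r)
  case (pCons a r)
  have "j (pCons a r) = j ([:a:] + [:0, 1:] * r)" by simp
  also have "... = emb a + x0 * j r" by (simp only: jh(2,3) emb_def x0_def)
  finally show ?case using pCons by (simp add: map_poly_pCons eh)
qed (simp add: jh)

lemma x0_bv: "x0 = bv [:[:0, 1:]:]" by (simp add: x0_def bev_const[OF j])

lemma x0_quotient: "evh emb Xg gx ~= 0" "x0 = evh emb Xg fx / evh emb Xg gx"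
proof -
  obtain d where d: "form d fx" "form d gx" using x_forms by blast
  have v: "ev P gx ~= 0 & zev (xy P) [:[:0, 1:]:] = ev P fx / ev P gx" if "P : points C" "P ~: bad1" for P
   using good1[OF that] by (simp add: zev_const xy_def)
  from bv_quotient[OF d bad_finite(1) v] show "evh emb Xg gx ~= 0" "x0 = evh emb Xg fx / evh emb Xg gx"
   unfolding x0_bv by auto
qed

sublocale ff: function_field C emb ffield Xg
proof unfold_locales
  show "!!i. amb C < i ==> Xg i = 0" by (simp add: Xg_def Hf_def H0 is_homD(4)[OF is_hom_evh[OF const_hom]] bv(4))
  show "~ ffield \<subseteq> range emb"
  proof
   assume "ffield \<subseteq> range emb"
   then obtain c where "x0 = emb c" using bv_ffield x0_bv by fastforce
   hence "j [:- c, 1:] = 0" using jh(6)[of "[:0, 1:]" "[:c:]"] by (simp add: x0_def emb_def)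
   thus False using j_inj by force
  qed
  show "EX Q. Q ~= 0 & bev (%r. poly (map_poly emb r) x) w Q = 0" if "x : ffield" "w : ffield" for x w
   using algebraic_dependence[OF that] unfolding pev_def[abs_def] .
qed (use emb_hom ffield_subf proj generic quotients smooth in auto)

sublocale cc: cyclic_cover C emb ffield Xg \<delta> m x0
proof unfold_locales
  show "ff.compatible \<delta> (%c. c)" unfolding ff.compatible_def using delta_bij delta_hom by auto
  show "m >= 1" by (rule m)
  show "!!x. x : ffield ==> (\<delta> ^^ m) x = x" by (rule delta_period)
  show "x0 : ffield" using bv_ffield x0_bv by simp
  show "\<delta> x0 = x0" unfolding x0_def by (rule delta_hom)
  show "!!r. ff.pev x0 r = 0 ==> r = 0" unfolding ff.pev_def pev_x0 by (rule j_inj)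
  show "!!x. x : ffield ==> \<delta> x = x ==> EX n d. d ~= 0 & x = ff.pev x0 n / ff.pev x0 d"
   unfolding ff.pev_def pev_x0 by (rule delta_fixed)
  show "!!f. f : ffield ==> (\<Prod>i<m. (\<delta> ^^ i) f) = 1 ==> EX g:ffield. g ~= 0 & f * \<delta> g = g" by (rule hilbert90)
  show "!!d f. form d f ==> evh emb Xg f ~= 0 ==> finite {P : points C. ev P f = 0}" by (rule finite_form_zeros)
qed

text \<open>At a point where x is finite, the order of \<open>gx\<close> does not exceed that of
  \<open>fx\<close>. So \<open>ram_index\<close> subtracts the order of \<open>gx\<close>, and what
  remains is the order of x - v.\<close>

lemma branch_points:
  assumes v: "v : cc.branch"
  shows "EX u:branch_locus C (fx, gx). v : range u"
proof -
  obtain P where P: "P : points C" "cc.xval P = Some v" "ff.ord P (x0 - emb v) > 1" using v unfolding cc.branch_def by blast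
  note n = ff.normalised_coordinate[OF P(1)]
  obtain k where k: "k <= amb C" "P k = 1" using n(1) by blast
  obtain d where d: "form d fx" "form d gx" using x_forms by blast
  define u :: "nat => 'a" where "u i = (if i = 0 then 1 else if i = 1 then v else 0)" for i
  have up: "u : points (1, {})"
  proof -
   have "(LEAST i. u i ~= 0) = 0" by (rule Least_eq_0) (simp add: u_def)
   hence "normalise u = u" by (simp add: normalise_def u_def fun_eq_iff)
   moreover have "u : cone (1, {})" by (auto simp: cone_iff u_def)
   ultimately show ?thesis unfolding points_def by (metis imageI)
  qed
  let ?h = "single 0 (u 0) * fx - single 0 (u 1) * gx"
  have h: "form d ?h" by (intro forms_minus' forms_const_mult d)
  have Xk: "Xg k ~= 0" using ff.u(5)[OF n(2) k] .
  have hX: "evh emb Xg ?h = evh emb Xg gx * (x0 - emb v)"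
   using x0_quotient by (simp add: ff.xh evh_single[OF emb_hom] u_def eh field_simps)
  have nz: "evh emb Xg ?h ~= 0" "evh emb Xg fx ~= 0" "evh emb Xg gx ~= 0"
   using hX x0_quotient cc.x0_minus(2)[of v] cc.x0_nonzero by auto
  have F: "evh emb Xg f / Xg k ^ d : ffield" if "form d f" for f
   using ff.form_quotient(1)[OF n(2) that k(1)] k(2) ff.local_ring(6)[OF n(2)] by auto
  have vo: "int (vanishing_order C P f) = ff.ord P (evh emb Xg f / Xg k ^ d)" if "form d f" "evh emb Xg f ~= 0" for f
   by (rule ff.vanishing_order_ord[OF P(1) that k])
  have x0O: "ff.ord P x0 >= 0" using P(2) cc.xval_None[of P] ff.ord_iff(1)[OF P(1) cc.x0(1) cc.x0_nonzero] by auto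
  have "evh emb Xg fx / Xg k ^ d = (evh emb Xg gx / Xg k ^ d) * x0" using x0_quotient by simp
  hence 1: "int (vanishing_order C P fx) = int (vanishing_order C P gx) + ff.ord P x0"
   using vo[OF d(1) nz(2)] vo[OF d(2) nz(3)] ff.ord_mult[OF P(1) F[OF d(2)] _ cc.x0(1) cc.x0_nonzero] nz Xk by simp
  have "evh emb Xg ?h / Xg k ^ d = (evh emb Xg gx / Xg k ^ d) * (x0 - emb v)" unfolding hX by simp
  hence 2: "int (vanishing_order C P ?h) = int (vanishing_order C P gx) + ff.ord P (x0 - emb v)"
   using vo[OF h nz(1)] vo[OF d(2) nz(3)] ff.ord_mult[OF P(1) F[OF d(2)] _ cc.x0_minus] nz Xk by simp
  have "ram_index C (fx, gx) P u > 1" unfolding ram_index_def prod.case using 1 2 x0O P(3) by linarith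
  hence "u : branch_locus C (fx, gx)" unfolding branch_locus_def using up P(1) by blast
  moreover have "v : range u" by (rule range_eqI[of _ _ 1]) (simp add: u_def)
  ultimately show ?thesis by blast
qed

text \<open>\<open>s\<close> acts on coefficients. It permutes the points of the affine curve,
  because p and q are over \<open>k\<close>; so it respects vanishing almost everywhere and extends
  to the function field. Ratios of generic coordinates are fixed because \<open>H\<close> is over
  \<open>k\<close>, and fixing \<zeta> makes the extension commute with \<delta>.\<close>

lemma galois_automorphism:
  assumes s: "is_hom s" "bij s" "!!a. a : k ==> s a = a" and si: "is_hom (inv_into UNIV s)"
   and k: "!!i. H i : polys k UNIV" "!!i. coeff p i : k" "!!i. coeff q i : k" and z: "s \<zeta> = \<zeta>"
  shows "cc.galois s"
proof -
  define D where "D t = (map_poly (map_poly t) :: 'a poly poly => 'a poly poly)" for t :: "'a => 'a"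
  have Dh: "is_hom (D t)" if "is_hom t" for t unfolding D_def by (intro is_hom_map_poly that)
  have zevD: "zev (t a, t b) (D t g) = t (zev (a, b) g)" if "is_hom t" for t a b g
  proof (induction g)
   case 0
   thus ?case by (simp add: is_homD(4)[OF Dh[OF that]] is_homD(4)[OF is_hom_zev] is_homD(4)[OF that])
  next
   case (pCons c g)
   have "D t (pCons c g) = pCons (map_poly t c) (D t g)"
    by (simp add: D_def map_poly_pCons is_homD(4)[OF is_hom_map_poly[OF that]])
   thus ?case using pCons by (simp add: zev_pCons is_homD(2,3)[OF that] poly_map_hom[OF that])
  qed
  have Zs: "(t a, t b) : Zc \<longleftrightarrow> (a, b) : Zc" if t: "is_hom t" "!!a. a : k ==> t a = a" for t a b
  proof -
   have "map_poly t p = p" "map_poly t q = q"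
    using k t by (auto intro!: poly_eqI simp: coeff_map_poly is_homD(4)[OF t(1)])
   hence e: "poly p (t a) = t (poly p a)" "poly q (t a) = t (poly q a)" using poly_map_hom[OF t(1)] by metis+
   have "(t b ^ m = t (poly p a) / t (poly q a)) \<longleftrightarrow> b ^ m = poly p a / poly q a"
    using is_hom_field(2,4)[OF t(1)] is_homD(7)[OF t(1)] by metis
   thus ?thesis unfolding affine_curve_def using e is_hom_field(1)[OF t(1)] by simp
  qed
  have adm: "admissible (D t)" if t: "is_hom t" "bij t" "!!a. a : k ==> t a = a" for t
  proof -
   have "bv (D t g) = 0 \<longleftrightarrow> bv g = 0" for g
   proof -
    have "{z:Zc. zev z (D t g) ~= 0} = map_prod t t ` {z:Zc. zev z g ~= 0}"
    proof (intro subset_antisym subsetI)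
     fix z assume z: "z : {z:Zc. zev z (D t g) ~= 0}"
     obtain a b where ab: "z = (t a, t b)" using t(2) by (metis bij_pointE surj_pair)
     have "(a, b) : {z:Zc. zev z g ~= 0}" using z Zs[OF t(1,3)] zevD[OF t(1)] is_hom_field(1)[OF t(1)] unfolding ab by simp
     thus "z : map_prod t t ` {z:Zc. zev z g ~= 0}" unfolding ab by (rule rev_image_eqI) simp
    next
     fix z assume "z : map_prod t t ` {z:Zc. zev z g ~= 0}"
     then obtain a b where "z = (t a, t b)" "(a, b) : Zc" "zev (a, b) g ~= 0" by auto
     thus "z : {z:Zc. zev z (D t g) ~= 0}" using Zs[OF t(1,3)] zevD[OF t(1)] is_hom_field(1)[OF t(1)] by simp
    qed
    moreover have "inj_on (map_prod t t) A" for A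
     using t(2) by (intro inj_on_subset[OF prod.inj_map]) (auto simp: bij_is_inj)
    ultimately have "finite {z:Zc. zev z (D t g) ~= 0} \<longleftrightarrow> finite {z:Zc. zev z g ~= 0}" by (simp add: finite_image_iff)
    thus ?thesis by (simp add: bv_iff vanishes_ae_def)
   qed
   thus ?thesis unfolding admissible_def using Dh[OF t(1)] by blast
  qed
  let ?i = "inv_into UNIV s"
  have ii: "!!a. s (?i a) = a" "!!a. ?i (s a) = a" using s(2) by (simp_all add: bij_is_surj surj_f_inv_f bij_is_inj)
  have ik: "?i a = a" if "a : k" for a using s(3)[OF that] ii(2)[of a] by simp
  have bi: "bij ?i" using s(2) by (rule bij_imp_bij_inv)
  have A: "admissible (D s)" "admissible (D ?i)" using adm[OF s(1,2,3)] adm[OF si bi ik] by auto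
  have inv: "D s (D ?i g) = g" "D ?i (D s g) = g" for g
   unfolding D_def by (intro poly_eqI; simp add: coeff_map_poly is_homD(4)[OF s(1)] is_homD(4)[OF si] ii)+
  have const: "D s [:[:c:]:] = [:[:s c:]:]" "D s [:[:0, 1:]:] = [:[:0, 1:]:]" "D s [:0, 1:] = [:0, 1:]" for c
   by (simp_all add: D_def map_poly_pCons is_homD(4,1)[OF s(1)] one_pCons)
  have emb_bv: "emb c = bv [:[:c:]:]" for c by (simp add: emb_def bev_const[OF j])
  define sg where "sg = ext (D s)"
  have "ff.compatible sg s" unfolding ff.compatible_def
  proof (intro conjI ballI allI)
   show "bij_betw sg ffield ffield" unfolding sg_def by (rule ext_bij[OF A inv])
   show "sg (x + w) = sg x + sg w" "sg (x * w) = sg x * sg w" if "x : ffield" "w : ffield" for x w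
    unfolding sg_def using ext_hom[OF A(1) that] by auto
   show "sg (emb c) = emb (s c)" for c unfolding sg_def emb_bv by (simp add: ext_bv[OF A(1)] const)
   show "surj s" using s(2) by (rule bij_is_surj)
  qed
  moreover have "sg x0 = x0" unfolding sg_def x0_bv by (simp add: ext_bv[OF A(1)] const)
  moreover have "ALL x:ffield. sg (\<delta> x) = \<delta> (sg x)"
  proof
   fix x assume x: "x : ffield"
   have "D s (rot \<zeta> g) = rot \<zeta> (D s g)" for g
   proof (rule poly_eqI)
    fix i
    have "map_poly s [:\<zeta> ^ i:] = [:\<zeta> ^ i:]" by (simp add: map_poly_pCons is_homD(4,7)[OF s(1)] z)
    thus "coeff (D s (rot \<zeta> g)) i = coeff (rot \<zeta> (D s g)) i"
     by (simp only: D_def coeff_map_poly[of "map_poly s"] is_homD(4,3)[OF is_hom_map_poly[OF s(1)]] coeff_rot)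
   qed
   hence "(%g. D s (rot \<zeta> g)) = (%g. rot \<zeta> (D s g))" by (rule ext)
   thus "sg (\<delta> x) = \<delta> (sg x)"
    unfolding sg_def \<delta>_def ext_comp(1)[OF A(1) delta_adm x] ext_comp(1)[OF delta_adm A(1) x] by simp
  qed
  moreover have "ALL i k. Xg k ~= 0 --> sg (Xg i / Xg k) = Xg i / Xg k"
  proof -
   have "D s (Hf i) = Hf i" for i
    unfolding Hf_def evh_hom[OF Dh[OF s(1)]] by (rule evh_cong_polys[OF k(1)]) (auto simp: const s(3))
   thus ?thesis unfolding sg_def Xg_def using ext_eval[OF A(1)] by simp
  qed
  ultimately show ?thesis unfolding cc.galois_def using s(1) by (intro conjI exI[of _ sg]) auto
qed

end

text \<open>\<open>w\<close> is a root of 1 + X + ... + X^(l - 1), hence different from 1, and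
  \<open>z\<close> is an l^(n - 1)-th root of it. If z^d = 1 with 0 < d < l^n, then the gcd of d and
  l^n is a smaller power of \<open>l\<close> that also annihilates \<open>z\<close>, and
  \<open>w\<close> would be 1.\<close>

lemma primitive_root_exists:
  assumes l: "prime l" and n: "n >= 1"
  shows "EX z :: 'a::{alg_closed_field, field_char_0}. z ^ (l ^ n) = 1 & inj_on (%i. z ^ i) {..<l ^ n}"
proof -
  have l2: "l >= 2" using l by (rule prime_ge_2_nat)
  define P where "P = (\<Sum>i<l. monom (1::'a) i)"
  have "coeff P (l - 1) = 1" using l2 by (simp add: P_def coeff_sum)
  hence "degree P >= l - 1" by (intro le_degree) simp
  hence "0 < degree P" using l2 by linarith
  then obtain w where w: "poly P w = 0" using alg_closed_imp_poly_has_root[of P] by blast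
  hence s: "(\<Sum>i<l. w ^ i) = 0" by (simp add: P_def poly_sum poly_monom)
  have w1: "w ~= 1" using s l2 by auto
  have "1 - w ^ l = (1 - w) * (\<Sum>i<l. w ^ i)" by (rule one_diff_power_eq)
  hence wl: "w ^ l = 1" using s by simp
  obtain z where z: "z ^ (l ^ (n - 1)) = w" using nth_root_exists[of "l ^ (n - 1)" w] l2 by auto
  have "l ^ n = l ^ (n - 1) * l" using n by (metis One_nat_def Suc_diff_le Suc_eq_plus1 diff_Suc_1 le_add_diff_inverse2 power_Suc2)
  hence zn: "z ^ (l ^ n) = 1" using z wl by (simp add: power_mult)
  have z0: "z ~= 0" using zn l2 by (auto simp: power_0_left split: if_splits)
  have no: "z ^ d ~= 1" if d: "0 < d" "d < l ^ n" for d
  proof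
   assume zd: "z ^ d = 1"
   obtain x y where xy: "d * x = l ^ n * y + gcd d (l ^ n)" using bezout_nat[of d "l ^ n"] d by auto
   have "z ^ (d * x) = 1" by (simp add: power_mult zd)
   hence zg: "z ^ gcd d (l ^ n) = 1" unfolding xy power_add by (simp add: power_mult zn)
   obtain t where t: "t <= n" "gcd d (l ^ n) = l ^ t" using divides_primepow_nat[OF l, of "gcd d (l ^ n)" n] by auto
   have "gcd d (l ^ n) <= d" using d by (intro dvd_imp_le) auto
   hence "l ^ t < l ^ n" using d t by simp
   hence "t < n" using t l2 by (metis le_less nat_less_le)
   then obtain r where r: "n - 1 = t + r" by (metis One_nat_def Suc_leI diff_Suc_1 le_Suc_ex less_natE add_Suc_right)
   have "z ^ (l ^ (n - 1)) = 1" unfolding r power_add power_mult using zg t by simp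
   thus False using z w1 by simp
  qed
  have "inj_on (%i. z ^ i) {..<l ^ n}"
  proof -
   have ne: False if "i < k" "k < l ^ n" "z ^ i = z ^ k" for i k
   proof -
    have "z ^ k = z ^ i * z ^ (k - i)" using that(1) by (simp flip: power_add)
    hence "z ^ (k - i) = 1" using that(3) z0 by simp
    thus False using no[of "k - i"] that by auto
   qed
   show ?thesis
   proof (rule inj_onI)
    fix i k assume a: "i : {..<l ^ n}" "k : {..<l ^ n}" "z ^ i = z ^ k"
    show "i = k" using ne[of i k] ne[of k i] a by (cases i k rule: linorder_cases) auto
   qed
  qed
  thus ?thesis using zn by blast
qed

subsection \<open>Galois action on divisor classes\<close>

text \<open>Differences A - B generate the divisors of degree 0: a point of positive and one of
  negative multiplicity are split off, which lowers the sum of the absolute values. It is on these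
  differences that \<open>jacobian\<close> provides a morphism over \<open>k\<close>.\<close>

lemma div0_hom_unique:
  fixes h1 h2 :: "'a::field divisor => 'c"
  assumes G: "group G"
   and h1: "!!D. D : div0 C ==> h1 D : carrier G" "!!D E. D : div0 C ==> E : div0 C ==> h1 (D + E) = h1 D \<otimes>\<^bsub>G\<^esub> h1 E"
   and h2: "!!D. D : div0 C ==> h2 D : carrier G" "!!D E. D : div0 C ==> E : div0 C ==> h2 (D + E) = h2 D \<otimes>\<^bsub>G\<^esub> h2 E"
   and gen: "!!A B. A : points C ==> B : points C ==> h1 (single A 1 - single B 1) = h2 (single A 1 - single B 1)"
   and D: "D : div0 C"
  shows "h1 D = h2 D" using D
proof (induction "\<Sum>P\<in>keys D. nat \<bar>lookup D P\<bar>" arbitrary: D rule: less_induct)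
  case less
  interpret group G by (rule G)
  let ?K = "keys D" and ?l = "lookup D"
  show ?case
  proof (cases "D = 0")
   case True
   have z: "0 : div0 C" by (simp add: div0_def)
   have "h1 0 = \<one>\<^bsub>G\<^esub>" using h1(1)[OF z] h1(2)[OF z z] by simp
   moreover have "h2 0 = \<one>\<^bsub>G\<^esub>" using h2(1)[OF z] h2(2)[OF z z] by simp
   ultimately show ?thesis using True by simp
  next
   case False
   hence "?K ~= {}" by simp
   then obtain P0 where P0: "P0 : ?K" by blast
   have s0: "(\<Sum>P\<in>?K. ?l P) = 0" "?K \<subseteq> points C" using less.prems by (auto simp: div0_def)
   have "EX A:?K. ?l A > 0"
   proof (rule ccontr)
    assume "~ ?thesis"
    hence "ALL P:?K. 0 <= - ?l P" by auto
    moreover have "(\<Sum>P\<in>?K. - ?l P) = 0" using s0 by (simp add: sum_negf)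
    ultimately have "ALL P:?K. - ?l P = 0" by (subst (asm) sum_nonneg_eq_0_iff) auto
    thus False using P0 by (simp add: in_keys_iff)
   qed
   then obtain A where A: "A : ?K" "?l A > 0" by blast
   have "EX B:?K. ?l B < 0"
   proof (rule ccontr)
    assume "~ ?thesis"
    hence "ALL P:?K. 0 <= ?l P" by auto
    hence "ALL P:?K. ?l P = 0" using sum_nonneg_eq_0_iff[of ?K ?l] s0 by auto
    thus False using P0 by (simp add: in_keys_iff)
   qed
   then obtain B where B: "B : ?K" "?l B < 0" by blast
   have AB: "A ~= B" using A B by auto
   define E :: "'a divisor" where "E = single A 1 - single B 1"
   have lE: "lookup E P = (if P = A then 1 else 0) - (if P = B then 1 else 0)" for P
    by (simp add: E_def lookup_minus lookup_single when_def eq_commute)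
   have kE: "keys E = {A, B}" using AB by (auto simp: in_keys_iff lE split: if_splits)
   have E: "E : div0 C" using A B AB s0(2) by (auto simp: div0_def kE lE)
   define D' where "D' = D - E"
   have lD': "lookup D' P = ?l P - lookup E P" for P by (simp add: D'_def lookup_minus)
   have kD': "keys D' \<subseteq> ?K" using A B by (auto simp: in_keys_iff lD' lE split: if_splits)
   have sub: "(\<Sum>P\<in>keys D'. f (lookup D' P)) = (\<Sum>P\<in>?K. f (lookup D' P))"
    if "f 0 = 0" for f :: "int => 'd::comm_monoid_add"
    by (rule sum.mono_neutral_left) (use kD' that in "auto simp: in_keys_iff")
   have "(\<Sum>P\<in>?K. lookup D' P) = 0"
   proof -
    have "(\<Sum>P\<in>?K. lookup E P) = 0" using A(1) B(1) by (simp add: lE sum_subtractf)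
    thus ?thesis using s0(1) by (simp add: lD' sum_subtractf)
   qed
   hence D': "D' : div0 C" using kD' s0(2) sub[of "%x. x"] by (auto simp: div0_def)
   have "(\<Sum>P\<in>keys D'. nat \<bar>lookup D' P\<bar>) = (\<Sum>P\<in>?K. nat \<bar>lookup D' P\<bar>)" by (rule sub) simp
   also have "... < (\<Sum>P\<in>?K. nat \<bar>?l P\<bar>)"
   proof (rule sum_strict_mono_ex1)
    show "ALL P:?K. nat \<bar>lookup D' P\<bar> <= nat \<bar>?l P\<bar>" using A B by (auto simp: lD' lE)
    show "EX P:?K. nat \<bar>lookup D' P\<bar> < nat \<bar>?l P\<bar>" by (rule bexI[OF _ A(1)]) (use A AB in "auto simp: lD' lE")
   qed simp
   finally have "h1 D' = h2 D'" using less.hyps D' by blast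
   moreover have "D = D' + E" by (simp add: D'_def)
   moreover have "h1 E = h2 E" unfolding E_def by (rule gen) (use A B s0(2) in auto)
   ultimately show ?thesis using h1(2)[OF D' E] h2(2)[OF D' E] by simp
  qed
qed

lemma multiple_divisor:
  fixes C :: "'a::field scheme"
  assumes G: "comm_group G"
   and cls: "cls ` div0 C = carrier G" "!!D E. D : div0 C ==> E : div0 C ==> cls (D + E) = cls D \<otimes>\<^bsub>G\<^esub> cls E"
   and D: "D : div0 C"
  shows "EX E:div0 C. (ALL P. lookup E P = int n * lookup D P) & cls E = cls D [^]\<^bsub>G\<^esub> n"
proof -
  interpret comm_group G by (rule G)
  have add: "D + E : div0 C" if "D : div0 C" "E : div0 C" for D E
  proof -
   let ?K = "keys D \<union> keys E"
   have s: "(\<Sum>P\<in>keys X'. lookup X' P) = (\<Sum>P\<in>?K. lookup X' P)"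
    if "keys X' \<subseteq> ?K" for X' :: "'a divisor"
    by (rule sum.mono_neutral_left) (use that in "auto simp: in_keys_iff")
   have k: "keys (D + E) \<subseteq> ?K" by (rule keys_add)
   have "(\<Sum>P\<in>keys (D + E). lookup (D + E) P) = 0"
    unfolding s[OF k] using that s[of D] s[of E] by (simp add: lookup_add sum.distrib div0_def)
   thus ?thesis using that k unfolding div0_def by blast
  qed
  show ?thesis
  proof (induction n)
   case 0
   have z: "0 : div0 C" by (simp add: div0_def)
   have "cls 0 : carrier G" using cls(1) z by blast
   hence "cls 0 = \<one>\<^bsub>G\<^esub>" using cls(2)[OF z z] by simp
   thus ?case using z by (intro bexI[of _ 0]) auto
  next
   case (Suc n)
   then obtain E where E: "E : div0 C" "ALL P. lookup E P = int n * lookup D P" "cls E = cls D [^]\<^bsub>G\<^esub> n" by blast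
   thus ?case using add[OF E(1) D] cls(2)[OF E(1) D]
    by (intro bexI[of _ "E + D"]) (auto simp: lookup_add algebra_simps)
  qed
qed

lemma group_law_equivariant:
  assumes alg: "!!z::'a::{alg_closed_field, field_char_0}. algebraic z" and k: "subf k" and ab: "abelian_variety k J G"
   and s: "(s :: 'a => 'a) : Gal k UNIV"
  shows "A : carrier G ==> (%i. s (A i)) : carrier G"
   "A : carrier G ==> B : carrier G ==> (%i. s ((A \<otimes>\<^bsub>G\<^esub> B) i)) = (%i. s (A i)) \<otimes>\<^bsub>G\<^esub> (%i. s (B i))"
   "A : torsion l G ==> (%i. s (A i)) : torsion l G"
proof -
  have J: "proj_scheme k J" "comm_group G" "carrier G = points J" "bimorphism k J J J (%A B. A \<otimes>\<^bsub>G\<^esub> B)"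
   using ab by (auto simp: abelian_scheme_def smooth_projective_def)
  interpret comm_group G by (rule J(2))
  note h = Gal_UNIV_D[OF alg s]
  note g = geom_generic[OF alg subf_subr[OF k]]
  show c: "(%i. s (A i)) : carrier G" if "A : carrier G" for A
   using points_hom[OF J(1) h(1,3)] that by (simp add: J(3))
  show m: "(%i. s ((A \<otimes>\<^bsub>G\<^esub> B) i)) = (%i. s (A i)) \<otimes>\<^bsub>G\<^esub> (%i. s (B i))" if "A : carrier G" "B : carrier G" for A B
   by (rule bimorphism_equivariant[OF J(4) g J(1) J(1) order_refl order_refl h(1) h(3), symmetric]) (use that J(3) in auto)
  have one: "(%i. s (\<one>\<^bsub>G\<^esub> i)) = \<one>\<^bsub>G\<^esub>" using m[of "\<one>\<^bsub>G\<^esub>" "\<one>\<^bsub>G\<^esub>"] c[of "\<one>\<^bsub>G\<^esub>"] by simp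
  have pw: "(%i. s (A i)) [^]\<^bsub>G\<^esub> n = (%i. s ((A [^]\<^bsub>G\<^esub> n) i))" if "A : carrier G" for A and n :: nat
   by (induction n) (use one m that in "auto simp: nat_pow_closed")
  show "(%i. s (A i)) : torsion l G" if AT: "A : torsion l G"
  proof -
   obtain m where A: "A : carrier G" "A [^]\<^bsub>G\<^esub> (l ^ m) = \<one>\<^bsub>G\<^esub>" using AT by (auto simp: torsion_def)
   have "(%i. s (A i)) [^]\<^bsub>G\<^esub> (l ^ m) = \<one>\<^bsub>G\<^esub>" unfolding pw[OF A(1)] A(2) by (rule one)
   thus ?thesis using c[OF A(1)] unfolding torsion_def by blast
  qed
qed

text \<open>Both sides are homomorphisms on divisors of degree 0 and agree on differences of points,
  where the class map is a morphism over \<open>k\<close>. \<open>map_key\<close> pulls a divisor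
  back along \<open>t\<close>, which moves its points by the inverse of \<open>t\<close>; hence the
  inverse on the right.\<close>

lemma class_equivariant:
  assumes alg: "!!z::'a::{alg_closed_field, field_char_0}. algebraic z" and k: "subf k" and C: "proj_scheme k C"
   and ab: "abelian_variety k J G" and t: "(t :: 'a => 'a) : Gal k UNIV"
   and cls: "cls ` div0 C = carrier G" "!!D E. D : div0 C ==> E : div0 C ==> cls (D + E) = cls D \<otimes>\<^bsub>G\<^esub> cls E"
    "bimorphism k C C J (%A B. cls (single A 1 - single B 1))" and D: "D : div0 C"
  shows "Poly_Mapping.map_key (%P i. t (P i)) D : div0 C"
   "cls (Poly_Mapping.map_key (%P i. t (P i)) D) = (%i. inv_into UNIV t (cls D i))"
proof -
  have J: "proj_scheme k J" "comm_group G" "carrier G = points J"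
   using ab by (auto simp: abelian_scheme_def smooth_projective_def)
  interpret comm_group G by (rule J(2))
  let ?s = "inv_into UNIV t" and ?f = "%P i. t (P i)"
  have s: "?s : Gal k UNIV" by (rule Gal_UNIV_comp(3)[OF alg t])
  note h = Gal_UNIV_D[OF alg s] and ht = Gal_UNIV_D[OF alg t]
  note g = geom_generic[OF alg subf_subr[OF k]]
  have ii: "t (?s a) = a" "?s (t a) = a" for a using ht(2) by (simp_all add: bij_is_surj surj_f_inv_f bij_is_inj)
  have inj: "inj (?f :: (nat => 'a) => nat => 'a)"
  proof (rule injI)
   fix x y :: "nat => 'a" assume "(%i. t (x i)) = (%i. t (y i))"
   hence "t (x i) = t (y i)" for i by (rule fun_cong)
   thus "x = y" using ii(2) by (metis ext)
  qed
  have si: "inj (%(P :: nat => 'a) i. ?s (P i))"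
  proof (rule injI)
   fix x y :: "nat => 'a" assume "(%i. ?s (x i)) = (%i. ?s (y i))"
   hence "?s (x i) = ?s (y i)" for i by (rule fun_cong)
   thus "x = y" using ii(1) by (metis ext)
  qed
  let ?p = "%D :: 'a divisor. Poly_Mapping.map_key (%P i. t (P i)) D"
  have lk: "lookup (?p D) P = lookup D (%i. t (P i))" for D P unfolding map_key.rep_eq[OF inj] by simp
  have ks: "keys (?p D) = (%P i. ?s (P i)) ` keys D" for D
  proof (intro subset_antisym subsetI)
   fix P assume "P : keys (?p D)"
   hence "(%i. t (P i)) : keys D" by (simp add: in_keys_iff lk)
   thus "P : (%P i. ?s (P i)) ` keys D" by (rule rev_image_eqI) (simp add: ii)
  qed (auto simp: in_keys_iff lk ii)
  have dv: "?p D : div0 C" if "D : div0 C" for D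
  proof -
   have "(\<Sum>P\<in>keys (?p D). lookup (?p D) P) = (\<Sum>P\<in>keys D. lookup D P)"
    unfolding ks by (subst sum.reindex[OF inj_on_subset[OF si subset_UNIV]]) (simp add: lk ii)
   moreover have "keys (?p D) \<subseteq> points C" unfolding ks using that points_hom[OF C h(1,3)] by (auto simp: div0_def)
   ultimately show ?thesis using that by (simp add: div0_def)
  qed
  show "?p D : div0 C" by (rule dv[OF D])
  note e = group_law_equivariant[OF alg k ab s]
  have cc: "cls D : carrier G" if "D : div0 C" for D using cls(1) that by blast
  have "(%D. cls (?p D)) D = (%D i. ?s (cls D i)) D"
  proof (rule div0_hom_unique[OF is_group, of C])
   fix A B assume AB: "A : points C" "B : points C"
   have "?p (single A 1 - single B 1) = single (%i. ?s (A i)) 1 - single (%i. ?s (B i)) 1"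
   proof (rule poly_mapping_eqI)
    fix P :: "nat => 'a"
    have q: "Q = (%i. t (P i)) \<longleftrightarrow> (%i. ?s (Q i)) = P" for Q using ii by (metis ext)
    show "lookup (?p (single A 1 - single B 1)) P = lookup (single (%i. ?s (A i)) 1 - single (%i. ?s (B i)) 1) P"
     unfolding lk lookup_minus lookup_single q ..
   qed
   thus "cls (?p (single A 1 - single B 1)) = (%i. ?s (cls (single A 1 - single B 1) i))"
    using bimorphism_equivariant[OF cls(3) g C C order_refl order_refl h(1) h(3) AB] by simp
  next
   fix D E assume DE: "D : div0 C" "E : div0 C"
   have "?p (D + E) = ?p D + ?p E" by (rule poly_mapping_eqI) (simp add: lk lookup_add)
   thus "cls (?p (D + E)) = cls (?p D) \<otimes>\<^bsub>G\<^esub> cls (?p E)" using cls(2)[OF dv dv] DE by simp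
   show "(%i. ?s (cls (D + E) i)) = (%i. ?s (cls D i)) \<otimes>\<^bsub>G\<^esub> (%i. ?s (cls E i))"
    unfolding cls(2)[OF DE] by (rule e(2)) (use cc DE in auto)
  qed (use dv cc e(1) D in auto)
  thus "cls (?p D) = (%i. ?s (cls D i))" .
qed

lemma torsion_points_unipotent:
  fixes k :: "'a::{alg_closed_field, field_char_0} set"
  assumes alg: "!!z :: 'a. algebraic z" and k: "subf k" and l: "prime l" and n: "n >= 1"
   and pq: "set (coeffs p) \<subseteq> k" "set (coeffs q) \<subseteq> k"
   and C: "smooth_projective k C 1" and model: "affine_model k C (l ^ n) p q x y" and J: "jacobian k C J G"
   and branch: "!!u. u : branch_locus C x ==> range u \<subseteq> max_pro_ext l k"
   and P: "P : torsion l G" and s: "s : Gal (cyclotomic l k) UNIV"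
  shows "EX e. (%i. (s ^^ (l ^ e)) (P i)) = P"
proof -
  note k0 = subrD[OF subf_subr[OF k]]
  obtain fx gx where x: "x = (fx, gx)" by (cases x)
  obtain fy gy where y: "y = (fy, gy)" by (cases y)
  have g: "(UNIV, {0::'a}) : geom_points k" by (rule geom_generic[OF alg subf_subr[OF k]])
  have Ck: "proj_scheme k C" "irreducible_fibre C (UNIV, {0})" "!!P. P : cone C ==> smooth_at k C 1 (UNIV, {0}) P"
   using C g by (auto simp: smooth_projective_def cone_def)
  have CU: "proj_scheme UNIV C" by (rule proj_scheme_mono[OF _ Ck(1)]) simp
  obtain H where H: "ALL i. H i : polys k UNIV" "ALL i>amb C. H i = 0"
   and bir: "finite {P : points C. ~ (defined_at P x & defined_at P y &
       (value_at P x, value_at P y) : affine_curve (l ^ n) p q &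
       (EX i. ev2 (value_at P x, value_at P y) (H i) ~= 0) &
       normalise (%i. ev2 (value_at P x, value_at P y) (H i)) = P)}"
    "finite {z : affine_curve (l ^ n) p q. ~ ((EX i. ev2 z (H i) ~= 0) &
       (EX P:points C. P = normalise (%i. ev2 z (H i)) & defined_at P x & defined_at P y &
        z = (value_at P x, value_at P y)))}"
   using model unfolding affine_model_def by (elim conjE exE) (rule that)
  have md: "p ~= 0" "q ~= 0" "rat_fun k C x" "rat_fun k C y" using model by (auto simp: affine_model_def)
  obtain \<zeta> :: 'a where z: "\<zeta> ^ (l ^ n) = 1" "inj_on (%i. \<zeta> ^ i) {..<l ^ n}" using primitive_root_exists[OF l n] by blast
  \<comment> \<open>The algebraic closure of the rational functions of x contains an
    \<open>l ^ n\<close>-th root \<open>y0\<close> of p/q, as \<open>affine_cover\<close> demands of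
    the target field.\<close>
  define j where "j r = (to_ac (to_fract r) :: 'a poly fract alg_closure)" for r
  have m: "l ^ n >= 1" using prime_gt_0_nat[OF l] by simp
  obtain y0 where y0: "y0 ^ (l ^ n) = j p / j q" using nth_root_exists[of "l ^ n" "j p / j q"] prime_gt_0_nat[OF l] by auto
  interpret ac: affine_cover C "l ^ n" p q fx gx fy gy H \<zeta> j y0
  proof unfold_locales
   show "EX R. smooth_at R C 1 (UNIV, {0}) P" if "P : cone C" for P using Ck(3)[OF that] by blast
   show "EX d. fx : forms UNIV (amb C) d & gx : forms UNIV (amb C) d"
    using md(3) forms_UNIV unfolding x rat_fun_def prod.case by blast
   show "EX d. fy : forms UNIV (amb C) d & gy : forms UNIV (amb C) d"
    using md(4) forms_UNIV unfolding y rat_fun_def prod.case by blast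
   show "is_hom j" by (simp add: is_hom_def j_def)
   show "!!r. j r = 0 ==> r = 0" by (simp add: j_def)
   show "j q * y0 ^ (l ^ n) = j p" using y0 md(2) by (simp add: j_def)
  qed (use CU Ck(2) md(1,2) m H(2) z bir in "auto simp: x y defined_at_def value_at_def")
  obtain cls where ab: "abelian_variety k J G" and c1: "cls ` div0 C = carrier G"
   and c2: "ALL D:div0 C. ALL E:div0 C. cls (D + E) = cls D \<otimes>\<^bsub>G\<^esub> cls E"
   and c3: "ALL D:div0 C. cls D = \<one>\<^bsub>G\<^esub> \<longleftrightarrow> principal C D"
   and c4: "bimorphism k C C J (%A B. cls (single A 1 - single B 1))"
   using J unfolding jacobian_def by (elim conjE exE) (rule that)
  have cls: "cls ` div0 C = carrier G" "!!D E. D : div0 C ==> E : div0 C ==> cls (D + E) = cls D \<otimes>\<^bsub>G\<^esub> cls E"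
   "!!D. D : div0 C ==> cls D = \<one>\<^bsub>G\<^esub> \<longleftrightarrow> principal C D" "bimorphism k C C J (%A B. cls (single A 1 - single B 1))"
   using c1 c2 c3 c4 by blast+
  have G: "comm_group G" using ab by (simp add: abelian_scheme_def)
  interpret comm_group G by (rule G)
  have kK: "k \<subseteq> cyclotomic l k" by (rule cyclotomic_subf(2))
  have sk: "s : Gal k UNIV" using Gal_mono[OF kK] s by blast
  note hs = Gal_UNIV_D[OF alg sk]
  have gal: "ac.cc.galois s"
  proof (rule ac.galois_automorphism[OF hs(1,2)])
   show "is_hom (inv_into UNIV s)" by (rule Gal_UNIV_D(1)[OF alg Gal_UNIV_comp(3)[OF alg sk]])
   \<comment> \<open>Here the base field \<open>cyclotomic l k\<close> is used: it contains
     \<zeta>.\<close>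
   show "s \<zeta> = \<zeta>" using Gal_UNIV_D(3)[OF alg s] cyclotomic_subf(3)[OF z(1)] by blast
   show "!!i. coeff p i : k" "!!i. coeff q i : k" using pq coeffs_subset_iff[OF k0(1)] by blast+
  qed (use hs(3) H(1) in auto)
  obtain D where D: "D : div0 C" "P = cls D" using P cls(1) by (auto simp: torsion_def)
  obtain M where M: "P [^]\<^bsub>G\<^esub> (l ^ M) = \<one>\<^bsub>G\<^esub>" using P by (auto simp: torsion_def)
  obtain E where E: "E : div0 C" "!!Q. lookup E Q = int (l ^ M) * lookup D Q" "cls E = cls D [^]\<^bsub>G\<^esub> (l ^ M)"
   using multiple_divisor[OF G cls(1,2) D(1)] by blast
  have "principal C E" using cls(3)[OF E(1)] E(3) M D(2) by simp
  moreover have "keys E \<subseteq> points C" using E(1) by (simp add: div0_def)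
  ultimately have pE: "ac.ff.prin (%Q. int l ^ M * lookup D Q)"
   unfolding ac.ff.prin_def using ac.ff.principal_iff E(2) by simp
  have fD: "ac.ff.fin (lookup D)" unfolding ac.ff.fin_def
   by (rule finite_subset[OF _ finite_keys[of D]]) (auto simp: in_keys_iff)
  have br: "EX e. (s ^^ (l ^ e)) v = v" if v: "v : ac.cc.branch" for v
  proof -
   obtain u where "u : branch_locus C (fx, gx)" "v : range u" using ac.branch_points[OF v] by blast
   hence "v : max_pro_ext l k" using branch[of u] unfolding x by blast
   hence "v : l_torsion_at l s" using max_pro_ext_torsion[OF alg s] by blast
   thus ?thesis by (simp add: l_torsion_at_def)
  qed
  obtain e where e: "ac.ff.prin (%Q. lookup D (ac.cc.tr (s ^^ (l ^ e)) Q) - lookup D Q)"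
   using ac.cc.unipotent[OF l refl gal br fD pE] by blast
  define t where "t = s ^^ (l ^ e)"
  have t: "t : Gal k UNIV" unfolding t_def by (rule Gal_UNIV_comp(2)[OF alg sk])
  note ht = Gal_UNIV_D[OF alg t]
  have ii: "t (inv_into UNIV t a) = a" for a using ht(2) by (simp add: bij_is_surj surj_f_inv_f)
  define T where "T = Poly_Mapping.map_key (%P i. t (P i)) D"
  note ce = class_equivariant[OF alg k Ck(1) ab t cls(1,2,4) D(1), folded T_def]
  have inj: "inj (%(P :: nat => 'a) i. t (P i))"
  proof (rule injI)
   fix x y :: "nat => 'a" assume "(%i. t (x i)) = (%i. t (y i))"
   hence "t (x i) = t (y i)" for i by (rule fun_cong)
   thus "x = y" using bij_is_inj[OF ht(2)] by (intro ext) (auto dest: injD)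
  qed
  have lT: "lookup T Q = lookup D (%i. t (Q i))" for Q unfolding T_def map_key.rep_eq[OF inj] by simp
  \<comment> \<open>By \<open>e\<close> this difference is principal, so \<open>D\<close> and its
    pullback have the same class; hence the inverse of \<open>t\<close>, and then \<open>t\<close>,
    fixes \<open>P\<close>.\<close>
  define W where "W = T - D"
  have lW: "lookup W Q = lookup D (%i. t (Q i)) - lookup D Q" for Q by (simp add: W_def lookup_minus lT)
  have kW: "keys W \<subseteq> keys T \<union> keys D" unfolding W_def by (rule keys_diff)
  have W: "W : div0 C"
  proof -
   have s0: "(\<Sum>Q\<in>keys X'. lookup X' Q) = (\<Sum>Q\<in>keys T \<union> keys D. lookup X' Q)"
    if "keys X' \<subseteq> keys T \<union> keys D" for X' :: "'a divisor"
    by (rule sum.mono_neutral_left) (use that in "auto simp: in_keys_iff")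
   have "(\<Sum>Q\<in>keys W. lookup W Q) = 0"
    unfolding s0[OF kW] using ce(1) D(1) s0[of T] s0[of D] by (simp add: W_def lookup_minus sum_subtractf div0_def)
   thus ?thesis using ce(1) D(1) kW unfolding div0_def by blast
  qed
  have "keys W \<subseteq> points C" using W by (simp add: div0_def)
  moreover have "EX x:ac.ffield. x ~= 0 & (ALL P:points C. lookup W P = ac.ff.ord P x)"
   using e unfolding ac.ff.prin_def t_def[symmetric] ac.cc.tr_def lW .
  ultimately have "principal C W" using ac.ff.principal_iff by simp
  hence "cls W = \<one>\<^bsub>G\<^esub>" using cls(3)[OF W] by blast
  moreover have "T = W + D" by (simp add: W_def)
  ultimately have "cls T = cls D" using cls(2)[OF W D(1)] cls(1) D(1) by (metis imageI l_one)
  hence "(%i. inv_into UNIV t (P i)) = P" using ce(2) D(2) by simp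
  hence "t (P i) = P i" for i using ii by metis
  thus ?thesis unfolding t_def by blast
qed

section \<open>The field generated by the l-power torsion points\<close>

theorem theoremB:
  fixes k :: "'a::{alg_closed_field, field_char_0} set"
    and l n :: nat
    and p q :: "'a poly"
    and C J :: "'a scheme"
    and G :: "(nat \<Rightarrow> 'a) monoid"
    and x y :: "(nat, 'a) mpol \<times> (nat, 'a) mpol"
  assumes "number_field k"
    and "\<And>z :: 'a. algebraic z"
    and "prime l"
    and "n \<ge> 1"
    and "set (coeffs p) \<subseteq> k" and "set (coeffs q) \<subseteq> k"
    and "smooth_projective k C 1"
    and "affine_model k C (l ^ n) p q x y"
    and "jacobian k C J G"
    and "\<And>\<pp>. \<pp> \<in> finite_places k \<Longrightarrow> of_nat l \<notin> \<pp> \<Longrightarrow> good_reduction k \<pp> J G"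
    and "\<And>u. u \<in> branch_locus C x \<Longrightarrow> range u \<subseteq> max_pro_ext l k"
  shows "field_of_points k (torsion l G) \<subseteq> max_pro_ext l k"
proof -
  note alg = assms(2)
  have k: "subf k" using assms(1) by (simp add: number_field_def subfield_iff)
  have ab: "abelian_variety k J G" using assms(9) by (simp add: jacobian_def)
  define K where "K = cyclotomic l k"
  have K: "subf K" "k \<subseteq> K" unfolding K_def by (rule cyclotomic_subf)+
  define T where "T = torsion l G"
  define M where "M = adjoin K {z. EX P:T. z : range P}"
  have M: "subf M" "K \<subseteq> M" "!!P. P : T ==> range P \<subseteq> M"
   using adjoin_subf(1,2)[of K "{z. EX P:T. z : range P}"] unfolding M_def by blast+
  have kM: "k \<subseteq> M" using K(2) M(2) by blast
  \<comment> \<open>Minimality reduces the conditions on \<open>M\<close> to the coordinates of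
    torsion points.\<close>
  have min: "M \<subseteq> F" if "subf F" "K \<subseteq> F" "!!P. P : T ==> range P \<subseteq> F" for F
   unfolding M_def by (rule adjoin_subf(3)[OF that(1)]) (use that in blast)
  have stable: "gal_stable K M" unfolding M_def
  proof (rule adjoin_stable[OF alg])
   fix s z assume s: "s : Gal K UNIV" and z: "z : {z. EX P:T. z : range P}"
   obtain P i where P: "P : T" "z = P i" using z by blast
   have "s : Gal k UNIV" using Gal_mono[OF K(2)] s by blast
   hence sT: "(%i. s (P i)) : T" using group_law_equivariant(3)[OF alg k ab] P(1) by (simp add: T_def)
   have "s z : range (%i. s (P i))" using P(2) by blast
   hence "EX P:T. s z : range P" by (rule bexI[OF _ sT])
   thus "s z : {z. EX P:T. z : range P}" by (rule CollectI)
  qed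
  have "pro_ext l K M"
  proof (rule pro_ext_intro[OF alg assms(3) stable M(2,1) K(1)])
   fix s assume s: "s : Gal K UNIV"
   show "M \<subseteq> l_torsion_at l s"
   proof (rule min)
    show "subf (l_torsion_at l s)" "K \<subseteq> l_torsion_at l s" by (rule l_torsion_at_subf[OF alg s])+
    fix P assume "P : T"
    then obtain e where e: "(%i. (s ^^ (l ^ e)) (P i)) = P"
     using torsion_points_unipotent[OF alg k assms(3-9) assms(11) _ s[unfolded K_def]] unfolding T_def by blast
    have "(s ^^ (l ^ e)) (P i) = P i" for i using fun_cong[OF e, of i] .
    thus "range P \<subseteq> l_torsion_at l s" by (auto simp: l_torsion_at_def)
   qed
  qed
  moreover have "unramified_away l K M" unfolding unramified_away_def
  proof (intro ballI impI)
   fix Q s z assume Q: "Q : finite_places M" "of_nat l ~: Q" and s: "s : Gal K M"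
    and inert: "ALL z:integers M. s z - z : Q" and z: "z : M"
   obtain t where t: "t : Gal K UNIV" "!!z. z : M ==> t z = s z" by (rule Gal_extend[OF alg M(1,2) s]) blast
   \<comment> \<open>Good reduction is a condition over \<open>k\<close>; an automorphism in the
     inertia group over \<open>K\<close> is also one over \<open>k\<close>.\<close>
   have tk: "t : Gal k UNIV" using Gal_mono[OF K(2)] t(1) by blast
   have pr: "prime_on (integers M) Q" "Q ~= {0}"
    using Q(1) primeideal_iff[OF integers_subr[OF M(1)]] by (auto simp: finite_places_def)
   have ik: "integers k = integers M \<inter> k" using kM by (auto simp: integers_def)
   have a: "ideal_on (integers M) Q" "1 ~: Q"
    "ALL a:integers M. ALL b:integers M. a * b : Q --> a : Q | b : Q" using pr(1) by (simp_all add: prime_on_def)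
   note I = ideal_onD[OF a(1)] and kk = subrD(1,3,4)[OF subf_subr[OF k]]
   have "ideal_on (integers k) (Q \<inter> k)" unfolding ideal_on_def ik
   proof (intro conjI ballI)
    show "Q \<inter> k \<subseteq> integers M \<inter> k" "0 : Q \<inter> k" using I(1,2) kk(1) by blast+
    show "a + b : Q \<inter> k" if "a : Q \<inter> k" "b : Q \<inter> k" for a b using that I(3)[of a b] kk(2)[of a b] by blast
    show "a * b : Q \<inter> k" if "a : integers M \<inter> k" "b : Q \<inter> k" for a b using that I(4)[of a b] kk(3)[of a b] by blast
   qed
   hence "prime_on (integers k) (Q \<inter> k)" using a(2,3) unfolding prime_on_def ik by blast
   hence "Q \<inter> k : finite_places k"
    using primeideal_iff[OF integers_subr[OF k]] prime_below_nonzero[OF alg M(1) k pr] by (simp add: finite_places_def)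
   hence good: "good_reduction k (Q \<inter> k) J G" using assms(10) Q(2) by blast
   have "(%i. t (P i)) = P" if "P : T" for P
   proof (rule good_reduction_inertia[OF alg k M(1) kM pr(1) Q(2) tk _ good ab])
    show "t z - z : Q" if "z : integers M" for z using inert that t(2) by (auto simp: integers_def)
    show "P : torsion l G" "range P \<subseteq> M" using that M(3) by (auto simp: T_def)
   qed
   hence "t (P i) = P i" if "P : T" for P i using that by metis
   hence "M \<subseteq> {z. t z = z}" using Gal_UNIV_D[OF alg t(1)] by (intro min Gal_fix_subf) auto
   thus "s z = z" using z t(2) by auto
  qed
  ultimately have MT: "M \<subseteq> max_pro_ext l k" unfolding K_def by (rule max_pro_ext_maximal)
  show ?thesis
  proof
   fix z assume z: "z : field_of_points k (torsion l G)"
   \<comment> \<open>\<open>field_of_points\<close> is defined by automorphisms over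
     \<open>k\<close>. An element outside \<open>M\<close> is moved by an automorphism over
     \<open>M\<close>, and that automorphism fixes every torsion point.\<close>
   have "z : M"
   proof (rule ccontr)
    assume "z ~: M"
    then obtain t where t: "t : Gal M UNIV" "t z ~= z" by (rule Gal_moves[OF alg M(1)])
    have "t \<circ> P = P" if "P : torsion l G" for P
     using Gal_UNIV_D(3)[OF alg t(1)] M(3)[of P] that by (auto simp: T_def fun_eq_iff)
    moreover have "t : Gal k UNIV" using Gal_mono[OF kM] t(1) by blast
    ultimately show False using z t(2) by (auto simp: field_of_points_def)
   qed
   thus "z : max_pro_ext l k" using MT by blast
  qed
qed

end
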